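(* Let $t\in2\mathbb Z^{\le0}$, $\underline k:=-\tfrac t2$, and let $\lambda\in\mathcal I$ be $\underline k$-quasiregular. Then the eigenvalue polynomial $\boldsymbol f_\lambda$ of the categorical Capelli operator $\boldsymbol D_{t,\lambda}$ is $$\boldsymbol f_\lambda=\lim_{s\to t}\left(\frac{1}{H_\lambda\left(-\frac s2\right)}P^{-\frac s2}_\lambda+\frac{1}{H_{\lambda^\dagger}\left(-\frac s2\right)}P^{-\frac s2}_{\lambda^\dagger}\right).$$
   Context: Deligne category. $\mathsf{Rep}(O_t)$ is Deligne's Karoubian $\mathbb C$-linear rigid symmetric monoidal category generated by a self-dual object $\mathsf V_t$ of categorical dimension $t$, with symmetric evaluation $\boldsymbol\epsilon:\mathsf V_t\otimes\mathsf V_t\to\mathbf 1$ and coevaluation $\boldsymbol\iota:\mathbf 1\to\mathsf V_t\otimes\mathsf V_t$, $\boldsymbol\epsilon\boldsymbol\iota=t$, so that $\mathrm{End}(\mathsf V_t^{\otimes d})$ is the Brauer algebra $Br_d(t)$. In its inductive completion put $\mathsf P:=\bigoplus_{d\ge0}\mathsf P^d$, $\mathsf P^d:=\mathsf S^d(\mathsf V_t)$, and $\mathsf{PD}:=\mathsf P\otimes\bigoplus_{p\ge0}\mathsf S^p(\mathsf V_t^* )$. $\mathsf{PD}$ is an associative algebra object acting on $\mathsf P$ as polynomial-coefficient differential operators: $\mathsf P$ acts by multiplication, $\mathsf V_t^*$ by the derivations of $\mathsf P$ extending the evaluation $\mathsf V_t^*\otimes\mathsf V_t\to\mathbf 1$,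 and $\mathsf S^p(\mathsf V_t^* )$ by their composites (giving contractions $\mathsf S^p(\mathsf V_t^* )\otimes\mathsf S^q(\mathsf V_t)\to\mathsf S^{q-p}(\mathsf V_t)$, zero if $p>q$). Put $\mathsf A_t:=\mathrm{Hom}(\mathbf 1,\bigoplus_p\mathsf S^p(\mathsf V_t)\otimes\mathsf S^p(\mathsf V_t^* ))$; this is an algebra acting faithfully on $\mathsf P$. Let $\boldsymbol E_t\in\mathsf A_t$ be the element given by the coevaluation of $\mathsf V_t$ (it acts on $\mathsf P^d$ by $d$). Let $\boldsymbol\Theta_t$ be $\tfrac12$ times multiplication by the element $\mathbf 1\to\mathsf S^2(\mathsf V_t)$ given by $\boldsymbol\iota$, and $\boldsymbol\Delta_t$ be $\tfrac12$ times the action of the corresponding element $\mathbf 1\to\mathsf S^2(\mathsf V_t^* )$; then $[\boldsymbol E_t,\boldsymbol\Delta_t]=-2\boldsymbol\Delta_t$, $[\boldsymbol E_t,\boldsymbol\Theta_t]=2\boldsymbol\Theta_t$, $[\boldsymbol\Delta_t,\boldsymbol\Theta_t]=\boldsymbol E_t+\tfrac t2$. The Casimir operator is $\boldsymbol C_t:=\boldsymbol E_t^2+t\boldsymbol E_t-4\boldsymbol\Theta_t\boldsymbol\Delta_t-2\boldsymbol E_t$, and $\boldsymbol C_{t,d}$ is its restriction to $\mathsf P^d$. Partitions. $\mathcal I:=\{(\lambda_1,\lambda_2)\in\mathbb Z^2:\lambda_1\ge\lambda_2\ge0\}$, $|\lambda|=\lambda_1+\lambda_2$. For an integer $k\ge0$,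 $\lambda\in\mathcal I$ is $k$-regular if $\lambda_1\le k$ or $\lambda_1-\lambda_2=k+1$ or $\lambda_1-\lambda_2\ge2k+3$; $k$-quasiregular if $\lambda_1\ge k+1$ and $\lambda_1-\lambda_2\le k$; $k$-singular if $k+2\le\lambda_1-\lambda_2\le2k+2$. $\mathcal I'_k$ is the set of $k$-regular and $k$-quasiregular elements. With $k=\underline k$, $\lambda^\dagger:=(\lambda_2+\underline k+1,\lambda_1-\underline k-1)$; this interchanges $\underline k$-quasiregular and $\underline k$-singular elements. Components. Set $\boldsymbol c_\lambda(t):=(\lambda_1-\lambda_2)(\lambda_1-\lambda_2+t-2)$. The minimal polynomial of $\boldsymbol C_{t,d}$ is $\prod_{0\le a\le d,\,a\equiv d\,(2)}(x-a(a+t-2))$; for $|\lambda|=d$ let $m_\lambda\in\{1,2\}$ be the multiplicity of its root $\boldsymbol c_\lambda(t)$ and $\mathsf V_{t,\lambda}:=\ker((\boldsymbol C_{t,d}-\boldsymbol c_\lambda(t))^{m_\lambda})\subseteq\mathsf P^d$. Then (for $t\in2\mathbb Z^{\le0}$) $\mathsf P^d\cong\bigoplus_{\lambda\in\mathcal I'_{\underline k},|\lambda|=d}\mathsf V_{t,\lambda}$ with indecomposable summands. Capelli operators. For $\lambda\in\mathcal I'_{\underline k}$, with $d=|\lambda|$, $\boldsymbol D_{t,\lambda}\in\mathsf A_t$ is the element given by the coevaluation $\mathbf 1\to\mathsf V_{t,\lambda}\otimes\mathsf V_{t,\lambda}^*$, where $\mathsf V_{t,\lambda}\otimes\mathsf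 V_{t,\lambda}^*$ is a direct summand of $\mathsf S^d(\mathsf V_t)\otimes\mathsf S^d(\mathsf V_t^* )$ via the identification $\mathsf S^d(\mathsf V_t^* )\cong\mathsf S^d(\mathsf V_t)^*$ given by the contraction pairing above. For $\boldsymbol D\in\mathsf A_t$ the eigenvalue polynomial $\boldsymbol f_{\boldsymbol D}\in\mathbb C[x,y]$ is the unique symmetric polynomial such that for all $\mu\in\mathcal I'_{\underline k}$, $\boldsymbol D|_{\mathsf V_{t,\mu}}=\boldsymbol f_{\boldsymbol D}(\mu_1-\underline k-1,\mu_2)\cdot1+\boldsymbol\eta_\mu$ with $\boldsymbol\eta_\mu^2=0$. Write $\boldsymbol f_\lambda:=\boldsymbol f_{\boldsymbol D_{t,\lambda}}$. Knop–Sahi polynomials. With $a^{\underline r}:=a(a-1)\cdots(a-r+1)$, $$P_\lambda^\kappa(x,y):=\sum_{i+j\le\lambda_1-\lambda_2}\frac{(\lambda_1-\lambda_2)!\,(\kappa+1)^{\underline{\lambda_1-\lambda_2-i}}(\kappa+1)^{\underline{\lambda_1-\lambda_2-j}}}{i!\,j!\,(\lambda_1-\lambda_2-i-j)!\,(\kappa+1)^{\underline{\lambda_1-\lambda_2}}}\,x^{\underline{\lambda_2+i}}y^{\underline{\lambda_2+j}}\in\mathbb Q(\kappa)[x,y]$$ (sum over $i,j\ge 0$), $H_\lambda(\kappa):=(\lambda_1-\lambda_2)!\,\lambda_2!\,(\lambda_1-1-\kappa)^{\underline{\lambda_2}}$. $P^{-s/2}_{\lambda}$ is the specialization at $\kappa=-s/2$;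 limits of polynomials are coefficientwise. *)

theory Defs
  imports
    Complex_Main
    "HOL-Library.Poly_Mapping"
    "HOL-Library.Disjoint_Sets"
    "HOL-Combinatorics.Permutations"
    "HOL-Computational_Algebra.Polynomial"
begin

section \<open>The Brauer category\<close>

text \<open>
  A diagram from \<open>m\<close> to \<open>n\<close> is a perfect matching of the \<open>m\<close> points \<open>(0, i)\<close> of its source layer
  and the \<open>n\<close> points \<open>(1, j)\<close> of its target layer.
\<close>

type_synonym diagram = "(nat \<times> nat) set set"

definition diagrams :: "nat \<Rightarrow> nat \<Rightarrow> diagram set" where
  "diagrams m n =
     {D. partition_on ({0} \<times> {..<m} \<union> {1} \<times> {..<n}) D \<and> (\<forall>b\<in>D. card b = 2)}"

definition dsrc :: "diagram \<Rightarrow> nat" where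
  "dsrc D = card {i. (0, i) \<in> \<Union>D}"

definition dtgt :: "diagram \<Rightarrow> nat" where
  "dtgt D = card {i. (1, i) \<in> \<Union>D}"

text \<open>
  To compose, \<open>E\<close> is put on the layers 1 and 2, above \<open>D\<close> on the layers 0 and 1; the blocks of the
  composite are the connected components that reach layer 0 or 2, the remaining dcomponents are the
  closed loops.
\<close>

definition glue :: "diagram \<Rightarrow> diagram \<Rightarrow> diagram" where
  "glue E D = D \<union> (\<lambda>b. map_prod Suc id ` b) ` E"

definition dcomponents :: "diagram \<Rightarrow> diagram" where
  "dcomponents G = \<Union>G // {(x, y). \<exists>b\<in>G. x \<in> b \<and> y \<in> b}\<^sup>+"

definition loops :: "diagram \<Rightarrow> diagram \<Rightarrow> nat" where
  "loops E D = card {c \<in> dcomponents (glue E D). fst ` c = {1}}"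

definition dcomp :: "diagram \<Rightarrow> diagram \<Rightarrow> diagram" where
  "dcomp E D =
     (\<lambda>c. {(0, i) |i. (0, i) \<in> c} \<union> {(1, i) |i. (2, i) \<in> c}) `
       {c \<in> dcomponents (glue E D). fst ` c \<noteq> {1}}"

definition dtensor :: "diagram \<Rightarrow> diagram \<Rightarrow> diagram" where
  "dtensor D E =
     D \<union> (\<lambda>b. (\<lambda>(l, i). (l, i + (if l = 0 then dsrc D else dtgt D))) ` b) ` E"

definition dflip :: "diagram \<Rightarrow> diagram" where
  "dflip D = (\<lambda>b. (\<lambda>(l, i). (1 - l, i)) ` b) ` D"

definition perm_diagram :: "nat \<Rightarrow> (nat \<Rightarrow> nat) \<Rightarrow> diagram" where
  "perm_diagram n \<pi> = (\<lambda>i. {(0, i), (1, \<pi> i)}) ` {..<n}"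

text \<open>
  Morphisms are formal linear combinations of diagrams. Since a diagram determines its source and
  target, all spaces of morphisms \<open>bhom m n\<close> sit in one ambient vector space, on which composition
  is extended by 0 to pairs of diagrams that are not composable.
\<close>

type_synonym bmor = "diagram \<Rightarrow>\<^sub>0 complex"

definition bscale :: "complex \<Rightarrow> bmor \<Rightarrow> bmor"  (infixr "\<bullet>\<^sub>s" 75) where
  "c \<bullet>\<^sub>s f = Poly_Mapping.map ((*) c) f"

definition diag :: "diagram \<Rightarrow> bmor" where
  "diag D = Poly_Mapping.single D 1"

definition bhom :: "nat \<Rightarrow> nat \<Rightarrow> bmor set" where
  "bhom m n = {f. Poly_Mapping.keys f \<subseteq> diagrams m n}"

definition bcomp :: "complex \<Rightarrow> bmor \<Rightarrow> bmor \<Rightarrow> bmor" where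
  "bcomp t g f =
     (\<Sum>E\<in>Poly_Mapping.keys g. \<Sum>D\<in>Poly_Mapping.keys f.
        if dtgt D = dsrc E
        then (Poly_Mapping.lookup g E * Poly_Mapping.lookup f D * t ^ loops E D) \<bullet>\<^sub>s
               diag (dcomp E D)
        else 0)"

definition btensor :: "bmor \<Rightarrow> bmor \<Rightarrow> bmor"  (infixr "\<otimes>" 72) where
  "f \<otimes> g =
     (\<Sum>D\<in>Poly_Mapping.keys f. \<Sum>E\<in>Poly_Mapping.keys g.
        (Poly_Mapping.lookup f D * Poly_Mapping.lookup g E) \<bullet>\<^sub>s diag (dtensor D E))"

definition bflip :: "bmor \<Rightarrow> bmor" where
  "bflip f = (\<Sum>D\<in>Poly_Mapping.keys f. Poly_Mapping.lookup f D \<bullet>\<^sub>s diag (dflip D))"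

definition idm :: "nat \<Rightarrow> bmor" where
  "idm n = diag (perm_diagram n id)"

definition braid :: bmor where
  "braid = diag (perm_diagram 2 (Transposition.transpose 0 1))"

definition ev :: bmor where
  "ev = diag {{(0, 0), (0, 1)}}"

text \<open>
  \<open>coev n\<close> makes \<open>V\<^sup>\<otimes>\<^sup>n\<close> its own dual, the \<open>i\<close>-th factor being dual to the \<open>i\<close>-th factor. The
  dual of a morphism is then \<open>bflip\<close>. For \<open>n = 1\<close> this is the coevaluation of \<open>V\<close>.
\<close>

definition coev :: "nat \<Rightarrow> bmor" where
  "coev n = diag ((\<lambda>i. {(1, i), (1, n + i)}) ` {..<n})"

definition symmetrizer :: "nat \<Rightarrow> bmor" where
  "symmetrizer n = (1 / fact n) \<bullet>\<^sub>s (\<Sum>\<pi> | \<pi> permutes {..<n}. diag (perm_diagram n \<pi>))"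


section \<open>The Karoubi envelope\<close>

text \<open>
  An object is a pair of some \<open>n\<close> and an idempotent \<open>e\<close> on \<open>V\<^sup>\<otimes>\<^sup>n\<close>, a morphism \<open>(m, e) \<rightarrow> (n, e')\<close>
  is an \<open>f : m \<rightarrow> n\<close> with \<open>e' f = f = f e\<close>; in particular \<open>e\<close> is the identity of \<open>(n, e)\<close>.
  The category \<open>Rep(O\<^sub>t)\<close> is obtained from this one by adjoining finite direct sums. A morphism from
  or to a direct sum is a tuple, so kernels and direct sum decompositions of objects \<open>(n, e)\<close> do not
  depend on whether direct sums are adjoined.
\<close>

type_synonym kobj = "nat \<times> bmor"

definition kobjects :: "complex \<Rightarrow> kobj set" where
  "kobjects t = {(n, e). e \<in> bhom n n \<and> bcomp t e e = e}"

definition khom :: "complex \<Rightarrow> kobj \<Rightarrow> kobj \<Rightarrow> bmor set" where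
  "khom t X Y =
     {f \<in> bhom (fst X) (fst Y). bcomp t (snd Y) f = f \<and> bcomp t f (snd X) = f}"

definition kunit :: kobj where
  "kunit = (0, idm 0)"

definition ktensor :: "kobj \<Rightarrow> kobj \<Rightarrow> kobj" where
  "ktensor X Y = (fst X + fst Y, snd X \<otimes> snd Y)"

definition kdual :: "kobj \<Rightarrow> kobj" where
  "kdual X = (fst X, bflip (snd X))"

definition kcoev :: "complex \<Rightarrow> kobj \<Rightarrow> bmor" where
  "kcoev t X = bcomp t (snd X \<otimes> bflip (snd X)) (coev (fst X))"

definition is_kernel :: "complex \<Rightarrow> kobj \<Rightarrow> kobj \<Rightarrow> bmor \<Rightarrow> kobj \<Rightarrow> bmor \<Rightarrow> bool" where
  "is_kernel t X Y f K i \<longleftrightarrow>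
     K \<in> kobjects t \<and> i \<in> khom t K X \<and> bcomp t f i = 0 \<and>
     (\<forall>Z\<in>kobjects t. \<forall>g\<in>khom t Z X. bcomp t f g = 0 \<longrightarrow> (\<exists>!h. h \<in> khom t Z K \<and> bcomp t i h = g))"

primrec end_pow :: "complex \<Rightarrow> kobj \<Rightarrow> bmor \<Rightarrow> nat \<Rightarrow> bmor" where
  "end_pow t X f 0 = snd X"
| "end_pow t X f (Suc n) = bcomp t f (end_pow t X f n)"

definition end_poly :: "complex \<Rightarrow> kobj \<Rightarrow> complex poly \<Rightarrow> bmor \<Rightarrow> bmor" where
  "end_poly t X p f = (\<Sum>i\<le>degree p. coeff p i \<bullet>\<^sub>s end_pow t X f i)"

definition min_poly :: "complex \<Rightarrow> kobj \<Rightarrow> bmor \<Rightarrow> complex poly" where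
  "min_poly t X f =
     (THE p. lead_coeff p = 1 \<and> end_poly t X p f = 0 \<and>
             (\<forall>q. q \<noteq> 0 \<and> end_poly t X q f = 0 \<longrightarrow> degree p \<le> degree q))"


section \<open>Polynomial differential operators\<close>

text \<open>
  \<open>V\<^sup>*\<close> is \<open>V\<close> with the evaluation \<open>ev\<close>, so the objects \<open>S\<^sup>d(V)\<close> and \<open>S\<^sup>d(V\<^sup>*)\<close> are both
  \<open>symP d\<close>. The graded object \<open>P\<close> is the family of its homogeneous components
  \<open>P\<^sup>d = symP d\<close>, and a homogeneous operator on \<open>P\<close> is the family of its restrictions to them.
\<close>

definition symP :: "nat \<Rightarrow> kobj" where
  "symP d = (d, symmetrizer d)"

context
  fixes t :: complex
begin

abbreviation bcomp_t  (infixr "\<odot>" 70) where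
  "g \<odot> f \<equiv> bcomp t g f"

definition mulP :: "nat \<Rightarrow> nat \<Rightarrow> bmor" where
  "mulP p q = symmetrizer (p + q) \<odot> (symmetrizer p \<otimes> symmetrizer q)"

text \<open>
  \<open>leibniz q : V\<^sup>* \<otimes> V\<^sup>\<otimes>\<^sup>q \<rightarrow> V\<^sup>\<otimes>\<^sup>(\<^sup>q\<^sup>-\<^sup>1\<^sup>)\<close> is the action of \<open>V\<^sup>*\<close> on the tensor algebra by the derivations
  extending the evaluation; it is computed by the Leibniz rule \<open>\<partial>(v w) = \<partial>(v) w + v \<partial>(w)\<close>
  for \<open>v\<close> in \<open>V\<close>. It induces the action \<open>deriv1 q\<close> on the symmetric algebra. It vanishes for
  \<open>q = 0\<close>, so the truncated subtraction on natural numbers is harmless here and below.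
\<close>

primrec leibniz :: "nat \<Rightarrow> bmor" where
  "leibniz 0 = 0"
| "leibniz (Suc q) = (ev \<otimes> idm q) + ((idm 1 \<otimes> leibniz q) \<odot> (braid \<otimes> idm q))"

definition deriv1 :: "nat \<Rightarrow> bmor" where
  "deriv1 q = symmetrizer (q - 1) \<odot> leibniz q \<odot> (idm 1 \<otimes> symmetrizer q)"

primrec derivs :: "nat \<Rightarrow> nat \<Rightarrow> bmor" where
  "derivs 0 q = symmetrizer q"
| "derivs (Suc p) q = deriv1 (q - p) \<odot> (idm 1 \<otimes> derivs p q)"

text \<open>The contraction \<open>S\<^sup>p(V\<^sup>*) \<otimes> S\<^sup>q(V) \<rightarrow> S\<^sup>q\<^sup>-\<^sup>p(V)\<close>, zero if \<open>p > q\<close>.\<close>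

definition contr :: "nat \<Rightarrow> nat \<Rightarrow> bmor" where
  "contr p q = derivs p q \<odot> (symmetrizer p \<otimes> symmetrizer q)"

text \<open>
  An element of the algebra \<open>A\<^sub>t\<close> is a finitely supported family of morphisms
  \<open>a\<^sub>p : 1 \<rightarrow> S\<^sup>p(V) \<otimes> S\<^sup>p(V\<^sup>*)\<close>. Its restriction to \<open>P\<^sup>d\<close> is \<open>act a d\<close>.
\<close>

definition act :: "(nat \<Rightarrow>\<^sub>0 bmor) \<Rightarrow> nat \<Rightarrow> bmor" where
  "act a d =
     (\<Sum>p\<in>Poly_Mapping.keys a.
        mulP p (d - p) \<odot> (symmetrizer p \<otimes> contr p d) \<odot> (Poly_Mapping.lookup a p \<otimes> symmetrizer d))"

definition euler :: "nat \<Rightarrow>\<^sub>0 bmor" where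
  "euler = Poly_Mapping.single 1 (coev 1)"

definition Theta :: "nat \<Rightarrow> bmor" where
  "Theta d = (1 / 2) \<bullet>\<^sub>s (mulP 2 d \<odot> (coev 1 \<otimes> symmetrizer d))"

definition Delta :: "nat \<Rightarrow> bmor" where
  "Delta d = (1 / 2) \<bullet>\<^sub>s (contr 2 d \<odot> (coev 1 \<otimes> symmetrizer d))"

definition casimir :: "nat \<Rightarrow> bmor" where
  "casimir d =
     (act euler d \<odot> act euler d) + t \<bullet>\<^sub>s act euler d
     - 4 \<bullet>\<^sub>s (Theta (d - 2) \<odot> Delta d) - 2 \<bullet>\<^sub>s act euler d"

end


section \<open>Components and Capelli operators\<close>

definition partitions2 :: "(nat \<times> nat) set" where
  "partitions2 = {(l1, l2). l2 \<le> l1}"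

definition psize :: "nat \<times> nat \<Rightarrow> nat" where
  "psize l = fst l + snd l"

definition kregular :: "nat \<Rightarrow> nat \<times> nat \<Rightarrow> bool" where
  "kregular k l \<longleftrightarrow> fst l \<le> k \<or> fst l - snd l = k + 1 \<or> fst l - snd l \<ge> 2 * k + 3"

definition kquasiregular :: "nat \<Rightarrow> nat \<times> nat \<Rightarrow> bool" where
  "kquasiregular k l \<longleftrightarrow> fst l \<ge> k + 1 \<and> fst l - snd l \<le> k"

definition Ireg :: "nat \<Rightarrow> (nat \<times> nat) set" where
  "Ireg k = {l \<in> partitions2. kregular k l \<or> kquasiregular k l}"

text \<open>Only used for quasiregular arguments, where \<open>fst l \<ge> k + 1\<close>.\<close>

definition dagger :: "nat \<Rightarrow> nat \<times> nat \<Rightarrow> nat \<times> nat" where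
  "dagger k l = (snd l + k + 1, fst l - k - 1)"

definition c_val :: "complex \<Rightarrow> nat \<times> nat \<Rightarrow> complex" where
  "c_val t l = of_nat (fst l - snd l) * (of_nat (fst l - snd l) + t - 2)"

definition m_val :: "complex \<Rightarrow> nat \<times> nat \<Rightarrow> nat" where
  "m_val t l = order (c_val t l) (min_poly t (symP (psize l)) (casimir t (psize l)))"

definition gen_eigen_op :: "complex \<Rightarrow> nat \<times> nat \<Rightarrow> bmor" where
  "gen_eigen_op t l =
     end_pow t (symP (psize l))
       (casimir t (psize l) - c_val t l \<bullet>\<^sub>s symmetrizer (psize l)) (m_val t l)"

text \<open>
  A direct sum decomposition of \<open>P\<^sup>d\<close> is given by the projections \<open>pr l\<close> onto its summands, which
  are then the objects \<open>(d, pr l)\<close> with inclusion and projection \<open>pr l\<close>.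
\<close>

definition is_decomposition :: "complex \<Rightarrow> nat \<Rightarrow> nat \<Rightarrow> (nat \<times> nat \<Rightarrow> bmor) \<Rightarrow> bool" where
  "is_decomposition t k d pr \<longleftrightarrow>
     (let I = {l \<in> Ireg k. psize l = d} in
       (\<forall>l\<in>I. pr l \<in> khom t (symP d) (symP d) \<and> bcomp t (pr l) (pr l) = pr l \<and>
              is_kernel t (symP d) (symP d) (gen_eigen_op t l) (d, pr l) (pr l)) \<and>
       (\<forall>l\<in>I. \<forall>m\<in>I. l \<noteq> m \<longrightarrow> bcomp t (pr l) (pr m) = 0) \<and>
       (\<Sum>l\<in>I. pr l) = symmetrizer d \<and>
       (\<forall>l. l \<notin> I \<longrightarrow> pr l = 0))"

definition Vproj :: "complex \<Rightarrow> nat \<Rightarrow> nat \<times> nat \<Rightarrow> bmor" where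
  "Vproj t k l = (THE pr. is_decomposition t k (psize l) pr) l"

definition Vcomp :: "complex \<Rightarrow> nat \<Rightarrow> nat \<times> nat \<Rightarrow> kobj" where
  "Vcomp t k l = (psize l, Vproj t k l)"

text \<open>
  The identification \<open>S\<^sup>d(V\<^sup>*) \<rightarrow> S\<^sup>d(V)\<^sup>*\<close> given by the pairing \<open>contr d d\<close>. It is \<open>d!\<close> times the
  one that comes from regarding both sides as direct summands of \<open>V\<^sup>\<otimes>\<^sup>d\<close>.
\<close>

definition dual_iso :: "complex \<Rightarrow> nat \<Rightarrow> bmor" where
  "dual_iso t d =
     bcomp t (contr t d d \<otimes> snd (kdual (symP d))) (symmetrizer d \<otimes> kcoev t (symP d))"

text \<open>
  Since \<open>Vcomp \<otimes> Vcomp\<^sup>*\<close> is the summand of \<open>S\<^sup>d(V) \<otimes> S\<^sup>d(V)\<^sup>*\<close> cut out by an idempotent, its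
  coevaluation is literally a morphism to the latter object.
\<close>

definition capelli :: "complex \<Rightarrow> nat \<Rightarrow> nat \<times> nat \<Rightarrow> (nat \<Rightarrow>\<^sub>0 bmor)" where
  "capelli t k l =
     (let d = psize l in
       Poly_Mapping.single d
         (THE x. x \<in> khom t kunit (ktensor (symP d) (symP d)) \<and>
                 bcomp t (symmetrizer d \<otimes> dual_iso t d) x = kcoev t (Vcomp t k l)))"

text \<open>
  In \<open>complex poly poly\<close> the inner variable is \<open>x\<close> and the outer one is \<open>y\<close>: the coefficient of
  \<open>x\<^sup>i y\<^sup>j\<close> in \<open>f\<close> is \<open>coeff (coeff f j) i\<close>.
\<close>

definition poly2 :: "complex poly poly \<Rightarrow> complex \<Rightarrow> complex \<Rightarrow> complex" where
  "poly2 f x y = poly (poly f [:y:]) x"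

definition symmetric_poly2 :: "complex poly poly \<Rightarrow> bool" where
  "symmetric_poly2 f \<longleftrightarrow> (\<forall>i j. coeff (coeff f j) i = coeff (coeff f i) j)"

definition eigenvalue_poly :: "complex \<Rightarrow> nat \<Rightarrow> (nat \<Rightarrow>\<^sub>0 bmor) \<Rightarrow> complex poly poly" where
  "eigenvalue_poly t k D =
     (THE f. symmetric_poly2 f \<and>
        (\<forall>m\<in>Ireg k. \<exists>\<eta>\<in>khom t (Vcomp t k m) (Vcomp t k m).
           bcomp t \<eta> \<eta> = 0 \<and>
           bcomp t (act t D (psize m)) (Vproj t k m) =
             poly2 f (of_nat (fst m) - of_nat k - 1) (of_nat (snd m)) \<bullet>\<^sub>s Vproj t k m + \<eta>))"


section \<open>Knop--Sahi polynomials\<close>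

definition ffact :: "'a :: comm_ring_1 \<Rightarrow> nat \<Rightarrow> 'a" where
  "ffact a r = (\<Prod>i<r. a - of_nat i)"

abbreviation const2 :: "complex \<Rightarrow> complex poly poly" where
  "const2 c \<equiv> [:[:c:]:]"

abbreviation X2 :: "complex poly poly" where
  "X2 \<equiv> [:[:0, 1:]:]"

abbreviation Y2 :: "complex poly poly" where
  "Y2 \<equiv> [:0, 1:]"

text \<open>
  The coefficients are evaluated at the complex number \<open>\<kappa>\<close> directly, which gives the
  specialization of the polynomial over \<open>\<rat>(\<kappa>)\<close> wherever the denominator does not vanish.
\<close>

definition KnopSahi :: "nat \<times> nat \<Rightarrow> complex \<Rightarrow> complex poly poly" where
  "KnopSahi l \<kappa> =
     (let n = fst l - snd l in
       \<Sum>(i, j) \<in> {(i, j). i + j \<le> n}.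
         const2 (fact n * ffact (\<kappa> + 1) (n - i) * ffact (\<kappa> + 1) (n - j)
                 / (fact i * fact j * fact (n - i - j) * ffact (\<kappa> + 1) n))
         * ffact X2 (snd l + i) * ffact Y2 (snd l + j))"

definition Hnorm :: "nat \<times> nat \<Rightarrow> complex \<Rightarrow> complex" where
  "Hnorm l \<kappa> =
     fact (fst l - snd l) * fact (snd l) * ffact (of_nat (fst l) - 1 - \<kappa>) (snd l)"

end

theory Submission
  imports Defs "HOL-Computational_Algebra.Fundamental_Theorem_Algebra"
    "HOL-Computational_Algebra.Formal_Power_Series"
begin

text \<open>
  The operators \<open>u\<^sub>j = \<Theta>\<^sup>j \<Delta>\<^sup>j\<close> span the polynomials in the Casimir operator on \<open>P\<^sup>d\<close>, and
  \<open>u\<^sub>j = \<Prod>\<^sub>i\<^sub><\<^sub>j (c\<^sub>i - C) / 4\<close> is a Newton basis for its eigenvalues \<open>c\<^sub>i\<close>. The projection onto a component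
  is therefore \<open>\<Sum> A\<^sub>j u\<^sub>j\<close>, where the \<open>A\<^sub>j\<close> are the Newton coefficients of an interpolation polynomial. The
  \<open>u\<^sub>j\<close> extend to operators of higher degree in a simple way, so the \<open>A\<^sub>j\<close> also determine the eigenvalues
  of the Capelli operator. For generic \<open>s\<close>, Vandermonde's identity shows that the normalized
  Knop--Sahi polynomial arises in this way from a Lagrange basis polynomial. As \<open>s\<close> tends to \<open>t\<close>, the nodes
  of a quasiregular partition and of its dagger collide; the sum of their Lagrange basis polynomials
  converges to the polynomial that gives the projection onto a generalized eigenspace.
\<close>

section \<open>Colourings of diagrams\<close>

text \<open>\<open>dcomp\<close> is defined through connected components and a count of closed
  loops, which is awkward for associativity, interchange and zigzags. A diagram is therefore
  replaced by the set of its boundary 2-colourings that are constant on blocks. This set determines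
  the matching, and the middle colourings compatible with both factors number 2^loops or 0
  (\<open>card_sat_dcomp\<close>), so composite and loops are both recovered by counting subsets. In
  effect this is the case t = 2, where matrix entries of diagrams are 0 or 1. Diagrams from d to d
  modulo permutations of both layers are classified by their number of cups. Hence there is one
  symmetrized diagram for each j \<le> d/2, and the Casimir operator acts on them by a bidiagonal
  matrix; the minimal polynomial follows, and the rest is arithmetic modulo its factors. At t = -2k
  the eigenvalues of index i and r agree iff i = r or i + r + k + 1 = d. So at most two indices
  share an eigenvalue, which is why nilpotent parts square to zero and why only simple poles have to
  cancel in the limit.\<close>

definition monochr :: "'a set set \<Rightarrow> 'a set \<Rightarrow> bool" where
  "monochr G S \<longleftrightarrow> (\<forall>b\<in>G. \<forall>p\<in>b. \<forall>q\<in>b. p \<in> S \<longleftrightarrow> q \<in> S)"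

text \<open>This is the matrix entry of \<open>D\<close> at a pair of basis tensors when V is
  two-dimensional with an orthonormal basis: \<open>A\<close> and \<open>B\<close> record which
  tensor positions carry the first basis vector.\<close>

definition sat :: "diagram \<Rightarrow> nat set \<Rightarrow> nat set \<Rightarrow> bool" where
  "sat D A B = monochr D ({0} \<times> A \<union> {1} \<times> B)"

text \<open>The transitive closure is already reflexive on the points of \<open>G\<close>, because a
  point is related to itself by any block that contains it.\<close>

lemma equiv_conn:
  "equiv (\<Union>G) ({(x, y). \<exists>b\<in>G. x \<in> b \<and> y \<in> b}\<^sup>+)"
proof (rule equivI)
  let ?R = "{(x, y). \<exists>b\<in>G. x \<in> b \<and> y \<in> b}"
  have s: "?R\<^sup>+ \<subseteq> \<Union>G \<times> \<Union>G"
    by (rule trancl_subset_Sigma) auto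
  show "?R\<^sup>+ \<subseteq> \<Union>G \<times> \<Union>G" by (rule s)
  show "refl_on (\<Union>G) (?R\<^sup>+)"
    by (auto simp: refl_on_def)
  show "sym (?R\<^sup>+)"
    by (rule sym_trancl) (auto simp: sym_def)
  show "trans (?R\<^sup>+)" by (rule trans_trancl)
qed

lemma partition_on_dcomponents: "partition_on (\<Union>G) (dcomponents G)"
  unfolding dcomponents_def by (rule partition_on_quotient[OF equiv_conn])

lemma Union_dcomponents: "\<Union>(dcomponents G) = \<Union>G"
  using partition_onD1[OF partition_on_dcomponents] by simp

lemma block_in_dcomponent:
  assumes "b \<in> G" "c \<in> dcomponents G" "p \<in> b" "p \<in> c"
  shows "b \<subseteq> c"
proof
  fix q assume "q \<in> b"
  let ?R = "{(x, y). \<exists>b\<in>G. x \<in> b \<and> y \<in> b}"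
  have "(p, q) \<in> ?R\<^sup>+" using assms \<open>q \<in> b\<close> by (intro r_into_trancl) auto
  moreover obtain x where "c = ?R\<^sup>+ `` {x}"
    using assms(2) by (auto simp: dcomponents_def quotient_def)
  ultimately show "q \<in> c" using assms(4) by (auto intro: trancl_trans)
qed

lemma monochr_trancl:
  assumes "monochr G S" "(p, q) \<in> {(x, y). \<exists>b\<in>G. x \<in> b \<and> y \<in> b}\<^sup>+"
  shows "p \<in> S \<longleftrightarrow> q \<in> S"
  using assms(2)
proof (induction rule: trancl_induct)
  case (base y)
  then show ?case using assms(1) by (auto simp: monochr_def)
next
  case (step y z)
  then show ?case using assms(1) by (auto simp: monochr_def)
qed

text \<open>Blocks lie inside components, and conversely a colour propagates along a chain of
  overlapping blocks.\<close>

lemma monochr_dcomponents: "monochr (dcomponents G) S \<longleftrightarrow> monochr G S"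
proof
  assume m: "monochr (dcomponents G) S"
  show "monochr G S" unfolding monochr_def
  proof (intro ballI)
    fix b p q assume b: "b \<in> G" "p \<in> b" "q \<in> b"
    then have "p \<in> \<Union>(dcomponents G)" by (auto simp: Union_dcomponents)
    then obtain c where c: "c \<in> dcomponents G" "p \<in> c" by blast
    then have "q \<in> c" using block_in_dcomponent[OF b(1) c(1) b(2)] b(3) by auto
    then show "p \<in> S \<longleftrightarrow> q \<in> S" using m c unfolding monochr_def by blast
  qed
next
  assume m: "monochr G S"
  show "monochr (dcomponents G) S" unfolding monochr_def
  proof (intro ballI)
    fix c p q assume c: "c \<in> dcomponents G" "p \<in> c" "q \<in> c"
    have "(p, q) \<in> {(x, y). \<exists>b\<in>G. x \<in> b \<and> y \<in> b}\<^sup>+"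
      using quotient_eq_iff[OF equiv_conn, of c G c p q] c by (auto simp: dcomponents_def)
    from monochr_trancl[OF m this] show "p \<in> S \<longleftrightarrow> q \<in> S" .
  qed
qed

lemma monochr_diff:
  assumes "monochr G S" "monochr G T"
  shows "monochr G ((S - T) \<union> (T - S))"
  using assms unfolding monochr_def by (intro ballI) (metis Diff_iff Un_iff)

lemma monochr_insert: "monochr (insert {u, v} G) S \<longleftrightarrow> (u \<in> S \<longleftrightarrow> v \<in> S) \<and> monochr G S"
  by (auto simp: monochr_def)

text \<open>Under symmetric difference the monochromatic subsets form a group, and each additional
  edge cuts out a subgroup of index at most 2. Keeping the power of 2 on the right avoids
  subtracting exponents.\<close>

lemma card_mono_ge:
  assumes "finite G" "finite V" "\<forall>b\<in>G. card b = 2"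
  shows "2 ^ card V \<le> card {S \<in> Pow V. monochr G S} * 2 ^ card G"
  using assms(1,3)
proof (induction G rule: finite_induct)
  case empty
  have "{S \<in> Pow V. monochr {} S} = Pow V" by (auto simp: monochr_def)
  then show ?case using assms(2) by (simp add: card_Pow)
next
  case (insert b G)
  let ?X = "{S \<in> Pow V. monochr G S}" and ?Y = "{S \<in> Pow V. monochr (insert b G) S}"
  have fX: "finite ?X" and fY: "finite ?Y" using assms(2) by auto
  have sub: "?Y \<subseteq> ?X" by (auto simp: monochr_def)
  obtain u v where b: "b = {u, v}" "u \<noteq> v"
    using insert by (auto simp: card_2_iff)
  \<comment> \<open>If some \<open>T\<close> violates the new edge, symmetric difference with
    \<open>T\<close> carries the violating subsets injectively to subsets that respect it.\<close>
  have "card (?X - ?Y) \<le> card ?Y"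
  proof (cases "?X - ?Y = {}")
    case False
    then obtain T where T: "T \<in> ?X" "T \<notin> ?Y" by blast
    have Tb: "u \<in> T \<longleftrightarrow> v \<notin> T" using T unfolding b monochr_insert by blast
    show ?thesis
    proof (rule card_inj_on_le[OF _ _ fY])
      show "inj_on (\<lambda>S. (S - T) \<union> (T - S)) (?X - ?Y)"
        by (auto simp: inj_on_def)
      show "(\<lambda>S. (S - T) \<union> (T - S)) ` (?X - ?Y) \<subseteq> ?Y"
      proof
        fix Z assume "Z \<in> (\<lambda>S. (S - T) \<union> (T - S)) ` (?X - ?Y)"
        then obtain S where S: "S \<in> ?X" "S \<notin> ?Y" "Z = (S - T) \<union> (T - S)" by blast
        have Sb: "u \<in> S \<longleftrightarrow> v \<notin> S" using S unfolding b monochr_insert by blast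
        have "monochr G Z" using monochr_diff[of G S T] S T by auto
        moreover have "u \<in> Z \<longleftrightarrow> v \<in> Z" using Sb Tb S(3) by auto
        ultimately show "Z \<in> ?Y" using S T unfolding b monochr_insert by blast
      qed
    qed
  next
    case True
    then show ?thesis by (simp only: card.empty zero_le)
  qed
  moreover have "card ?X = card (?X - ?Y) + card ?Y"
    using card_Diff_subset[OF fY sub] card_mono[OF fX sub] by simp
  ultimately have "card ?X \<le> card ?Y * 2" by simp
  then have "card ?X * 2 ^ card G \<le> card ?Y * 2 * 2 ^ card G" by (rule mult_right_mono) simp
  moreover have "2 ^ card V \<le> card ?X * 2 ^ card G" using insert by auto
  moreover have "card (insert b G) = Suc (card G)" using insert by simp
  ultimately show ?case by (simp only: power_Suc mult.assoc)
qed

subsection \<open>Composition of diagrams\<close>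

lemma diagramsD:
  assumes "D \<in> diagrams m n"
  shows "\<Union>D = {0} \<times> {..<m} \<union> {1} \<times> {..<n}" "\<And>b. b \<in> D \<Longrightarrow> card b = 2"
    "\<And>b b' p. b \<in> D \<Longrightarrow> b' \<in> D \<Longrightarrow> p \<in> b \<Longrightarrow> p \<in> b' \<Longrightarrow> b = b'" "finite D"
    "\<And>b. b \<in> D \<Longrightarrow> finite b"
proof -
  have p: "partition_on ({0} \<times> {..<m} \<union> {1} \<times> {..<n}) D" and c: "\<forall>b\<in>D. card b = 2"
    using assms by (auto simp: diagrams_def)
  show "\<Union>D = {0} \<times> {..<m} \<union> {1} \<times> {..<n}" using partition_onD1[OF p] by simp
  show "\<And>b. b \<in> D \<Longrightarrow> card b = 2" using c by auto
  show "\<And>b b' p. b \<in> D \<Longrightarrow> b' \<in> D \<Longrightarrow> p \<in> b \<Longrightarrow> p \<in> b' \<Longrightarrow> b = b'"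
    using partition_onD2[OF p] by (auto simp: disjoint_def)
  show "finite D" using finite_elements[OF _ p] by auto
  show "\<And>b. b \<in> D \<Longrightarrow> finite b" using c by (auto intro: card_ge_0_finite)
qed

lemma diagramsI:
  assumes "\<Union>D = {0} \<times> {..<m} \<union> {1} \<times> {..<n}" "\<And>b. b \<in> D \<Longrightarrow> card b = 2"
    "\<And>b b' p. b \<in> D \<Longrightarrow> b' \<in> D \<Longrightarrow> p \<in> b \<Longrightarrow> p \<in> b' \<Longrightarrow> b = b'"
  shows "D \<in> diagrams m n"
proof -
  have "b \<noteq> {}" if "b \<in> D" for b using assms(2)[OF that] by auto
  moreover have "disjoint D" using assms(3) by (auto simp: disjoint_def)
  ultimately show ?thesis
    using assms(1,2) by (auto simp: diagrams_def partition_on_def)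
qed

lemma dsrc_eq: "D \<in> diagrams m n \<Longrightarrow> dsrc D = m"
  and dtgt_eq: "D \<in> diagrams m n \<Longrightarrow> dtgt D = n"
  unfolding dsrc_def dtgt_def by (simp_all only: diagramsD(1)) (auto simp: lessThan_def[symmetric])

lemma Union_glue:
  assumes "D \<in> diagrams m n" "E \<in> diagrams n p"
  shows "\<Union>(glue E D) = {0} \<times> {..<m} \<union> {1} \<times> {..<n} \<union> {2} \<times> {..<p}"
proof -
  have "\<Union>(glue E D) = \<Union>D \<union> map_prod Suc id ` \<Union>E" by (auto simp: glue_def)
  also have "\<dots> = {0} \<times> {..<m} \<union> {1} \<times> {..<n} \<union> {2} \<times> {..<p}"
    unfolding diagramsD(1)[OF assms(1)] diagramsD(1)[OF assms(2)] by (auto simp: image_Un image_iff)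
  finally show ?thesis .
qed

lemma monochr_glue:
  assumes "D \<in> diagrams m n" "E \<in> diagrams n p"
  shows "monochr (glue E D) ({0} \<times> A \<union> {1} \<times> B \<union> {2} \<times> C) \<longleftrightarrow> sat D A B \<and> sat E B C"
proof -
  have l: "fst x \<in> {0, 1}" if "b \<in> D" "x \<in> b" for b x
  proof -
    have "x \<in> \<Union>D" using that by blast
    then show ?thesis unfolding diagramsD(1)[OF assms(1)] by auto
  qed
  have l': "fst x \<in> {0, 1}" if "b \<in> E" "x \<in> b" for b x
  proof -
    have "x \<in> \<Union>E" using that by blast
    then show ?thesis unfolding diagramsD(1)[OF assms(2)] by auto
  qed
  have "x \<in> {0} \<times> A \<union> {1} \<times> B \<union> {2} \<times> C \<longleftrightarrow> x \<in> {0} \<times> A \<union> {1} \<times> B"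
    if "b \<in> D" "x \<in> b" for b x using l[OF that] by (cases x) auto
  then have "monochr D ({0} \<times> A \<union> {1} \<times> B \<union> {2} \<times> C) \<longleftrightarrow> sat D A B"
    unfolding sat_def monochr_def by simp
  moreover have "monochr ((\<lambda>b. map_prod Suc id ` b) ` E) ({0} \<times> A \<union> {1} \<times> B \<union> {2} \<times> C) \<longleftrightarrow> sat E B C"
  proof -
    have eq: "map_prod Suc id x \<in> {0} \<times> A \<union> {1} \<times> B \<union> {2} \<times> C \<longleftrightarrow> x \<in> {0} \<times> B \<union> {1} \<times> C"
      if "fst x \<in> {0, 1::nat}" for x using that by (cases x) auto
    have "map_prod Suc id x \<in> {0} \<times> A \<union> {1} \<times> B \<union> {2} \<times> C \<longleftrightarrow> x \<in> {0} \<times> B \<union> {1} \<times> C"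
      if "b \<in> E" "x \<in> b" for b x using eq[OF l'[OF that]] .
    then show ?thesis unfolding sat_def monochr_def by simp
  qed
  ultimately show ?thesis by (simp add: glue_def monochr_def ball_Un)
qed

text \<open>Double counting of points and edges: a point of \<open>c\<close> brings its whole block
  into \<open>c\<close>. It is applied to a component of a glued graph, once for each of the two
  matchings.\<close>

lemma card_saturated:
  assumes "finite D" "\<And>b. b \<in> D \<Longrightarrow> card b = 2"
    "\<And>b b' p. b \<in> D \<Longrightarrow> b' \<in> D \<Longrightarrow> p \<in> b \<Longrightarrow> p \<in> b' \<Longrightarrow> b = b'"
    "\<And>b p. b \<in> D \<Longrightarrow> p \<in> b \<Longrightarrow> p \<in> c \<Longrightarrow> b \<subseteq> c"
  shows "card (c \<inter> \<Union>D) = 2 * card {b \<in> D. b \<subseteq> c}"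
proof -
  have "c \<inter> \<Union>D = \<Union>{b \<in> D. b \<subseteq> c}" using assms(4) by blast
  moreover have "card (\<Union>{b \<in> D. b \<subseteq> c}) = sum card {b \<in> D. b \<subseteq> c}"
  proof (rule card_Union_disjoint)
    show "pairwise disjnt {b \<in> D. b \<subseteq> c}" using assms(3) by (auto simp: pairwise_def disjnt_def)
    show "finite A" if "A \<in> {b \<in> D. b \<subseteq> c}" for A using that assms(2)[of A] by (auto intro: card_ge_0_finite)
  qed
  ultimately show ?thesis using assms(2) by simp
qed

text \<open>
  A connected graph with \<open>e\<close> edges has at most \<open>e + 1\<close> vertices, since each edge at most halves the
  number of monochromatic 2-colourings; the inner vertices have degree 2 and the outer ones degree 1.
\<close>
lemma card_outer_points:
  assumes D: "D \<in> diagrams m n" and E: "E \<in> diagrams n p"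
    and c: "c \<in> dcomponents (glue E D)" "fst ` c \<noteq> {1}"
  shows "card {x \<in> c. fst x \<noteq> 1} = 2"
proof -
  let ?G = "glue E D" and ?E = "(\<lambda>b. map_prod Suc id ` b) ` E"
  let ?Dc = "{b \<in> D. b \<subseteq> c}" and ?Ec = "{b \<in> ?E. b \<subseteq> c}"
  have inj: "inj (map_prod Suc (id :: nat \<Rightarrow> nat))" by (simp add: prod.inj_map)
  have UE: "\<Union>?E = map_prod Suc id ` \<Union>E" by auto
  have UE': "\<Union>?E = {1} \<times> {..<n} \<union> {2} \<times> {..<p}"
    unfolding UE diagramsD(1)[OF E] by (auto simp: image_Un image_iff)
  have cV: "c \<subseteq> \<Union>?G" using c(1) Union_dcomponents by blast
  have cV': "c \<subseteq> {0} \<times> {..<m} \<union> {1} \<times> {..<n} \<union> {2} \<times> {..<p}"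
    using cV Union_glue[OF D E] by simp
  have finc: "finite c" by (rule finite_subset[OF cV']) auto
  have cne: "c \<noteq> {}" using partition_onD3[OF partition_on_dcomponents] c(1) by metis
  have bc: "b \<subseteq> c" if "b \<in> ?G" "x \<in> b" "x \<in> c" for b x
    using block_in_dcomponent[OF that(1) c(1) that(2,3)] .
  have card2: "card b = 2" if "b \<in> ?G" for b
    using that diagramsD(2)[OF D] diagramsD(2)[OF E] inj
    by (auto simp: glue_def card_image inj_on_subset)
  have Dcount: "card (c \<inter> \<Union>D) = 2 * card ?Dc"
  proof (rule card_saturated)
    show "finite D" by (rule diagramsD(4)[OF D])
    show "card b = 2" if "b \<in> D" for b using diagramsD(2)[OF D that] .
    show "b = b'" if "b \<in> D" "b' \<in> D" "p \<in> b" "p \<in> b'" for b b' p using diagramsD(3)[OF D that] .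
    show "b \<subseteq> c" if "b \<in> D" "p \<in> b" "p \<in> c" for b p using bc that by (auto simp: glue_def)
  qed
  have Ecount: "card (c \<inter> \<Union>?E) = 2 * card ?Ec"
  proof (rule card_saturated)
    show "finite ?E" using diagramsD(4)[OF E] by simp
    show "card b = 2" if "b \<in> ?E" for b using card2 that by (auto simp: glue_def)
    show "b = b'" if b: "b \<in> ?E" "b' \<in> ?E" "x \<in> b" "x \<in> b'" for b b' x
    proof -
      obtain e where e: "b = map_prod Suc id ` e" "e \<in> E" using b(1) by (rule imageE)
      obtain e' where e': "b' = map_prod Suc id ` e'" "e' \<in> E" using b(2) by (rule imageE)
      obtain y where y: "x = map_prod Suc id y" "y \<in> e" using b(3) unfolding e by (rule imageE)
      obtain y' where y': "x = map_prod Suc id y'" "y' \<in> e'" using b(4) unfolding e' by (rule imageE)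
      have "y = y'" using y(1) y'(1) injD[OF inj] by simp
      then have "e = e'" using diagramsD(3)[OF E e(2) e'(2) y(2)] y'(2) by simp
      then show ?thesis using e e' by simp
    qed
    show "b \<subseteq> c" if "b \<in> ?E" "p \<in> b" "p \<in> c" for b p using bc that by (auto simp: glue_def)
  qed
  let ?a0 = "card (c \<inter> {0} \<times> {..<m})" and ?a1 = "card (c \<inter> {1} \<times> {..<n})"
    and ?a2 = "card (c \<inter> {2} \<times> {..<p})"
  have split: "card (c \<inter> (X \<union> Y)) = card (c \<inter> X) + card (c \<inter> Y)" if "X \<inter> Y = {}" for X Y
    unfolding Int_Un_distrib using finc that by (intro card_Un_disjoint) auto
  have dj: "({0::nat} \<times> {..<m}) \<inter> ({1} \<times> {..<n}) = {}" "({1::nat} \<times> {..<n}) \<inter> ({2} \<times> {..<p}) = {}"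
    "({0::nat} \<times> {..<m}) \<inter> ({2} \<times> {..<p}) = {}"
    "({0::nat} \<times> {..<m} \<union> {1} \<times> {..<n}) \<inter> ({2} \<times> {..<p}) = {}" by auto
  have D2: "?a0 + ?a1 = 2 * card ?Dc"
    using Dcount unfolding diagramsD(1)[OF D] split[OF dj(1)] .
  have E2: "?a1 + ?a2 = 2 * card ?Ec"
    using Ecount unfolding UE' split[OF dj(2)] .
  have call: "card c = ?a0 + ?a1 + ?a2"
    using split[OF dj(4)] split[OF dj(1)] Int_absorb2[OF cV'] by (simp only:)
  have "{x \<in> c. fst x \<noteq> 1} = c \<inter> ({0} \<times> {..<m} \<union> {2} \<times> {..<p})"
    using cV' by auto
  then have cout: "card {x \<in> c. fst x \<noteq> 1} = ?a0 + ?a2"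
    using split[OF dj(3)] by (simp only:)
  let ?Gc = "{b \<in> ?G. b \<subseteq> c}"
  have finG: "finite ?G" using diagramsD(4)[OF D] diagramsD(4)[OF E] by (simp add: glue_def)
  have "?Gc = ?Dc \<union> ?Ec" by (auto simp: glue_def)
  then have Gc: "card ?Gc \<le> card ?Dc + card ?Ec" by (simp only: card_Un_le)
  \<comment> \<open>Connectedness: a subset of \<open>c\<close> that respects the edges inside
    \<open>c\<close> respects every edge of the glued graph, so it is empty or all of
    \<open>c\<close>.\<close>
  have "{S \<in> Pow c. monochr ?Gc S} \<subseteq> {{}, c}"
  proof
    fix S assume S: "S \<in> {S \<in> Pow c. monochr ?Gc S}"
    have "monochr ?G S" unfolding monochr_def
    proof (intro ballI)
      fix b x y assume b: "b \<in> ?G" "x \<in> b" "y \<in> b"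
      show "x \<in> S \<longleftrightarrow> y \<in> S"
      proof (cases "b \<subseteq> c")
        case True
        then have "b \<in> ?Gc" using b by auto
        then show ?thesis using S b unfolding monochr_def by blast
      next
        case False
        then have "x \<notin> c" "y \<notin> c" using bc b by blast+
        then show ?thesis using S by auto
      qed
    qed
    then have "monochr (dcomponents ?G) S" by (simp add: monochr_dcomponents)
    then have "\<forall>x\<in>c. \<forall>y\<in>c. x \<in> S \<longleftrightarrow> y \<in> S" using c(1) unfolding monochr_def by blast
    then show "S \<in> {{}, c}" using S by blast
  qed
  then have "card {S \<in> Pow c. monochr ?Gc S} \<le> card {{}, c}" by (intro card_mono) auto
  also have "\<dots> \<le> 2" by (simp add: card_insert_if)
  finally have c2: "card {S \<in> Pow c. monochr ?Gc S} \<le> 2" .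
  have "2 ^ card c \<le> card {S \<in> Pow c. monochr ?Gc S} * 2 ^ card ?Gc"
    by (rule card_mono_ge) (use finG finc card2 in auto)
  also have "\<dots> \<le> 2 * 2 ^ (card ?Dc + card ?Ec)"
    using c2 Gc by (intro mult_mono power_increasing) auto
  also have "\<dots> = (2::nat) ^ (card ?Dc + card ?Ec + 1)" by simp
  finally have "card c \<le> card ?Dc + card ?Ec + 1" by (rule power_le_imp_le_exp[rotated]) simp
  \<comment> \<open>Twice the number of edges in \<open>c\<close> counts its inner points twice and
    its outer points once; compared with twice \<open>card c\<close> this leaves at most two outer
    points.\<close>
  then have le: "?a0 + ?a2 \<le> 2" using call D2 E2 by linarith
  have "\<not> (\<forall>x\<in>c. fst x = 1)"
  proof
    assume "\<forall>x\<in>c. fst x = 1"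
    then have "fst ` c = {1}" using cne by (auto simp: image_iff)
    then show False using c(2) by simp
  qed
  then obtain x where "x \<in> c" "fst x \<noteq> 1" by auto
  then have "x \<in> {x \<in> c. fst x \<noteq> 1}" by simp
  moreover have "finite {x \<in> c. fst x \<noteq> 1}" using finc by simp
  ultimately have "card {x \<in> c. fst x \<noteq> 1} > 0" using card_gt_0_iff by blast
  \<comment> \<open>There are one or two outer points, and parity excludes one.\<close>
  moreover have "even (?a0 + ?a2)"
  proof -
    have "(?a0 + ?a2) + 2 * ?a1 = 2 * (card ?Dc + card ?Ec)" using D2 E2 by simp
    then show ?thesis by presburger
  qed
  ultimately show ?thesis using le cout by presburger
qed

definition dproj :: "(nat \<times> nat) set \<Rightarrow> (nat \<times> nat) set" where
  "dproj c = {(0, i) |i. (0, i) \<in> c} \<union> {(1, i) |i. (2, i) \<in> c}"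

text \<open>In this form cardinalities and quantifiers transfer from a component to a block of the
  composite; halving sends the layers 0 and 2 to 0 and 1.\<close>

lemma dproj_image: "dproj c = (\<lambda>x. (fst x div 2, snd x)) ` {x \<in> c. fst x \<in> {0, 2}}"
proof (intro equalityI subsetI)
  fix x assume "x \<in> dproj c"
  then consider i where "x = (0, i)" "(0, i) \<in> c" | i where "x = (1, i)" "(2, i) \<in> c"
    unfolding dproj_def by blast
  then show "x \<in> (\<lambda>x. (fst x div 2, snd x)) ` {x \<in> c. fst x \<in> {0, 2}}"
  proof cases
    case (1 i) then show ?thesis by (intro image_eqI[of _ _ "(0, i)"]) auto
  next
    case (2 i) then show ?thesis by (intro image_eqI[of _ _ "(2, i)"]) auto
  qed
next
  fix x assume "x \<in> (\<lambda>x. (fst x div 2, snd x)) ` {x \<in> c. fst x \<in> {0, 2}}"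
  then obtain y where "y \<in> c" "fst y \<in> {0, 2}" "x = (fst y div 2, snd y)" by blast
  then show "x \<in> dproj c" unfolding dproj_def by (cases y) auto
qed

lemma dcomp_dproj: "dcomp E D = dproj ` {c \<in> dcomponents (glue E D). fst ` c \<noteq> {1}}"
  by (auto simp: dcomp_def dproj_def)

lemma mem_dproj [simp]: "(0, i) \<in> dproj c \<longleftrightarrow> (0, i) \<in> c" "(1, i) \<in> dproj c \<longleftrightarrow> (2, i) \<in> c"
    "(Suc 0, i) \<in> dproj c \<longleftrightarrow> (2, i) \<in> c"
  by (auto simp: dproj_def)

theorem dcomp_in_diagrams:
  assumes D: "D \<in> diagrams m n" and E: "E \<in> diagrams n p"
  shows "dcomp E D \<in> diagrams m p"
proof (rule diagramsI)
  let ?C = "dcomponents (glue E D)"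
  have U: "\<Union>?C = {0} \<times> {..<m} \<union> {1} \<times> {..<n} \<union> {2} \<times> {..<p}"
    using Union_dcomponents Union_glue[OF D E] by simp
  show "\<Union>(dcomp E D) = {0} \<times> {..<m} \<union> {1} \<times> {..<p}"
  proof (intro equalityI subsetI)
    fix x assume "x \<in> \<Union>(dcomp E D)"
    then obtain c where c: "c \<in> ?C" "x \<in> dproj c" by (auto simp: dcomp_dproj)
    have "c \<subseteq> \<Union>?C" using c by blast
    then show "x \<in> {0} \<times> {..<m} \<union> {1} \<times> {..<p}" using c(2) unfolding U by (auto simp: dproj_def)
  next
    fix x assume x: "x \<in> {0} \<times> {..<m} \<union> {1::nat} \<times> {..<p}"
    then obtain l i where li: "x = (l, i)" by (cases x)
    let ?y = "(2 * l, i)"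
    have "?y \<in> \<Union>?C" using x unfolding li U by auto
    then obtain c where c: "c \<in> ?C" "?y \<in> c" by blast
    have "fst ` c \<noteq> {1}"
    proof
      assume "fst ` c = {1}"
      then have "fst ?y = 1" using c(2) by (metis imageI singletonD)
      then show False by simp
    qed
    moreover have "x \<in> dproj c" using x c(2) li by (auto simp: dproj_def)
    ultimately show "x \<in> \<Union>(dcomp E D)" using c(1) by (auto simp: dcomp_dproj)
  qed
  show "card b = 2" if b: "b \<in> dcomp E D" for b
  proof -
    obtain c where c: "c \<in> ?C" "fst ` c \<noteq> {1}" "b = dproj c" using b by (auto simp: dcomp_dproj)
    have cV: "c \<subseteq> {0} \<times> {..<m} \<union> {1} \<times> {..<n} \<union> {2} \<times> {..<p}" using c(1) U by blast
    have o: "{x \<in> c. fst x \<in> {0, 2}} = {x \<in> c. fst x \<noteq> 1}" using cV by auto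
    have "inj_on (\<lambda>x. (fst x div 2, snd x)) {x \<in> c. fst x \<in> {0, 2}}"
    proof (rule inj_onI)
      fix x y assume "x \<in> {x \<in> c. fst x \<in> {0, 2}}" "y \<in> {x \<in> c. fst x \<in> {0, 2}}"
        and eq: "(fst x div 2, snd x) = (fst y div 2, snd y)"
      then have "fst x = 0 \<or> fst x = 2" "fst y = 0 \<or> fst y = 2" by auto
      then have "fst x = fst y" using eq by auto
      then show "x = y" using eq by (simp add: prod_eq_iff)
    qed
    then have "card b = card {x \<in> c. fst x \<in> {0, 2}}" unfolding c(3) dproj_image by (rule card_image)
    then show ?thesis unfolding o using card_outer_points[OF D E c(1,2)] by simp
  qed
  show "b = b'" if b: "b \<in> dcomp E D" "b' \<in> dcomp E D" "x \<in> b" "x \<in> b'" for b b' x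
  proof -
    obtain c c' where c: "c \<in> ?C" "c' \<in> ?C" "b = dproj c" "b' = dproj c'"
      using b by (auto simp: dcomp_dproj)
    have "c \<inter> c' \<noteq> {}" using b unfolding c dproj_def by auto
    then have "c = c'" using partition_onD2[OF partition_on_dcomponents] c(1,2)
      by (metis disjointD)
    then show ?thesis using c by simp
  qed
qed


lemma ball_conj: "(\<forall>x\<in>{x \<in> S. Q x}. R x) \<longleftrightarrow> (\<forall>x\<in>S. Q x \<longrightarrow> R x)"
  by blast

lemma sat_dcomp:
  "sat (dcomp E D) A C \<longleftrightarrow>
     (\<forall>c\<in>dcomponents (glue E D). fst ` c \<noteq> {1} \<longrightarrow>
       (\<forall>x\<in>{x \<in> c. fst x \<in> {0, 2}}. \<forall>y\<in>{x \<in> c. fst x \<in> {0, 2}}.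
          x \<in> {0} \<times> A \<union> {2} \<times> C \<longleftrightarrow> y \<in> {0} \<times> A \<union> {2} \<times> C))"
proof -
  have h: "(fst x div 2, snd x) \<in> {0} \<times> A \<union> {1} \<times> C \<longleftrightarrow> x \<in> {0} \<times> A \<union> {2} \<times> C"
    if "fst x \<in> {0, 2}" for x :: "nat \<times> nat" using that by (cases x) auto
  have "(\<forall>p\<in>dproj c. \<forall>q\<in>dproj c. p \<in> {0} \<times> A \<union> {1} \<times> C \<longleftrightarrow> q \<in> {0} \<times> A \<union> {1} \<times> C) \<longleftrightarrow>
    (\<forall>x\<in>{x \<in> c. fst x \<in> {0, 2}}. \<forall>y\<in>{x \<in> c. fst x \<in> {0, 2}}.
          x \<in> {0} \<times> A \<union> {2} \<times> C \<longleftrightarrow> y \<in> {0} \<times> A \<union> {2} \<times> C)" for c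
    unfolding dproj_image ball_simps(9) by (intro ball_cong refl) (metis (no_types, lifting) h mem_Collect_eq)
  then show ?thesis
    unfolding sat_def monochr_def dcomp_dproj by (simp only: ball_simps(9) ball_conj)
qed

text \<open>The middle points of an open component get the colour of its outer points, which have to
  agree, while every closed loop may take either colour. The compatible middle colourings are
  therefore parametrized by the subsets of the set \<open>L\<close> of loops.\<close>

theorem card_sat_dcomp:
  assumes D: "D \<in> diagrams m n" and E: "E \<in> diagrams n p"
  shows "card {B. B \<subseteq> {..<n} \<and> sat D A B \<and> sat E B C} =
    (if sat (dcomp E D) A C then 2 ^ loops E D else 0)"
proof -
  define \<C> where "\<C> = dcomponents (glue E D)"
  define L where "L = {c \<in> \<C>. fst ` c = {1}}"
  define X where "X = {B. B \<subseteq> {..<n} \<and> sat D A B \<and> sat E B C}"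
  have U: "\<Union>\<C> = {0} \<times> {..<m} \<union> {1} \<times> {..<n} \<union> {2} \<times> {..<p}"
    unfolding \<C>_def using Union_dcomponents Union_glue[OF D E] by simp
  have disj: "c = c'" if "c \<in> \<C>" "c' \<in> \<C>" "x \<in> c" "x \<in> c'" for c c' x
    using partition_onD2[OF partition_on_dcomponents] that unfolding \<C>_def
    by (metis disjointD IntI empty_iff)
  have ne: "c \<noteq> {}" if "c \<in> \<C>" for c
    using partition_onD3[OF partition_on_dcomponents] that unfolding \<C>_def by metis
  have pts: "x \<in> {0} \<times> {..<m} \<union> {1} \<times> {..<n} \<union> {2} \<times> {..<p}" if "c \<in> \<C>" "x \<in> c" for c x
    using U that by blast
  have fin\<C>: "finite \<C>"
    by (rule finite_UnionD) (simp add: U)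
  define Ou where "Ou = {0::nat} \<times> A \<union> {2} \<times> C"
  have Xiff: "B \<in> X \<longleftrightarrow> B \<subseteq> {..<n} \<and> (\<forall>c\<in>\<C>. \<forall>x\<in>c. \<forall>y\<in>c. x \<in> Ou \<union> {1} \<times> B \<longleftrightarrow> y \<in> Ou \<union> {1} \<times> B)" for B
  proof -
    have "sat D A B \<and> sat E B C \<longleftrightarrow> monochr \<C> ({0} \<times> A \<union> {1} \<times> B \<union> {2} \<times> C)"
      unfolding \<C>_def monochr_dcomponents monochr_glue[OF D E] ..
    moreover have "{0} \<times> A \<union> {1} \<times> B \<union> {2} \<times> C = Ou \<union> {1} \<times> B" unfolding Ou_def by blast
    ultimately show ?thesis unfolding X_def monochr_def by (simp only: mem_Collect_eq)
  qed
  have Xn: "B \<subseteq> {..<n}" if "B \<in> X" for B using that unfolding X_def by simp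
  have XD: "x \<in> Ou \<union> {1} \<times> B \<longleftrightarrow> y \<in> Ou \<union> {1} \<times> B" if "B \<in> X" "c \<in> \<C>" "x \<in> c" "y \<in> c" for B c x y
    using bspec[OF bspec[OF bspec[OF conjunct2[OF that(1)[unfolded Xiff]] that(2)] that(3)] that(4)] .
  have out: "\<exists>x\<in>c. fst x \<in> {0, 2}" if "c \<in> \<C> - L" for c
  proof (rule ccontr)
    assume "\<not> (\<exists>x\<in>c. fst x \<in> {0, 2})"
    then have "\<forall>x\<in>c. fst x = 1" using pts[of c] that by fastforce
    then have "fst ` c = {1}" using ne[of c] that by (auto simp: image_iff)
    then show False using that unfolding L_def by simp
  qed
  have satiff: "sat (dcomp E D) A C \<longleftrightarrow>
     (\<forall>c\<in>\<C>-L. \<forall>x\<in>{x \<in> c. fst x \<in> {0, 2}}. \<forall>y\<in>{x \<in> c. fst x \<in> {0, 2}}. x \<in> Ou \<longleftrightarrow> y \<in> Ou)"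
  proof -
    have "\<C> - L = {c \<in> \<C>. fst ` c \<noteq> {1}}" by (auto simp: L_def)
    then show ?thesis unfolding sat_dcomp \<C>_def[symmetric] Ou_def by (simp only: ball_conj)
  qed
  show ?thesis
  proof (cases "sat (dcomp E D) A C")
    case False
    then have "\<exists>c\<in>\<C> - L. \<exists>x\<in>{x \<in> c. fst x \<in> {0, 2}}. \<exists>y\<in>{x \<in> c. fst x \<in> {0, 2}}. (x \<in> Ou) \<noteq> (y \<in> Ou)"
      unfolding satiff by (simp only: ball_simps(10))
    then obtain c x y where c: "c \<in> \<C> - L" "x \<in> {x \<in> c. fst x \<in> {0, 2}}"
      "y \<in> {x \<in> c. fst x \<in> {0, 2}}" "(x \<in> Ou) \<noteq> (y \<in> Ou)"
      by (elim bexE)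
    have "x \<notin> {1} \<times> B" "y \<notin> {1} \<times> B" for B using c(2,3) by auto
    then have "B \<notin> X" for B using XD[of B c x y] c by auto
    then have "X = {}" by blast
    then show ?thesis using False unfolding X_def[symmetric] by simp
  next
    case True
    \<comment> \<open>The middle colouring for a choice \<open>T\<close> of loops: it colours the
      points on chosen loops and on open components with a coloured outer point.\<close>
    define f where "f T = {i. \<exists>c\<in>\<C>. (1, i) \<in> c \<and> (c \<in> T \<or> c \<notin> L \<and> c \<inter> Ou \<noteq> {})}" for T
    have key: "x \<in> Ou \<union> {1} \<times> f T \<longleftrightarrow> c \<in> T \<or> c \<notin> L \<and> c \<inter> Ou \<noteq> {}"
      if T: "T \<subseteq> L" and c: "c \<in> \<C>" and x: "x \<in> c" for T c x
    proof (cases "fst x = 1")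
      case True
      then obtain i where i: "x = (1, i)" by (cases x) auto
      have "x \<notin> Ou" using True unfolding Ou_def by auto
      moreover have "i \<in> f T \<longleftrightarrow> c \<in> T \<or> c \<notin> L \<and> c \<inter> Ou \<noteq> {}"
      proof
        assume "i \<in> f T"
        then obtain c' where c': "c' \<in> \<C>" "(1, i) \<in> c'" "c' \<in> T \<or> c' \<notin> L \<and> c' \<inter> Ou \<noteq> {}"
          unfolding f_def by blast
        have "c' = c" using disj[OF c'(1) c c'(2)] x i by simp
        then show "c \<in> T \<or> c \<notin> L \<and> c \<inter> Ou \<noteq> {}" using c' by simp
      next
        assume "c \<in> T \<or> c \<notin> L \<and> c \<inter> Ou \<noteq> {}"
        then show "i \<in> f T" using c x i unfolding f_def by blast
      qed
      ultimately show ?thesis using i by simp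
    next
      case False
      then have fx: "fst x \<in> {0, 2}" using pts[OF c x] by auto
      have cL: "c \<notin> L"
      proof
        assume "c \<in> L"
        then have "fst x \<in> {1}" using x unfolding L_def by blast
        then show False using False by simp
      qed
      have "x \<in> Ou" if "y \<in> c" "y \<in> Ou" for y
      proof -
        have "fst y \<in> {0, 2}" using that(2) unfolding Ou_def by auto
        then show ?thesis using True fx cL c x that unfolding satiff by blast
      qed
      then have "x \<in> Ou \<longleftrightarrow> c \<inter> Ou \<noteq> {}" using x by blast
      moreover have "x \<notin> {1} \<times> f T" using False by auto
      ultimately show ?thesis using cL T by blast
    qed
    have "bij_betw f (Pow L) X"
    \<comment> \<open>In the other direction a colouring selects the loops that it colours
      throughout.\<close>
    proof (rule bij_betwI[where g = "\<lambda>B. {c \<in> L. c \<subseteq> {1} \<times> B}"])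
      show "f \<in> Pow L \<rightarrow> X"
      proof
        fix T assume T: "T \<in> Pow L"
        have "f T \<subseteq> {..<n}" using pts unfolding f_def by fastforce
        moreover have "\<forall>c\<in>\<C>. \<forall>x\<in>c. \<forall>y\<in>c. x \<in> Ou \<union> {1} \<times> f T \<longleftrightarrow> y \<in> Ou \<union> {1} \<times> f T"
        proof (intro ballI)
          fix c x y assume "c \<in> \<C>" "x \<in> c" "y \<in> c"
          then show "x \<in> Ou \<union> {1} \<times> f T \<longleftrightarrow> y \<in> Ou \<union> {1} \<times> f T"
            using key[of T c x] key[of T c y] T by (simp only: PowD)
        qed
        ultimately show "f T \<in> X" unfolding Xiff by (rule conjI)
      qed
      show "(\<lambda>B. {c \<in> L. c \<subseteq> {1} \<times> B}) \<in> X \<rightarrow> Pow L" by blast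
      show "{c \<in> L. c \<subseteq> {1} \<times> f T} = T" if T: "T \<in> Pow L" for T
      proof -
        have "c \<subseteq> {1} \<times> f T \<longleftrightarrow> c \<in> T" if c: "c \<in> L" for c
        proof -
          have c\<C>: "c \<in> \<C>" using c L_def by blast
          have "x \<in> {1} \<times> f T \<longleftrightarrow> c \<in> T" if x: "x \<in> c" for x
          proof -
            have "fst x \<in> {1}" using x c unfolding L_def by blast
            then have "x \<notin> Ou" unfolding Ou_def by auto
            then show ?thesis using key[of T c x] T c\<C> x c by blast
          qed
          then show ?thesis using ne[OF c\<C>] by blast
        qed
        then show ?thesis using T by blast
      qed
      show "f {c \<in> L. c \<subseteq> {1} \<times> B} = B" if B: "B \<in> X" for B
      proof (rule set_eqI)
        fix i
        let ?T = "{c \<in> L. c \<subseteq> {1} \<times> B}"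
        show "i \<in> f ?T \<longleftrightarrow> i \<in> B"
        proof (cases "i < n")
          case True
          then have "(1, i) \<in> \<Union>\<C>" unfolding U by auto
          then obtain c where c: "c \<in> \<C>" "(1, i) \<in> c" by blast
          have eq: "x \<in> Ou \<union> {1} \<times> B \<longleftrightarrow> i \<in> B" if x: "x \<in> c" for x
          proof -
            have "x \<in> Ou \<union> {1} \<times> B \<longleftrightarrow> (1, i) \<in> Ou \<union> {1} \<times> B" using XD[OF B c(1) x c(2)] .
            also have "\<dots> \<longleftrightarrow> i \<in> B" unfolding Ou_def by auto
            finally show ?thesis .
          qed
          have "i \<in> f ?T \<longleftrightarrow> (1, i) \<in> Ou \<union> {1} \<times> f ?T" unfolding Ou_def by auto
          also have "\<dots> \<longleftrightarrow> c \<in> ?T \<or> c \<notin> L \<and> c \<inter> Ou \<noteq> {}"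
            by (rule key) (use c in auto)
          also have "\<dots> \<longleftrightarrow> i \<in> B"
          proof (cases "c \<in> L")
            case True
            have "x \<in> {1} \<times> B \<longleftrightarrow> i \<in> B" if x: "x \<in> c" for x
            proof -
              have "fst x \<in> {1}" using x True unfolding L_def by blast
              then have "x \<notin> Ou" unfolding Ou_def by auto
              then show ?thesis using eq[OF x] by blast
            qed
            then show ?thesis using True c by blast
          next
            case False
            then obtain x where x: "x \<in> c" "fst x \<in> {0, 2}" using out[of c] c by blast
            have "y \<in> Ou \<Longrightarrow> y \<notin> {1} \<times> B" for y unfolding Ou_def by auto
            moreover have "x \<notin> {1} \<times> B" using x by auto
            ultimately have "c \<inter> Ou \<noteq> {} \<longleftrightarrow> i \<in> B" using eq x by blast
            then show ?thesis using False by blast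
          qed
          finally show ?thesis .
        next
          case False
          then have "i \<notin> B" using Xn[OF B] by auto
          moreover have "i \<notin> f ?T" using False pts unfolding f_def by fastforce
          ultimately show ?thesis by simp
        qed
      qed
    qed
    then have "card X = card (Pow L)" by (simp add: bij_betw_same_card)
    also have "\<dots> = 2 ^ loops E D"
      using fin\<C> unfolding loops_def L_def \<C>_def by (subst card_Pow) auto
    finally show ?thesis using True unfolding X_def by simp
  qed
qed

section \<open>Recognizing diagrams and composites by their colourings\<close>

lemma sat_cong:
  assumes D: "D \<in> diagrams m n" and "\<And>i. i < m \<Longrightarrow> i \<in> A \<longleftrightarrow> i \<in> A'" "\<And>i. i < n \<Longrightarrow> i \<in> B \<longleftrightarrow> i \<in> B'"
  shows "sat D A B \<longleftrightarrow> sat D A' B'"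
proof -
  have "x \<in> {0} \<times> A \<union> {1} \<times> B \<longleftrightarrow> x \<in> {0} \<times> A' \<union> {1} \<times> B'" if "b \<in> D" "x \<in> b" for b x
  proof -
    have "x \<in> \<Union>D" using that by blast
    then show ?thesis unfolding diagramsD(1)[OF D] using assms(2,3) by auto
  qed
  then show ?thesis unfolding sat_def monochr_def by simp
qed

lemma sat_empty: "sat D {} {}"
  by (simp add: sat_def monochr_def)

text \<open>Colour exactly the points of one block of \<open>D'\<close>. This colouring is accepted
  by \<open>D'\<close>, hence by \<open>D\<close>, so the block of \<open>D\<close> through one of
  these points cannot leave the coloured set; having two points as well, it equals the block of
  \<open>D'\<close>.\<close>

lemma diagrams_eqI:
  assumes D: "D \<in> diagrams m n" and D': "D' \<in> diagrams m n"
    and eq: "\<And>A B. A \<subseteq> {..<m} \<Longrightarrow> B \<subseteq> {..<n} \<Longrightarrow> sat D A B \<longleftrightarrow> sat D' A B"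
  shows "D = D'"
proof -
  have sub: "D \<subseteq> D'" if D: "D \<in> diagrams m n" and D': "D' \<in> diagrams m n"
    and eq: "\<And>A B. A \<subseteq> {..<m} \<Longrightarrow> B \<subseteq> {..<n} \<Longrightarrow> sat D A B \<longleftrightarrow> sat D' A B" for D D'
  proof
    fix b assume b: "b \<in> D"
    have cb: "card b = 2" using diagramsD(2)[OF D b] .
    then obtain x where x: "x \<in> b" by (metis card.empty equals0I zero_neq_numeral)
    have "x \<in> \<Union>D" using b x by blast
    then have "x \<in> \<Union>D'" unfolding diagramsD(1)[OF D] diagramsD(1)[OF D'] .
    then obtain b' where b': "b' \<in> D'" "x \<in> b'" by blast
    define A where "A = {i. (0, i) \<in> b'}"
    define B where "B = {i. (1, i) \<in> b'}"
    have b'V: "b' \<subseteq> {0} \<times> {..<m} \<union> {1} \<times> {..<n}" using b'(1) diagramsD(1)[OF D'] by blast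
    have col: "{0} \<times> A \<union> {1} \<times> B = b'"
      using b'V unfolding A_def B_def by auto
    have "c = b'" if "c \<in> D'" "y \<in> c" "y \<in> b'" for c y
      using diagramsD(3)[OF D' that(1) b'(1) that(2,3)] .
    then have "sat D' A B" unfolding sat_def col monochr_def by blast
    moreover have "A \<subseteq> {..<m}" "B \<subseteq> {..<n}" using b'V unfolding A_def B_def by auto
    ultimately have "sat D A B" using eq by simp
    then have "\<forall>y\<in>b. y \<in> b'" using b x b'(2) unfolding sat_def col monochr_def by blast
    then have "b \<subseteq> b'" by blast
    moreover have "card b' = 2" "finite b'" using diagramsD(2,5)[OF D' b'(1)] .
    ultimately have "b = b'" using cb by (simp add: card_subset_eq)
    then show "b \<in> D'" using b' by simp
  qed
  show ?thesis using sub[OF D D' eq] sub[OF D' D eq[symmetric]] by blast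
qed

text \<open>The support of the count identifies the composite and its nonzero value the number of
  loops. Concrete composites are computed in this way, without touching connected
  components.\<close>

lemma dcomp_eqI:
  assumes D: "D \<in> diagrams m n" and E: "E \<in> diagrams n p" and X: "X \<in> diagrams m p"
    and count: "\<And>A C. A \<subseteq> {..<m} \<Longrightarrow> C \<subseteq> {..<p} \<Longrightarrow>
      card {B. B \<subseteq> {..<n} \<and> sat D A B \<and> sat E B C} = (if sat X A C then 2 ^ L else 0)"
  shows "dcomp E D = X" "loops E D = L"
proof -
  have "(if sat (dcomp E D) A C then 2 ^ loops E D else 0) = (if sat X A C then 2 ^ L else (0::nat))"
    if "A \<subseteq> {..<m}" "C \<subseteq> {..<p}" for A C
    using count[OF that] unfolding card_sat_dcomp[OF D E] .
  note h = this
  \<comment> \<open>The empty colouring is accepted by every diagram, so it isolates the power of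
    2.\<close>
  show "loops E D = L" using h[of "{}" "{}"] by (simp add: sat_empty)
  show "dcomp E D = X"
  proof (rule diagrams_eqI[OF dcomp_in_diagrams[OF D E] X])
    fix A B assume "A \<subseteq> {..<m}" "B \<subseteq> {..<p}"
    then show "sat (dcomp E D) A B \<longleftrightarrow> sat X A B" using h[of A B] by (simp split: if_splits)
  qed
qed

text \<open>The intermediate colouring is unique, so there are no loops.\<close>
lemma dcomp_eqI_unique:
  assumes D: "D \<in> diagrams m n" and E: "E \<in> diagrams n p" and X: "X \<in> diagrams m p"
    and uniq: "\<And>A C. A \<subseteq> {..<m} \<Longrightarrow> C \<subseteq> {..<p} \<Longrightarrow> f A C \<subseteq> {..<n} \<and>
      (\<forall>B\<subseteq>{..<n}. sat D A B \<and> sat E B C \<longleftrightarrow> sat X A C \<and> B = f A C)"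
  shows "dcomp E D = X" "loops E D = 0"
proof -
  have "card {B. B \<subseteq> {..<n} \<and> sat D A B \<and> sat E B C} = (if sat X A C then 2 ^ 0 else 0)"
    if "A \<subseteq> {..<m}" "C \<subseteq> {..<p}" for A C
  proof -
    have "{B. B \<subseteq> {..<n} \<and> sat D A B \<and> sat E B C} = (if sat X A C then {f A C} else {})"
      using uniq[OF that] by auto
    then show ?thesis by simp
  qed
  from dcomp_eqI[OF D E X this] show "dcomp E D = X" "loops E D = 0" by auto
qed

lemma dcomp_eq_dcompI:
  assumes D: "D \<in> diagrams m n" and E: "E \<in> diagrams n p"
    and D': "D' \<in> diagrams m n'" and E': "E' \<in> diagrams n' p"
    and count: "\<And>A C. A \<subseteq> {..<m} \<Longrightarrow> C \<subseteq> {..<p} \<Longrightarrow>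
      card {B. B \<subseteq> {..<n} \<and> sat D A B \<and> sat E B C} = card {B. B \<subseteq> {..<n'} \<and> sat D' A B \<and> sat E' B C}"
  shows "dcomp E D = dcomp E' D'" "loops E D = loops E' D'"
  using dcomp_eqI[OF D E dcomp_in_diagrams[OF D' E'], of "loops E' D'"] count
  unfolding card_sat_dcomp[OF D' E'] by simp_all

text \<open>Compares two composites without naming their common value. Each side admits at most one
  middle colouring, \<open>f A C\<close> or \<open>f' A C\<close>, under the same condition
  \<open>Q\<close>, so neither side has a loop.\<close>

lemma dcomp_eq_dcompI_unique:
  assumes D: "D \<in> diagrams m n" and E: "E \<in> diagrams n p"
    and D': "D' \<in> diagrams m n'" and E': "E' \<in> diagrams n' p"
    and uniq: "\<And>A C. A \<subseteq> {..<m} \<Longrightarrow> C \<subseteq> {..<p} \<Longrightarrow> f A C \<subseteq> {..<n} \<and> f' A C \<subseteq> {..<n'} \<and>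
      (\<forall>B\<subseteq>{..<n}. sat D A B \<and> sat E B C \<longleftrightarrow> Q A C \<and> B = f A C) \<and>
      (\<forall>B\<subseteq>{..<n'}. sat D' A B \<and> sat E' B C \<longleftrightarrow> Q A C \<and> B = f' A C)"
  shows "dcomp E D = dcomp E' D'" "loops E D = 0" "loops E' D' = 0"
proof -
  have c1: "card {B. B \<subseteq> {..<n} \<and> sat D A B \<and> sat E B C} = (if Q A C then 1 else 0)"
    if "A \<subseteq> {..<m}" "C \<subseteq> {..<p}" for A C
  proof -
    have "{B. B \<subseteq> {..<n} \<and> sat D A B \<and> sat E B C} = (if Q A C then {f A C} else {})"
      using uniq[OF that] by auto
    then show ?thesis by simp
  qed
  have c2: "card {B. B \<subseteq> {..<n'} \<and> sat D' A B \<and> sat E' B C} = (if Q A C then 1 else 0)"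
    if "A \<subseteq> {..<m}" "C \<subseteq> {..<p}" for A C
  proof -
    have "{B. B \<subseteq> {..<n'} \<and> sat D' A B \<and> sat E' B C} = (if Q A C then {f' A C} else {})"
      using uniq[OF that] by auto
    then show ?thesis by simp
  qed
  have eq: "dcomp E D = dcomp E' D' \<and> loops E D = loops E' D'"
    using dcomp_eq_dcompI[OF D E D' E'] c1 c2 by simp
  then show "dcomp E D = dcomp E' D'" by simp
  have "2 ^ loops E D \<le> (1::nat)"
    using card_sat_dcomp[OF D E, of "{}" "{}"] c1[of "{}" "{}"] by (simp add: sat_empty split: if_splits)
  then show "loops E D = 0" using one_less_power[of "2::nat" "loops E D"] by (cases "loops E D = 0") auto
  then show "loops E' D' = 0" using eq by simp
qed

text \<open>Both sides count the pairs of colourings of the two middle layers that are compatible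
  with \<open>D\<close>, \<open>E\<close> and \<open>F\<close>; the two bracketings correspond to
  the two orders of summation.\<close>

theorem dcomp_assoc:
  assumes D: "D \<in> diagrams m n" and E: "E \<in> diagrams n p" and F: "F \<in> diagrams p q"
  shows "dcomp F (dcomp E D) = dcomp (dcomp F E) D"
    "loops E D + loops F (dcomp E D) = loops F E + loops (dcomp F E) D"
proof -
  have ED: "dcomp E D \<in> diagrams m p" and FE: "dcomp F E \<in> diagrams n q"
    using dcomp_in_diagrams D E F by auto
  have h: "(if sat (dcomp F (dcomp E D)) A Q then 2 ^ (loops E D + loops F (dcomp E D)) else 0) =
     (if sat (dcomp (dcomp F E) D) A Q then 2 ^ (loops F E + loops (dcomp F E) D) else (0::nat))" for A Q
  proof -
    have "(if sat (dcomp F (dcomp E D)) A Q then 2 ^ (loops E D + loops F (dcomp E D)) else (0::nat))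
       = 2 ^ loops E D * card {C. C \<subseteq> {..<p} \<and> sat (dcomp E D) A C \<and> sat F C Q}"
      unfolding card_sat_dcomp[OF ED F] by (simp add: power_add)
    also have "\<dots> = (\<Sum>C\<in>Pow {..<p}. if sat (dcomp E D) A C \<and> sat F C Q then 2 ^ loops E D else 0)"
      by (subst sum.If_cases) (auto intro!: arg_cong[where f=card] simp: mult.commute)
    also have "\<dots> = (\<Sum>C\<in>Pow {..<p}. if sat F C Q then card {B. B \<subseteq> {..<n} \<and> sat D A B \<and> sat E B C} else 0)"
      by (intro sum.cong refl) (simp add: card_sat_dcomp[OF D E])
    also have "\<dots> = (\<Sum>C\<in>Pow {..<p}. \<Sum>B\<in>Pow {..<n}. if sat D A B \<and> sat E B C \<and> sat F C Q then 1 else 0)"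
      by (intro sum.cong refl) (auto simp: sum.If_cases intro!: arg_cong[where f=card])
    also have "\<dots> = (\<Sum>B\<in>Pow {..<n}. \<Sum>C\<in>Pow {..<p}. if sat D A B \<and> sat E B C \<and> sat F C Q then 1 else 0)"
      by (rule sum.swap)
    also have "\<dots> = (\<Sum>B\<in>Pow {..<n}. if sat D A B then card {C. C \<subseteq> {..<p} \<and> sat E B C \<and> sat F C Q} else 0)"
      by (intro sum.cong refl) (auto simp: sum.If_cases intro!: arg_cong[where f=card])
    also have "\<dots> = (\<Sum>B\<in>Pow {..<n}. if sat D A B \<and> sat (dcomp F E) B Q then 2 ^ loops F E else 0)"
      by (intro sum.cong refl) (simp add: card_sat_dcomp[OF E F])
    also have "\<dots> = 2 ^ loops F E * card {B. B \<subseteq> {..<n} \<and> sat D A B \<and> sat (dcomp F E) B Q}"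
      by (subst sum.If_cases) (auto intro!: arg_cong[where f=card] simp: mult.commute)
    also have "\<dots> = (if sat (dcomp (dcomp F E) D) A Q then 2 ^ (loops F E + loops (dcomp F E) D) else 0)"
      unfolding card_sat_dcomp[OF D FE] by (simp add: power_add)
    finally show ?thesis .
  qed
  have "(2::nat) ^ (loops E D + loops F (dcomp E D)) = 2 ^ (loops F E + loops (dcomp F E) D)"
    using h[of "{}" "{}"] by (simp only: sat_empty if_True)
  then show "loops E D + loops F (dcomp E D) = loops F E + loops (dcomp F E) D" by simp
  show "dcomp F (dcomp E D) = dcomp (dcomp F E) D"
  proof (rule diagrams_eqI)
    show "dcomp F (dcomp E D) \<in> diagrams m q" "dcomp (dcomp F E) D \<in> diagrams m q"
      by (rule dcomp_in_diagrams[OF ED F], rule dcomp_in_diagrams[OF D FE])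
    show "sat (dcomp F (dcomp E D)) A B \<longleftrightarrow> sat (dcomp (dcomp F E) D) A B" for A B
      using h[of A B] by (simp split: if_splits)
  qed
qed

section \<open>Permutation diagrams\<close>

lemma pairs_in_diagrams:
  assumes "inj_on f I" "inj_on g I" "f ` I \<inter> g ` I = {}"
    "f ` I \<union> g ` I = {0} \<times> {..<m} \<union> {1} \<times> {..<n}"
  shows "(\<lambda>i. {f i, g i}) ` I \<in> diagrams m n"
proof (rule diagramsI)
  show "\<Union>((\<lambda>i. {f i, g i}) ` I) = {0} \<times> {..<m} \<union> {1} \<times> {..<n}"
    unfolding assms(4)[symmetric] by auto
  show "card b = 2" if b: "b \<in> (\<lambda>i. {f i, g i}) ` I" for b
  proof -
    obtain i where i: "b = {f i, g i}" "i \<in> I" using b by (rule imageE)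
    have "f i \<noteq> g i" using assms(3) i(2) by (metis disjoint_iff imageI)
    then show ?thesis using i by simp
  qed
  show "b = b'" if b: "b \<in> (\<lambda>i. {f i, g i}) ` I" "b' \<in> (\<lambda>i. {f i, g i}) ` I" "x \<in> b" "x \<in> b'" for b b' x
  proof -
    obtain i where i: "b = {f i, g i}" "i \<in> I" using b(1) by (rule imageE)
    obtain j where j: "b' = {f j, g j}" "j \<in> I" using b(2) by (rule imageE)
    have "f i \<noteq> g j" "f j \<noteq> g i" using assms(3) i(2) j(2) by (metis disjoint_iff imageI)+
    then have "f i = f j \<or> g i = g j" using b(3,4) i j by auto
    then have "i = j" using assms(1,2) i(2) j(2) by (auto dest: inj_onD)
    then show ?thesis using i j by simp
  qed
qed

lemma sat_pairs: "sat ((\<lambda>i. {f i, g i}) ` I) A B \<longleftrightarrow>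
   (\<forall>i\<in>I. f i \<in> {0} \<times> A \<union> {1} \<times> B \<longleftrightarrow> g i \<in> {0} \<times> A \<union> {1} \<times> B)"
  by (auto simp: sat_def monochr_def)

lemma perm_diagram_in_diagrams:
  assumes "\<pi> permutes {..<n}"
  shows "perm_diagram n \<pi> \<in> diagrams n n"
  unfolding perm_diagram_def
proof (rule pairs_in_diagrams)
  show "inj_on (\<lambda>i. (0::nat, i)) {..<n}" by (simp add: inj_on_def)
  show "inj_on (\<lambda>i. (1::nat, \<pi> i)) {..<n}" using permutes_inj[OF assms] by (simp add: inj_on_def)
  show "(\<lambda>i. (0::nat, i)) ` {..<n} \<inter> (\<lambda>i. (1, \<pi> i)) ` {..<n} = {}" by auto
  have "(\<lambda>i. (1::nat, \<pi> i)) ` {..<n} = {1} \<times> \<pi> ` {..<n}" by auto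
  then show "(\<lambda>i. (0::nat, i)) ` {..<n} \<union> (\<lambda>i. (1, \<pi> i)) ` {..<n} = {0} \<times> {..<n} \<union> {1} \<times> {..<n}"
    unfolding permutes_image[OF assms] by auto
qed

lemma sat_perm_diagram: "sat (perm_diagram n \<pi>) A B \<longleftrightarrow> (\<forall>i<n. i \<in> A \<longleftrightarrow> \<pi> i \<in> B)"
  unfolding perm_diagram_def sat_pairs by auto

text \<open>A permutation diagram transports colourings bijectively, so the middle colouring can
  only be the preimage of \<open>C\<close> under \<open>\<pi>\<close>.\<close>

lemma dcomp_perm_left:
  assumes D: "D \<in> diagrams m n" and \<pi>: "\<pi> permutes {..<n}" and X: "X \<in> diagrams m n"
    and sat: "\<And>A C. A \<subseteq> {..<m} \<Longrightarrow> C \<subseteq> {..<n} \<Longrightarrow> sat X A C \<longleftrightarrow> sat D A (\<pi> -` C)"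
  shows "dcomp (perm_diagram n \<pi>) D = X" "loops (perm_diagram n \<pi>) D = 0"
proof -
  have "\<pi> -` C \<subseteq> {..<n} \<and> (\<forall>B\<subseteq>{..<n}. sat D A B \<and> sat (perm_diagram n \<pi>) B C \<longleftrightarrow> sat X A C \<and> B = \<pi> -` C)"
    if AC: "A \<subseteq> {..<m}" "C \<subseteq> {..<n}" for A C
  proof -
    have "\<pi> -` C \<subseteq> {..<n}"
      using AC(2) permutes_in_image[OF \<pi>] by blast
    moreover have "sat (perm_diagram n \<pi>) B C \<longleftrightarrow> B = \<pi> -` C" if "B \<subseteq> {..<n}" for B
      using calculation that unfolding sat_perm_diagram by auto
    ultimately show ?thesis using sat[OF AC] by auto
  qed
  from dcomp_eqI_unique[OF D perm_diagram_in_diagrams[OF \<pi>] X this]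
  show "dcomp (perm_diagram n \<pi>) D = X" "loops (perm_diagram n \<pi>) D = 0" by auto
qed

lemma dcomp_perm_right:
  assumes D: "D \<in> diagrams m n" and \<pi>: "\<pi> permutes {..<m}" and X: "X \<in> diagrams m n"
    and sat: "\<And>A C. A \<subseteq> {..<m} \<Longrightarrow> C \<subseteq> {..<n} \<Longrightarrow> sat X A C \<longleftrightarrow> sat D (\<pi> ` A) C"
  shows "dcomp D (perm_diagram m \<pi>) = X" "loops D (perm_diagram m \<pi>) = 0"
proof -
  have "\<pi> ` A \<subseteq> {..<m} \<and> (\<forall>B\<subseteq>{..<m}. sat (perm_diagram m \<pi>) A B \<and> sat D B C \<longleftrightarrow> sat X A C \<and> B = \<pi> ` A)"
    if AC: "A \<subseteq> {..<m}" "C \<subseteq> {..<n}" for A C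
  proof -
    have s: "\<pi> ` A \<subseteq> {..<m}"
      using AC(1) permutes_image[OF \<pi>] by blast
    moreover have "sat (perm_diagram m \<pi>) A B \<longleftrightarrow> B = \<pi> ` A" if B: "B \<subseteq> {..<m}" for B
    proof
      assume h: "sat (perm_diagram m \<pi>) A B"
      show "B = \<pi> ` A"
      proof (intro equalityI subsetI)
        fix x assume x: "x \<in> B"
        then obtain i where i: "i < m" "x = \<pi> i" using B permutes_image[OF \<pi>] by blast
        then show "x \<in> \<pi> ` A" using h x unfolding sat_perm_diagram by blast
      next
        fix x assume "x \<in> \<pi> ` A"
        then show "x \<in> B" using h AC(1) unfolding sat_perm_diagram by blast
      qed
    next
      assume "B = \<pi> ` A"
      then show "sat (perm_diagram m \<pi>) A B" unfolding sat_perm_diagram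
        using permutes_inj[OF \<pi>] by (simp add: inj_image_mem_iff)
    qed
    ultimately show ?thesis using sat[OF AC] by auto
  qed
  from dcomp_eqI_unique[OF perm_diagram_in_diagrams[OF \<pi>] D X this]
  show "dcomp D (perm_diagram m \<pi>) = X" "loops D (perm_diagram m \<pi>) = 0" by auto
qed

lemma dcomp_id_left:
  assumes "D \<in> diagrams m n"
  shows "dcomp (perm_diagram n id) D = D" "loops (perm_diagram n id) D = 0"
  using dcomp_perm_left[OF assms permutes_id assms] by simp_all

lemma dcomp_id_right:
  assumes "D \<in> diagrams m n"
  shows "dcomp D (perm_diagram m id) = D" "loops D (perm_diagram m id) = 0"
  using dcomp_perm_right[OF assms permutes_id assms] by simp_all

lemma dcomp_perm_perm:
  assumes "\<pi> permutes {..<n}" "\<sigma> permutes {..<n}"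
  shows "dcomp (perm_diagram n \<pi>) (perm_diagram n \<sigma>) = perm_diagram n (\<pi> \<circ> \<sigma>)"
    "loops (perm_diagram n \<pi>) (perm_diagram n \<sigma>) = 0"
proof -
  have X: "perm_diagram n (\<pi> \<circ> \<sigma>) \<in> diagrams n n"
    by (rule perm_diagram_in_diagrams) (rule permutes_compose[OF assms(2,1)])
  have "sat (perm_diagram n (\<pi> \<circ> \<sigma>)) A C \<longleftrightarrow> sat (perm_diagram n \<sigma>) A (\<pi> -` C)" for A C
    by (simp add: sat_perm_diagram)
  from dcomp_perm_left[OF perm_diagram_in_diagrams[OF assms(2)] assms(1) X this]
  show "dcomp (perm_diagram n \<pi>) (perm_diagram n \<sigma>) = perm_diagram n (\<pi> \<circ> \<sigma>)"
    "loops (perm_diagram n \<pi>) (perm_diagram n \<sigma>) = 0" by auto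
qed

section \<open>Tensor products of diagrams, flips, cups and caps\<close>

definition shift :: "nat \<Rightarrow> nat set \<Rightarrow> nat set" where
  "shift n A = {i. i + n \<in> A}"

lemma mem_shift [simp]: "i \<in> shift n A \<longleftrightarrow> i + n \<in> A"
  by (simp add: shift_def)

lemma shift_shift: "shift a (shift b A) = shift (a + b) A"
  by (auto simp: add_ac)

lemma sat_dtensor:
  assumes "D \<in> diagrams m n"
  shows "sat (dtensor D E) A B \<longleftrightarrow> sat D A B \<and> sat E (shift m A) (shift n B)"
proof -
  have "(\<lambda>(l, i). (l, i + (if l = 0 then m else n))) x \<in> {0} \<times> A \<union> {1} \<times> B \<longleftrightarrow>
      x \<in> {0} \<times> shift m A \<union> {1} \<times> shift n B" for x :: "nat \<times> nat"
    by (cases x) auto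
  then show ?thesis
    unfolding dtensor_def dsrc_eq[OF assms] dtgt_eq[OF assms] sat_def monochr_def
    by (simp only: ball_Un ball_simps(9))
qed

lemma dtensor_in_diagrams:
  assumes D: "D \<in> diagrams m n" and E: "E \<in> diagrams m' n'"
  shows "dtensor D E \<in> diagrams (m + m') (n + n')"
proof (rule diagramsI)
  define f where "f = (\<lambda>(l, i). (l, i + (if l = 0 then m else n)) :: nat \<times> nat)"
  have T: "dtensor D E = D \<union> (\<lambda>b. f ` b) ` E"
    unfolding dtensor_def dsrc_eq[OF D] dtgt_eq[OF D] f_def ..
  have inj: "inj f" unfolding f_def by (auto simp: inj_def)
  have "f ` ({0} \<times> {..<m'} \<union> {1} \<times> {..<n'}) = {0} \<times> {m..<m + m'} \<union> {1} \<times> {n..<n + n'}"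
  proof (intro equalityI subsetI)
    fix x assume "x \<in> {0} \<times> {m..<m + m'} \<union> {1::nat} \<times> {n..<n + n'}"
    then have "x = f (fst x, snd x - (if fst x = 0 then m else n))"
      "(fst x, snd x - (if fst x = 0 then m else n)) \<in> {0} \<times> {..<m'} \<union> {1} \<times> {..<n'}"
      unfolding f_def by auto
    then show "x \<in> f ` ({0} \<times> {..<m'} \<union> {1} \<times> {..<n'})" by (rule image_eqI)
  qed (auto simp: f_def)
  moreover have "\<Union>((\<lambda>b. f ` b) ` E) = f ` \<Union>E" by auto
  ultimately have UE: "\<Union>((\<lambda>b. f ` b) ` E) = {0} \<times> {m..<m + m'} \<union> {1} \<times> {n..<n + n'}"
    unfolding diagramsD(1)[OF E] by simp
  show "\<Union>(dtensor D E) = {0} \<times> {..<m + m'} \<union> {1} \<times> {..<n + n'}"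
    unfolding T Union_Un_distrib UE diagramsD(1)[OF D] by auto
  show "card b = 2" if "b \<in> dtensor D E" for b
    using that diagramsD(2)[OF D] diagramsD(2)[OF E] inj unfolding T
    by (auto simp: card_image inj_on_subset)
  have no: False if "b \<in> D" "x \<in> b" "b' \<in> E" "x \<in> f ` b'" for b b' x
  proof -
    have "x \<in> \<Union>D" "x \<in> \<Union>((\<lambda>b. f ` b) ` E)" using that by auto
    then show False unfolding UE diagramsD(1)[OF D] by auto
  qed
  show "b = b'" if b: "b \<in> dtensor D E" "b' \<in> dtensor D E" "x \<in> b" "x \<in> b'" for b b' x
  proof -
    consider "b \<in> D" "b' \<in> D" | e e' where "e \<in> E" "e' \<in> E" "b = f ` e" "b' = f ` e'"
      | e where "b \<in> D" "e \<in> E" "b' = f ` e" | e where "b' \<in> D" "e \<in> E" "b = f ` e"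
      using b(1,2) unfolding T by blast
    then show ?thesis
    proof cases
      case 1
      then show ?thesis using diagramsD(3)[OF D] b by blast
    next
      case (2 e e')
      obtain y where y: "x = f y" "y \<in> e" using b(3) unfolding 2 by (rule imageE)
      obtain y' where y': "x = f y'" "y' \<in> e'" using b(4) unfolding 2 by (rule imageE)
      have "y = y'" using y y' injD[OF inj] by simp
      then show ?thesis using diagramsD(3)[OF E 2(1,2) y(2)] y' 2 by simp
    next
      case 3 then show ?thesis using no[of b x] b by auto
    next
      case 4 then show ?thesis using no[of b' x] b by auto
    qed
  qed
qed

text \<open>A colouring of \<open>n + n'\<close> points is a pair of colourings. The hypothesis
  expresses that \<open>P\<close> sees only the first \<open>n\<close> points, so the count for a
  tensor product factors.\<close>

lemma card_split:
  assumes P: "\<And>B B'. (\<And>i. i < n \<Longrightarrow> i \<in> B \<longleftrightarrow> i \<in> B') \<Longrightarrow> P B \<longleftrightarrow> P B'"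
  shows "card {B. B \<subseteq> {..<n + n'} \<and> P B \<and> Q (shift n B)} =
     card {B. B \<subseteq> {..<n} \<and> P B} * card {B. B \<subseteq> {..<n'} \<and> Q B}"
proof -
  let ?X = "{B. B \<subseteq> {..<n + n'} \<and> P B \<and> Q (shift n B)}"
  let ?Y = "{B. B \<subseteq> {..<n} \<and> P B} \<times> {B. B \<subseteq> {..<n'} \<and> Q B}"
  have "bij_betw (\<lambda>B. (B \<inter> {..<n}, shift n B)) ?X ?Y"
  proof (rule bij_betwI[where g = "\<lambda>(B, B'). B \<union> (\<lambda>i. i + n) ` B'"])
    show "(\<lambda>B. (B \<inter> {..<n}, shift n B)) \<in> ?X \<rightarrow> ?Y"
    proof
      fix B assume B: "B \<in> ?X"
      then have "P (B \<inter> {..<n})" using P[of B "B \<inter> {..<n}"] by auto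
      then show "(B \<inter> {..<n}, shift n B) \<in> ?Y" using B by auto
    qed
    have sh: "shift n (B \<union> (\<lambda>i. i + n) ` B') = B'" if "B \<subseteq> {..<n}" for B B'
      using that by (auto simp: image_iff)
    show "(\<lambda>(B, B'). B \<union> (\<lambda>i. i + n) ` B') \<in> ?Y \<rightarrow> ?X"
    proof
      fix x assume x: "x \<in> ?Y"
      then obtain B B' where x': "x = (B, B')" by (cases x)
      have "P (B \<union> (\<lambda>i. i + n) ` B')" using P[of B "B \<union> (\<lambda>i. i + n) ` B'"] x x' by auto
      moreover have "B \<union> (\<lambda>i. i + n) ` B' \<subseteq> {..<n + n'}" using x x' by auto
      ultimately show "(\<lambda>(B, B'). B \<union> (\<lambda>i. i + n) ` B') x \<in> ?X" using sh x x' by auto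
    qed
    show "(\<lambda>(B, B'). B \<union> (\<lambda>i. i + n) ` B') (B \<inter> {..<n}, shift n B) = B" if "B \<in> ?X" for B
    proof -
      have "i \<in> B \<inter> {..<n} \<union> (\<lambda>i. i + n) ` shift n B \<longleftrightarrow> i \<in> B" for i
      proof (cases "i < n")
        case False
        then obtain j where "i = j + n" by (metis add.commute le_Suc_ex not_less)
        then show ?thesis by auto
      qed auto
      then show ?thesis by auto
    qed
    show "(\<lambda>B. (B \<inter> {..<n}, shift n B)) ((\<lambda>(B, B'). B \<union> (\<lambda>i. i + n) ` B') y) = y" if y: "y \<in> ?Y" for y
    proof -
      obtain B B' where y': "y = (B, B')" by (cases y)
      then have "B \<subseteq> {..<n}" using y by auto
      then show ?thesis using sh y' by auto
    qed
  qed
  then show ?thesis by (simp add: bij_betw_same_card card_cartesian_product)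
qed

theorem dcomp_dtensor:
  assumes D: "D \<in> diagrams m n" and E: "E \<in> diagrams n p"
    and D': "D' \<in> diagrams m' n'" and E': "E' \<in> diagrams n' p'"
  shows "dcomp (dtensor E E') (dtensor D D') = dtensor (dcomp E D) (dcomp E' D')"
    "loops (dtensor E E') (dtensor D D') = loops E D + loops E' D'"
proof -
  note ED = dcomp_in_diagrams[OF D E] and ED' = dcomp_in_diagrams[OF D' E']
  have "card {B. B \<subseteq> {..<n + n'} \<and> sat (dtensor D D') A B \<and> sat (dtensor E E') B C} =
     (if sat (dtensor (dcomp E D) (dcomp E' D')) A C then 2 ^ (loops E D + loops E' D') else 0)" for A C
  proof -
    let ?P = "\<lambda>B. sat D A B \<and> sat E B C" and ?Q = "\<lambda>B. sat D' (shift m A) B \<and> sat E' B (shift p C)"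
    have P: "?P B \<longleftrightarrow> ?P B'" if "\<And>i. i < n \<Longrightarrow> i \<in> B \<longleftrightarrow> i \<in> B'" for B B'
      using sat_cong[OF D, of A A B B'] sat_cong[OF E, of B B' C C] that by auto
    have "{B. B \<subseteq> {..<n + n'} \<and> sat (dtensor D D') A B \<and> sat (dtensor E E') B C} =
      {B. B \<subseteq> {..<n + n'} \<and> ?P B \<and> ?Q (shift n B)}"
      unfolding sat_dtensor[OF D] sat_dtensor[OF E] by (intro Collect_cong) blast
    then have "card {B. B \<subseteq> {..<n + n'} \<and> sat (dtensor D D') A B \<and> sat (dtensor E E') B C} =
        card {B. B \<subseteq> {..<n} \<and> ?P B} * card {B. B \<subseteq> {..<n'} \<and> ?Q B}"
      using card_split[of n ?P n' ?Q, OF P] by (simp only:)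
    also have "\<dots> = (if sat (dcomp E D) A C then 2 ^ loops E D else 0) *
       (if sat (dcomp E' D') (shift m A) (shift p C) then 2 ^ loops E' D' else 0)"
      by (simp only: card_sat_dcomp[OF D E] card_sat_dcomp[OF D' E'])
    also have "\<dots> = (if sat (dtensor (dcomp E D) (dcomp E' D')) A C then 2 ^ (loops E D + loops E' D') else 0)"
      by (simp add: sat_dtensor[OF ED] power_add)
    finally show ?thesis .
  qed
  from dcomp_eqI[OF dtensor_in_diagrams[OF D D'] dtensor_in_diagrams[OF E E'] dtensor_in_diagrams[OF ED ED'] this]
  show "dcomp (dtensor E E') (dtensor D D') = dtensor (dcomp E D) (dcomp E' D')"
    "loops (dtensor E E') (dtensor D D') = loops E D + loops E' D'" by auto
qed

lemma dtensor_assoc: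
  assumes D: "D \<in> diagrams m n" and E: "E \<in> diagrams m' n'" and F: "F \<in> diagrams m'' n''"
  shows "dtensor (dtensor D E) F = dtensor D (dtensor E F)"
proof (rule diagrams_eqI)
  show "dtensor (dtensor D E) F \<in> diagrams (m + m' + m'') (n + n' + n'')"
    by (intro dtensor_in_diagrams D E F)
  show "dtensor D (dtensor E F) \<in> diagrams (m + m' + m'') (n + n' + n'')"
    unfolding add.assoc by (intro dtensor_in_diagrams D E F)
  show "sat (dtensor (dtensor D E) F) A B \<longleftrightarrow> sat (dtensor D (dtensor E F)) A B" for A B
    unfolding sat_dtensor[OF D] sat_dtensor[OF E] sat_dtensor[OF dtensor_in_diagrams[OF D E]] shift_shift
    by (simp add: add.commute)
qed

lemma dtensor_empty_left: "dtensor (perm_diagram 0 id) D = D"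
proof -
  have "(\<lambda>(l, i). (l, i + (if l = 0 then dsrc {} else dtgt {}))) = (id :: nat \<times> nat \<Rightarrow> _)"
    by (auto simp: fun_eq_iff dsrc_def dtgt_def)
  then show ?thesis by (simp add: dtensor_def perm_diagram_def)
qed

lemma dtensor_empty_right: "dtensor D (perm_diagram 0 id) = D"
  by (simp add: dtensor_def perm_diagram_def)

text \<open>The block sum of two permutations.\<close>

definition psum :: "nat \<Rightarrow> (nat \<Rightarrow> nat) \<Rightarrow> (nat \<Rightarrow> nat) \<Rightarrow> nat \<Rightarrow> nat" where
  "psum n \<pi> \<sigma> i = (if i < n then \<pi> i else n + \<sigma> (i - n))"

lemma psum_permutes:
  assumes \<pi>: "\<pi> permutes {..<n}" and \<sigma>: "\<sigma> permutes {..<n'}"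
  shows "psum n \<pi> \<sigma> permutes {..<n + n'}"
proof (rule bij_imp_permutes)
  have "bij_betw (psum n \<pi> \<sigma>) ({..<n} \<union> {n..<n + n'}) ({..<n} \<union> {n..<n + n'})"
  proof (rule bij_betw_combine)
    show "bij_betw (psum n \<pi> \<sigma>) {..<n} {..<n}"
      using permutes_imp_bij[OF \<pi>] by (subst bij_betw_cong[of _ _ \<pi>]) (auto simp: psum_def)
    have "bij_betw (\<lambda>i. i - n) {n..<n + n'} {..<n'}"
      by (rule bij_betwI[where g = "\<lambda>i. i + n"]) auto
    moreover have "bij_betw (\<lambda>i. n + i) {..<n'} {n..<n + n'}"
      by (rule bij_betwI[where g = "\<lambda>i. i - n"]) auto
    ultimately have "bij_betw ((\<lambda>i. n + i) \<circ> (\<sigma> \<circ> (\<lambda>i. i - n))) {n..<n + n'} {n..<n + n'}"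
      using permutes_imp_bij[OF \<sigma>] by (blast intro: bij_betw_trans)
    then show "bij_betw (psum n \<pi> \<sigma>) {n..<n + n'} {n..<n + n'}"
      by (subst bij_betw_cong[of _ _ "(\<lambda>i. n + i) \<circ> (\<sigma> \<circ> (\<lambda>i. i - n))"]) (auto simp: psum_def)
    show "{..<n} \<inter> {n..<n + n'} = {}" by auto
  qed
  moreover have "{..<n} \<union> {n..<n + n'} = {..<n + n'}" by auto
  ultimately show "bij_betw (psum n \<pi> \<sigma>) {..<n + n'} {..<n + n'}" by simp
  show "psum n \<pi> \<sigma> x = x" if "x \<notin> {..<n + n'}" for x
    using that permutes_not_in[OF \<sigma>, of "x - n"] by (auto simp: psum_def)
qed

lemma dtensor_perm_diagram:
  assumes \<pi>: "\<pi> permutes {..<n}" and \<sigma>: "\<sigma> permutes {..<n'}"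
  shows "dtensor (perm_diagram n \<pi>) (perm_diagram n' \<sigma>) = perm_diagram (n + n') (psum n \<pi> \<sigma>)"
proof (rule diagrams_eqI)
  show "dtensor (perm_diagram n \<pi>) (perm_diagram n' \<sigma>) \<in> diagrams (n + n') (n + n')"
    by (intro dtensor_in_diagrams perm_diagram_in_diagrams assms)
  show "perm_diagram (n + n') (psum n \<pi> \<sigma>) \<in> diagrams (n + n') (n + n')"
    by (intro perm_diagram_in_diagrams psum_permutes assms)
  show "sat (dtensor (perm_diagram n \<pi>) (perm_diagram n' \<sigma>)) A B \<longleftrightarrow>
      sat (perm_diagram (n + n') (psum n \<pi> \<sigma>)) A B" for A B
  proof -
    have "(\<forall>i<n + n'. R i) \<longleftrightarrow> (\<forall>i<n. R i) \<and> (\<forall>i<n'. R (i + n))" for R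
    proof (intro iffI allI impI)
      fix i assume h: "(\<forall>i<n. R i) \<and> (\<forall>i<n'. R (i + n))" and i: "i < n + n'"
      show "R i"
      proof (cases "i < n")
        case False
        then have "i - n < n'" "i = (i - n) + n" using i by auto
        then show ?thesis using h by metis
      qed (use h in auto)
    qed auto
    then show ?thesis
      unfolding sat_dtensor[OF perm_diagram_in_diagrams[OF \<pi>]] sat_perm_diagram
      by (simp add: psum_def add.commute)
  qed
qed

lemma dtensor_id_id: "dtensor (perm_diagram n id) (perm_diagram n' id) = perm_diagram (n + n') id"
proof -
  have "psum n id id = id" by (rule ext) (simp add: psum_def)
  then show ?thesis unfolding dtensor_perm_diagram[OF permutes_id permutes_id] by simp
qed

lemma sat_dflip: 
  assumes "D \<in> diagrams m n"
  shows "sat (dflip D) A B \<longleftrightarrow> sat D B A"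
proof -
  have "(\<lambda>(l, i). (1 - l, i)) x \<in> {0} \<times> A \<union> {1} \<times> B \<longleftrightarrow> x \<in> {0} \<times> B \<union> {1} \<times> A"
    if "b \<in> D" "x \<in> b" for b x
  proof -
    have "x \<in> \<Union>D" using that by blast
    then show ?thesis unfolding diagramsD(1)[OF assms] by auto
  qed
  then show ?thesis
    unfolding dflip_def sat_def monochr_def by (simp only: ball_simps(9) cong: ball_cong)
qed

lemma dflip_in_diagrams:
  assumes D: "D \<in> diagrams m n"
  shows "dflip D \<in> diagrams n m"
proof -
  define f where "f = (\<lambda>(l, i). (1 - l, i) :: nat \<times> nat)"
  have F: "dflip D = (\<lambda>b. f ` b) ` D" unfolding dflip_def f_def ..
  have inj: "inj_on f (\<Union>D)" unfolding diagramsD(1)[OF D] f_def by (auto simp: inj_on_def)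
  show ?thesis unfolding F
  proof (rule diagramsI)
    have "f ` ({0} \<times> {..<m} \<union> {1} \<times> {..<n}) = {0} \<times> {..<n} \<union> {1} \<times> {..<m}"
      unfolding f_def image_Un by (auto simp: image_iff)
    moreover have "\<Union>((\<lambda>b. f ` b) ` D) = f ` \<Union>D" by auto
    ultimately show "\<Union>((\<lambda>b. f ` b) ` D) = {0} \<times> {..<n} \<union> {1} \<times> {..<m}"
      unfolding diagramsD(1)[OF D] by simp
    show "card b = 2" if b: "b \<in> (\<lambda>b. f ` b) ` D" for b
    proof -
      obtain e where e: "b = f ` e" "e \<in> D" using b by (rule imageE)
      have "inj_on f e" using inj_on_subset[OF inj, of e] e(2) by blast
      then show ?thesis using e diagramsD(2)[OF D] by (simp add: card_image)
    qed
    show "b = b'" if b: "b \<in> (\<lambda>b. f ` b) ` D" "b' \<in> (\<lambda>b. f ` b) ` D" "x \<in> b" "x \<in> b'" for b b' x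
    proof -
      obtain e where e: "b = f ` e" "e \<in> D" using b(1) by (rule imageE)
      obtain e' where e': "b' = f ` e'" "e' \<in> D" using b(2) by (rule imageE)
      obtain y where y: "x = f y" "y \<in> e" using b(3) unfolding e by (rule imageE)
      obtain y' where y': "x = f y'" "y' \<in> e'" using b(4) unfolding e' by (rule imageE)
      have "y = y'" using inj_onD[OF inj, of y y'] y y' e e' by blast
      then show ?thesis using diagramsD(3)[OF D e(2) e'(2) y(2)] y' e e' by simp
    qed
  qed
qed

definition coev_diagram :: "nat \<Rightarrow> diagram" where
  "coev_diagram n = (\<lambda>i. {(1, i), (1, n + i)}) ` {..<n}"

text \<open>The evaluation of \<open>V\<^sup>\<otimes>\<^sup>n \<otimes> V\<^sup>\<otimes>\<^sup>n\<close> with nested arcs, as produced by iterated derivations.\<close>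
definition ev_diagram :: "nat \<Rightarrow> diagram" where
  "ev_diagram n = (\<lambda>i. {(0, i), (0, 2 * n - 1 - i)}) ` {..<n}"

lemma coev_diagram_in_diagrams: "coev_diagram n \<in> diagrams 0 (2 * n)"
  unfolding coev_diagram_def
proof (rule pairs_in_diagrams)
  show "(\<lambda>i. (1::nat, i)) ` {..<n} \<union> (\<lambda>i. (1, n + i)) ` {..<n} = {0} \<times> {..<0} \<union> {1} \<times> {..<2 * n}"
  proof (intro equalityI subsetI)
    fix x assume "x \<in> {0::nat} \<times> {..<0::nat} \<union> {1} \<times> {..<2 * n}"
    then obtain i where i: "x = (1, i)" "i < 2 * n" by (cases x) auto
    show "x \<in> (\<lambda>i. (1::nat, i)) ` {..<n} \<union> (\<lambda>i. (1, n + i)) ` {..<n}"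
    proof (cases "i < n")
      case False
      then have "x = (1, n + (i - n))" "i - n \<in> {..<n}" using i by auto
      then show ?thesis by (intro UnI2) (rule image_eqI)
    qed (use i in auto)
  qed auto
qed (auto simp: inj_on_def)

lemma ev_diagram_in_diagrams: "ev_diagram n \<in> diagrams (2 * n) 0"
  unfolding ev_diagram_def
proof (rule pairs_in_diagrams)
  show "(\<lambda>i. (0::nat, i)) ` {..<n} \<union> (\<lambda>i. (0, 2 * n - 1 - i)) ` {..<n} = {0} \<times> {..<2 * n} \<union> {1} \<times> {..<0}"
  proof (intro equalityI subsetI)
    fix x assume "x \<in> {0::nat} \<times> {..<2 * n} \<union> {1} \<times> {..<0::nat}"
    then obtain i where i: "x = (0, i)" "i < 2 * n" by (cases x) auto
    show "x \<in> (\<lambda>i. (0::nat, i)) ` {..<n} \<union> (\<lambda>i. (0, 2 * n - 1 - i)) ` {..<n}"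
    proof (cases "i < n")
      case False
      then have "x = (0, 2 * n - 1 - (2 * n - 1 - i))" "2 * n - 1 - i \<in> {..<n}" using i by auto
      then show ?thesis by (intro UnI2) (rule image_eqI)
    qed (use i in auto)
  qed auto
qed (auto simp: inj_on_def)

lemma sat_coev_diagram: "sat (coev_diagram n) A B \<longleftrightarrow> (\<forall>i<n. i \<in> B \<longleftrightarrow> i + n \<in> B)"
  unfolding coev_diagram_def sat_pairs by (auto simp: add.commute)

lemma sat_ev_diagram: "sat (ev_diagram n) A B \<longleftrightarrow> (\<forall>i<n. i \<in> A \<longleftrightarrow> 2 * n - 1 - i \<in> A)"
  unfolding ev_diagram_def sat_pairs by auto

section \<open>The monoidal category\<close>

lemma lookup_bscale [simp]: "Poly_Mapping.lookup (c \<bullet>\<^sub>s f) D = c * Poly_Mapping.lookup f D"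
  by (simp add: bscale_def Poly_Mapping.map.rep_eq when_def)

interpretation bmor: vector_space bscale
  by unfold_locales (auto intro!: poly_mapping_eqI simp: lookup_add algebra_simps)

lemma lookup_diag: "Poly_Mapping.lookup (diag D) E = (if D = E then 1 else 0)"
  by (simp add: diag_def lookup_single when_def)

lemma keys_diag [simp]: "Poly_Mapping.keys (diag D) = {D}"
  by (simp add: diag_def)

text \<open>Composition, tensor product and flip are all linear extensions from diagrams; writing
  them with \<open>linext\<close> yields their linearity in every argument at once.\<close>

definition linext :: "(diagram \<Rightarrow> bmor) \<Rightarrow> bmor \<Rightarrow> bmor" where
  "linext \<phi> f = (\<Sum>D\<in>Poly_Mapping.keys f. Poly_Mapping.lookup f D \<bullet>\<^sub>s \<phi> D)"

lemma linext_superset: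
  assumes "finite S" "Poly_Mapping.keys f \<subseteq> S"
  shows "linext \<phi> f = (\<Sum>D\<in>S. Poly_Mapping.lookup f D \<bullet>\<^sub>s \<phi> D)"
  unfolding linext_def using assms
  by (intro sum.mono_neutral_left) (auto simp: in_keys_iff)

lemma linext_add: "linext \<phi> (f + g) = linext \<phi> f + linext \<phi> g"
proof -
  let ?S = "Poly_Mapping.keys f \<union> Poly_Mapping.keys g"
  have "linext \<phi> (f + g) = (\<Sum>D\<in>?S. Poly_Mapping.lookup (f + g) D \<bullet>\<^sub>s \<phi> D)"
    by (rule linext_superset) (auto simp: keys_add)
  moreover have "linext \<phi> f = (\<Sum>D\<in>?S. Poly_Mapping.lookup f D \<bullet>\<^sub>s \<phi> D)"
    "linext \<phi> g = (\<Sum>D\<in>?S. Poly_Mapping.lookup g D \<bullet>\<^sub>s \<phi> D)"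
    by (rule linext_superset; auto)+
  ultimately show ?thesis
    by (simp add: lookup_add bmor.scale_left_distrib sum.distrib)
qed

lemma linext_scale: "linext \<phi> (c \<bullet>\<^sub>s f) = c \<bullet>\<^sub>s linext \<phi> f"
proof -
  have "linext \<phi> (c \<bullet>\<^sub>s f) = (\<Sum>D\<in>Poly_Mapping.keys f. Poly_Mapping.lookup (c \<bullet>\<^sub>s f) D \<bullet>\<^sub>s \<phi> D)"
    by (rule linext_superset) (auto simp: in_keys_iff)
  then show ?thesis by (simp add: linext_def bmor.scale_sum_right)
qed

lemma linext_zero [simp]: "linext \<phi> 0 = 0"
  by (simp add: linext_def)

lemma linext_diag [simp]: "linext \<phi> (diag D) = \<phi> D"
  by (simp add: linext_def lookup_diag)

lemma linext_fun_add: "linext (\<lambda>D. \<phi> D + \<psi> D) f = linext \<phi> f + linext \<psi> f"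
  by (simp add: linext_def bmor.scale_right_distrib sum.distrib)

lemma linext_fun_scale: "linext (\<lambda>D. c \<bullet>\<^sub>s \<phi> D) f = c \<bullet>\<^sub>s linext \<phi> f"
  by (simp add: linext_def bmor.scale_sum_right mult.commute)

lemma linext_fun_zero [simp]: "linext (\<lambda>D. 0) f = 0"
  by (simp add: linext_def)

lemma bcomp_linext: "bcomp t g f = linext (\<lambda>E. linext (\<lambda>D.
    if dtgt D = dsrc E then t ^ loops E D \<bullet>\<^sub>s diag (dcomp E D) else 0) f) g"
  by (simp add: bcomp_def linext_def bmor.scale_sum_right mult.assoc if_distrib cong: if_cong)

lemma btensor_linext: "f \<otimes> g = linext (\<lambda>D. linext (\<lambda>E. diag (dtensor D E)) g) f"
  by (simp add: btensor_def linext_def bmor.scale_sum_right)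

lemma bflip_linext: "bflip f = linext (\<lambda>D. diag (dflip D)) f"
  by (simp add: bflip_def linext_def)

lemma bcomp_add_left: "bcomp t (g + g') f = bcomp t g f + bcomp t g' f"
  and bcomp_add_right: "bcomp t g (f + f') = bcomp t g f + bcomp t g f'"
  and bcomp_scale_left: "bcomp t (c \<bullet>\<^sub>s g) f = c \<bullet>\<^sub>s bcomp t g f"
  and bcomp_scale_right: "bcomp t g (c \<bullet>\<^sub>s f) = c \<bullet>\<^sub>s bcomp t g f"
  and bcomp_0_left: "bcomp t 0 f = 0" and bcomp_0_right: "bcomp t g 0 = 0"
  by (simp_all add: bcomp_linext linext_add linext_scale linext_fun_add linext_fun_scale)

lemma btensor_add_left: "(f + f') \<otimes> g = f \<otimes> g + f' \<otimes> g"
  and btensor_add_right: "f \<otimes> (g + g') = f \<otimes> g + f \<otimes> g'"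
  and btensor_scale_left: "(c \<bullet>\<^sub>s f) \<otimes> g = c \<bullet>\<^sub>s (f \<otimes> g)"
  and btensor_scale_right: "f \<otimes> (c \<bullet>\<^sub>s g) = c \<bullet>\<^sub>s (f \<otimes> g)"
  and btensor_0_left: "0 \<otimes> g = 0" and btensor_0_right: "f \<otimes> 0 = 0"
  by (simp_all add: btensor_linext linext_add linext_scale linext_fun_add linext_fun_scale)

lemma bflip_add: "bflip (f + f') = bflip f + bflip f'"
  and bflip_scale: "bflip (c \<bullet>\<^sub>s f) = c \<bullet>\<^sub>s bflip f" and bflip_0: "bflip 0 = 0"
  by (simp_all add: bflip_linext linext_add linext_scale)

lemmas bmor_linear = bcomp_add_left bcomp_add_right bcomp_scale_left bcomp_scale_right bcomp_0_left
  bcomp_0_right btensor_add_left btensor_add_right btensor_scale_left btensor_scale_right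
  btensor_0_left btensor_0_right bflip_add bflip_scale bflip_0

lemma bcomp_sum_left: "bcomp t (\<Sum>i\<in>I. g i) f = (\<Sum>i\<in>I. bcomp t (g i) f)"
  by (induction I rule: infinite_finite_induct) (simp_all add: bmor_linear)

lemma bcomp_sum_right: "bcomp t g (\<Sum>i\<in>I. f i) = (\<Sum>i\<in>I. bcomp t g (f i))"
  by (induction I rule: infinite_finite_induct) (simp_all add: bmor_linear)

lemma btensor_sum_left: "(\<Sum>i\<in>I. g i) \<otimes> f = (\<Sum>i\<in>I. g i \<otimes> f)"
  by (induction I rule: infinite_finite_induct) (simp_all add: bmor_linear)

lemma btensor_sum_right: "f \<otimes> (\<Sum>i\<in>I. g i) = (\<Sum>i\<in>I. f \<otimes> g i)"
  by (induction I rule: infinite_finite_induct) (simp_all add: bmor_linear)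

lemma bflip_sum: "bflip (\<Sum>i\<in>I. g i) = (\<Sum>i\<in>I. bflip (g i))"
  by (induction I rule: infinite_finite_induct) (simp_all add: bmor_linear)

lemma bcomp_diff_left: "bcomp t (g - g') f = bcomp t g f - bcomp t g' f"
  using bcomp_add_left[of t "g - g'" g' f] by (simp add: algebra_simps)

lemma bcomp_diff_right: "bcomp t g (f - f') = bcomp t g f - bcomp t g f'"
  using bcomp_add_right[of t g "f - f'" f'] by (simp add: algebra_simps)

lemma bcomp_diag:
  assumes "D \<in> diagrams m n" "E \<in> diagrams n p"
  shows "bcomp t (diag E) (diag D) = t ^ loops E D \<bullet>\<^sub>s diag (dcomp E D)"
  using dtgt_eq[OF assms(1)] dsrc_eq[OF assms(2)] by (simp add: bcomp_linext)

lemma btensor_diag: "diag D \<otimes> diag E = diag (dtensor D E)"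
  by (simp add: btensor_linext)

lemma bflip_diag: "bflip (diag D) = diag (dflip D)"
  by (simp add: bflip_linext)

lemma bhom_add: "f \<in> bhom m n \<Longrightarrow> g \<in> bhom m n \<Longrightarrow> f + g \<in> bhom m n"
  using keys_add[of f g] by (auto simp: bhom_def)

lemma bhom_scale: "f \<in> bhom m n \<Longrightarrow> c \<bullet>\<^sub>s f \<in> bhom m n"
  by (auto simp: bhom_def in_keys_iff)

lemma bhom_0: "0 \<in> bhom m n"
  by (simp add: bhom_def)

lemma bhom_diag: "D \<in> diagrams m n \<Longrightarrow> diag D \<in> bhom m n"
  by (simp add: bhom_def)

lemma bhom_diff: "f \<in> bhom m n \<Longrightarrow> g \<in> bhom m n \<Longrightarrow> f - g \<in> bhom m n"
  using bhom_add[of f m n "(-1) \<bullet>\<^sub>s g"] bhom_scale[of g m n "-1"] by simp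

lemma bhom_sum: "(\<And>i. i \<in> I \<Longrightarrow> f i \<in> bhom m n) \<Longrightarrow> (\<Sum>i\<in>I. f i) \<in> bhom m n"
  by (induction I rule: infinite_finite_induct) (simp_all add: bhom_0 bhom_add)

lemma bmor_sum_diag: "f = (\<Sum>D\<in>Poly_Mapping.keys f. Poly_Mapping.lookup f D \<bullet>\<^sub>s diag D)"
proof (rule poly_mapping_eqI)
  fix E
  have "(\<Sum>D\<in>Poly_Mapping.keys f. Poly_Mapping.lookup f D * Poly_Mapping.lookup (diag D) E) =
     (\<Sum>D\<in>Poly_Mapping.keys f. if D = E then Poly_Mapping.lookup f D else 0)"
    by (intro sum.cong refl) (simp add: lookup_diag)
  also have "\<dots> = Poly_Mapping.lookup f E"
    by (simp add: in_keys_iff)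
  finally show "Poly_Mapping.lookup f E =
      Poly_Mapping.lookup (\<Sum>D\<in>Poly_Mapping.keys f. Poly_Mapping.lookup f D \<bullet>\<^sub>s diag D) E"
    by (simp add: lookup_sum)
qed

text \<open>Identities of morphisms are linear in each variable; with this rule they only have to be
  checked on diagrams.\<close>

lemma bhom_induct [consumes 1, case_names zero diag add scale]:
  assumes f: "f \<in> bhom m n" and "P 0" "\<And>D. D \<in> diagrams m n \<Longrightarrow> P (diag D)"
    "\<And>f g. P f \<Longrightarrow> P g \<Longrightarrow> P (f + g)" "\<And>c f. P f \<Longrightarrow> P (c \<bullet>\<^sub>s f)"
  shows "P f"
proof -
  have "finite S \<Longrightarrow> S \<subseteq> Poly_Mapping.keys f \<Longrightarrow> P (\<Sum>D\<in>S. Poly_Mapping.lookup f D \<bullet>\<^sub>s diag D)" for S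
  proof (induction S rule: finite_induct)
    case (insert D S)
    have "D \<in> diagrams m n" using f insert by (auto simp: bhom_def)
    then show ?case using assms insert by simp
  qed (use assms in simp)
  then show ?thesis by (subst bmor_sum_diag) simp
qed

lemma bcomp_in_bhom:
  assumes g: "g \<in> bhom n p" and f: "f \<in> bhom m n"
  shows "bcomp t g f \<in> bhom m p"
  using g
proof (induction rule: bhom_induct)
  case (diag E)
  show ?case using f
  proof (induction rule: bhom_induct)
    case (diag D)
    then show ?case using \<open>E \<in> diagrams n p\<close>
      by (simp add: bcomp_diag bhom_scale bhom_diag dcomp_in_diagrams)
  qed (simp_all add: bmor_linear bhom_0 bhom_add bhom_scale)
qed (simp_all add: bmor_linear bhom_0 bhom_add bhom_scale)

lemma btensor_in_bhom:
  assumes f: "f \<in> bhom m n" and g: "g \<in> bhom m' n'"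
  shows "f \<otimes> g \<in> bhom (m + m') (n + n')"
  using f
proof (induction rule: bhom_induct)
  case (diag D)
  show ?case using g
  proof (induction rule: bhom_induct)
    case (diag E)
    then show ?case using \<open>D \<in> diagrams m n\<close>
      by (simp add: btensor_diag bhom_diag dtensor_in_diagrams)
  qed (simp_all add: bmor_linear bhom_0 bhom_add bhom_scale)
qed (simp_all add: bmor_linear bhom_0 bhom_add bhom_scale)

lemma bflip_in_bhom:
  assumes f: "f \<in> bhom m n"
  shows "bflip f \<in> bhom n m"
  using f
  by (induction rule: bhom_induct)
    (simp_all add: bmor_linear bhom_0 bhom_add bhom_scale bflip_diag bhom_diag dflip_in_diagrams)

lemma idm_in_bhom: "idm n \<in> bhom n n"
  unfolding idm_def by (intro bhom_diag perm_diagram_in_diagrams permutes_id)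

text \<open>By trilinearity only diagrams matter, where \<open>dcomp_assoc\<close> also says that
  the two bracketings create the same total number of loops, hence the same power of
  \<open>t\<close>.\<close>

theorem bcomp_assoc:
  assumes h: "h \<in> bhom p q" and g: "g \<in> bhom n p" and f: "f \<in> bhom m n"
  shows "bcomp t h (bcomp t g f) = bcomp t (bcomp t h g) f"
  using h
proof (induction rule: bhom_induct)
  case (diag F)
  note F = this
  show ?case using g
  proof (induction rule: bhom_induct)
    case (diag E)
    note E = this
    show ?case using f
    proof (induction rule: bhom_induct)
      case (diag D)
      show ?case
        using dcomp_assoc[OF diag E F]
        by (simp add: bcomp_diag[OF diag E] bcomp_diag[OF E F] bmor_linear
            bcomp_diag[OF dcomp_in_diagrams[OF diag E] F] bcomp_diag[OF diag dcomp_in_diagrams[OF E F]]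
            flip: power_add)
    qed (simp_all add: bmor_linear)
  qed (simp_all add: bmor_linear)
qed (simp_all add: bmor_linear)

lemma bcomp_idm_left:
  assumes f: "f \<in> bhom m n"
  shows "bcomp t (idm n) f = f"
  using f
proof (induction rule: bhom_induct)
  case (diag D)
  then show ?case unfolding idm_def
    by (simp add: bcomp_diag[OF diag perm_diagram_in_diagrams[OF permutes_id]] dcomp_id_left)
qed (simp_all add: bmor_linear)

lemma bcomp_idm_right:
  assumes f: "f \<in> bhom m n"
  shows "bcomp t f (idm m) = f"
  using f
proof (induction rule: bhom_induct)
  case (diag D)
  then show ?case unfolding idm_def
    by (simp add: bcomp_diag[OF perm_diagram_in_diagrams[OF permutes_id] diag] dcomp_id_right)
qed (simp_all add: bmor_linear)

text \<open>On diagrams the loops of a side-by-side composite add up, so the powers of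
  \<open>t\<close> of the two factors multiply.\<close>

theorem interchange:
  assumes g: "g \<in> bhom n p" and f: "f \<in> bhom m n" and g': "g' \<in> bhom n' p'" and f': "f' \<in> bhom m' n'"
  shows "bcomp t (g \<otimes> g') (f \<otimes> f') = bcomp t g f \<otimes> bcomp t g' f'"
  using g
proof (induction rule: bhom_induct)
  case (diag E)
  note E = this
  show ?case using f
  proof (induction rule: bhom_induct)
    case (diag D)
    note D = this
    show ?case using g'
    proof (induction rule: bhom_induct)
      case (diag E')
      note E' = this
      show ?case using f'
      proof (induction rule: bhom_induct)
        case (diag D')
        show ?case
          using dcomp_dtensor[OF D E diag E']
          by (simp add: btensor_diag bmor_linear bcomp_diag[OF D E] bcomp_diag[OF diag E']
             bcomp_diag[OF dtensor_in_diagrams[OF D diag] dtensor_in_diagrams[OF E E']]  power_add mult.commute)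
      qed (simp_all add: bmor_linear)
    qed (simp_all add: bmor_linear)
  qed (simp_all add: bmor_linear)
qed (simp_all add: bmor_linear)

lemma btensor_assoc:
  assumes f: "f \<in> bhom m n" and g: "g \<in> bhom m' n'" and h: "h \<in> bhom m'' n''"
  shows "(f \<otimes> g) \<otimes> h = f \<otimes> g \<otimes> h"
  using f
proof (induction rule: bhom_induct)
  case (diag D)
  note D = this
  show ?case using g
  proof (induction rule: bhom_induct)
    case (diag E)
    note E = this
    show ?case using h
    proof (induction rule: bhom_induct)
      case (diag F)
      show ?case by (simp add: btensor_diag dtensor_assoc[OF D E diag])
    qed (simp_all add: bmor_linear)
  qed (simp_all add: bmor_linear)
qed (simp_all add: bmor_linear)

lemma btensor_idm_0_left [simp]: "idm 0 \<otimes> f = f"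
  unfolding idm_def by (subst (1 2) bmor_sum_diag[of f], simp only: btensor_sum_right bmor_linear btensor_diag dtensor_empty_left)

lemma btensor_idm_0_right [simp]: "f \<otimes> idm 0 = f"
  unfolding idm_def by (subst (1 2) bmor_sum_diag[of f], simp only: btensor_sum_left bmor_linear btensor_diag dtensor_empty_right)

lemma btensor_idm_idm: "idm m \<otimes> idm n = idm (m + n)"
  unfolding idm_def btensor_diag dtensor_id_id ..

lemma diagrams_dim: "D \<in> diagrams m n \<Longrightarrow> m = m' \<Longrightarrow> n = n' \<Longrightarrow> D \<in> diagrams m' n'"
  by simp

lemma bhom_dim: "f \<in> bhom m n \<Longrightarrow> m = m' \<Longrightarrow> n = n' \<Longrightarrow> f \<in> bhom m' n'"
  by simp

section \<open>Permutations, cups and caps as morphisms\<close>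

lemma subset_eq_iff:
  assumes "B \<subseteq> {..<n}" "F \<subseteq> {..<n}"
  shows "B = F \<longleftrightarrow> (\<forall>i<n. i \<in> B \<longleftrightarrow> i \<in> F)"
  using assms by auto

definition pmor :: "nat \<Rightarrow> (nat \<Rightarrow> nat) \<Rightarrow> bmor" where
  "pmor n \<pi> = diag (perm_diagram n \<pi>)"

definition evn :: "nat \<Rightarrow> bmor" where
  "evn n = diag (ev_diagram n)"

definition rev_perm :: "nat \<Rightarrow> nat \<Rightarrow> nat" where
  "rev_perm n i = (if i < n then n - 1 - i else i)"

lemma rev_perm_permutes: "rev_perm n permutes {..<n}"
  by (rule bij_imp_permutes, rule bij_betwI[where g = "rev_perm n"]) (auto simp: rev_perm_def)

lemma coev_diag: "coev n = diag (coev_diagram n)"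
  by (simp add: coev_def coev_diagram_def)

lemma ev_eq_evn: "ev = evn 1"
proof -
  have "ev_diagram 1 = {{(0, 0), (0, 1)}}" by (simp add: ev_diagram_def lessThan_Suc)
  then show ?thesis by (simp add: ev_def evn_def)
qed

lemma coev_in_bhom: "coev n \<in> bhom 0 (2 * n)"
  unfolding coev_diag by (intro bhom_diag coev_diagram_in_diagrams)

lemma evn_in_bhom: "evn n \<in> bhom (2 * n) 0"
  unfolding evn_def by (intro bhom_diag ev_diagram_in_diagrams)

lemma ev_in_bhom: "ev \<in> bhom 2 0"
  using evn_in_bhom[of 1] by (simp add: ev_eq_evn)

lemma pmor_in_bhom: "\<pi> permutes {..<n} \<Longrightarrow> pmor n \<pi> \<in> bhom n n"
  unfolding pmor_def by (intro bhom_diag perm_diagram_in_diagrams)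

lemma transpose_permutes: "Transposition.transpose 0 (Suc 0) permutes {..<2}"
  by (rule permutes_swap_id) auto

lemma braid_pmor: "braid = pmor 2 (Transposition.transpose 0 1)"
  by (simp add: braid_def pmor_def)

lemma braid_in_bhom: "braid \<in> bhom 2 2"
  using pmor_in_bhom[OF transpose_permutes] by (simp add: braid_pmor)

subsection \<open>Zigzag identities\<close>

text \<open>Splits off the outermost arc. This recursion is the reason why iterated derivations lead
  to nested and not to parallel caps.\<close>

lemma ev_evn: "bcomp t ev (idm 1 \<otimes> evn p \<otimes> idm 1) = evn (Suc p)"
proof -
  let ?I = "perm_diagram 1 id"
  have I: "?I \<in> diagrams 1 1" by (intro perm_diagram_in_diagrams permutes_id)
  have D: "dtensor ?I (dtensor (ev_diagram p) ?I) \<in> diagrams (1 + (2 * p + 1)) (1 + (0 + 1))"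
    by (intro dtensor_in_diagrams I ev_diagram_in_diagrams)
  have E: "ev_diagram 1 \<in> diagrams (1 + (0 + 1)) 0" by (rule diagrams_dim[OF ev_diagram_in_diagrams[of 1]]) simp_all
  have X: "ev_diagram (Suc p) \<in> diagrams (1 + (2 * p + 1)) 0" by (rule diagrams_dim[OF ev_diagram_in_diagrams[of "Suc p"]]) simp_all
  define f :: "nat set \<Rightarrow> nat set" where "f A = {i. i = 0 \<and> 0 \<in> A \<or> i = Suc 0 \<and> Suc (2 * p) \<in> A}" for A
  have "f A \<subseteq> {..<1 + (0 + 1)} \<and> (\<forall>B\<subseteq>{..<1 + (0 + 1)}.
      sat (dtensor ?I (dtensor (ev_diagram p) ?I)) A B \<and> sat (ev_diagram 1) B C \<longleftrightarrow>
      sat (ev_diagram (Suc p)) A C \<and> B = f A)" for A C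
  proof (intro conjI allI impI)
    show s: "f A \<subseteq> {..<1 + (0 + 1)}" by (auto simp: f_def)
    fix B :: "nat set" assume B: "B \<subseteq> {..<1 + (0 + 1)}"
    have Bf: "B = f A \<longleftrightarrow> (0 \<in> B \<longleftrightarrow> 0 \<in> A) \<and> (Suc 0 \<in> B \<longleftrightarrow> Suc (2 * p) \<in> A)"
      unfolding subset_eq_iff[OF B s] by (auto simp: f_def All_less_Suc)
    have "(\<forall>i<Suc p. i \<in> A \<longleftrightarrow> Suc (2 * p) - i \<in> A) \<longleftrightarrow>
      (0 \<in> A \<longleftrightarrow> Suc (2 * p) \<in> A) \<and> (\<forall>i<p. Suc i \<in> A \<longleftrightarrow> 2 * p - i \<in> A)"
      by (auto simp: All_less_Suc2)
    moreover have "(\<forall>i<p. Suc i \<in> A \<longleftrightarrow> Suc (2 * p - Suc i) \<in> A) \<longleftrightarrow> (\<forall>i<p. Suc i \<in> A \<longleftrightarrow> 2 * p - i \<in> A)"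
      by (auto simp: Suc_diff_Suc)
    ultimately show "sat (dtensor ?I (dtensor (ev_diagram p) ?I)) A B \<and> sat (ev_diagram 1) B C \<longleftrightarrow>
      sat (ev_diagram (Suc p)) A C \<and> B = f A"
      unfolding Bf sat_dtensor[OF I] sat_dtensor[OF ev_diagram_in_diagrams] sat_perm_diagram sat_ev_diagram
      by auto
  qed
  from dcomp_eqI_unique[OF D E X this]
  show ?thesis unfolding ev_eq_evn evn_def idm_def btensor_diag bcomp_diag[OF D E] by simp
qed

text \<open>On both sides strands 0 and 2 are contracted and strand 1 passes through. It moves a
  braid from the left of the contraction to its right, where a symmetrizer can absorb it.\<close>

lemma ev_braid: "bcomp t (idm 1 \<otimes> ev) (braid \<otimes> idm 1) = bcomp t (ev \<otimes> idm 1) (idm 1 \<otimes> braid)"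
proof -
  let ?I = "perm_diagram 1 id" and ?T = "perm_diagram 2 (Transposition.transpose 0 (Suc 0))"
  have I: "?I \<in> diagrams 1 1" by (intro perm_diagram_in_diagrams permutes_id)
  have T: "?T \<in> diagrams 2 2" by (intro perm_diagram_in_diagrams transpose_permutes)
  have V: "ev_diagram 1 \<in> diagrams 2 0" by (rule diagrams_dim[OF ev_diagram_in_diagrams[of 1]]) simp_all
  have D: "dtensor ?T ?I \<in> diagrams 3 3" by (rule diagrams_dim[OF dtensor_in_diagrams[OF T I]]) simp_all
  have E: "dtensor ?I (ev_diagram 1) \<in> diagrams 3 1" by (rule diagrams_dim[OF dtensor_in_diagrams[OF I V]]) simp_all
  have D': "dtensor ?I ?T \<in> diagrams 3 3" by (rule diagrams_dim[OF dtensor_in_diagrams[OF I T]]) simp_all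
  have E': "dtensor (ev_diagram 1) ?I \<in> diagrams 3 1" by (rule diagrams_dim[OF dtensor_in_diagrams[OF V I]]) simp_all
  define f :: "nat set \<Rightarrow> nat set" where "f A = {i. i = 0 \<and> 1 \<in> A \<or> i = 1 \<and> 0 \<in> A \<or> i = 2 \<and> 2 \<in> A}" for A
  define f' :: "nat set \<Rightarrow> nat set" where "f' A = {i. i = 0 \<and> 0 \<in> A \<or> i = 1 \<and> 2 \<in> A \<or> i = 2 \<and> 1 \<in> A}" for A
  define Q where "Q A C \<longleftrightarrow> (1 \<in> A \<longleftrightarrow> 0 \<in> C) \<and> (0 \<in> A \<longleftrightarrow> 2 \<in> A)" for A C :: "nat set"
  have "f A \<subseteq> {..<3} \<and> f' A \<subseteq> {..<3} \<and>
    (\<forall>B\<subseteq>{..<3}. sat (dtensor ?T ?I) A B \<and> sat (dtensor ?I (ev_diagram 1)) B C \<longleftrightarrow> Q A C \<and> B = f A) \<and>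
    (\<forall>B\<subseteq>{..<3}. sat (dtensor ?I ?T) A B \<and> sat (dtensor (ev_diagram 1) ?I) B C \<longleftrightarrow> Q A C \<and> B = f' A)" for A C
  proof (intro conjI allI impI)
    show s: "f A \<subseteq> {..<3}" and s': "f' A \<subseteq> {..<3}" by (auto simp: f_def f'_def)
    fix B :: "nat set" assume B: "B \<subseteq> {..<3}"
    show "sat (dtensor ?T ?I) A B \<and> sat (dtensor ?I (ev_diagram 1)) B C \<longleftrightarrow> Q A C \<and> B = f A"
      unfolding subset_eq_iff[OF B s] sat_dtensor[OF I] sat_dtensor[OF T] sat_perm_diagram sat_ev_diagram Q_def
      by (auto simp: f_def All_less_Suc numeral_2_eq_2 numeral_3_eq_3 transpose_def)
    show "sat (dtensor ?I ?T) A B \<and> sat (dtensor (ev_diagram 1) ?I) B C \<longleftrightarrow> Q A C \<and> B = f' A"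
      unfolding subset_eq_iff[OF B s'] sat_dtensor[OF I] sat_dtensor[OF V] sat_perm_diagram sat_ev_diagram Q_def
      by (auto simp: f'_def All_less_Suc numeral_2_eq_2 numeral_3_eq_3 transpose_def)
  qed
  note h = dcomp_eq_dcompI_unique[OF D E D' E' this]
  show ?thesis
    unfolding ev_eq_evn evn_def idm_def braid_def btensor_diag One_nat_def[symmetric]
    using h by (simp add: bcomp_diag[OF D E, simplified] bcomp_diag[OF D' E', simplified])
qed

context
  fixes p :: nat and e :: "nat \<Rightarrow> nat" and a b0 b1 b2 c :: "nat \<Rightarrow> bool"
  assumes e: "\<And>i. i < p \<Longrightarrow> e i < p" "\<And>i. i < p \<Longrightarrow> e (e i) = i"
begin

text \<open>The propositional core of a zigzag: the middle layer has three rows \<open>b0\<close>,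
  \<open>b1\<close>, \<open>b2\<close> of \<open>p\<close> points, \<open>a\<close> and
  \<open>c\<close> are the outer layers, and \<open>e\<close> is the reversal of a row caused by
  nested caps.\<close>

lemma zz_right:
  "((\<forall>i<p. b0 i \<longleftrightarrow> b1 i) \<and> (\<forall>i<p. a i \<longleftrightarrow> b2 i)) \<and> (\<forall>i<p. b0 i \<longleftrightarrow> c i) \<and> (\<forall>i<p. b1 i \<longleftrightarrow> b2 (e i)) \<longleftrightarrow>
   (\<forall>i<p. a i \<longleftrightarrow> c (e i)) \<and> (\<forall>i<p. b0 i \<longleftrightarrow> c i) \<and> (\<forall>i<p. b1 i \<longleftrightarrow> c i) \<and> (\<forall>i<p. b2 i \<longleftrightarrow> a i)"
  by (intro iffI conjI allI impI; elim conjE; metis e)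

lemma zz_left:
  "((\<forall>i<p. a i \<longleftrightarrow> b0 i) \<and> (\<forall>i<p. b1 i \<longleftrightarrow> b2 i)) \<and> (\<forall>i<p. b0 i \<longleftrightarrow> b1 (e i)) \<and> (\<forall>i<p. b2 i \<longleftrightarrow> c i) \<longleftrightarrow>
   (\<forall>i<p. a i \<longleftrightarrow> c (e i)) \<and> (\<forall>i<p. b0 i \<longleftrightarrow> a i) \<and> (\<forall>i<p. b1 i \<longleftrightarrow> c i) \<and> (\<forall>i<p. b2 i \<longleftrightarrow> c i)"
  by (intro iffI conjI allI impI; elim conjE; metis e)

end

text \<open>The cups are parallel while the caps are nested, so straightening reverses the order of
  the strands. Wherever this is used, a symmetrizer absorbs the reversal.\<close>

lemma zigzag_right: "bcomp t (idm p \<otimes> evn p) (coev p \<otimes> idm p) = pmor p (rev_perm p)"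
proof -
  let ?I = "perm_diagram p id"
  have I: "?I \<in> diagrams p p" by (intro perm_diagram_in_diagrams permutes_id)
  have D: "dtensor (coev_diagram p) ?I \<in> diagrams p (3 * p)" by (rule diagrams_dim[OF dtensor_in_diagrams[OF coev_diagram_in_diagrams I]]) simp_all
  have E: "dtensor ?I (ev_diagram p) \<in> diagrams (3 * p) p" by (rule diagrams_dim[OF dtensor_in_diagrams[OF I ev_diagram_in_diagrams]]) simp_all
  have X: "perm_diagram p (rev_perm p) \<in> diagrams p p" by (intro perm_diagram_in_diagrams rev_perm_permutes)
  \<comment> \<open>The forced middle colouring: the first row continues to the target, the second
    is tied to the first by the cups, and the third comes from the source.\<close>
  define f where "f A C = {i. i < p \<and> i \<in> C \<or> p \<le> i \<and> i < 2 * p \<and> i - p \<in> C \<or> 2 * p \<le> i \<and> i < 3 * p \<and> i - 2 * p \<in> A}"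
    for A C
  have "f A C \<subseteq> {..<3 * p} \<and> (\<forall>B\<subseteq>{..<3 * p}. sat (dtensor (coev_diagram p) ?I) A B \<and> sat (dtensor ?I (ev_diagram p)) B C \<longleftrightarrow>
      sat (perm_diagram p (rev_perm p)) A C \<and> B = f A C)" for A C
  proof (intro conjI allI impI)
    show s: "f A C \<subseteq> {..<3 * p}" by (auto simp: f_def)
    fix B :: "nat set" assume B: "B \<subseteq> {..<3 * p}"
    have all3: "(\<forall>i<3 * p. R i) \<longleftrightarrow> (\<forall>i<p. R i) \<and> (\<forall>i<p. R (i + p)) \<and> (\<forall>i<p. R (i + 2 * p))" for R
    proof (intro iffI allI impI)
      fix i assume h: "(\<forall>i<p. R i) \<and> (\<forall>i<p. R (i + p)) \<and> (\<forall>i<p. R (i + 2 * p))" and i: "i < 3 * p"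
      consider "i < p" | "i - p < p" "i = i - p + p" | "i - 2 * p < p" "i = i - 2 * p + 2 * p" using i by linarith
      then show "R i" using h by cases metis+
    qed auto
    have Bf: "B = f A C \<longleftrightarrow> (\<forall>i<p. i \<in> B \<longleftrightarrow> i \<in> C) \<and> (\<forall>i<p. i + p \<in> B \<longleftrightarrow> i \<in> C) \<and> (\<forall>i<p. i + 2 * p \<in> B \<longleftrightarrow> i \<in> A)"
      unfolding subset_eq_iff[OF B s] all3 by (auto simp: f_def)
    have ar: "2 * p - Suc i + p = (p - Suc i) + 2 * p" if "i < p" for i using that by simp
    have pp: "p - Suc i < p \<and> p - Suc (p - Suc i) = i" if "i < p" for i using that by auto
    have sD: "sat (dtensor (coev_diagram p) ?I) A B \<longleftrightarrow>
        (\<forall>i<p. i \<in> B \<longleftrightarrow> i + p \<in> B) \<and> (\<forall>i<p. i \<in> A \<longleftrightarrow> i + 2 * p \<in> B)"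
      unfolding sat_dtensor[OF coev_diagram_in_diagrams] sat_perm_diagram sat_coev_diagram by simp
    have sE: "sat (dtensor ?I (ev_diagram p)) B C \<longleftrightarrow>
        (\<forall>i<p. i \<in> B \<longleftrightarrow> i \<in> C) \<and> (\<forall>i<p. i + p \<in> B \<longleftrightarrow> (p - Suc i) + 2 * p \<in> B)"
      unfolding sat_dtensor[OF I] sat_perm_diagram sat_ev_diagram by (simp add: ar)
    have sX: "sat (perm_diagram p (rev_perm p)) A C \<longleftrightarrow> (\<forall>i<p. i \<in> A \<longleftrightarrow> p - Suc i \<in> C)"
      unfolding sat_perm_diagram rev_perm_def by simp
    show "sat (dtensor (coev_diagram p) ?I) A B \<and> sat (dtensor ?I (ev_diagram p)) B C \<longleftrightarrow>
      sat (perm_diagram p (rev_perm p)) A C \<and> B = f A C"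
      unfolding Bf sD sE sX
      by (rule zz_right[where e = "\<lambda>i. p - Suc i" and a = "\<lambda>i. i \<in> A" and c = "\<lambda>i. i \<in> C" and ?b0.0 = "\<lambda>i. i \<in> B"
          and ?b1.0 = "\<lambda>i. i + p \<in> B" and ?b2.0 = "\<lambda>i. i + 2 * p \<in> B"]) (use pp in auto)
  qed
  from dcomp_eqI_unique[OF D E X this]
  show ?thesis unfolding evn_def idm_def coev_diag pmor_def btensor_diag bcomp_diag[OF D E] by simp
qed

lemma zigzag_left: "bcomp t (evn p \<otimes> idm p) (idm p \<otimes> coev p) = pmor p (rev_perm p)"
proof -
  let ?I = "perm_diagram p id"
  have I: "?I \<in> diagrams p p" by (intro perm_diagram_in_diagrams permutes_id)
  have D: "dtensor ?I (coev_diagram p) \<in> diagrams p (3 * p)" by (rule diagrams_dim[OF dtensor_in_diagrams[OF I coev_diagram_in_diagrams]]) simp_all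
  have E: "dtensor (ev_diagram p) ?I \<in> diagrams (3 * p) p" by (rule diagrams_dim[OF dtensor_in_diagrams[OF ev_diagram_in_diagrams I]]) simp_all
  have X: "perm_diagram p (rev_perm p) \<in> diagrams p p" by (intro perm_diagram_in_diagrams rev_perm_permutes)
  define f where "f A C = {i. i < p \<and> i \<in> A \<or> p \<le> i \<and> i < 2 * p \<and> i - p \<in> C \<or> 2 * p \<le> i \<and> i < 3 * p \<and> i - 2 * p \<in> C}"
    for A C
  have "f A C \<subseteq> {..<3 * p} \<and> (\<forall>B\<subseteq>{..<3 * p}. sat (dtensor ?I (coev_diagram p)) A B \<and> sat (dtensor (ev_diagram p) ?I) B C \<longleftrightarrow>
      sat (perm_diagram p (rev_perm p)) A C \<and> B = f A C)" for A C
  proof (intro conjI allI impI)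
    show s: "f A C \<subseteq> {..<3 * p}" by (auto simp: f_def)
    fix B :: "nat set" assume B: "B \<subseteq> {..<3 * p}"
    have all3: "(\<forall>i<3 * p. R i) \<longleftrightarrow> (\<forall>i<p. R i) \<and> (\<forall>i<p. R (i + p)) \<and> (\<forall>i<p. R (i + 2 * p))" for R
    proof (intro iffI allI impI)
      fix i assume h: "(\<forall>i<p. R i) \<and> (\<forall>i<p. R (i + p)) \<and> (\<forall>i<p. R (i + 2 * p))" and i: "i < 3 * p"
      consider "i < p" | "i - p < p" "i = i - p + p" | "i - 2 * p < p" "i = i - 2 * p + 2 * p" using i by linarith
      then show "R i" using h by cases metis+
    qed auto
    have Bf: "B = f A C \<longleftrightarrow> (\<forall>i<p. i \<in> B \<longleftrightarrow> i \<in> A) \<and> (\<forall>i<p. i + p \<in> B \<longleftrightarrow> i \<in> C) \<and> (\<forall>i<p. i + 2 * p \<in> B \<longleftrightarrow> i \<in> C)"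
      unfolding subset_eq_iff[OF B s] all3 by (auto simp: f_def)
    have ar: "2 * p - Suc i = (p - Suc i) + p" if "i < p" for i using that by simp
    have pp: "p - Suc i < p \<and> p - Suc (p - Suc i) = i" if "i < p" for i using that by auto
    have sD: "sat (dtensor ?I (coev_diagram p)) A B \<longleftrightarrow>
        (\<forall>i<p. i \<in> A \<longleftrightarrow> i \<in> B) \<and> (\<forall>i<p. i + p \<in> B \<longleftrightarrow> i + 2 * p \<in> B)"
      unfolding sat_dtensor[OF I] sat_perm_diagram sat_coev_diagram by (simp add: mult_2 add.assoc)
    have sE: "sat (dtensor (ev_diagram p) ?I) B C \<longleftrightarrow>
        (\<forall>i<p. i \<in> B \<longleftrightarrow> (p - Suc i) + p \<in> B) \<and> (\<forall>i<p. i + 2 * p \<in> B \<longleftrightarrow> i \<in> C)"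
      unfolding sat_dtensor[OF ev_diagram_in_diagrams] sat_perm_diagram sat_ev_diagram by (simp add: ar)
    have sX: "sat (perm_diagram p (rev_perm p)) A C \<longleftrightarrow> (\<forall>i<p. i \<in> A \<longleftrightarrow> p - Suc i \<in> C)"
      unfolding sat_perm_diagram rev_perm_def by simp
    show "sat (dtensor ?I (coev_diagram p)) A B \<and> sat (dtensor (ev_diagram p) ?I) B C \<longleftrightarrow>
      sat (perm_diagram p (rev_perm p)) A C \<and> B = f A C"
      unfolding Bf sD sE sX
      by (rule zz_left[where e = "\<lambda>i. p - Suc i" and a = "\<lambda>i. i \<in> A" and c = "\<lambda>i. i \<in> C" and ?b0.0 = "\<lambda>i. i \<in> B"
          and ?b1.0 = "\<lambda>i. i + p \<in> B" and ?b2.0 = "\<lambda>i. i + 2 * p \<in> B"]) (use pp in auto)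
  qed
  from dcomp_eqI_unique[OF D E X this]
  show ?thesis unfolding evn_def idm_def coev_diag pmor_def btensor_diag bcomp_diag[OF D E] by simp
qed

lemma evn_2_coev: "bcomp t (evn 2) (coev 1 \<otimes> idm 2) = ev"
proof -
  let ?I = "perm_diagram 2 id"
  have I: "?I \<in> diagrams 2 2" by (intro perm_diagram_in_diagrams permutes_id)
  have D: "dtensor (coev_diagram 1) ?I \<in> diagrams 2 4" by (rule diagrams_dim[OF dtensor_in_diagrams[OF coev_diagram_in_diagrams I, of 1]]) simp_all
  have E: "ev_diagram 2 \<in> diagrams 4 0" by (rule diagrams_dim[OF ev_diagram_in_diagrams[of 2]]) simp_all
  have X: "ev_diagram 1 \<in> diagrams 2 0" by (rule diagrams_dim[OF ev_diagram_in_diagrams[of 1]]) simp_all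
  define f :: "nat set \<Rightarrow> nat set" where "f A = {i. i \<in> {0, 1, 3} \<and> 1 \<in> A \<or> i = 2 \<and> 0 \<in> A}" for A
  have "f A \<subseteq> {..<4} \<and> (\<forall>B\<subseteq>{..<4}. sat (dtensor (coev_diagram 1) ?I) A B \<and> sat (ev_diagram 2) B C \<longleftrightarrow>
      sat (ev_diagram 1) A C \<and> B = f A)" for A C
  proof (intro conjI allI impI)
    show s: "f A \<subseteq> {..<4}" by (auto simp: f_def)
    fix B :: "nat set" assume B: "B \<subseteq> {..<4}"
    have n: "(4::nat) = Suc (Suc (Suc (Suc 0)))" by simp
    show "sat (dtensor (coev_diagram 1) ?I) A B \<and> sat (ev_diagram 2) B C \<longleftrightarrow> sat (ev_diagram 1) A C \<and> B = f A"
      unfolding subset_eq_iff[OF B s] sat_dtensor[OF coev_diagram_in_diagrams] sat_perm_diagram sat_ev_diagram sat_coev_diagram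
      by (auto simp: f_def All_less_Suc numeral_2_eq_2 numeral_3_eq_3 n)
  qed
  from dcomp_eqI_unique[OF D E X this]
  show ?thesis unfolding ev_eq_evn evn_def idm_def coev_diag btensor_diag bcomp_diag[OF D E] by simp
qed

text \<open>Dinaturality of the coevaluation: an endomorphism of one leg can be replaced by its dual
  on the other leg.\<close>

lemma slide_coev:
  assumes "f \<in> bhom d d"
  shows "bcomp t (f \<otimes> idm d) (coev d) = bcomp t (idm d \<otimes> bflip f) (coev d)"
  using assms
proof (induction rule: bhom_induct)
  case (diag G)
  let ?I = "perm_diagram d id"
  have I: "?I \<in> diagrams d d" by (intro perm_diagram_in_diagrams permutes_id)
  have D: "coev_diagram d \<in> diagrams 0 (d + d)" using coev_diagram_in_diagrams[of d] by (simp add: mult_2)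
  have E: "dtensor G ?I \<in> diagrams (d + d) (d + d)" using dtensor_in_diagrams[OF diag I] .
  have E': "dtensor ?I (dflip G) \<in> diagrams (d + d) (d + d)"
    using dtensor_in_diagrams[OF I dflip_in_diagrams[OF diag]] .
  define f where "f C = {i. i < d \<and> i + d \<in> C \<or> d \<le> i \<and> i < d + d \<and> i \<in> C}" for C
  define f' where "f' C = {i. i < d \<and> i \<in> C \<or> d \<le> i \<and> i < d + d \<and> i - d \<in> C}" for C
  have all2: "(\<forall>i<d + d. R i) \<longleftrightarrow> (\<forall>i<d. R i) \<and> (\<forall>i<d. R (i + d))" for R
  proof (intro iffI allI impI)
    fix i assume h: "(\<forall>i<d. R i) \<and> (\<forall>i<d. R (i + d))" and i: "i < d + d"
    consider "i < d" | "i - d < d" "i = i - d + d" using i by linarith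
    then show "R i" using h by cases metis+
  qed auto
  have "f C \<subseteq> {..<d + d} \<and> f' C \<subseteq> {..<d + d} \<and>
    (\<forall>B\<subseteq>{..<d + d}. sat (coev_diagram d) A B \<and> sat (dtensor G ?I) B C \<longleftrightarrow> sat G (shift d C) C \<and> B = f C) \<and>
    (\<forall>B\<subseteq>{..<d + d}. sat (coev_diagram d) A B \<and> sat (dtensor ?I (dflip G)) B C \<longleftrightarrow> sat G (shift d C) C \<and> B = f' C)" for A C
  proof (intro conjI allI impI)
    show s: "f C \<subseteq> {..<d + d}" and s': "f' C \<subseteq> {..<d + d}" by (auto simp: f_def f'_def)
    fix B :: "nat set" assume B: "B \<subseteq> {..<d + d}"
    have Bf: "B = f C \<longleftrightarrow> (\<forall>i<d. i \<in> B \<longleftrightarrow> i + d \<in> C) \<and> (\<forall>i<d. i + d \<in> B \<longleftrightarrow> i + d \<in> C)"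
      unfolding subset_eq_iff[OF B s] all2 by (auto simp: f_def)
    have Bf': "B = f' C \<longleftrightarrow> (\<forall>i<d. i \<in> B \<longleftrightarrow> i \<in> C) \<and> (\<forall>i<d. i + d \<in> B \<longleftrightarrow> i \<in> C)"
      unfolding subset_eq_iff[OF B s'] all2 by (auto simp: f'_def)
    have c1: "sat G B C \<longleftrightarrow> sat G (shift d C) C" if "\<forall>i<d. i \<in> B \<longleftrightarrow> i + d \<in> C"
      by (rule sat_cong[OF diag]) (use that in auto)
    have c2: "sat G (shift d C) (shift d B) \<longleftrightarrow> sat G (shift d C) C" if "\<forall>i<d. i + d \<in> B \<longleftrightarrow> i \<in> C"
      by (rule sat_cong[OF diag]) (use that in auto)
    show "sat (coev_diagram d) A B \<and> sat (dtensor G ?I) B C \<longleftrightarrow> sat G (shift d C) C \<and> B = f C"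
      unfolding Bf sat_coev_diagram sat_dtensor[OF diag] sat_perm_diagram using c1 by auto
    show "sat (coev_diagram d) A B \<and> sat (dtensor ?I (dflip G)) B C \<longleftrightarrow> sat G (shift d C) C \<and> B = f' C"
      unfolding Bf' sat_coev_diagram sat_dtensor[OF I] sat_perm_diagram sat_dflip[OF diag] using c2 by auto
  qed
  note h = dcomp_eq_dcompI_unique[OF D E D E' this]
  show ?case
    unfolding idm_def coev_diag btensor_diag bflip_diag using h by (simp add: bcomp_diag[OF D E] bcomp_diag[OF D E'])
qed (simp_all add: bmor_linear)

section \<open>Symmetrizers\<close>

lemma symmetrizer_pmor: "symmetrizer n = (1 / fact n) \<bullet>\<^sub>s (\<Sum>\<pi> | \<pi> permutes {..<n}. pmor n \<pi>)"
  by (simp add: symmetrizer_def pmor_def)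

lemma symm_in_bhom: "symmetrizer n \<in> bhom n n"
  unfolding symmetrizer_pmor by (intro bhom_scale bhom_sum pmor_in_bhom) simp

lemma idm_pmor: "idm n = pmor n id"
  by (simp add: idm_def pmor_def)


lemma pmor_comp:
  assumes \<pi>: "\<pi> permutes {..<n}" and \<sigma>: "\<sigma> permutes {..<n}"
  shows "bcomp t (pmor n \<pi>) (pmor n \<sigma>) = pmor n (\<pi> \<circ> \<sigma>)"
  unfolding pmor_def bcomp_diag[OF perm_diagram_in_diagrams[OF \<sigma>] perm_diagram_in_diagrams[OF \<pi>]]
  using dcomp_perm_perm[OF \<pi> \<sigma>] by simp

lemma pmor_tensor:
  assumes \<pi>: "\<pi> permutes {..<n}" and \<sigma>: "\<sigma> permutes {..<m}"
  shows "pmor n \<pi> \<otimes> pmor m \<sigma> = pmor (n + m) (psum n \<pi> \<sigma>)"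
  unfolding pmor_def btensor_diag dtensor_perm_diagram[OF assms] ..

text \<open>The symmetrizer is an average of permutations, so a linear map that is constant on
  permutations takes that constant value. Absorption of partial symmetrizers is thus checked one
  permutation at a time.\<close>

lemma symm_avg:
  assumes "\<And>f g. \<phi> (f + g) = \<phi> f + \<phi> g" "\<And>a f. \<phi> (a \<bullet>\<^sub>s f) = a \<bullet>\<^sub>s \<phi> f"
    "\<And>\<pi>. \<pi> permutes {..<n} \<Longrightarrow> \<phi> (pmor n \<pi>) = c"
  shows "\<phi> (symmetrizer n) = (c :: bmor)"
proof -
  have z: "\<phi> 0 = 0" using assms(2)[of 0 0] by simp
  have s: "\<phi> (\<Sum>\<pi>\<in>I. pmor n \<pi>) = (\<Sum>\<pi>\<in>I. \<phi> (pmor n \<pi>))" for I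
    by (induction I rule: infinite_finite_induct) (simp_all add: z assms(1))
  have "\<phi> (symmetrizer n) = (1 / fact n) \<bullet>\<^sub>s (\<Sum>\<pi> | \<pi> permutes {..<n}. c)"
    unfolding symmetrizer_pmor assms(2) s using assms(3) by simp
  also have "(\<Sum>\<pi> | \<pi> permutes {..<n}. c) = of_nat (fact n) \<bullet>\<^sub>s c"
  proof -
    have "(\<Sum>\<pi>\<in>I. c) = of_nat (card I) \<bullet>\<^sub>s c" for I :: "(nat \<Rightarrow> nat) set"
      by (induction I rule: infinite_finite_induct) (simp_all add: bmor.scale_left_distrib)
    moreover have "card {\<pi>. \<pi> permutes {..<n}} = fact n" by (rule card_permutations) auto
    ultimately show ?thesis by simp
  qed
  finally show ?thesis by simp
qed

lemma symm_pmor: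
  assumes \<sigma>: "\<sigma> permutes {..<n}"
  shows "bcomp t (symmetrizer n) (pmor n \<sigma>) = symmetrizer n"
proof -
  have "(\<Sum>\<pi> | \<pi> permutes {..<n}. pmor n \<pi>) = (\<Sum>\<pi> | \<pi> permutes {..<n}. pmor n (\<pi> \<circ> \<sigma>))"
    by (rule sum_permutations_compose_right[OF \<sigma>])
  then show ?thesis
    unfolding symmetrizer_pmor bmor_linear bcomp_sum_left using pmor_comp[OF _ \<sigma>] by simp
qed

lemma pmor_symm:
  assumes \<sigma>: "\<sigma> permutes {..<n}"
  shows "bcomp t (pmor n \<sigma>) (symmetrizer n) = symmetrizer n"
proof -
  have "(\<Sum>\<pi> | \<pi> permutes {..<n}. pmor n \<pi>) = (\<Sum>\<pi> | \<pi> permutes {..<n}. pmor n (\<sigma> \<circ> \<pi>))"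
    by (rule setum_permutations_compose_left[OF \<sigma>])
  then show ?thesis
    unfolding symmetrizer_pmor bmor_linear bcomp_sum_right using pmor_comp[OF \<sigma>] by simp
qed

lemma symm_symm: "bcomp t (symmetrizer n) (symmetrizer n) = symmetrizer n"
  by (rule symm_avg[where \<phi> = "bcomp t (symmetrizer n)"]) (simp_all add: bmor_linear symm_pmor)

lemma symm_pmor_tensor:
  assumes "\<pi> permutes {..<p}" "\<sigma> permutes {..<q}"
  shows "bcomp t (symmetrizer (p + q)) (pmor p \<pi> \<otimes> pmor q \<sigma>) = symmetrizer (p + q)"
    "bcomp t (pmor p \<pi> \<otimes> pmor q \<sigma>) (symmetrizer (p + q)) = symmetrizer (p + q)"
  unfolding pmor_tensor[OF assms] using symm_pmor pmor_symm psum_permutes[OF assms] by auto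

lemma symm_pmor_symm_tensor:
  assumes "\<pi> permutes {..<p}"
  shows "bcomp t (symmetrizer (p + q)) (pmor p \<pi> \<otimes> symmetrizer q) = symmetrizer (p + q)"
    "bcomp t (pmor p \<pi> \<otimes> symmetrizer q) (symmetrizer (p + q)) = symmetrizer (p + q)"
  by (rule symm_avg[where \<phi> = "\<lambda>f. bcomp t (symmetrizer (p + q)) (pmor p \<pi> \<otimes> f)"];
      simp add: bmor_linear symm_pmor_tensor[OF assms])
    (rule symm_avg[where \<phi> = "\<lambda>f. bcomp t (pmor p \<pi> \<otimes> f) (symmetrizer (p + q))"];
      simp add: bmor_linear symm_pmor_tensor[OF assms])

lemma symm_symm_pmor_tensor:
  assumes "\<pi> permutes {..<q}"
  shows "bcomp t (symmetrizer (p + q)) (symmetrizer p \<otimes> pmor q \<pi>) = symmetrizer (p + q)"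
    "bcomp t (symmetrizer p \<otimes> pmor q \<pi>) (symmetrizer (p + q)) = symmetrizer (p + q)"
  by (rule symm_avg[where \<phi> = "\<lambda>f. bcomp t (symmetrizer (p + q)) (f \<otimes> pmor q \<pi>)"];
      simp add: bmor_linear symm_pmor_tensor[OF _ assms])
    (rule symm_avg[where \<phi> = "\<lambda>f. bcomp t (f \<otimes> pmor q \<pi>) (symmetrizer (p + q))"];
      simp add: bmor_linear symm_pmor_tensor[OF _ assms])

lemma symm_symm_tensor:
  "bcomp t (symmetrizer (p + q)) (symmetrizer p \<otimes> symmetrizer q) = symmetrizer (p + q)"
  "bcomp t (symmetrizer p \<otimes> symmetrizer q) (symmetrizer (p + q)) = symmetrizer (p + q)"
  by (rule symm_avg[where \<phi> = "\<lambda>f. bcomp t (symmetrizer (p + q)) (f \<otimes> symmetrizer q)"];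
      simp add: bmor_linear symm_pmor_symm_tensor)
    (rule symm_avg[where \<phi> = "\<lambda>f. bcomp t (f \<otimes> symmetrizer q) (symmetrizer (p + q))"];
      simp add: bmor_linear symm_pmor_symm_tensor)

lemmas symm_idm_tensor =
  symm_pmor_symm_tensor[OF permutes_id, folded idm_pmor]
  symm_symm_pmor_tensor[OF permutes_id, folded idm_pmor]

text \<open>Flipping a permutation diagram inverts the permutation, and inversion only rearranges
  the summands.\<close>

lemma bflip_symm: "bflip (symmetrizer n) = symmetrizer n"
proof -
  have "bflip (pmor n \<pi>) = pmor n (inv \<pi>)" if \<pi>: "\<pi> permutes {..<n}" for \<pi>
  proof -
    have "dflip (perm_diagram n \<pi>) = perm_diagram n (inv \<pi>)"
    proof (rule diagrams_eqI)
      show "dflip (perm_diagram n \<pi>) \<in> diagrams n n"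
        by (intro dflip_in_diagrams perm_diagram_in_diagrams \<pi>)
      show "perm_diagram n (inv \<pi>) \<in> diagrams n n"
        by (intro perm_diagram_in_diagrams permutes_inv \<pi>)
      have "(\<forall>i<n. i \<in> B \<longleftrightarrow> \<pi> i \<in> A) \<longleftrightarrow> (\<forall>i<n. i \<in> A \<longleftrightarrow> inv \<pi> i \<in> B)" for A B
        using permutes_in_image[OF \<pi>] permutes_in_image[OF permutes_inv[OF \<pi>]] permutes_inverses[OF \<pi>]
        by (metis lessThan_iff)
      then show "sat (dflip (perm_diagram n \<pi>)) A B \<longleftrightarrow> sat (perm_diagram n (inv \<pi>)) A B" for A B
        unfolding sat_dflip[OF perm_diagram_in_diagrams[OF \<pi>]] sat_perm_diagram .
    qed
    then show ?thesis by (simp add: pmor_def bflip_diag)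
  qed
  then show ?thesis
    unfolding symmetrizer_pmor bmor_linear bflip_sum
    by (subst (2) sum_permutations_inverse) simp
qed

lemma permutations_less_1: "\<pi> permutes {..<1::nat} \<Longrightarrow> \<pi> = id"
  by (simp add: lessThan_Suc)

lemma symmetrizer_1: "symmetrizer 1 = idm 1"
  by (rule symm_avg[where \<phi> = "\<lambda>f. f"]) (auto simp only: idm_pmor dest!: permutations_less_1)

text \<open>A permutation of two points at most exchanges the two ends of the single arc.\<close>

lemma symm_2_coev: "bcomp t (symmetrizer 2) (coev 1) = coev 1"
proof (rule symm_avg[where \<phi> = "\<lambda>f. bcomp t f (coev 1)"])
  fix \<pi> :: "nat \<Rightarrow> nat" assume \<pi>: "\<pi> permutes {..<2}"
  have X: "coev_diagram 1 \<in> diagrams 0 2" using coev_diagram_in_diagrams[of 1] by simp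
  have "\<pi> 0 < 2" "\<pi> 1 < 2" using permutes_in_image[OF \<pi>] by auto
  moreover have "\<pi> 0 \<noteq> \<pi> 1" using permutes_inj[OF \<pi>] by (auto dest: injD)
  ultimately have "\<pi> 0 = 0 \<and> \<pi> 1 = 1 \<or> \<pi> 0 = 1 \<and> \<pi> 1 = 0" by linarith
  then have "sat (coev_diagram 1) A C \<longleftrightarrow> sat (coev_diagram 1) A (\<pi> -` C)" for A C
    unfolding sat_coev_diagram by auto
  from dcomp_perm_left[OF X \<pi> X this]
  show "bcomp t (pmor 2 \<pi>) (coev 1) = coev 1"
    unfolding pmor_def coev_diag bcomp_diag[OF X perm_diagram_in_diagrams[OF \<pi>]] by simp
qed (simp_all add: bmor_linear)

section \<open>Contractions and the action of invariants\<close>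

lemma idm_tensor_assoc:
  assumes "f \<in> bhom m n"
  shows "idm p \<otimes> idm q \<otimes> f = idm (p + q) \<otimes> f"
  using btensor_assoc[OF idm_in_bhom[of p] idm_in_bhom[of q] assms] by (simp add: btensor_idm_idm)

lemma tensor_idm_assoc:
  assumes "f \<in> bhom m n"
  shows "(f \<otimes> idm p) \<otimes> idm q = f \<otimes> idm (p + q)"
  using btensor_assoc[OF assms idm_in_bhom[of p] idm_in_bhom[of q]] by (simp add: btensor_idm_idm)

declare One_nat_def [simp del] plus_1_eq_Suc [simp]

context
  fixes t :: complex
begin

abbreviation bcomp_contr  (infixr "\<odot>" 70) where
  "g \<odot> f \<equiv> bcomp t g f"

text \<open>Together with \<open>tensor_split_right\<close> this lets morphisms on disjoint strands
  slide past each other.\<close>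

lemma tensor_split_left:
  assumes f: "f \<in> bhom m n" and g: "g \<in> bhom m' n'"
  shows "f \<otimes> g = (f \<otimes> idm n') \<odot> (idm m \<otimes> g)"
  using interchange[OF f idm_in_bhom idm_in_bhom g, of t] bcomp_idm_left[OF g] bcomp_idm_right[OF f] by simp

lemma tensor_split_right:
  assumes f: "f \<in> bhom m n" and g: "g \<in> bhom m' n'"
  shows "f \<otimes> g = (idm n \<otimes> g) \<odot> (f \<otimes> idm m')"
  using interchange[OF idm_in_bhom f g idm_in_bhom, of t] bcomp_idm_right[OF g] bcomp_idm_left[OF f] by simp

lemma idm_tensor_comp:
  assumes "g \<in> bhom n p" "f \<in> bhom m n"
  shows "idm q \<otimes> (g \<odot> f) = (idm q \<otimes> g) \<odot> (idm q \<otimes> f)"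
  using interchange[OF idm_in_bhom idm_in_bhom assms, where t = t] bcomp_idm_left[OF idm_in_bhom[of q]] by simp

lemma comp_tensor_idm:
  assumes "g \<in> bhom n p" "f \<in> bhom m n"
  shows "(g \<odot> f) \<otimes> idm q = (g \<otimes> idm q) \<odot> (f \<otimes> idm q)"
  using interchange[OF assms idm_in_bhom idm_in_bhom, where t = t] bcomp_idm_left[OF idm_in_bhom[of q]] by simp

lemma evn_in_bhom': "evn p \<in> bhom (p + p) 0"
  using evn_in_bhom[of p] by (simp add: mult_2)

lemma coev_in_bhom': "coev p \<in> bhom 0 (p + p)"
  using coev_in_bhom[of p] by (simp add: mult_2)

lemma leibniz_in_bhom: "leibniz t q \<in> bhom (1 + q) (q - 1)"
proof (induction q)
  case (Suc q)
  have a: "ev \<otimes> idm q \<in> bhom (1 + Suc q) q"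
    by (rule bhom_dim[OF btensor_in_bhom[OF ev_in_bhom idm_in_bhom]]) simp_all
  have b: "braid \<otimes> idm q \<in> bhom (1 + Suc q) (1 + (1 + q))"
    by (rule bhom_dim[OF btensor_in_bhom[OF braid_in_bhom idm_in_bhom]]) simp_all
  have c: "(idm 1 \<otimes> leibniz t q) \<odot> (braid \<otimes> idm q) \<in> bhom (1 + Suc q) (1 + (q - 1))"
    by (rule bcomp_in_bhom[OF btensor_in_bhom[OF idm_in_bhom Suc] b])
  show ?case
  proof (cases q)
    case 0
    then show ?thesis using a by (simp add: bmor_linear)
  next
    case (Suc q')
    then have "(idm 1 \<otimes> leibniz t q) \<odot> (braid \<otimes> idm q) \<in> bhom (1 + Suc q) q" using c by simp
    then show ?thesis using a bhom_add by simp
  qed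
qed (simp add: bhom_0)

text \<open>Contracting part of a symmetric tensor leaves a symmetric tensor: the symmetrizer on
  \<open>p + r\<close> strands emits one on the last \<open>r\<close> strands, which slides past the
  caps.\<close>

lemma evn_slide:
  "(evn p \<otimes> idm r) \<odot> (idm p \<otimes> symmetrizer (p + r)) =
   symmetrizer r \<odot> (evn p \<otimes> idm r) \<odot> (idm p \<otimes> symmetrizer (p + r))"
proof -
  let ?S = "symmetrizer (p + r)" and ?s = "symmetrizer r"
  have iS: "idm p \<otimes> ?s \<in> bhom (p + r) (p + r)" by (intro btensor_in_bhom idm_in_bhom symm_in_bhom)
  have e1: "evn p \<otimes> idm r \<in> bhom ((p + p) + r) r"
    using btensor_in_bhom[OF evn_in_bhom' idm_in_bhom] by simp
  have e2: "idm (p + p) \<otimes> ?s \<in> bhom ((p + p) + r) ((p + p) + r)"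
    by (intro btensor_in_bhom idm_in_bhom symm_in_bhom)
  have e3: "idm p \<otimes> ?S \<in> bhom (p + (p + r)) ((p + p) + r)"
    by (rule bhom_dim[OF btensor_in_bhom[OF idm_in_bhom symm_in_bhom]]) simp_all
  have "idm p \<otimes> ?S = idm p \<otimes> ((idm p \<otimes> ?s) \<odot> ?S)" by (simp add: symm_idm_tensor)
  also have "\<dots> = (idm p \<otimes> idm p \<otimes> ?s) \<odot> (idm p \<otimes> ?S)"
    by (rule idm_tensor_comp[OF iS symm_in_bhom])
  also have "\<dots> = (idm (p + p) \<otimes> ?s) \<odot> (idm p \<otimes> ?S)"
    by (simp add: idm_tensor_assoc[OF symm_in_bhom])
  finally have absorb: "idm p \<otimes> ?S = (idm (p + p) \<otimes> ?s) \<odot> (idm p \<otimes> ?S)" .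
  have "(evn p \<otimes> idm r) \<odot> (idm p \<otimes> ?S) = ((evn p \<otimes> idm r) \<odot> (idm (p + p) \<otimes> ?s)) \<odot> (idm p \<otimes> ?S)"
    using bcomp_assoc[OF e1 e2 e3, of t] by (simp only: absorb[symmetric])
  also have "(evn p \<otimes> idm r) \<odot> (idm (p + p) \<otimes> ?s) = ?s \<odot> (evn p \<otimes> idm r)"
    using tensor_split_left[OF evn_in_bhom' symm_in_bhom[of r], of p] tensor_split_right[OF evn_in_bhom' symm_in_bhom[of r], of p] by simp
  also have "(?s \<odot> (evn p \<otimes> idm r)) \<odot> (idm p \<otimes> ?S) = ?s \<odot> (evn p \<otimes> idm r) \<odot> (idm p \<otimes> ?S)"
    by (rule bcomp_assoc[OF symm_in_bhom e1 e3, symmetric])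
  finally show ?thesis .
qed

text \<open>On symmetric tensors all \<open>q + 1\<close> terms of the Leibniz rule agree with
  contraction against the first factor. In the induction, the braid that moves the derivation past
  the first factor is carried across \<open>ev\<close> and absorbed.\<close>

lemma leibniz_symm:
  "leibniz t (Suc q) \<odot> (idm 1 \<otimes> symmetrizer (Suc q)) =
   of_nat (Suc q) \<bullet>\<^sub>s ((ev \<otimes> idm q) \<odot> (idm 1 \<otimes> symmetrizer (Suc q)))"
proof (induction q)
  case 0
  show ?case by (simp add: bmor_linear)
next
  case (Suc q)
  let ?S = "symmetrizer (Suc (Suc q))" and ?s = "symmetrizer (Suc q)" and ?L = "leibniz t (Suc q)"
  have L: "?L \<in> bhom (1 + Suc q) q" using leibniz_in_bhom[of "Suc q"] by simp
  have iS: "idm 1 \<otimes> ?S \<in> bhom (2 + Suc q) (2 + Suc q)"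
    by (rule bhom_dim[OF btensor_in_bhom[OF idm_in_bhom symm_in_bhom]]) simp_all
  have ix: "idm 1 \<otimes> ?s \<in> bhom (1 + Suc q) (1 + Suc q)" by (intro btensor_in_bhom idm_in_bhom symm_in_bhom)
  have i2s: "idm 2 \<otimes> ?s \<in> bhom (2 + Suc q) (2 + Suc q)" by (intro btensor_in_bhom idm_in_bhom symm_in_bhom)
  have B: "braid \<otimes> idm (Suc q) \<in> bhom (2 + Suc q) (2 + Suc q)"
    by (intro btensor_in_bhom idm_in_bhom braid_in_bhom)
  have iL: "idm 1 \<otimes> ?L \<in> bhom (2 + Suc q) (Suc q)"
    by (rule bhom_dim[OF btensor_in_bhom[OF idm_in_bhom L]]) simp_all
  have ie: "idm 1 \<otimes> ev \<in> bhom 3 1"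
    by (rule bhom_dim[OF btensor_in_bhom[OF idm_in_bhom ev_in_bhom]]) simp_all
  have eI: "ev \<otimes> idm 1 \<in> bhom 3 1"
    by (rule bhom_dim[OF btensor_in_bhom[OF ev_in_bhom idm_in_bhom]]) simp_all
  have bI: "braid \<otimes> idm 1 \<in> bhom 3 3"
    by (rule bhom_dim[OF btensor_in_bhom[OF braid_in_bhom idm_in_bhom]]) simp_all
  have Ib: "idm 1 \<otimes> braid \<in> bhom 3 3"
    by (rule bhom_dim[OF btensor_in_bhom[OF idm_in_bhom braid_in_bhom]]) simp_all
  have ieq: "(idm 1 \<otimes> ev) \<otimes> idm q \<in> bhom (2 + Suc q) (Suc q)"
    by (rule bhom_dim[OF btensor_in_bhom[OF ie idm_in_bhom]]) simp_all
  have eq: "ev \<otimes> idm q \<in> bhom (1 + Suc q) q"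
    by (rule bhom_dim[OF btensor_in_bhom[OF ev_in_bhom idm_in_bhom]]) simp_all
  have eSq: "ev \<otimes> idm (Suc q) \<in> bhom (2 + Suc q) (Suc q)"
    by (rule bhom_dim[OF btensor_in_bhom[OF ev_in_bhom idm_in_bhom]]) simp_all
  have bq: "braid \<otimes> idm q \<in> bhom (Suc (Suc q)) (Suc (Suc q))"
    by (rule bhom_dim[OF btensor_in_bhom[OF braid_in_bhom idm_in_bhom]]) simp_all
  have Ibq: "idm 1 \<otimes> braid \<otimes> idm q \<in> bhom (2 + Suc q) (2 + Suc q)"
    by (rule bhom_dim[OF btensor_in_bhom[OF idm_in_bhom bq]]) simp_all
  \<comment> \<open>A symmetrizer on the last \<open>Suc q\<close> strands is emitted, so that the
    induction hypothesis applies under \<open>idm 1\<close>; afterwards it is absorbed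
    again.\<close>
  have absorb: "idm 1 \<otimes> ?S = (idm 2 \<otimes> ?s) \<odot> (idm 1 \<otimes> ?S)"
  proof -
    have "(idm 1 \<otimes> ?s) \<odot> ?S = ?S" using symm_idm_tensor(2)[of t 1 "Suc q"] by simp
    then have "idm 1 \<otimes> ?S = (idm 1 \<otimes> idm 1 \<otimes> ?s) \<odot> (idm 1 \<otimes> ?S)"
      using idm_tensor_comp[OF bhom_dim[OF ix] symm_in_bhom, of "Suc (Suc q)" "Suc (Suc q)" 1] by simp
    then show ?thesis using idm_tensor_assoc[OF symm_in_bhom[of "Suc q"], of 1 1] by simp
  qed
  have "(idm 1 \<otimes> ?L) \<odot> (braid \<otimes> idm (Suc q)) \<odot> (idm 1 \<otimes> ?S)
      = (idm 1 \<otimes> ?L) \<odot> (braid \<otimes> idm (Suc q)) \<odot> (idm 2 \<otimes> ?s) \<odot> (idm 1 \<otimes> ?S)"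
    by (simp only: absorb[symmetric])
  also have "(braid \<otimes> idm (Suc q)) \<odot> (idm 2 \<otimes> ?s) \<odot> (idm 1 \<otimes> ?S)
      = ((braid \<otimes> idm (Suc q)) \<odot> (idm 2 \<otimes> ?s)) \<odot> (idm 1 \<otimes> ?S)"
    by (rule bcomp_assoc[OF B i2s iS])
  also have "(braid \<otimes> idm (Suc q)) \<odot> (idm 2 \<otimes> ?s) = (idm 2 \<otimes> ?s) \<odot> (braid \<otimes> idm (Suc q))"
    using tensor_split_left[OF braid_in_bhom symm_in_bhom, of "Suc q"] tensor_split_right[OF braid_in_bhom symm_in_bhom, of "Suc q"] by simp
  also have "((idm 2 \<otimes> ?s) \<odot> (braid \<otimes> idm (Suc q))) \<odot> (idm 1 \<otimes> ?S) =
      (idm 2 \<otimes> ?s) \<odot> (braid \<otimes> idm (Suc q)) \<odot> (idm 1 \<otimes> ?S)"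
    by (rule bcomp_assoc[OF i2s B iS, symmetric])
  also have "(idm 1 \<otimes> ?L) \<odot> (idm 2 \<otimes> ?s) \<odot> (braid \<otimes> idm (Suc q)) \<odot> (idm 1 \<otimes> ?S)
      = ((idm 1 \<otimes> ?L) \<odot> (idm 2 \<otimes> ?s)) \<odot> (braid \<otimes> idm (Suc q)) \<odot> (idm 1 \<otimes> ?S)"
    by (rule bcomp_assoc[OF iL i2s bcomp_in_bhom[OF B iS]])
  also have "(idm 1 \<otimes> ?L) \<odot> (idm 2 \<otimes> ?s) = idm 1 \<otimes> (?L \<odot> (idm 1 \<otimes> ?s))"
    using idm_tensor_comp[OF L ix, of 1] idm_tensor_assoc[OF symm_in_bhom[of "Suc q"], of 1 1] by simp
  also have "\<dots> = of_nat (Suc q) \<bullet>\<^sub>s (idm 1 \<otimes> ((ev \<otimes> idm q) \<odot> (idm 1 \<otimes> ?s)))"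
    unfolding Suc by (simp only: bmor_linear)
  also have "idm 1 \<otimes> ((ev \<otimes> idm q) \<odot> (idm 1 \<otimes> ?s)) = ((idm 1 \<otimes> ev) \<otimes> idm q) \<odot> (idm 2 \<otimes> ?s)"
    using idm_tensor_comp[OF eq ix, of 1] idm_tensor_assoc[OF symm_in_bhom[of "Suc q"], of 1 1]
      btensor_assoc[OF idm_in_bhom[of 1] ev_in_bhom idm_in_bhom[of q]] by simp
  also have "(of_nat (Suc q) \<bullet>\<^sub>s (((idm 1 \<otimes> ev) \<otimes> idm q) \<odot> (idm 2 \<otimes> ?s))) \<odot> (braid \<otimes> idm (Suc q)) \<odot> (idm 1 \<otimes> ?S)
     = of_nat (Suc q) \<bullet>\<^sub>s (((idm 1 \<otimes> ev) \<otimes> idm q) \<odot> (idm 2 \<otimes> ?s) \<odot> (braid \<otimes> idm (Suc q)) \<odot> (idm 1 \<otimes> ?S))"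
    by (simp only: bmor_linear bcomp_assoc[OF ieq i2s bcomp_in_bhom[OF B iS]])
  also have "(idm 2 \<otimes> ?s) \<odot> (braid \<otimes> idm (Suc q)) \<odot> (idm 1 \<otimes> ?S) =
      ((braid \<otimes> idm (Suc q)) \<odot> (idm 2 \<otimes> ?s)) \<odot> (idm 1 \<otimes> ?S)"
    using tensor_split_left[OF braid_in_bhom symm_in_bhom, of "Suc q"] tensor_split_right[OF braid_in_bhom symm_in_bhom, of "Suc q"]
      bcomp_assoc[OF i2s B iS] by simp
  also have "\<dots> = (braid \<otimes> idm (Suc q)) \<odot> (idm 1 \<otimes> ?S)"
    using bcomp_assoc[OF B i2s iS, of t] by (simp only: absorb[symmetric])
  also have "((idm 1 \<otimes> ev) \<otimes> idm q) \<odot> (braid \<otimes> idm (Suc q)) \<odot> (idm 1 \<otimes> ?S)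
     = (((idm 1 \<otimes> ev) \<otimes> idm q) \<odot> ((braid \<otimes> idm 1) \<otimes> idm q)) \<odot> (idm 1 \<otimes> ?S)"
    using bcomp_assoc[OF ieq B iS] tensor_idm_assoc[OF braid_in_bhom, of 1 q] by simp
  \<comment> \<open>Here the braid passes from the contracted strand and its neighbour to two
    strands of the symmetric tensor.\<close>
  also have "((idm 1 \<otimes> ev) \<otimes> idm q) \<odot> ((braid \<otimes> idm 1) \<otimes> idm q) = ((ev \<otimes> idm 1) \<otimes> idm q) \<odot> ((idm 1 \<otimes> braid) \<otimes> idm q)"
    using comp_tensor_idm[OF ie bI, of q] comp_tensor_idm[OF eI Ib, of q] ev_braid[of t] by simp
  also have "\<dots> = (ev \<otimes> idm (Suc q)) \<odot> (idm 1 \<otimes> braid \<otimes> idm q)"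
    using tensor_idm_assoc[OF ev_in_bhom, of 1 q] btensor_assoc[OF idm_in_bhom[of 1] braid_in_bhom idm_in_bhom[of q]] by simp
  also have "((ev \<otimes> idm (Suc q)) \<odot> (idm 1 \<otimes> braid \<otimes> idm q)) \<odot> (idm 1 \<otimes> ?S) =
      (ev \<otimes> idm (Suc q)) \<odot> (idm 1 \<otimes> braid \<otimes> idm q) \<odot> (idm 1 \<otimes> ?S)"
    by (rule bcomp_assoc[OF eSq Ibq iS, symmetric])
  also have "(idm 1 \<otimes> braid \<otimes> idm q) \<odot> (idm 1 \<otimes> ?S) = idm 1 \<otimes> ?S"
  proof -
    have "(braid \<otimes> idm q) \<odot> ?S = ?S"
      using symm_pmor_tensor(2)[OF transpose_permutes[folded One_nat_def] permutes_id, of t q]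
      by (simp add: braid_pmor idm_pmor)
    then show ?thesis using idm_tensor_comp[OF bq symm_in_bhom, of 1] by simp
  qed
  finally have second: "(idm 1 \<otimes> ?L) \<odot> (braid \<otimes> idm (Suc q)) \<odot> (idm 1 \<otimes> ?S) =
      of_nat (Suc q) \<bullet>\<^sub>s ((ev \<otimes> idm (Suc q)) \<odot> (idm 1 \<otimes> ?S))" .
  have "leibniz t (Suc (Suc q)) \<odot> (idm 1 \<otimes> ?S) = (ev \<otimes> idm (Suc q)) \<odot> (idm 1 \<otimes> ?S) +
      ((idm 1 \<otimes> ?L) \<odot> (braid \<otimes> idm (Suc q))) \<odot> (idm 1 \<otimes> ?S)"
    by (simp only: leibniz.simps(2)[of t "Suc q"] bmor_linear)
  also have "((idm 1 \<otimes> ?L) \<odot> (braid \<otimes> idm (Suc q))) \<odot> (idm 1 \<otimes> ?S) =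
      of_nat (Suc q) \<bullet>\<^sub>s ((ev \<otimes> idm (Suc q)) \<odot> (idm 1 \<otimes> ?S))"
    using second bcomp_assoc[OF iL B iS] by simp
  finally show ?case
    by (simp only: of_nat_Suc[of "Suc q"] bmor.scale_left_distrib bmor.scale_one)
qed

lemma deriv1_Suc:
  "deriv1 t (Suc q) = of_nat (Suc q) \<bullet>\<^sub>s ((ev \<otimes> idm q) \<odot> (idm 1 \<otimes> symmetrizer (Suc q)))"
  unfolding deriv1_def diff_Suc_1 leibniz_symm bmor_linear
  using evn_slide[of 1 q, folded ev_eq_evn] by simp

lemma deriv1_0: "deriv1 t 0 = 0"
  by (simp add: deriv1_def bmor_linear)

lemma evn_0: "evn 0 = idm 0"
  by (simp add: evn_def ev_diagram_def idm_def perm_diagram_def)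

text \<open>By \<open>deriv1_Suc\<close> each derivation contributes the degree of its argument,
  which accumulates to a falling factorial, and by \<open>ev_evn\<close> it wraps one more arc
  around the caps.\<close>

lemma derivs_eq:
  "derivs t p (p + r) = (fact (p + r) / fact r) \<bullet>\<^sub>s ((evn p \<otimes> idm r) \<odot> (idm p \<otimes> symmetrizer (p + r)))"
proof (induction p arbitrary: r)
  case 0
  show ?case by (simp add: evn_0 bcomp_idm_left[OF symm_in_bhom])
next
  case (Suc p)
  let ?S = "symmetrizer (p + Suc r)" and ?s = "symmetrizer (Suc r)"
  let ?K = "(evn p \<otimes> idm (Suc r)) \<odot> (idm p \<otimes> ?S)"
  have e1: "evn p \<otimes> idm (Suc r) \<in> bhom (p + (p + Suc r)) (Suc r)"
    by (rule bhom_dim[OF btensor_in_bhom[OF evn_in_bhom' idm_in_bhom]]) simp_all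
  have pS: "idm p \<otimes> ?S \<in> bhom (p + (p + Suc r)) (p + (p + Suc r))"
    by (intro btensor_in_bhom idm_in_bhom symm_in_bhom)
  have K: "?K \<in> bhom (p + (p + Suc r)) (Suc r)" by (rule bcomp_in_bhom[OF e1 pS])
  have er: "ev \<otimes> idm r \<in> bhom (1 + Suc r) r"
    by (rule bhom_dim[OF btensor_in_bhom[OF ev_in_bhom idm_in_bhom]]) simp_all
  have ix: "idm 1 \<otimes> ?s \<in> bhom (1 + Suc r) (1 + Suc r)" by (intro btensor_in_bhom idm_in_bhom symm_in_bhom)
  have iK: "idm 1 \<otimes> ?K \<in> bhom (1 + (p + (p + Suc r))) (1 + Suc r)" by (intro btensor_in_bhom idm_in_bhom K)
  have ie1: "idm 1 \<otimes> evn p \<otimes> idm (Suc r) \<in> bhom (1 + (p + (p + Suc r))) (1 + Suc r)"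
    by (intro btensor_in_bhom idm_in_bhom e1)
  have ipS: "idm 1 \<otimes> idm p \<otimes> ?S \<in> bhom (1 + (p + (p + Suc r))) (1 + (p + (p + Suc r)))"
    by (intro btensor_in_bhom idm_in_bhom pS)
  have ep1: "evn p \<otimes> idm 1 \<in> bhom ((p + p) + 1) 1"
    by (rule bhom_dim[OF btensor_in_bhom[OF evn_in_bhom' idm_in_bhom]]) simp_all
  have iep: "idm 1 \<otimes> evn p \<otimes> idm 1 \<in> bhom (1 + ((p + p) + 1)) 2"
    by (rule bhom_dim[OF btensor_in_bhom[OF idm_in_bhom ep1]]) simp_all
  have "(ev \<otimes> idm r) \<odot> (idm 1 \<otimes> ?s) \<odot> (idm 1 \<otimes> ?K) = (ev \<otimes> idm r) \<odot> (idm 1 \<otimes> ?K)"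
    using idm_tensor_comp[OF symm_in_bhom K, of 1] evn_slide[of p "Suc r"] by simp
  also have "\<dots> = (ev \<otimes> idm r) \<odot> (idm 1 \<otimes> evn p \<otimes> idm (Suc r)) \<odot> (idm 1 \<otimes> idm p \<otimes> ?S)"
    by (simp only: idm_tensor_comp[OF e1 pS])
  also have "\<dots> = ((ev \<otimes> idm r) \<odot> (idm 1 \<otimes> evn p \<otimes> idm (Suc r))) \<odot> (idm 1 \<otimes> idm p \<otimes> ?S)"
    by (rule bcomp_assoc[OF er ie1 ipS])
  also have "idm 1 \<otimes> evn p \<otimes> idm (Suc r) = (idm 1 \<otimes> evn p \<otimes> idm 1) \<otimes> idm r"
    using tensor_idm_assoc[OF evn_in_bhom', of p 1 r] btensor_assoc[OF idm_in_bhom[of 1] ep1 idm_in_bhom[of r]] by simp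
  also have "(ev \<otimes> idm r) \<odot> \<dots> = evn (Suc p) \<otimes> idm r"
    using comp_tensor_idm[OF ev_in_bhom iep, of r] by (simp add: ev_evn)
  also have "idm 1 \<otimes> idm p \<otimes> ?S = idm (Suc p) \<otimes> ?S"
    using idm_tensor_assoc[OF symm_in_bhom, of 1 p] by simp
  finally have key: "(ev \<otimes> idm r) \<odot> (idm 1 \<otimes> ?s) \<odot> (idm 1 \<otimes> ?K) = (evn (Suc p) \<otimes> idm r) \<odot> (idm (Suc p) \<otimes> ?S)" .
  have sc: "(of_nat (Suc r) :: complex) * (fact (p + Suc r) / fact (Suc r)) = fact (p + Suc r) / fact r"
    by (simp add: field_simps del: of_nat_Suc)
  have "derivs t (Suc p) (Suc p + r) = deriv1 t (Suc r) \<odot> (idm 1 \<otimes> derivs t p (p + Suc r))" by simp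
  also have "\<dots> = (of_nat (Suc r) * (fact (p + Suc r) / fact (Suc r))) \<bullet>\<^sub>s
      (((ev \<otimes> idm r) \<odot> (idm 1 \<otimes> ?s)) \<odot> (idm 1 \<otimes> ?K))"
    unfolding Suc deriv1_Suc by (simp only: bmor_linear bmor.scale_scale mult.commute)
  also have "((ev \<otimes> idm r) \<odot> (idm 1 \<otimes> ?s)) \<odot> (idm 1 \<otimes> ?K) = (ev \<otimes> idm r) \<odot> (idm 1 \<otimes> ?s) \<odot> (idm 1 \<otimes> ?K)"
    by (rule bcomp_assoc[OF er ix iK, symmetric])
  finally show ?case unfolding key sc by simp
qed

text \<open>After \<open>q\<close> derivations the degree is 0 and the next one is
  \<open>deriv1 t 0\<close>, which vanishes; derivations of zero remain zero.\<close>

lemma derivs_gt: "derivs t (Suc (q + i)) q = 0"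
proof (induction i)
  case 0
  show ?case by (simp add: deriv1_0 bmor_linear)
next
  case (Suc i)
  have "derivs t (Suc (q + Suc i)) q = deriv1 t (q - Suc (q + i)) \<odot> (idm 1 \<otimes> derivs t (Suc (q + i)) q)"
    by (simp only: derivs.simps(2)[of t "Suc (q + i)"] add_Suc_right)
  then show ?case unfolding Suc by (simp add: bmor_linear)
qed

lemma contr_gt: "q < p \<Longrightarrow> contr t p q = 0"
  using derivs_gt[of q "p - Suc q"] by (simp add: contr_def bmor_linear)

lemma contr_eq:
  "contr t p (p + r) = (fact (p + r) / fact r) \<bullet>\<^sub>s ((evn p \<otimes> idm r) \<odot> (symmetrizer p \<otimes> symmetrizer (p + r)))"
proof -
  have e: "evn p \<otimes> idm r \<in> bhom (p + (p + r)) r"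
    by (rule bhom_dim[OF btensor_in_bhom[OF evn_in_bhom' idm_in_bhom]]) simp_all
  have S: "idm p \<otimes> symmetrizer (p + r) \<in> bhom (p + (p + r)) (p + (p + r))"
    "symmetrizer p \<otimes> symmetrizer (p + r) \<in> bhom (p + (p + r)) (p + (p + r))"
    by (intro btensor_in_bhom idm_in_bhom symm_in_bhom)+
  have "(idm p \<otimes> symmetrizer (p + r)) \<odot> (symmetrizer p \<otimes> symmetrizer (p + r)) = symmetrizer p \<otimes> symmetrizer (p + r)"
    by (simp add: interchange[OF idm_in_bhom symm_in_bhom symm_in_bhom symm_in_bhom] symm_symm bcomp_idm_left[OF symm_in_bhom])
  then show ?thesis
    unfolding contr_def derivs_eq bmor_linear using bcomp_assoc[OF e S, of t, symmetric] by simp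
qed

end

section \<open>Action of invariants, and the Casimir operator\<close>

context
  fixes t :: complex
begin

abbreviation bcomp_act  (infixr "\<odot>" 70) where
  "g \<odot> f \<equiv> bcomp t g f"

lemma act_single:
  "act t (Poly_Mapping.single p x) e = mulP t p (e - p) \<odot> (symmetrizer p \<otimes> contr t p e) \<odot> (x \<otimes> symmetrizer e)"
  by (cases "x = 0") (simp_all add: act_def bmor_linear)

lemma mulP_eq: "mulP t p q = symmetrizer (p + q)"
  by (simp add: mulP_def symm_symm_tensor)

lemma coev_twist_in_bhom: "f \<in> bhom p p \<Longrightarrow> (f \<otimes> idm p) \<odot> coev p \<in> bhom 0 (p + p)"
  by (intro bcomp_in_bhom[OF btensor_in_bhom[OF _ idm_in_bhom] coev_in_bhom'])

lemma symm_coev: "(symmetrizer p \<otimes> idm p) \<odot> coev p = (idm p \<otimes> symmetrizer p) \<odot> coev p"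
  using slide_coev[OF symm_in_bhom, of t p] by (simp add: bflip_symm)

lemma symm_symm_coev:
  assumes f: "f \<in> bhom p p" and Sf: "symmetrizer p \<odot> f = f" and fS: "f \<odot> symmetrizer p = f"
  shows "(symmetrizer p \<otimes> symmetrizer p) \<odot> (f \<otimes> idm p) \<odot> coev p = (f \<otimes> idm p) \<odot> coev p"
proof -
  let ?S = "symmetrizer p"
  note SS = btensor_in_bhom[OF symm_in_bhom[of p] symm_in_bhom[of p]]
  note fi = btensor_in_bhom[OF f idm_in_bhom[of p]]
  note iS = btensor_in_bhom[OF idm_in_bhom[of p] symm_in_bhom[of p]]
  note Si = btensor_in_bhom[OF symm_in_bhom[of p] idm_in_bhom[of p]]
  have "(?S \<otimes> ?S) \<odot> (f \<otimes> idm p) \<odot> coev p = ((?S \<otimes> ?S) \<odot> (f \<otimes> idm p)) \<odot> coev p"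
    by (rule bcomp_assoc[OF SS fi coev_in_bhom'])
  also have "(?S \<otimes> ?S) \<odot> (f \<otimes> idm p) = f \<otimes> ?S"
    by (simp add: interchange[OF symm_in_bhom f symm_in_bhom idm_in_bhom] Sf bcomp_idm_right[OF symm_in_bhom])
  also have "f \<otimes> ?S = (f \<otimes> idm p) \<odot> (idm p \<otimes> ?S)" by (rule tensor_split_left[OF f symm_in_bhom])
  also have "((f \<otimes> idm p) \<odot> (idm p \<otimes> ?S)) \<odot> coev p = (f \<otimes> idm p) \<odot> (?S \<otimes> idm p) \<odot> coev p"
    by (simp add: symm_coev bcomp_assoc[OF fi iS coev_in_bhom'])
  also have "\<dots> = ((f \<otimes> idm p) \<odot> (?S \<otimes> idm p)) \<odot> coev p"
    by (rule bcomp_assoc[OF fi Si coev_in_bhom'])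
  also have "(f \<otimes> idm p) \<odot> (?S \<otimes> idm p) = f \<otimes> idm p"
    by (simp add: comp_tensor_idm[OF f symm_in_bhom, symmetric] fS)
  finally show ?thesis .
qed

text \<open>The contraction bends the dual leg of the coevaluation back, so \<open>f\<close> is
  applied to \<open>p\<close> of the input strands, up to a reversal that the symmetrizer absorbs.
  The constant is the one in \<open>contr_eq\<close>. Both the Euler operator and the Capelli
  operators are instances.\<close>

theorem act_coev:
  assumes f: "f \<in> bhom p p" and Sf: "symmetrizer p \<odot> f = f" and fS: "f \<odot> symmetrizer p = f"
  shows "act t (Poly_Mapping.single p ((f \<otimes> idm p) \<odot> coev p)) (p + r) =
    (fact (p + r) / fact r) \<bullet>\<^sub>s (symmetrizer (p + r) \<odot> (f \<otimes> idm r) \<odot> symmetrizer (p + r))"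
proof -
  let ?e = "p + r" and ?S = "symmetrizer (p + r)" and ?s = "symmetrizer p" and ?c = "fact (p + r) / fact r :: complex"
  define x where "x = (f \<otimes> idm p) \<odot> coev p"
  have x: "x \<in> bhom 0 (p + p)" unfolding x_def by (rule coev_twist_in_bhom[OF f])
  have e: "evn p \<otimes> idm r \<in> bhom (p + ?e) r"
    by (rule bhom_dim[OF btensor_in_bhom[OF evn_in_bhom' idm_in_bhom]]) simp_all
  have sS: "?s \<otimes> ?S \<in> bhom (p + ?e) (p + ?e)" by (intro btensor_in_bhom symm_in_bhom)
  have ssS: "?s \<otimes> ?s \<otimes> ?S \<in> bhom (p + (p + ?e)) (p + (p + ?e))" by (intro btensor_in_bhom symm_in_bhom)
  have ie: "idm p \<otimes> evn p \<otimes> idm r \<in> bhom (p + (p + ?e)) (p + r)"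
    by (intro btensor_in_bhom idm_in_bhom e)
  have xS: "x \<otimes> ?S \<in> bhom ?e (p + (p + ?e))"
    by (rule bhom_dim[OF btensor_in_bhom[OF x symm_in_bhom]]) simp_all
  have xe: "x \<otimes> idm ?e \<in> bhom ?e (p + (p + ?e))"
    by (rule bhom_dim[OF btensor_in_bhom[OF x idm_in_bhom]]) simp_all
  have iep: "idm p \<otimes> evn p \<in> bhom (p + p + p) p"
    by (rule bhom_dim[OF btensor_in_bhom[OF idm_in_bhom evn_in_bhom']]) simp_all
  have xp: "x \<otimes> idm p \<in> bhom p (p + p + p)"
    by (rule bhom_dim[OF btensor_in_bhom[OF x idm_in_bhom]]) simp_all
  have fr: "f \<otimes> idm r \<in> bhom ?e ?e" by (intro btensor_in_bhom f idm_in_bhom)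
  have rr: "pmor p (rev_perm p) \<otimes> idm r \<in> bhom ?e ?e"
    by (intro btensor_in_bhom idm_in_bhom pmor_in_bhom rev_perm_permutes)
  have fS1: "f \<otimes> idm p \<in> bhom (p + p) (p + p)" by (intro btensor_in_bhom f idm_in_bhom)
  have "?s \<otimes> ((evn p \<otimes> idm r) \<odot> (?s \<otimes> ?S)) = (idm p \<otimes> evn p \<otimes> idm r) \<odot> (?s \<otimes> ?s \<otimes> ?S)"
    by (simp add: interchange[OF idm_in_bhom symm_in_bhom e sS] bcomp_idm_left[OF symm_in_bhom])
  then have "(?s \<otimes> contr t p ?e) \<odot> (x \<otimes> ?S) = ?c \<bullet>\<^sub>s (((idm p \<otimes> evn p \<otimes> idm r) \<odot> (?s \<otimes> ?s \<otimes> ?S)) \<odot> (x \<otimes> ?S))"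
    by (simp only: contr_eq bmor_linear)
  also have "((idm p \<otimes> evn p \<otimes> idm r) \<odot> (?s \<otimes> ?s \<otimes> ?S)) \<odot> (x \<otimes> ?S)
     = (idm p \<otimes> evn p \<otimes> idm r) \<odot> (?s \<otimes> ?s \<otimes> ?S) \<odot> (x \<otimes> ?S)"
    by (rule bcomp_assoc[OF ie ssS xS, symmetric])
  also have "(?s \<otimes> ?s \<otimes> ?S) \<odot> (x \<otimes> ?S) = (x \<otimes> idm ?e) \<odot> ?S"
  proof -
    have "(?s \<otimes> ?s \<otimes> ?S) \<odot> (x \<otimes> ?S) = ((?s \<otimes> ?s) \<odot> x) \<otimes> (?S \<odot> ?S)"
      by (simp add: btensor_assoc[OF symm_in_bhom symm_in_bhom symm_in_bhom, symmetric]
          interchange[OF btensor_in_bhom[OF symm_in_bhom symm_in_bhom] x symm_in_bhom symm_in_bhom])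
    also have "\<dots> = x \<otimes> ?S" unfolding x_def by (simp add: symm_symm_coev[OF assms] symm_symm)
    also have "\<dots> = (x \<otimes> idm ?e) \<odot> ?S"
      using tensor_split_left[OF x symm_in_bhom[of ?e], where t = t] by simp
    finally show ?thesis .
  qed
  also have "(idm p \<otimes> evn p \<otimes> idm r) \<odot> (x \<otimes> idm ?e) \<odot> ?S = ((idm p \<otimes> evn p \<otimes> idm r) \<odot> (x \<otimes> idm ?e)) \<odot> ?S"
    by (rule bcomp_assoc[OF ie xe symm_in_bhom])
  also have "(idm p \<otimes> evn p \<otimes> idm r) \<odot> (x \<otimes> idm ?e) = ((idm p \<otimes> evn p) \<odot> (x \<otimes> idm p)) \<otimes> idm r"
    by (simp add: comp_tensor_idm[OF iep xp] tensor_idm_assoc[OF x] btensor_assoc[OF idm_in_bhom evn_in_bhom' idm_in_bhom])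
  \<comment> \<open>Sliding \<open>f\<close> past the caps exposes a bare zigzag.\<close>
  also have "(idm p \<otimes> evn p) \<odot> (x \<otimes> idm p) = f \<odot> pmor p (rev_perm p)"
  proof -
    have f2: "f \<otimes> idm (p + p) \<in> bhom (p + p + p) (p + p + p)"
      by (rule bhom_dim[OF btensor_in_bhom[OF f idm_in_bhom]]) simp_all
    have ci: "coev p \<otimes> idm p \<in> bhom p (p + p + p)"
      by (rule bhom_dim[OF btensor_in_bhom[OF coev_in_bhom' idm_in_bhom]]) simp_all
    have "x \<otimes> idm p = (f \<otimes> idm (p + p)) \<odot> (coev p \<otimes> idm p)"
      unfolding x_def by (simp add: comp_tensor_idm[OF fS1 coev_in_bhom'] tensor_idm_assoc[OF f])
    then have "(idm p \<otimes> evn p) \<odot> (x \<otimes> idm p) = ((idm p \<otimes> evn p) \<odot> (f \<otimes> idm (p + p))) \<odot> (coev p \<otimes> idm p)"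
      by (simp add: bcomp_assoc[OF iep f2 ci])
    also have "(idm p \<otimes> evn p) \<odot> (f \<otimes> idm (p + p)) = f \<odot> (idm p \<otimes> evn p)"
      using tensor_split_right[OF f evn_in_bhom', where t = t] tensor_split_left[OF f evn_in_bhom', where t = t] by simp
    also have "(f \<odot> (idm p \<otimes> evn p)) \<odot> (coev p \<otimes> idm p) = f \<odot> (idm p \<otimes> evn p) \<odot> (coev p \<otimes> idm p)"
      by (rule bcomp_assoc[OF f iep ci, symmetric])
    finally show ?thesis by (simp add: zigzag_right)
  qed
  also have "((f \<odot> pmor p (rev_perm p)) \<otimes> idm r) \<odot> ?S = (f \<otimes> idm r) \<odot> ?S"
  proof -
    have "((f \<odot> pmor p (rev_perm p)) \<otimes> idm r) \<odot> ?S = ((f \<otimes> idm r) \<odot> (pmor p (rev_perm p) \<otimes> idm r)) \<odot> ?S"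
      by (simp only: comp_tensor_idm[OF f pmor_in_bhom[OF rev_perm_permutes]])
    also have "\<dots> = (f \<otimes> idm r) \<odot> (pmor p (rev_perm p) \<otimes> idm r) \<odot> ?S"
      by (rule bcomp_assoc[OF fr rr symm_in_bhom, symmetric])
    also have "(pmor p (rev_perm p) \<otimes> idm r) \<odot> ?S = ?S"
      unfolding idm_pmor by (rule symm_pmor_tensor(2)[OF rev_perm_permutes permutes_id])
    finally show ?thesis .
  qed
  finally have "(?s \<otimes> contr t p ?e) \<odot> (x \<otimes> ?S) = ?c \<bullet>\<^sub>s ((f \<otimes> idm r) \<odot> ?S)" .
  then show ?thesis
    unfolding act_single x_def[symmetric] by (simp add: mulP_eq bmor_linear)
qed

lemma act_single_gt: "d < p \<Longrightarrow> act t (Poly_Mapping.single p x) d = 0"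
  by (simp add: act_single contr_gt bmor_linear)

lemma act_euler: "act t euler d = of_nat d \<bullet>\<^sub>s symmetrizer d"
proof (cases d)
  case 0
  then show ?thesis by (simp add: euler_def act_single_gt)
next
  case (Suc r)
  have "coev 1 = (idm 1 \<otimes> idm 1) \<odot> coev 1"
    using bcomp_idm_left[OF coev_in_bhom'[of 1]] by (simp add: btensor_idm_idm)
  then have "act t euler (1 + r) = (fact (1 + r) / fact r) \<bullet>\<^sub>s (symmetrizer (1 + r) \<odot> (idm 1 \<otimes> idm r) \<odot> symmetrizer (1 + r))"
    using act_coev[OF idm_in_bhom[of 1], of r] bcomp_idm_left[OF idm_in_bhom[of 1]]
    by (simp add: euler_def symmetrizer_1)
  then show ?thesis
    using Suc by (simp add: btensor_idm_idm bcomp_idm_left[OF symm_in_bhom] symm_symm)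
qed

text \<open>The copy of \<open>f\<close> on the dual leg is moved across the coevaluation and merges
  with the other copy, because \<open>f\<close> is idempotent.\<close>

lemma kcoev_eq:
  assumes f: "f \<in> bhom d d" and "f \<odot> f = f"
  shows "kcoev t (d, f) = (f \<otimes> idm d) \<odot> coev d"
proof -
  note ff = btensor_in_bhom[OF f idm_in_bhom[of d]] and fb = btensor_in_bhom[OF idm_in_bhom[of d] bflip_in_bhom[OF f]]
  have "kcoev t (d, f) = ((f \<otimes> idm d) \<odot> (idm d \<otimes> bflip f)) \<odot> coev d"
    by (simp add: kcoev_def tensor_split_left[OF f bflip_in_bhom[OF f], where t = t])
  also have "\<dots> = (f \<otimes> idm d) \<odot> (f \<otimes> idm d) \<odot> coev d"
    by (simp add: slide_coev[OF f] bcomp_assoc[OF ff fb coev_in_bhom'])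
  also have "\<dots> = ((f \<otimes> idm d) \<odot> (f \<otimes> idm d)) \<odot> coev d"
    by (rule bcomp_assoc[OF ff ff coev_in_bhom'])
  finally show ?thesis by (simp add: comp_tensor_idm[OF f f, symmetric] assms)
qed

text \<open>The factor d! is the constant of \<open>contr_eq\<close> with nothing left uncontracted;
  the remaining diagram is a zigzag between symmetrizers. It is the origin of the factor 1/d! in
  \<open>capelli_eq\<close>.\<close>

lemma dual_iso_eq: "dual_iso t d = fact d \<bullet>\<^sub>s symmetrizer d"
proof -
  let ?S = "symmetrizer d"
  have SSS: "(?S \<otimes> ?S) \<otimes> ?S \<in> bhom (d + d + d) (d + d + d)" by (intro btensor_in_bhom symm_in_bhom)
  have ei: "evn d \<otimes> idm d \<in> bhom (d + d + d) d"
    using btensor_in_bhom[OF evn_in_bhom' idm_in_bhom] by simp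
  have ic: "idm d \<otimes> coev d \<in> bhom d (d + d + d)"
    by (rule bhom_dim[OF btensor_in_bhom[OF idm_in_bhom coev_in_bhom']]) simp_all
  have iiS: "idm (d + d) \<otimes> ?S \<in> bhom (d + d + d) (d + d + d)" by (intro btensor_in_bhom symm_in_bhom idm_in_bhom)
  define k where "k = (?S \<otimes> idm d) \<odot> coev d"
  have k: "k \<in> bhom 0 (d + d)" unfolding k_def by (rule coev_twist_in_bhom[OF symm_in_bhom])
  have Sk: "(?S \<otimes> ?S) \<odot> k = k"
    unfolding k_def by (rule symm_symm_coev[OF symm_in_bhom symm_symm symm_symm])
  have Skh: "?S \<otimes> k \<in> bhom d (d + d + d)"
    by (rule bhom_dim[OF btensor_in_bhom[OF symm_in_bhom k]]) simp_all
  have "contr t d d = fact d \<bullet>\<^sub>s (evn d \<odot> (?S \<otimes> ?S))"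
    using contr_eq[of t d 0] by simp
  then have "dual_iso t d = fact d \<bullet>\<^sub>s (((evn d \<odot> (?S \<otimes> ?S)) \<otimes> ?S) \<odot> (?S \<otimes> k))"
    by (simp add: dual_iso_def kdual_def symP_def bflip_symm kcoev_eq[OF symm_in_bhom symm_symm] k_def bmor_linear)
  also have "(evn d \<odot> (?S \<otimes> ?S)) \<otimes> ?S = (evn d \<otimes> idm d) \<odot> ((?S \<otimes> ?S) \<otimes> ?S)"
    by (simp add: interchange[OF evn_in_bhom' btensor_in_bhom[OF symm_in_bhom symm_in_bhom] idm_in_bhom symm_in_bhom] bcomp_idm_left[OF symm_in_bhom])
  also have "((evn d \<otimes> idm d) \<odot> ((?S \<otimes> ?S) \<otimes> ?S)) \<odot> (?S \<otimes> k) = (evn d \<otimes> idm d) \<odot> ((?S \<otimes> ?S) \<otimes> ?S) \<odot> (?S \<otimes> k)"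
    by (rule bcomp_assoc[OF ei SSS Skh, symmetric])
  also have "((?S \<otimes> ?S) \<otimes> ?S) \<odot> (?S \<otimes> k) = ?S \<otimes> k"
    by (simp only: btensor_assoc[OF symm_in_bhom symm_in_bhom symm_in_bhom]
        interchange[OF symm_in_bhom symm_in_bhom btensor_in_bhom[OF symm_in_bhom symm_in_bhom] k] symm_symm Sk)
  also have "?S \<otimes> k = (idm d \<otimes> k) \<odot> ?S"
    using tensor_split_right[OF symm_in_bhom k, where t = t] by simp
  also have "idm d \<otimes> k = (idm (d + d) \<otimes> ?S) \<odot> (idm d \<otimes> coev d)"
    unfolding k_def symm_coev
    by (simp add: idm_tensor_comp[OF btensor_in_bhom[OF idm_in_bhom symm_in_bhom] coev_in_bhom'] idm_tensor_assoc[OF symm_in_bhom])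
  also have "(evn d \<otimes> idm d) \<odot> ((idm (d + d) \<otimes> ?S) \<odot> (idm d \<otimes> coev d)) \<odot> ?S
     = ((evn d \<otimes> idm d) \<odot> (idm (d + d) \<otimes> ?S)) \<odot> (idm d \<otimes> coev d) \<odot> ?S"
    using bcomp_assoc[OF iiS ic symm_in_bhom, of t] bcomp_assoc[OF ei iiS bcomp_in_bhom[OF ic symm_in_bhom, of t], of t]
    by simp
  also have "(evn d \<otimes> idm d) \<odot> (idm (d + d) \<otimes> ?S) = ?S \<odot> (evn d \<otimes> idm d)"
    using tensor_split_left[OF evn_in_bhom' symm_in_bhom, where t = t] tensor_split_right[OF evn_in_bhom' symm_in_bhom, where t = t]
    by simp
  also have "(?S \<odot> (evn d \<otimes> idm d)) \<odot> (idm d \<otimes> coev d) \<odot> ?S = ?S \<odot> ((evn d \<otimes> idm d) \<odot> (idm d \<otimes> coev d)) \<odot> ?S"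
    using bcomp_assoc[OF ei ic symm_in_bhom, of t] bcomp_assoc[OF symm_in_bhom ei bcomp_in_bhom[OF ic symm_in_bhom, of t], of t]
    by simp
  finally show ?thesis by (simp add: zigzag_left pmor_symm[OF rev_perm_permutes] symm_symm)
qed

text \<open>The cup-cap generator of the Brauer algebra on two strands.\<close>

definition cupcap :: bmor where
  "cupcap = coev 1 \<odot> ev"

lemma cupcap_in_bhom: "cupcap \<in> bhom 2 2"
  unfolding cupcap_def by (rule bhom_dim[OF bcomp_in_bhom[OF coev_in_bhom' ev_in_bhom]]) simp_all

lemma Delta_eq: "Delta t (2 + r) =
  (1 / 2 * (fact (2 + r) / fact r)) \<bullet>\<^sub>s ((ev \<otimes> idm r) \<odot> symmetrizer (2 + r))"
proof -
  let ?e = "2 + r" and ?S = "symmetrizer (2 + r)" and ?s = "symmetrizer 2"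
  have c: "coev 1 \<in> bhom 0 2" using coev_in_bhom[of 1] by simp
  have e2: "evn 2 \<in> bhom 4 0" using evn_in_bhom[of 2] by simp
  have e: "evn 2 \<otimes> idm r \<in> bhom (2 + ?e) r"
    by (rule bhom_dim[OF btensor_in_bhom[OF e2 idm_in_bhom]]) simp_all
  have sS: "?s \<otimes> ?S \<in> bhom (2 + ?e) (2 + ?e)" by (intro btensor_in_bhom symm_in_bhom)
  have cS: "coev 1 \<otimes> ?S \<in> bhom ?e (2 + ?e)"
    by (rule bhom_dim[OF btensor_in_bhom[OF c symm_in_bhom]]) simp_all
  have ce: "coev 1 \<otimes> idm ?e \<in> bhom ?e (2 + ?e)"
    by (rule bhom_dim[OF btensor_in_bhom[OF c idm_in_bhom]]) simp_all
  have c2: "coev 1 \<otimes> idm 2 \<in> bhom 2 4"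
    by (rule bhom_dim[OF btensor_in_bhom[OF c idm_in_bhom]]) simp_all
  have "((evn 2 \<otimes> idm r) \<odot> (?s \<otimes> ?S)) \<odot> (coev 1 \<otimes> ?S) = (evn 2 \<otimes> idm r) \<odot> (?s \<otimes> ?S) \<odot> (coev 1 \<otimes> ?S)"
    by (rule bcomp_assoc[OF e sS cS, symmetric])
  also have "(?s \<otimes> ?S) \<odot> (coev 1 \<otimes> ?S) = (coev 1 \<otimes> idm ?e) \<odot> ?S"
  proof -
    have "(?s \<otimes> ?S) \<odot> (coev 1 \<otimes> ?S) = coev 1 \<otimes> ?S"
      by (simp only: interchange[OF symm_in_bhom c symm_in_bhom symm_in_bhom] symm_2_coev symm_symm)
    also have "\<dots> = (coev 1 \<otimes> idm ?e) \<odot> ?S"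
      using tensor_split_left[OF c symm_in_bhom[of ?e], where t = t] by (simp only: btensor_idm_0_left)
    finally show ?thesis .
  qed
  also have "(evn 2 \<otimes> idm r) \<odot> (coev 1 \<otimes> idm ?e) \<odot> ?S = ((evn 2 \<otimes> idm r) \<odot> (coev 1 \<otimes> idm ?e)) \<odot> ?S"
    by (rule bcomp_assoc[OF e ce symm_in_bhom])
  also have "(evn 2 \<otimes> idm r) \<odot> (coev 1 \<otimes> idm ?e) = ev \<otimes> idm r"
    using comp_tensor_idm[OF e2 c2, of t r] tensor_idm_assoc[OF c, of 2 r] by (simp only: evn_2_coev)
  finally show ?thesis
    unfolding Delta_def by (simp only: contr_eq bmor_linear bmor.scale_scale)
qed

lemma Theta_eq: "Theta t r = (1 / 2) \<bullet>\<^sub>s (symmetrizer (2 + r) \<odot> (coev 1 \<otimes> symmetrizer r))"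
  by (simp only: Theta_def mulP_eq)

text \<open>The two factors 1/2 give 1/4, and (2 + r)! / r! is the number of ordered pairs of
  strands; \<open>cap_W\<close> interprets the symmetrized cup-cap as an average over these
  pairs.\<close>

lemma Theta_Delta: "Theta t r \<odot> Delta t (2 + r) =
  (1 / 4 * (fact (2 + r) / fact r)) \<bullet>\<^sub>s (symmetrizer (2 + r) \<odot> (cupcap \<otimes> idm r) \<odot> symmetrizer (2 + r))"
proof -
  let ?S = "symmetrizer (2 + r)" and ?s = "symmetrizer r"
  have c: "coev 1 \<in> bhom 0 2" using coev_in_bhom[of 1] by simp
  have cs: "coev 1 \<otimes> ?s \<in> bhom r (2 + r)"
    by (rule bhom_dim[OF btensor_in_bhom[OF c symm_in_bhom]]) simp_all
  have er: "ev \<otimes> idm r \<in> bhom (2 + r) r"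
    by (rule bhom_dim[OF btensor_in_bhom[OF ev_in_bhom idm_in_bhom]]) simp_all
  have kr: "cupcap \<otimes> idm r \<in> bhom (2 + r) (2 + r)" by (intro btensor_in_bhom cupcap_in_bhom idm_in_bhom)
  have isx: "idm 2 \<otimes> ?s \<in> bhom (2 + r) (2 + r)" by (intro btensor_in_bhom symm_in_bhom idm_in_bhom)
  have "(?S \<odot> (coev 1 \<otimes> ?s)) \<odot> (ev \<otimes> idm r) \<odot> ?S = ?S \<odot> (coev 1 \<otimes> ?s) \<odot> (ev \<otimes> idm r) \<odot> ?S"
    by (rule bcomp_assoc[OF symm_in_bhom cs bcomp_in_bhom[OF er symm_in_bhom], symmetric])
  also have "(coev 1 \<otimes> ?s) \<odot> (ev \<otimes> idm r) \<odot> ?S = ((coev 1 \<otimes> ?s) \<odot> (ev \<otimes> idm r)) \<odot> ?S"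
    by (rule bcomp_assoc[OF cs er symm_in_bhom])
  also have "(coev 1 \<otimes> ?s) \<odot> (ev \<otimes> idm r) = cupcap \<otimes> ?s"
    by (simp only: interchange[OF c ev_in_bhom symm_in_bhom idm_in_bhom] cupcap_def bcomp_idm_right[OF symm_in_bhom])
  also have "cupcap \<otimes> ?s = (cupcap \<otimes> idm r) \<odot> (idm 2 \<otimes> ?s)"
    by (rule tensor_split_left[OF cupcap_in_bhom symm_in_bhom])
  also have "((cupcap \<otimes> idm r) \<odot> (idm 2 \<otimes> ?s)) \<odot> ?S = (cupcap \<otimes> idm r) \<odot> (idm 2 \<otimes> ?s) \<odot> ?S"
    by (rule bcomp_assoc[OF kr isx symm_in_bhom, symmetric])
  also have "(idm 2 \<otimes> ?s) \<odot> ?S = ?S" by (rule symm_idm_tensor)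
  finally show ?thesis
    unfolding Theta_eq Delta_eq by (simp only: bmor_linear bmor.scale_scale) (simp add: field_simps)
qed

text \<open>\<open>U d\<close> is the restriction of \<open>\<Theta>\<Delta>\<close> to \<open>P\<^sup>d\<close>.\<close>
definition U :: "nat \<Rightarrow> bmor" where
  "U d = Theta t (d - 2) \<odot> Delta t d"

text \<open>Settles the degrees in which \<open>d - 2\<close> is truncated: there
  \<open>Delta\<close> already vanishes.\<close>

lemma U_less_2: "d < 2 \<Longrightarrow> U d = 0"
  by (simp add: U_def Delta_def contr_gt bmor_linear)

text \<open>The Euler operator is the scalar \<open>d\<close> on degree \<open>d\<close>, so the
  Casimir operator is an affine function of \<open>U t d\<close> and only the latter has to be
  understood.\<close>

lemma casimir_eq: "casimir t d = (of_nat d * (of_nat d + t - 2)) \<bullet>\<^sub>s symmetrizer d - 4 \<bullet>\<^sub>s U d"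
proof -
  have "casimir t d = (of_nat d * of_nat d) \<bullet>\<^sub>s symmetrizer d + (t * of_nat d) \<bullet>\<^sub>s symmetrizer d
     - 4 \<bullet>\<^sub>s U d - (2 * of_nat d) \<bullet>\<^sub>s symmetrizer d"
    by (simp add: casimir_def act_euler bmor_linear symm_symm U_def)
  moreover have "of_nat d * (of_nat d + t - 2) = of_nat d * of_nat d + t * of_nat d - 2 * of_nat d"
    by (simp add: algebra_simps)
  ultimately show ?thesis
    by (simp only: bmor.scale_left_distrib bmor.scale_left_diff_distrib) (simp add: algebra_simps)
qed

end

declare One_nat_def [simp] plus_1_eq_Suc [simp del]

section \<open>Double cosets of diagrams\<close>

text \<open>The two-sided action of the symmetric groups: \<open>\<pi>\<close> is postcomposed and
  the inverse of \<open>\<sigma>\<close> is precomposed.\<close>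

definition relabel :: "(nat \<Rightarrow> nat) \<Rightarrow> (nat \<Rightarrow> nat) \<Rightarrow> diagram \<Rightarrow> diagram" where
  "relabel \<sigma> \<pi> D = (\<lambda>b. (\<lambda>x. (fst x, (if fst x = 0 then \<sigma> else \<pi>) (snd x))) ` b) ` D"

text \<open>A diagram from \<open>d\<close> to \<open>d\<close> has as many caps as cups, so this
  single number is a complete invariant of its double coset.\<close>

definition cups :: "diagram \<Rightarrow> nat" where
  "cups D = card {b \<in> D. b \<subseteq> {1} \<times> UNIV}"

lemma sat_relabel: "sat (relabel \<sigma> \<pi> D) A B \<longleftrightarrow> sat D (\<sigma> -` A) (\<pi> -` B)"
proof -
  have "(fst x, (if fst x = 0 then \<sigma> else \<pi>) (snd x)) \<in> {0} \<times> A \<union> {1} \<times> B \<longleftrightarrow>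
      x \<in> {0} \<times> \<sigma> -` A \<union> {1} \<times> \<pi> -` B" for x :: "nat \<times> nat"
    by (cases x) auto
  then show ?thesis unfolding relabel_def sat_def monochr_def by (simp only: ball_simps(9))
qed

lemma relabel:
  assumes D: "D \<in> diagrams m n" and \<sigma>: "\<sigma> permutes {..<m}" and \<pi>: "\<pi> permutes {..<n}"
  shows "relabel \<sigma> \<pi> D \<in> diagrams m n" "cups (relabel \<sigma> \<pi> D) = cups D"
proof -
  define f where "f = (\<lambda>x. (fst x, (if fst x = 0 then \<sigma> else \<pi>) (snd x)) :: nat \<times> nat)"
  have R: "relabel \<sigma> \<pi> D = (\<lambda>b. f ` b) ` D" by (simp add: relabel_def f_def)
  have inj: "inj f"
  proof (rule injI)
    fix x y assume xy: "f x = f y"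
    then have 1: "fst x = fst y" by (simp add: f_def)
    have "(if fst x = 0 then \<sigma> else \<pi>) (snd x) = (if fst x = 0 then \<sigma> else \<pi>) (snd y)"
      using arg_cong[OF xy, of snd] unfolding f_def snd_conv 1 .
    moreover have "inj (if fst x = 0 then \<sigma> else \<pi>)" using permutes_inj[OF \<sigma>] permutes_inj[OF \<pi>] by simp
    ultimately have "snd x = snd y" by (rule injD[rotated])
    with 1 show "x = y" by (rule prod_eqI)
  qed
  show "relabel \<sigma> \<pi> D \<in> diagrams m n" unfolding R
  proof (rule diagramsI)
    have f1: "f ` ({0} \<times> X) = {0} \<times> \<sigma> ` X" for X
    proof (intro equalityI subsetI)
      fix x assume "x \<in> {0::nat} \<times> \<sigma> ` X"
      then obtain i where "x = (0, \<sigma> i)" "i \<in> X" by blast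
      then show "x \<in> f ` ({0} \<times> X)" by (intro image_eqI[of _ _ "(0, i)"]) (auto simp: f_def)
    qed (auto simp: f_def)
    have f2: "f ` ({1} \<times> X) = {1} \<times> \<pi> ` X" for X
    proof (intro equalityI subsetI)
      fix x assume "x \<in> {1::nat} \<times> \<pi> ` X"
      then obtain i where "x = (1, \<pi> i)" "i \<in> X" by blast
      then show "x \<in> f ` ({1} \<times> X)" by (intro image_eqI[of _ _ "(1, i)"]) (auto simp: f_def)
    qed (auto simp: f_def)
    have "\<Union>((\<lambda>b. f ` b) ` D) = f ` \<Union>D" by auto
    then show "\<Union>((\<lambda>b. f ` b) ` D) = {0} \<times> {..<m} \<union> {1} \<times> {..<n}"
      unfolding diagramsD(1)[OF D] image_Un f1 f2 permutes_image[OF \<sigma>] permutes_image[OF \<pi>] .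
    show "card b = 2" if "b \<in> (\<lambda>b. f ` b) ` D" for b
      using that diagramsD(2)[OF D] inj by (auto simp: card_image inj_on_subset)
    show "b = b'" if b: "b \<in> (\<lambda>b. f ` b) ` D" "b' \<in> (\<lambda>b. f ` b) ` D" "x \<in> b" "x \<in> b'" for b b' x
    proof -
      obtain e where e: "b = f ` e" "e \<in> D" using b(1) by (rule imageE)
      obtain e' where e': "b' = f ` e'" "e' \<in> D" using b(2) by (rule imageE)
      obtain y where y: "x = f y" "y \<in> e" using b(3) unfolding e by (rule imageE)
      obtain y' where y': "x = f y'" "y' \<in> e'" using b(4) unfolding e' by (rule imageE)
      have "y = y'" using y(1) y'(1) injD[OF inj] by simp
      then show ?thesis using diagramsD(3)[OF D e(2) e'(2) y(2)] y' e e' by simp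
    qed
  qed
  have "S \<subseteq> {1} \<times> UNIV \<longleftrightarrow> (\<forall>x\<in>S. fst x = 1)" for S :: "(nat \<times> nat) set"
    by (simp add: subset_iff mem_Times_iff Ball_def)
  then have "f ` b \<subseteq> {1} \<times> UNIV \<longleftrightarrow> b \<subseteq> {1} \<times> UNIV" for b
    by (simp add: f_def)
  then have "{b \<in> (\<lambda>b. f ` b) ` D. b \<subseteq> {1} \<times> UNIV} = (\<lambda>b. f ` b) ` {b \<in> D. b \<subseteq> {1} \<times> UNIV}"
    by auto
  moreover have "inj_on (\<lambda>b. f ` b) {b \<in> D. b \<subseteq> {1} \<times> UNIV}"
    using inj by (auto simp: inj_on_def inj_image_eq_iff)
  ultimately show "cups (relabel \<sigma> \<pi> D) = cups D"
    unfolding R cups_def by (simp add: card_image)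
qed

lemma dcomp_perm_left_relabel:
  assumes D: "D \<in> diagrams m n" and \<pi>: "\<pi> permutes {..<n}"
  shows "dcomp (perm_diagram n \<pi>) D = relabel id \<pi> D" "loops (perm_diagram n \<pi>) D = 0"
proof -
  have s: "sat (relabel id \<pi> D) A C \<longleftrightarrow> sat D A (\<pi> -` C)" for A C by (simp add: sat_relabel)
  show "dcomp (perm_diagram n \<pi>) D = relabel id \<pi> D" "loops (perm_diagram n \<pi>) D = 0"
    using dcomp_perm_left[OF D \<pi> relabel(1)[OF D permutes_id \<pi>] s] by auto
qed

lemma dcomp_perm_right_relabel:
  assumes D: "D \<in> diagrams m n" and \<pi>: "\<pi> permutes {..<m}"
  shows "dcomp D (perm_diagram m \<pi>) = relabel (inv \<pi>) id D" "loops D (perm_diagram m \<pi>) = 0"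
proof -
  have "inv \<pi> -` A = \<pi> ` A" for A
    using bij_vimage_eq_inv_image[OF bij_imp_bij_inv[OF permutes_bij[OF \<pi>]]]
    by (simp add: inv_inv_eq[OF permutes_bij[OF \<pi>]])
  then show "dcomp D (perm_diagram m \<pi>) = relabel (inv \<pi>) id D" "loops D (perm_diagram m \<pi>) = 0"
    using dcomp_perm_right[OF D \<pi> relabel(1)[OF D permutes_inv[OF \<pi>] permutes_id]]
    by (simp_all add: sat_relabel)
qed

text \<open>Bijections are chosen fibre by fibre. The lemma serves twice: to match blocks by their
  number of source points, and to match the points inside matched blocks by layer.\<close>

lemma bij_betw_fibres:
  assumes "finite A" "finite B" "\<And>v. card {a \<in> A. f a = v} = card {b \<in> B. g b = v}"
  shows "\<exists>h. bij_betw h A B \<and> (\<forall>a\<in>A. g (h a) = f a)"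
proof -
  have "\<exists>h. bij_betw h {a \<in> A. f a = v} {b \<in> B. g b = v}" for v
    using assms by (intro finite_same_card_bij) auto
  then obtain h where h: "\<And>v. bij_betw (h v) {a \<in> A. f a = v} {b \<in> B. g b = v}" by metis
  have mem: "h (f a) a \<in> {b \<in> B. g b = f a}" if "a \<in> A" for a
    using bij_betwE[OF h[of "f a"]] that by auto
  have "bij_betw (\<lambda>a. h (f a) a) A B" unfolding bij_betw_def
  proof
    show "inj_on (\<lambda>a. h (f a) a) A"
    proof (rule inj_onI)
      fix x y assume xy: "x \<in> A" "y \<in> A" "h (f x) x = h (f y) y"
      have "f x = f y" using mem[OF xy(1)] mem[OF xy(2)] xy(3) by simp
      then show "x = y" using xy bij_betw_imp_inj_on[OF h[of "f x"]] by (auto dest: inj_onD)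
    qed
    show "(\<lambda>a. h (f a) a) ` A = B"
    proof (intro equalityI subsetI)
      fix b assume b: "b \<in> B"
      then have "b \<in> h (g b) ` {a \<in> A. f a = g b}"
        using bij_betw_imp_surj_on[OF h[of "g b"]] by simp
      then obtain x where x: "x \<in> A" "f x = g b" "b = h (g b) x" by blast
      show "b \<in> (\<lambda>a. h (f a) a) ` A" using x(3)[folded x(2)] x(1) by (rule image_eqI)
    qed (use mem in auto)
  qed
  then show ?thesis using mem by (intro exI[of _ "\<lambda>a. h (f a) a"]) auto
qed

lemma card_fst_block:
  assumes D: "D \<in> diagrams m n" and b: "b \<in> D"
  shows "card {x \<in> b. fst x = 0} + card {x \<in> b. fst x = 1} = 2"
    "\<And>v. v \<noteq> 0 \<Longrightarrow> v \<noteq> 1 \<Longrightarrow> {x \<in> b. fst x = v} = {}"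
proof -
  have f: "finite b" using diagramsD(5)[OF D b] .
  have l: "fst x = 0 \<or> fst x = 1" if "x \<in> b" for x
  proof -
    have "x \<in> \<Union>D" using that b by blast
    then show ?thesis unfolding diagramsD(1)[OF D] by auto
  qed
  have "b = {x \<in> b. fst x = 0} \<union> {x \<in> b. fst x = 1}" using l by auto
  then have "card b = card ({x \<in> b. fst x = 0} \<union> {x \<in> b. fst x = 1})" by simp
  also have "\<dots> = card {x \<in> b. fst x = 0} + card {x \<in> b. fst x = 1}"
    using f by (intro card_Un_disjoint) auto
  finally show "card {x \<in> b. fst x = 0} + card {x \<in> b. fst x = 1} = 2"
    using diagramsD(2)[OF D b] by simp
  show "{x \<in> b. fst x = v} = {}" if v: "v \<noteq> 0" "v \<noteq> 1" for v
  proof (rule equals0I)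
    fix x assume "x \<in> {x \<in> b. fst x = v}"
    then show False using l[of x] v by auto
  qed
qed

text \<open>A block has 0, 1 or 2 points in the source layer and the others in the target layer.
  Counting the \<open>d\<close> points of each layer forces equally many caps and cups.\<close>

lemma card_blocks:
  assumes D: "D \<in> diagrams d d"
  shows "card {b \<in> D. card {x \<in> b. fst x = 0} = 0} = cups D"
    "card {b \<in> D. card {x \<in> b. fst x = 0} = 1} + 2 * cups D = d"
    "card {b \<in> D. card {x \<in> b. fst x = 0} = 2} = cups D"
proof -
  define T where "T v = {b \<in> D. card {x \<in> b. fst x = 0} = v}" for v
  have fD: "finite D" by (rule diagramsD(4)[OF D])
  have fb: "finite b" if "b \<in> D" for b using diagramsD(5)[OF D that] .
  have split: "D = T 0 \<union> T 1 \<union> T 2"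
    using card_fst_block(1)[OF D] unfolding T_def by fastforce
  have sumT: "(\<Sum>b\<in>D. F b) = (\<Sum>b\<in>T 0. F b) + (\<Sum>b\<in>T 1. F b) + (\<Sum>b\<in>T 2. F b)" for F :: "_ \<Rightarrow> nat"
  proof -
    have fT: "finite (T v)" for v using fD by (simp add: T_def)
    have "(\<Sum>b\<in>T 0 \<union> T 1 \<union> T 2. F b) = (\<Sum>b\<in>T 0 \<union> T 1. F b) + (\<Sum>b\<in>T 2. F b)"
      by (rule sum.union_disjoint) (use fT in \<open>auto simp: T_def\<close>)
    also have "(\<Sum>b\<in>T 0 \<union> T 1. F b) = (\<Sum>b\<in>T 0. F b) + (\<Sum>b\<in>T 1. F b)"
      by (rule sum.union_disjoint) (use fT in \<open>auto simp: T_def\<close>)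
    finally show ?thesis using split by simp
  qed
  have layer: "(\<Sum>b\<in>D. card {x \<in> b. fst x = v}) = d" if v: "v = 0 \<or> v = 1" for v
  proof -
    have "(\<Sum>b\<in>D. card {x \<in> b. fst x = v}) = card (\<Union>b\<in>D. {x \<in> b. fst x = v})"
    proof (rule card_UN_disjoint[symmetric])
      show "\<forall>i\<in>D. \<forall>j\<in>D. i \<noteq> j \<longrightarrow> {x \<in> i. fst x = v} \<inter> {x \<in> j. fst x = v} = {}"
        using diagramsD(3)[OF D] by blast
    qed (use fD fb in auto)
    also have "(\<Union>b\<in>D. {x \<in> b. fst x = v}) = {x \<in> \<Union>D. fst x = v}" by auto
    also have "\<dots> = {v} \<times> {..<d}" unfolding diagramsD(1)[OF D] using v by auto
    finally show ?thesis by simp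
  qed
  have c1: "card {x \<in> b. fst x = 1} = 2 - v" if "b \<in> T v" for b v
    using card_fst_block(1)[OF D, of b] that unfolding T_def by auto
  have "(\<Sum>b\<in>D. card {x \<in> b. fst x = 0}) = card (T 1) + 2 * card (T 2)"
    unfolding sumT by (simp add: T_def)
  moreover have "(\<Sum>b\<in>D. card {x \<in> b. fst x = 1}) = 2 * card (T 0) + card (T 1)"
  proof -
    have "(\<Sum>b\<in>T v. card {x \<in> b. fst x = 1}) = (\<Sum>b\<in>T v. 2 - v)" for v
      by (rule sum.cong[OF refl c1])
    then show ?thesis unfolding sumT by simp
  qed
  ultimately have c: "card (T 1) + 2 * card (T 2) = d" "2 * card (T 0) + card (T 1) = d"
    using layer by auto
  have "T 0 = {b \<in> D. b \<subseteq> {1} \<times> UNIV}"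
  proof -
    have "card {x \<in> b. fst x = 0} = 0 \<longleftrightarrow> b \<subseteq> {1} \<times> UNIV" if b: "b \<in> D" for b
    proof -
      have "fst x = 0 \<or> fst x = 1" if "x \<in> b" for x
        using card_fst_block(2)[OF D b, of "fst x"] that by blast
      then have "{x \<in> b. fst x = 0} = {} \<longleftrightarrow> (\<forall>x\<in>b. fst x = 1)" by fastforce
      moreover have "b \<subseteq> {1} \<times> UNIV \<longleftrightarrow> (\<forall>x\<in>b. fst x = 1)" by force
      ultimately show ?thesis using fb[OF b] by simp
    qed
    then show ?thesis unfolding T_def by blast
  qed
  then have t0: "card (T 0) = cups D" by (simp add: cups_def)
  show "card {b \<in> D. card {x \<in> b. fst x = 0} = 0} = cups D" using t0 by (simp add: T_def)
  show "card {b \<in> D. card {x \<in> b. fst x = 0} = 1} + 2 * cups D = d"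
    using c(2) t0 unfolding T_def by simp
  show "card {b \<in> D. card {x \<in> b. fst x = 0} = 2} = cups D"
    using c t0 unfolding T_def by simp
qed

text \<open>Blocks are matched with blocks of the same type and then points with points of the same
  layer. The resulting bijection of points preserves layers, so it is a pair of
  permutations.\<close>

theorem same_cups_relabel:
  assumes D: "D \<in> diagrams d d" and D': "D' \<in> diagrams d d" and eq: "cups D = cups D'"
  shows "\<exists>\<sigma> \<pi>. \<sigma> permutes {..<d} \<and> \<pi> permutes {..<d} \<and> D' = relabel \<sigma> \<pi> D"
proof -
  have "card {b \<in> D. card {x \<in> b. fst x = 0} = v} = card {b \<in> D'. card {x \<in> b. fst x = 0} = v}" for v
  proof -
    have "{b \<in> X. card {x \<in> b. fst x = 0} = v} = {}" if X: "X \<in> diagrams d d" and v: "v > 2" for X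
    proof -
      have "card {x \<in> b. fst x = 0} \<le> 2" if "b \<in> X" for b
        using card_fst_block(1)[OF X that] by linarith
      then show ?thesis using v by fastforce
    qed
    note big = this
    consider "v = 0" | "v = 1" | "v = 2" | "v > 2" by linarith
    then show ?thesis
    proof cases
      case 2
      then show ?thesis using card_blocks(2)[OF D] card_blocks(2)[OF D'] eq by simp
    next
      case 4
      then show ?thesis using big[OF D] big[OF D'] by (simp only: )
    qed (use card_blocks(1,3)[OF D] card_blocks(1,3)[OF D'] eq in auto)
  qed
  from bij_betw_fibres[OF diagramsD(4)[OF D] diagramsD(4)[OF D'] this]
  obtain \<beta> where \<beta>: "bij_betw \<beta> D D'"
    "\<And>b. b \<in> D \<Longrightarrow> card {x \<in> \<beta> b. fst x = 0} = card {x \<in> b. fst x = 0}" by blast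
  have \<beta>D: "\<beta> b \<in> D'" if "b \<in> D" for b using bij_betwE[OF \<beta>(1)] that by blast
  have "\<exists>\<theta>. bij_betw \<theta> b (\<beta> b) \<and> (\<forall>x\<in>b. fst (\<theta> x) = fst x)" if b: "b \<in> D" for b
  proof (rule bij_betw_fibres)
    show "finite b" "finite (\<beta> b)" using diagramsD(5)[OF D b] diagramsD(5)[OF D' \<beta>D[OF b]] .
    show "card {x \<in> b. fst x = v} = card {x \<in> \<beta> b. fst x = v}" for v
    proof -
      consider "v = 0" | "v = 1" | "v \<noteq> 0" "v \<noteq> 1" by blast
      then show ?thesis
      proof cases
        case 2
        then show ?thesis
          using card_fst_block(1)[OF D b] card_fst_block(1)[OF D' \<beta>D[OF b]] \<beta>(2)[OF b] by simp
      next
        case 3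
        then show ?thesis
          unfolding card_fst_block(2)[OF D b 3] card_fst_block(2)[OF D' \<beta>D[OF b] 3] by (simp only: card.empty)
      qed (use \<beta>(2)[OF b] in simp)
    qed
  qed
  then obtain \<theta> where \<theta>: "\<And>b. b \<in> D \<Longrightarrow> bij_betw (\<theta> b) b (\<beta> b)" "\<And>b x. b \<in> D \<Longrightarrow> x \<in> b \<Longrightarrow> fst (\<theta> b x) = fst x"
    by metis
  define B where "B x = (THE b. b \<in> D \<and> x \<in> b)" for x
  have B: "B x = b" if "b \<in> D" "x \<in> b" for b x
    unfolding B_def
  proof (rule the_equality)
    show "b' = b" if "b' \<in> D \<and> x \<in> b'" for b'
      using diagramsD(3)[OF D _ \<open>b \<in> D\<close> _ \<open>x \<in> b\<close>] that by blast
  qed (use that in simp)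
  \<comment> \<open>The bijections of the individual blocks are glued; \<open>B x\<close> is the
    unique block through \<open>x\<close>.\<close>
  define \<Theta> where "\<Theta> x = \<theta> (B x) x" for x
  have \<Theta>: "\<Theta> x = \<theta> b x" if "b \<in> D" "x \<in> b" for b x using B[OF that] by (simp add: \<Theta>_def)
  have img: "\<Theta> ` b = \<beta> b" if "b \<in> D" for b
  proof -
    have "\<Theta> ` b = \<theta> b ` b" using \<Theta>[OF that] by (intro image_cong) auto
    then show ?thesis using bij_betw_imp_surj_on[OF \<theta>(1)[OF that]] by simp
  qed
  have fst\<Theta>: "fst (\<Theta> x) = fst x" if x: "x \<in> \<Union>D" for x
  proof -
    obtain b where "b \<in> D" "x \<in> b" using x by blast
    then show ?thesis using \<Theta> \<theta>(2) by simp
  qed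
  have "D' = \<beta> ` D" using bij_betw_imp_surj_on[OF \<beta>(1)] by simp
  also have "\<dots> = (\<lambda>b. \<Theta> ` b) ` D" by (rule image_cong[OF refl]) (simp add: img)
  finally have D'eq: "D' = (\<lambda>b. \<Theta> ` b) ` D" .
  have surj: "\<Theta> ` \<Union>D = \<Union>D'" unfolding D'eq by (rule image_Union)
  have UD: "\<Union>D = {0} \<times> {..<d} \<union> {1} \<times> {..<d}" "\<Union>D' = {0} \<times> {..<d} \<union> {1} \<times> {..<d}"
    using diagramsD(1)[OF D] diagramsD(1)[OF D'] by auto
  have lay: "(\<lambda>i. snd (\<Theta> (l, i))) ` {..<d} = {..<d}" if l: "l = 0 \<or> l = 1" for l
  proof (intro equalityI subsetI)
    fix j assume "j \<in> (\<lambda>i. snd (\<Theta> (l, i))) ` {..<d}"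
    then obtain i where i: "i < d" "j = snd (\<Theta> (l, i))" by blast
    then have "(l, i) \<in> \<Union>D" unfolding UD using l by auto
    then have "\<Theta> (l, i) \<in> \<Union>D'" using surj by blast
    then show "j \<in> {..<d}" unfolding UD i by auto
  next
    fix j assume j: "j \<in> {..<d}"
    then have "(l, j) \<in> \<Union>D'" unfolding UD using l by auto
    then obtain x where x: "x \<in> \<Union>D" "(l, j) = \<Theta> x" using surj by blast
    then have "fst x = l" using fst\<Theta>[OF x(1)] by (metis fst_conv)
    then have "x = (l, snd x)" "snd x < d" using x(1) unfolding UD by auto
    then show "j \<in> (\<lambda>i. snd (\<Theta> (l, i))) ` {..<d}" using x(2)
      by (intro image_eqI[of _ _ "snd x"]) (auto, metis snd_conv)
  qed
  \<comment> \<open>The two permutations; outside the layer they are the identity, as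
    \<open>permutes\<close> demands.\<close>
  define p where "p l i = (if i < d then snd (\<Theta> (l, i)) else i)" for l i
  have p: "p l permutes {..<d}" if l: "l = 0 \<or> l = 1" for l
  proof (rule bij_imp_permutes)
    have im: "p l ` {..<d} = {..<d}" using lay[OF l] by (simp add: p_def)
    then have "inj_on (p l) {..<d}" by (intro eq_card_imp_inj_on) auto
    then show "bij_betw (p l) {..<d} {..<d}" using im by (simp add: bij_betw_def)
  qed (simp add: p_def)
  have h: "\<Theta> x = (fst x, (if fst x = 0 then p 0 else p 1) (snd x))" if "x \<in> \<Union>D" for x
    using fst\<Theta>[OF that] that unfolding UD by (auto simp: p_def prod_eq_iff)
  have "\<Theta> ` b = (\<lambda>x. (fst x, (if fst x = 0 then p 0 else p 1) (snd x))) ` b" if b: "b \<in> D" for b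
  proof (rule image_cong[OF refl])
    fix x assume "x \<in> b"
    then have "x \<in> \<Union>D" using b by blast
    then show "\<Theta> x = (fst x, (if fst x = 0 then p 0 else p 1) (snd x))" by (rule h)
  qed
  then have "(\<lambda>b. \<Theta> ` b) ` D = (\<lambda>b. (\<lambda>x. (fst x, (if fst x = 0 then p 0 else p 1) (snd x))) ` b) ` D"
    by (rule image_cong[OF refl])
  then have "D' = relabel (p 0) (p 1) D"
    unfolding relabel_def by (subst D'eq)
  then show ?thesis using p by blast
qed

section \<open>Cups of tensor products, and a cup-cap stacked on a diagram\<close>

lemma cups_dtensor:
  assumes D: "D \<in> diagrams m n" and E: "E \<in> diagrams m' n'"
  shows "cups (dtensor D E) = cups D + cups E"
proof -
  define f where "f = (\<lambda>(l, i). (l, i + (if l = 0 then m else n)) :: nat \<times> nat)"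
  have T: "dtensor D E = D \<union> (\<lambda>b. f ` b) ` E"
    unfolding dtensor_def dsrc_eq[OF D] dtgt_eq[OF D] f_def ..
  have inj: "inj f" unfolding f_def by (auto simp: inj_def)
  have fst_f: "fst (f x) = fst x" for x by (cases x) (simp add: f_def)
  have sub: "S \<subseteq> {1} \<times> UNIV \<longleftrightarrow> (\<forall>x\<in>S. fst x = 1)" for S :: "(nat \<times> nat) set"
    by (simp add: subset_iff mem_Times_iff Ball_def)
  have fb: "f ` b \<subseteq> {1} \<times> UNIV \<longleftrightarrow> b \<subseteq> {1} \<times> UNIV" for b
    unfolding sub by (simp add: fst_f)
  let ?D = "{b \<in> D. b \<subseteq> {1} \<times> UNIV}" and ?E = "{b \<in> E. b \<subseteq> {1} \<times> UNIV}"
  have "{b \<in> dtensor D E. b \<subseteq> {1} \<times> UNIV} = ?D \<union> (\<lambda>b. f ` b) ` ?E"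
    unfolding T using fb by auto
  moreover have "?D \<inter> (\<lambda>b. f ` b) ` ?E = {}"
  proof (rule equals0I)
    fix b assume b: "b \<in> ?D \<inter> (\<lambda>b. f ` b) ` ?E"
    then have "b \<in> D" by simp
    then have "b \<noteq> {}" using diagramsD(2)[OF D, of b] by auto
    then obtain x where x: "x \<in> b" by blast
    then have "x \<in> \<Union>D" using \<open>b \<in> D\<close> by blast
    moreover have "x \<in> f ` \<Union>E" using b x by blast
    ultimately show False unfolding diagramsD(1)[OF D] diagramsD(1)[OF E] by (auto simp: f_def)
  qed
  moreover have "card ((\<lambda>b. f ` b) ` ?E) = card ?E"
    by (rule card_image) (use inj in \<open>auto simp: inj_on_def inj_image_eq_iff\<close>)
  ultimately show ?thesis
    unfolding cups_def using diagramsD(4)[OF D] diagramsD(4)[OF E] by (simp add: card_Un_disjoint)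
qed

lemma cups_perm_diagram: "cups (perm_diagram n \<pi>) = 0"
proof -
  have "{b \<in> perm_diagram n \<pi>. b \<subseteq> {1} \<times> UNIV} = {}" by (auto simp: perm_diagram_def)
  then show ?thesis by (simp only: cups_def card.empty)
qed

definition cupcap_diagram :: diagram where
  "cupcap_diagram = (\<lambda>l. {(l, 0), (l, 1)}) ` {0, 1}"

lemma cupcap_diagram_in_diagrams: "cupcap_diagram \<in> diagrams 2 2"
  unfolding cupcap_diagram_def
proof (rule pairs_in_diagrams)
  have "{..<2} = {0, 1::nat}" by auto
  then show "(\<lambda>l. (l, 0::nat)) ` {0, 1} \<union> (\<lambda>l. (l, 1)) ` {0, 1} = {0} \<times> {..<2} \<union> {1::nat} \<times> {..<2}"
    by auto
qed (auto simp: inj_on_def)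

lemma sat_cupcap_diagram: "sat cupcap_diagram A B \<longleftrightarrow> (0 \<in> A \<longleftrightarrow> 1 \<in> A) \<and> (0 \<in> B \<longleftrightarrow> 1 \<in> B)"
  unfolding cupcap_diagram_def sat_pairs by auto

lemma cups_cupcap_diagram: "cups cupcap_diagram = 1"
proof -
  have "{b \<in> cupcap_diagram. b \<subseteq> {1} \<times> UNIV} = {{(1, 0), (1, 1)}}" by (auto simp: cupcap_diagram_def)
  then show ?thesis by (simp add: cups_def)
qed

lemma cupcap_diag: "cupcap t = diag cupcap_diagram"
proof -
  have D: "ev_diagram 1 \<in> diagrams 2 0" using ev_diagram_in_diagrams[of 1] by simp
  have E: "coev_diagram 1 \<in> diagrams 0 2" using coev_diagram_in_diagrams[of 1] by simp
  have "{} \<subseteq> {..<0::nat} \<and> (\<forall>B\<subseteq>{..<0}. sat (ev_diagram 1) A B \<and> sat (coev_diagram 1) B C \<longleftrightarrow>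
      sat cupcap_diagram A C \<and> B = {})" for A C
    unfolding sat_cupcap_diagram sat_ev_diagram sat_coev_diagram by auto
  from dcomp_eqI_unique[OF D E cupcap_diagram_in_diagrams this]
  show ?thesis unfolding cupcap_def ev_eq_evn evn_def coev_diag bcomp_diag[OF D E] by simp
qed

lemma exists_cups: "2 * j \<le> d \<Longrightarrow> \<exists>D\<in>diagrams d d. cups D = j"
proof (induction j arbitrary: d)
  case 0
  show ?case
    using perm_diagram_in_diagrams[OF permutes_id] cups_perm_diagram by blast
next
  case (Suc j)
  then have "2 * j \<le> d - 2" by simp
  from Suc.IH[OF this] obtain D where D: "D \<in> diagrams (d - 2) (d - 2)" "cups D = j" by blast
  have "dtensor cupcap_diagram D \<in> diagrams d d"
    by (rule diagrams_dim[OF dtensor_in_diagrams[OF cupcap_diagram_in_diagrams D(1)]]) (use Suc in auto)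
  moreover have "cups (dtensor cupcap_diagram D) = Suc j"
    using cups_dtensor[OF cupcap_diagram_in_diagrams D(1)] D(2) by (simp add: cups_cupcap_diagram)
  ultimately show ?case by blast
qed

definition thru :: "diagram \<Rightarrow> nat \<Rightarrow> bool" where
  "thru D a \<longleftrightarrow> (\<exists>i. {(0, i), (1, a)} \<in> D)"

definition arc :: "diagram \<Rightarrow> nat \<Rightarrow> nat \<Rightarrow> bool" where
  "arc D a b \<longleftrightarrow> {(1, a), (1, b)} \<in> D"

abbreviation cap_diagram :: "nat \<Rightarrow> diagram" where
  "cap_diagram r \<equiv> dtensor cupcap_diagram (perm_diagram r id)"

lemma cap_diagram_in_diagrams: "cap_diagram r \<in> diagrams (2 + r) (2 + r)"
  by (intro dtensor_in_diagrams cupcap_diagram_in_diagrams perm_diagram_in_diagrams permutes_id)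

lemma sat_cap_diagram:
  assumes "B \<subseteq> {..<2 + r}" "C \<subseteq> {..<2 + r}"
  shows "sat (cap_diagram r) B C \<longleftrightarrow>
    (0 \<in> B \<longleftrightarrow> 1 \<in> B) \<and> (0 \<in> C \<longleftrightarrow> 1 \<in> C) \<and> B - {0, 1} = C - {0, 1}"
proof -
  have "B - {0, 1} = C - {0, 1} \<longleftrightarrow> (\<forall>i<r. i + 2 \<in> B \<longleftrightarrow> i + 2 \<in> C)"
  proof
    assume "B - {0, 1} = C - {0, 1}"
    moreover have "i + 2 \<in> X \<longleftrightarrow> i + 2 \<in> X - {0, 1}" for i :: nat and X by auto
    ultimately show "\<forall>i<r. i + 2 \<in> B \<longleftrightarrow> i + 2 \<in> C" by metis
  next
    assume h: "\<forall>i<r. i + 2 \<in> B \<longleftrightarrow> i + 2 \<in> C"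
    have "i \<in> B \<longleftrightarrow> i \<in> C" if i: "i \<noteq> 0" "i \<noteq> 1" for i
    proof (cases "i < 2 + r")
      case True
      then have "i = (i - 2) + 2" "i - 2 < r" using i by auto
      then show ?thesis using h by metis
    qed (use assms in auto)
    then show "B - {0, 1} = C - {0, 1}" by auto
  qed
  then show ?thesis
    unfolding sat_dtensor[OF cupcap_diagram_in_diagrams] sat_cupcap_diagram sat_perm_diagram by simp
qed

lemma block_partner:
  assumes D: "D \<in> diagrams m n" and x: "x \<in> {0} \<times> {..<m} \<union> {1} \<times> {..<n}"
  obtains p where "{x, p} \<in> D" "p \<noteq> x" "p \<in> {0} \<times> {..<m} \<union> {1} \<times> {..<n}"
proof -
  have "x \<in> \<Union>D" using x unfolding diagramsD(1)[OF D] .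
  then obtain b where b: "b \<in> D" "x \<in> b" by blast
  then obtain u v where uv: "b = {u, v}" "u \<noteq> v" using diagramsD(2)[OF D b(1)] by (auto simp: card_2_iff)
  define p where "p = (if x = u then v else u)"
  have "b = {x, p}" "p \<noteq> x" using uv b(2) unfolding p_def by auto
  moreover have "p \<in> \<Union>D" using calculation b(1) by blast
  ultimately show ?thesis using that b(1) unfolding diagramsD(1)[OF D] by blast
qed

text \<open>The cap closes the arc between targets 0 and 1 to a loop, and the cup puts an equal arc
  back. In terms of colourings, the two middle colourings are those of the loop.\<close>

lemma cap_arc:
  assumes D: "D \<in> diagrams m (2 + r)" and arc: "arc D 0 1"
  shows "dcomp (cap_diagram r) D = D" "loops (cap_diagram r) D = 1"
proof -
  have b: "{(1, 0), (1, 1)} \<in> D" using arc by (simp add: arc_def)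
  have only: "b' = {(1, 0), (1, 1)}" if "b' \<in> D" "(1, 0) \<in> b' \<or> (1, 1) \<in> b'" for b'
    using that diagramsD(3)[OF D that(1) b] by auto
  have sat01: "0 \<in> B \<longleftrightarrow> 1 \<in> B" if "sat D A B" for A B
    using that b unfolding sat_def monochr_def by fastforce
  \<comment> \<open>Only the block joining targets 0 and 1 sees their colours, so both may be
    recoloured together.\<close>
  have swap: "sat D A B'" if s: "sat D A B" and eq: "B - {0, 1} = B' - {0, 1}" and c: "0 \<in> B' \<longleftrightarrow> 1 \<in> B'" for A B B'
    unfolding sat_def monochr_def
  proof (intro ballI)
    fix b' p q assume b': "b' \<in> D" "p \<in> b'" "q \<in> b'"
    show "p \<in> {0} \<times> A \<union> {1} \<times> B' \<longleftrightarrow> q \<in> {0} \<times> A \<union> {1} \<times> B'"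
    proof (cases "(1, 0) \<in> b' \<or> (1, 1) \<in> b'")
      case True
      then have "b' = {(1, 0), (1, 1)}" using only b'(1) by blast
      then show ?thesis using b' c by auto
    next
      case False
      have "x \<in> {0} \<times> A \<union> {1} \<times> B' \<longleftrightarrow> x \<in> {0} \<times> A \<union> {1} \<times> B" if "x \<in> b'" for x
      proof -
        have "x \<noteq> (1, 0)" "x \<noteq> (1, 1)" using False that by auto
        then have "fst x = 1 \<Longrightarrow> snd x \<notin> {0, 1}" by (auto simp: prod_eq_iff)
        then have "fst x = 1 \<Longrightarrow> snd x \<in> B' \<longleftrightarrow> snd x \<in> B" using eq by blast
        then show ?thesis by (cases x) auto
      qed
      then show ?thesis
        using bspec[OF bspec[OF bspec[OF s[unfolded sat_def monochr_def] b'(1)] b'(2)] b'(3)] b'(2,3) by blast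
    qed
  qed
  have "card {B. B \<subseteq> {..<2 + r} \<and> sat D A B \<and> sat (cap_diagram r) B C} = (if sat D A C then 2 ^ 1 else 0)"
    if AC: "A \<subseteq> {..<m}" "C \<subseteq> {..<2 + r}" for A C
  proof (cases "sat D A C")
    case True
    have "{B. B \<subseteq> {..<2 + r} \<and> sat D A B \<and> sat (cap_diagram r) B C} = {C - {0, 1}, C \<union> {0, 1}}"
    proof (intro equalityI subsetI)
      fix B assume "B \<in> {B. B \<subseteq> {..<2 + r} \<and> sat D A B \<and> sat (cap_diagram r) B C}"
      then have B: "B \<subseteq> {..<2 + r}" "sat (cap_diagram r) B C" by auto
      then have "(0 \<in> B \<longleftrightarrow> 1 \<in> B)" "B - {0, 1} = C - {0, 1}" using sat_cap_diagram[OF B(1) AC(2)] by auto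
      then show "B \<in> {C - {0, 1}, C \<union> {0, 1}}" by (cases "0 \<in> B") auto
    next
      fix B assume B: "B \<in> {C - {0, 1}, C \<union> {0, 1}}"
      then have B': "B \<subseteq> {..<2 + r}" "(0 \<in> B \<longleftrightarrow> 1 \<in> B)" "B - {0, 1} = C - {0, 1}" using AC(2) by auto
      then show "B \<in> {B. B \<subseteq> {..<2 + r} \<and> sat D A B \<and> sat (cap_diagram r) B C}"
        using swap[OF True _ B'(2)] sat01[OF True] sat_cap_diagram[OF B'(1) AC(2)] by auto
    qed
    moreover have "C - {0, 1} \<noteq> C \<union> {0, 1}" by blast
    ultimately show ?thesis using True by simp
  next
    case False
    have "\<not> (sat D A B \<and> sat (cap_diagram r) B C)" if "B \<subseteq> {..<2 + r}" for B
      using False swap[of A B C] sat_cap_diagram[OF that AC(2)] by blast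
    then have "{B. B \<subseteq> {..<2 + r} \<and> sat D A B \<and> sat (cap_diagram r) B C} = {}" by blast
    then show ?thesis using False by simp
  qed
  from dcomp_eqI[OF D cap_diagram_in_diagrams D this]
  show "dcomp (cap_diagram r) D = D" "loops (cap_diagram r) D = 1" by auto
qed

text \<open>Let \<open>p\<close> and \<open>q\<close> be the partners of targets 0 and 1. The cap
  joins \<open>p\<close> to \<open>q\<close> and a new cup takes the two targets. If
  \<open>p\<close> and \<open>q\<close> are both sources this is one cup more; otherwise as many
  cups are lost as gained.\<close>

lemma cap_merge:
  assumes D: "D \<in> diagrams m (2 + r)" and no: "\<not> arc D 0 1"
  shows "loops (cap_diagram r) D = 0"
    "cups (dcomp (cap_diagram r) D) = (if thru D 0 \<and> thru D 1 then Suc (cups D) else cups D)"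
proof -
  define V where "V = {0} \<times> {..<m} \<union> {1::nat} \<times> {..<2 + r}"
  let ?x = "(1::nat, 0::nat)" and ?y = "(1::nat, 1::nat)"
  have xV: "?x \<in> V" "?y \<in> V" by (auto simp: V_def)
  obtain p where p: "{?x, p} \<in> D" "p \<noteq> ?x" "p \<in> V" using block_partner[OF D, of ?x] xV unfolding V_def by blast
  obtain q where q: "{?y, q} \<in> D" "q \<noteq> ?y" "q \<in> V" using block_partner[OF D, of ?y] xV unfolding V_def by blast
  define N where "N = D - {{?x, p}, {?y, q}}"
  have py: "p \<noteq> ?y" using no p(1) unfolding arc_def by auto
  have qx: "q \<noteq> ?x" using no q(1) unfolding arc_def by (auto simp: insert_commute)
  have bne: "{?x, p} \<noteq> {?y, q}" using py by (auto simp: doubleton_eq_iff)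
  have pq: "p \<noteq> q" using diagramsD(3)[OF D p(1) q(1), of p] bne by auto
  have DN: "D = insert {?x, p} (insert {?y, q} N)" using p(1) q(1) by (auto simp: N_def)
  have NN: "{?x, p} \<notin> N" "{?y, q} \<notin> N" by (auto simp: N_def)
  have Npt: "z \<notin> {?x, ?y, p, q}" if "b \<in> N" "z \<in> b" for b z
  proof
    assume "z \<in> {?x, ?y, p, q}"
    then have "z \<in> {?x, p} \<or> z \<in> {?y, q}" by auto
    moreover have "b \<in> D" using that(1) by (auto simp: N_def)
    ultimately have "b = {?x, p} \<or> b = {?y, q}"
      using diagramsD(3)[OF D _ p(1) that(2)] diagramsD(3)[OF D _ q(1) that(2)] by blast
    then show False using that(1) NN by auto
  qed
  have ND: "b \<in> D" if "b \<in> N" for b using that by (simp add: N_def)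
  define X where "X = insert {p, q} (insert {?x, ?y} N)"
  have "\<Union>X = \<Union>D" unfolding X_def DN by auto
  then have UX: "\<Union>X = {0} \<times> {..<m} \<union> {1} \<times> {..<2 + r}" unfolding diagramsD(1)[OF D] .
  have XX: "X \<in> diagrams m (2 + r)"
  proof (rule diagramsI[OF UX])
    show "card b = 2" if "b \<in> X" for b
      using that pq diagramsD(2)[OF D ND] unfolding X_def by auto
    have aux: "b = b'" if "b \<in> N" "b' \<in> X" "z \<in> b" "z \<in> b'" for b b' z
      using that Npt[OF that(1,3)] diagramsD(3)[OF D ND ND] unfolding X_def by blast
    show "b = b'" if bb: "b \<in> X" "b' \<in> X" "z \<in> b" "z \<in> b'" for b b' z
    proof -
      consider "b \<in> N" | "b' \<in> N" | "b \<in> {{p, q}, {?x, ?y}}" "b' \<in> {{p, q}, {?x, ?y}}"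
        using bb(1,2) unfolding X_def by blast
      then show ?thesis
      proof cases
        case 1
        then show ?thesis using aux[OF _ bb(2-4)] by simp
      next
        case 2
        then show ?thesis using aux[OF _ bb(1,4,3)] by simp
      next
        case 3
        then show ?thesis using bb(3,4) p(2) q(2) py qx by auto
      qed
    qed
  qed
  define c where "c x A C \<longleftrightarrow> x \<in> {0} \<times> A \<union> {1} \<times> C" for x :: "nat \<times> nat" and A C :: "nat set"
  \<comment> \<open>The forced middle colouring: targets 0 and 1 both carry the colour of
    \<open>p\<close>, the other targets that of the top layer.\<close>
  define f where "f A C = C - {0, 1} \<union> (if c p A C then {0, 1} else {})" for A C
  have agree: "c z A B \<longleftrightarrow> c z A C" if "B - {0, 1} = C - {0, 1}" "z \<noteq> ?x" "z \<noteq> ?y" for z A B C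
  proof -
    have "fst z = 1 \<Longrightarrow> snd z \<notin> {0, 1}" using that by (auto simp: prod_eq_iff)
    then have "fst z = 1 \<Longrightarrow> snd z \<in> B \<longleftrightarrow> snd z \<in> C" using that(1) by blast
    then show ?thesis unfolding c_def by (cases z) auto
  qed
  have cxy: "c ?x A B \<longleftrightarrow> 0 \<in> B" "c ?y A B \<longleftrightarrow> 1 \<in> B" for A B unfolding c_def by auto
  have satN: "sat N A B \<longleftrightarrow> sat N A C" if "B - {0, 1} = C - {0, 1}" for A B C
  proof -
    have "c z A B \<longleftrightarrow> c z A C" if z: "b \<in> N" "z \<in> b" for b z
      using Npt[OF z] by (intro agree[OF \<open>B - {0, 1} = C - {0, 1}\<close>]) auto
    then show ?thesis unfolding sat_def monochr_def c_def by simp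
  qed
  have satD: "sat D A B \<longleftrightarrow> sat N A B \<and> (0 \<in> B \<longleftrightarrow> c p A B) \<and> (1 \<in> B \<longleftrightarrow> c q A B)" for A B
    unfolding DN sat_def monochr_insert c_def by auto
  have satX: "sat X A B \<longleftrightarrow> sat N A B \<and> (c p A B \<longleftrightarrow> c q A B) \<and> (0 \<in> B \<longleftrightarrow> 1 \<in> B)" for A B
    unfolding X_def sat_def monochr_insert c_def by auto
  have "f A C \<subseteq> {..<2 + r} \<and> (\<forall>B\<subseteq>{..<2 + r}. sat D A B \<and> sat (cap_diagram r) B C \<longleftrightarrow> sat X A C \<and> B = f A C)"
    if AC: "A \<subseteq> {..<m}" "C \<subseteq> {..<2 + r}" for A C
  proof (intro conjI allI impI)
    show "f A C \<subseteq> {..<2 + r}" using AC(2) unfolding f_def by auto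
    fix B assume B: "B \<subseteq> {..<2 + r}"
    show "sat D A B \<and> sat (cap_diagram r) B C \<longleftrightarrow> sat X A C \<and> B = f A C"
    proof (cases "B - {0, 1} = C - {0, 1}")
      case True
      have e: "c p A B \<longleftrightarrow> c p A C" "c q A B \<longleftrightarrow> c q A C" using agree[OF True] p(2) py q(2) qx by auto
      have fi: "i \<in> f A C \<longleftrightarrow> (if i \<in> {0, 1} then c p A C else i \<in> C)" for i unfolding f_def by simp
      have Bi: "i \<in> B \<longleftrightarrow> i \<in> C" if "i \<notin> {0, 1}" for i
      proof -
        have "i \<in> B \<longleftrightarrow> i \<in> B - {0, 1}" using that by simp
        also have "\<dots> \<longleftrightarrow> i \<in> C" unfolding True using that by simp
        finally show ?thesis .
      qed
      have "B = f A C \<longleftrightarrow> (0 \<in> B \<longleftrightarrow> c p A C) \<and> (1 \<in> B \<longleftrightarrow> c p A C)"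
      proof
        assume "B = f A C"
        then show "(0 \<in> B \<longleftrightarrow> c p A C) \<and> (1 \<in> B \<longleftrightarrow> c p A C)" using fi[of 0] fi[of 1] by simp
      next
        assume h: "(0 \<in> B \<longleftrightarrow> c p A C) \<and> (1 \<in> B \<longleftrightarrow> c p A C)"
        show "B = f A C"
        proof (rule set_eqI)
          fix i
          show "i \<in> B \<longleftrightarrow> i \<in> f A C"
          proof (cases "i \<in> {0, 1}")
            case False
            then show ?thesis using Bi[OF False] fi[of i] by simp
          qed (use h fi in auto)
        qed
      qed
      then show ?thesis
        unfolding satD satX sat_cap_diagram[OF B AC(2)] e satN[OF True] using True by blast
    next
      case False
      moreover have "f A C - {0, 1} = C - {0, 1}" unfolding f_def by auto
      ultimately have "B \<noteq> f A C" by blast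
      then show ?thesis using False unfolding sat_cap_diagram[OF B AC(2)] by blast
    qed
  qed
  from dcomp_eqI_unique[OF D cap_diagram_in_diagrams XX this]
  have X: "dcomp (cap_diagram r) D = X" "loops (cap_diagram r) D = 0" by auto
  show "loops (cap_diagram r) D = 0" by (rule X)
  have fN: "finite N" using diagramsD(4)[OF D] by (simp add: N_def)
  have fil: "{b \<in> insert a Y. b \<subseteq> {1} \<times> UNIV} = (if a \<subseteq> {1} \<times> UNIV then insert a {b \<in> Y. b \<subseteq> {1} \<times> UNIV} else {b \<in> Y. b \<subseteq> {1} \<times> UNIV})"
    for a Y by auto
  have cins: "cups (insert a Y) = (if a \<subseteq> {1} \<times> UNIV then 1 else 0) + cups Y" if "finite Y" "a \<notin> Y" for a Y
    using that unfolding cups_def fil by simp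
  have cD: "cups D = (if fst p = 1 then 1 else 0) + ((if fst q = 1 then 1 else 0) + cups N)"
    using cins[of "insert {?y, q} N" "{?x, p}"] cins[of N "{?y, q}"] fN NN bne unfolding DN by (simp add: mem_Times_iff)
  have "{p, q} \<noteq> {?x, ?y}" using p(2) py by auto
  moreover have "{p, q} \<notin> N" "{?x, ?y} \<notin> N" using Npt[of "{p, q}" p] Npt[of "{?x, ?y}" ?x] by auto
  ultimately have cX: "cups X = (if fst p = 1 \<and> fst q = 1 then 1 else 0) + (1 + cups N)"
    using cins[of "insert {?x, ?y} N" "{p, q}"] cins[of N "{?x, ?y}"] fN unfolding X_def by (simp add: mem_Times_iff)
  have th: "thru D a \<longleftrightarrow> fst z = 0" if z: "{(1, a), z} \<in> D" "z \<noteq> (1, a)" for a z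
  proof
    assume "thru D a"
    then obtain i where i: "{(0, i), (1, a)} \<in> D" unfolding thru_def by blast
    have "{(0, i), (1, a)} = {(1, a), z}" using diagramsD(3)[OF D i z(1), of "(1, a)"] by simp
    then show "fst z = 0" using z(2) by (auto simp: doubleton_eq_iff)
  next
    assume "fst z = 0"
    then have "{(1, a), z} = {(0, snd z), (1, a)}" by (cases z) auto
    then show "thru D a" using z(1) unfolding thru_def by metis
  qed
  have "fst p = 0 \<or> fst p = 1" "fst q = 0 \<or> fst q = 1" using p(3) q(3) unfolding V_def by auto
  then show "cups (dcomp (cap_diagram r) D) = (if thru D 0 \<and> thru D 1 then Suc (cups D) else cups D)"
    unfolding X th[OF p(1,2)] th[OF q(1,2)] cX cD by auto
qed

section \<open>Counting strands and averaging over permutations\<close>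

lemma symm_expand:
  assumes "\<And>f g. \<phi> (f + g) = \<phi> f + \<phi> g" "\<And>a f. \<phi> (a \<bullet>\<^sub>s f) = a \<bullet>\<^sub>s (\<phi> f :: bmor)"
  shows "\<phi> (symmetrizer n) = (1 / fact n) \<bullet>\<^sub>s (\<Sum>\<pi> | \<pi> permutes {..<n}. \<phi> (pmor n \<pi>))"
proof -
  have z: "\<phi> 0 = 0" using assms(2)[of 0 0] by simp
  have "\<phi> (\<Sum>\<pi>\<in>I. pmor n \<pi>) = (\<Sum>\<pi>\<in>I. \<phi> (pmor n \<pi>))" for I
    by (induction I rule: infinite_finite_induct) (simp_all add: z assms(1))
  then show ?thesis unfolding symmetrizer_pmor assms(2) by simp
qed

lemma thru_not_arc:
  assumes "D \<in> diagrams m n" "thru D a"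
  shows "\<not> arc D a b"
proof
  assume "arc D a b"
  then have b: "{(1, a), (1, b)} \<in> D" by (simp add: arc_def)
  obtain i where i: "{(0, i), (1, a)} \<in> D" using assms(2) unfolding thru_def by blast
  have "{(0::nat, i), (1, a)} = {(1, a), (1, b)}" using diagramsD(3)[OF assms(1) i b, of "(1, a)"] by simp
  then show False by (auto simp: doubleton_eq_iff)
qed

lemma arc_neq: "D \<in> diagrams m n \<Longrightarrow> arc D a b \<Longrightarrow> a \<noteq> b"
  using diagramsD(2)[of D m n "{(1, a), (1, b)}"] by (auto simp: arc_def)

lemma arc_or_thru:
  assumes D: "D \<in> diagrams m n" and a: "a < n"
  shows "thru D a \<or> (\<exists>b<n. arc D a b)"
proof -
  have x: "(1, a) \<in> {0} \<times> {..<m} \<union> {1} \<times> {..<n}" using a by auto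
  obtain p where p: "{(1, a), p} \<in> D" "p \<noteq> (1, a)" "p \<in> {0} \<times> {..<m} \<union> {1} \<times> {..<n}"
    by (rule block_partner[OF D x])
  from p(3) consider i where "p = (0, i)" | b where "p = (1, b)" "b < n" by auto
  then show ?thesis
  proof cases
    case (1 i)
    then show ?thesis using p(1) unfolding thru_def by (metis insert_commute)
  qed (use p(1) in \<open>auto simp: arc_def\<close>)
qed

text \<open>A through strand has exactly one target end, so these targets correspond to the blocks
  with one source point, already counted in \<open>card_blocks\<close>.\<close>

lemma card_thru:
  assumes D: "D \<in> diagrams d d"
  shows "card {a. a < d \<and> thru D a} = d - 2 * cups D"
proof -
  define F where "F a = (THE b. b \<in> D \<and> (1, a) \<in> b)" for a :: nat
  have F: "F a = b" if "b \<in> D" "(1, a) \<in> b" for a b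
    unfolding F_def
  proof (rule the_equality)
    show "b' = b" if "b' \<in> D \<and> (1, a) \<in> b'" for b'
      using diagramsD(3)[OF D _ \<open>b \<in> D\<close> _ \<open>(1, a) \<in> b\<close>] that by blast
  qed (use that in simp)
  let ?T = "{a. a < d \<and> thru D a}" and ?B = "{b \<in> D. card {x \<in> b. fst x = 0} = 1}"
  have one: "card {x \<in> {(0::nat, i), (1, a)}. fst x = 0} = 1" for i a :: nat
  proof -
    have "{x \<in> {(0::nat, i), (1, a)}. fst x = 0} = {(0, i)}" by auto
    then show ?thesis by simp
  qed
  have "bij_betw F ?T ?B"
  proof (rule bij_betw_imageI)
    show "inj_on F ?T"
    proof (rule inj_onI)
      fix a b assume ab: "a \<in> ?T" "b \<in> ?T" "F a = F b"
      obtain i where i: "{(0, i), (1, a)} \<in> D" using ab(1) unfolding thru_def by blast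
      obtain j where j: "{(0, j), (1, b)} \<in> D" using ab(2) unfolding thru_def by blast
      have "F a = {(0, i), (1, a)}" "F b = {(0, j), (1, b)}" using F[OF i] F[OF j] by auto
      then have "{(0::nat, i), (1::nat, a)} = {(0, j), (1, b)}" using ab(3) by simp
      then show "a = b" by (auto simp: doubleton_eq_iff)
    qed
    show "F ` ?T = ?B"
    proof (intro equalityI subsetI)
      fix b assume "b \<in> F ` ?T"
      then obtain a where a: "b = F a" "a < d" "thru D a" by blast
      then obtain i where i: "{(0, i), (1, a)} \<in> D" unfolding thru_def by blast
      have "b = {(0, i), (1, a)}" using F[OF i] a by simp
      then show "b \<in> ?B" using i one by simp
    next
      fix b assume "b \<in> ?B"
      then have b: "b \<in> D" "card {x \<in> b. fst x = 0} = 1" by auto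
      then have "card {x \<in> b. fst x = 1} = 1" using card_fst_block(1)[OF D b(1)] by simp
      then obtain y where y: "{x \<in> b. fst x = 1} = {y}" by (auto simp: card_1_singleton_iff)
      obtain x where x: "{x \<in> b. fst x = 0} = {x}" using b(2) by (auto simp: card_1_singleton_iff)
      have xy: "x \<in> b" "fst x = 0" "y \<in> b" "fst y = 1" using x y by auto
      have "z = x \<or> z = y" if "z \<in> b" for z
      proof -
        have "fst z = 0 \<or> fst z = 1" using card_fst_block(2)[OF D b(1), of "fst z"] that by blast
        then show ?thesis using that x y by blast
      qed
      then have "b = {x, y}" using xy by auto
      moreover have "x = (0, snd x)" "y = (1, snd y)" using xy by (auto simp: prod_eq_iff)
      ultimately have be: "b = {(0, snd x), (1, snd y)}" by metis
      have "y \<in> \<Union>D" using xy b by blast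
      then have "snd y < d" using xy(4) unfolding diagramsD(1)[OF D] by auto
      moreover have "thru D (snd y)" using b(1) unfolding be thru_def by blast
      moreover have "F (snd y) = b" using F[OF b(1)] be by simp
      ultimately show "b \<in> F ` ?T" by blast
    qed
  qed
  then have "card ?T = card ?B" by (rule bij_betw_same_card)
  then show ?thesis using card_blocks(2)[OF D] by simp
qed

text \<open>The pairs are ordered, hence the factor 2. The first component of a pair runs
  bijectively through the targets that are not on a through strand.\<close>

lemma card_arcs:
  assumes D: "D \<in> diagrams d d"
  shows "card {(a, b). a < d \<and> b < d \<and> arc D a b} = 2 * cups D"
proof -
  let ?A = "{(a, b). a < d \<and> b < d \<and> arc D a b}" and ?N = "{a. a < d \<and> \<not> thru D a}"
  have "bij_betw fst ?A ?N"
  proof (rule bij_betw_imageI)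
    show "inj_on fst ?A"
    proof (rule inj_onI)
      fix x y assume xy: "x \<in> ?A" "y \<in> ?A" "fst x = fst y"
      then have x: "{(1, fst x), (1, snd x)} \<in> D" and y: "{(1, fst x), (1, snd y)} \<in> D" unfolding arc_def by auto
      have "{(1::nat, fst x), (1, snd x)} = {(1, fst x), (1, snd y)}" using diagramsD(3)[OF D x y, of "(1, fst x)"] by simp
      then have "snd x = snd y" by (auto simp: doubleton_eq_iff)
      then show "x = y" using xy(3) by (rule prod_eqI[rotated])
    qed
    show "fst ` ?A = ?N"
    proof (intro equalityI subsetI)
      fix a assume "a \<in> fst ` ?A"
      then show "a \<in> ?N" using thru_not_arc[OF D] by auto
    next
      fix a assume "a \<in> ?N"
      then obtain b where "b < d" "arc D a b" "a < d" using arc_or_thru[OF D, of a] by auto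
      then show "a \<in> fst ` ?A" by (intro image_eqI[of _ _ "(a, b)"]) auto
    qed
  qed
  then have "card ?A = card ?N" by (rule bij_betw_same_card)
  also have "?N = {..<d} - {a. a < d \<and> thru D a}" by auto
  also have "card \<dots> = d - card {a. a < d \<and> thru D a}" by (subst card_Diff_subset) auto
  also have "\<dots> = 2 * cups D" using card_thru[OF D] card_blocks(2)[OF D] by simp
  finally show ?thesis .
qed

lemma card_off_diagonal:
  assumes "finite T"
  shows "card {(a, b). a \<in> T \<and> b \<in> T \<and> a \<noteq> b} = card T * (card T - 1)"
proof -
  have "{(a, b). a \<in> T \<and> b \<in> T \<and> a \<noteq> b} = Sigma T (\<lambda>a. T - {a})" by auto
  then show ?thesis using assms by simp
qed

text \<open>
  For a random permutation, the images of 0 and 1 are a uniformly distributed pair of distinct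
  elements.
\<close>
lemma average_pairs:
  fixes G :: "nat \<Rightarrow> nat \<Rightarrow> bmor"
  assumes d: "2 \<le> d"
  shows "of_nat (d * (d - 1)) \<bullet>\<^sub>s (\<Sum>\<pi> | \<pi> permutes {..<d}. G (\<pi> 0) (\<pi> 1)) =
    fact d \<bullet>\<^sub>s (\<Sum>(a, b)\<in>{(a, b). a \<in> {..<d} \<and> b \<in> {..<d} \<and> a \<noteq> b}. G a b)"
proof -
  let ?O = "{(a, b). a \<in> {..<d} \<and> b \<in> {..<d} \<and> a \<noteq> b}"
  have const: "(\<Sum>x\<in>I. c) = of_nat (card I) \<bullet>\<^sub>s c" for I :: "'i set" and c :: bmor
    by (induction I rule: infinite_finite_induct) (simp_all add: bmor.scale_left_distrib)
  have shift: "(\<Sum>\<pi> | \<pi> permutes {..<d}. G (\<pi> 0) (\<pi> 1)) = (\<Sum>\<pi> | \<pi> permutes {..<d}. G (\<pi> a) (\<pi> b))"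
    if ab: "a < d" "b < d" "a \<noteq> b" for a b
  proof -
    \<comment> \<open>The permutation \<tau> is to send 0 to \<open>a\<close> and 1 to
      \<open>b\<close>; \<open>c\<close> is the point that the swap of 0 and \<open>a\<close> takes
      to \<open>b\<close>.\<close>
    define c where "c = Transposition.transpose 0 a b"
    define \<tau> where "\<tau> = Transposition.transpose 0 a \<circ> Transposition.transpose 1 c"
    have c: "c < d" "c \<noteq> 0" using ab d unfolding c_def
      by (cases "b = 0"; cases "a = 0"; auto simp: transpose_def)+
    have "\<tau> permutes {..<d}"
      unfolding \<tau>_def using c(1) ab d by (intro permutes_compose permutes_swap_id) auto
    moreover have "\<tau> 0 = a" using c(2) by (simp add: \<tau>_def transpose_def)
    moreover have "\<tau> 1 = b" by (simp add: \<tau>_def c_def)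
    ultimately show ?thesis
      using sum_permutations_compose_right[of \<tau> "{..<d}" "\<lambda>\<pi>. G (\<pi> 0) (\<pi> 1)"] by simp
  qed
  have perm: "(\<Sum>(a, b)\<in>?O. G (\<pi> a) (\<pi> b)) = (\<Sum>(a, b)\<in>?O. G a b)" if \<pi>: "\<pi> permutes {..<d}" for \<pi>
  proof -
    let ?f = "map_prod \<pi> \<pi>"
    have inj: "inj_on ?f ?O"
      using permutes_inj[OF \<pi>] by (intro inj_on_subset[OF prod.inj_map]) auto
    have "\<pi> a < d" if "a < d" for a using permutes_in_image[OF \<pi>, of a] that by simp
    moreover have "\<pi> a \<noteq> \<pi> b" if "a \<noteq> b" for a b using permutes_inj[OF \<pi>] that by (auto dest: injD)
    ultimately have sub: "?f ` ?O \<subseteq> ?O" by auto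
    have "finite ?O" by (rule finite_subset[of _ "{..<d} \<times> {..<d}"]) auto
    then have "?f ` ?O = ?O" using sub inj by (rule endo_inj_surj)
    then have "(\<Sum>(a, b)\<in>?O. G a b) = (\<Sum>(a, b)\<in>?f ` ?O. G a b)" by (simp only:)
    also have "\<dots> = (\<Sum>x\<in>?O. G (\<pi> (fst x)) (\<pi> (snd x)))"
      by (subst sum.reindex[OF inj]) (simp only: o_def split_beta fst_map_prod snd_map_prod)
    finally have "(\<Sum>x\<in>?O. G (\<pi> (fst x)) (\<pi> (snd x))) = (\<Sum>(a, b)\<in>?O. G a b)" by (rule sym)
    then show ?thesis by (simp only: case_prod_unfold)
  qed
  \<comment> \<open>The double sum over pairs and permutations is evaluated in two ways: by
    \<open>shift\<close> the inner sum does not depend on the pair, by \<open>perm\<close> it does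
    not depend on the permutation.\<close>
  have "(\<Sum>x\<in>?O. \<Sum>\<pi> | \<pi> permutes {..<d}. G (\<pi> 0) (\<pi> 1)) = (\<Sum>(a, b)\<in>?O. \<Sum>\<pi> | \<pi> permutes {..<d}. G (\<pi> a) (\<pi> b))"
    by (intro sum.cong refl) (use shift in auto)
  also have "\<dots> = (\<Sum>\<pi> | \<pi> permutes {..<d}. \<Sum>(a, b)\<in>?O. G (\<pi> a) (\<pi> b))"
    unfolding split_beta by (rule sum.swap)
  also have "\<dots> = (\<Sum>\<pi> | \<pi> permutes {..<d}. \<Sum>(a, b)\<in>?O. G a b)"
    by (intro sum.cong refl perm) simp
  also have "\<dots> = of_nat (fact d) \<bullet>\<^sub>s (\<Sum>(a, b)\<in>?O. G a b)"
    unfolding const card_permutations[OF card_lessThan finite_lessThan] ..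
  finally show ?thesis unfolding const card_off_diagonal[OF finite_lessThan] by simp
qed

lemma relabel_arc_thru:
  assumes D: "D \<in> diagrams d d" and \<pi>: "\<pi> permutes {..<d}"
  shows "arc (relabel id \<pi> D) (\<pi> a) (\<pi> b) \<longleftrightarrow> arc D a b"
    "thru (relabel id \<pi> D) (\<pi> a) \<longleftrightarrow> thru D a"
proof -
  define f where "f = (\<lambda>x. (fst x, (if fst x = 0 then id else \<pi>) (snd x)) :: nat \<times> nat)"
  have R: "relabel id \<pi> D = (\<lambda>b. f ` b) ` D" by (simp add: relabel_def f_def)
  have "inj f"
  proof (rule injI)
    fix x y assume xy: "f x = f y"
    then have 1: "fst x = fst y" by (simp add: f_def)
    have "(if fst x = 0 then id else \<pi>) (snd x) = (if fst x = 0 then id else \<pi>) (snd y)"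
      using arg_cong[OF xy, of snd] unfolding f_def snd_conv 1 .
    moreover have "inj (if fst x = 0 then id else \<pi>)" using permutes_inj[OF \<pi>] by simp
    ultimately have "snd x = snd y" by (rule injD[rotated])
    with 1 show "x = y" by (rule prod_eqI)
  qed
  then have "inj (\<lambda>b. f ` b)" by (simp add: inj_def inj_image_eq_iff)
  note mem = inj_image_mem_iff[OF this]
  have "{(1, \<pi> a), (1, \<pi> b)} = f ` {(1, a), (1, b)}" for a b by (simp add: f_def)
  then show "arc (relabel id \<pi> D) (\<pi> a) (\<pi> b) \<longleftrightarrow> arc D a b" unfolding arc_def R by (simp only: mem)
  have "{(0, i), (1, \<pi> a)} = f ` {(0, i), (1, a)}" for a i by (simp add: f_def)
  then show "thru (relabel id \<pi> D) (\<pi> a) \<longleftrightarrow> thru D a" unfolding thru_def R by (simp only: mem)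
qed

section \<open>The endomorphism algebra of \<open>P\<^sup>d\<close>\<close>

context
  fixes t :: complex
begin

abbreviation bcomp_end  (infixr "\<odot>" 70) where
  "g \<odot> f \<equiv> bcomp t g f"

text \<open>The double coset element of the diagrams with \<open>j\<close> cups. The choice made by
  \<open>SOME\<close> is immaterial by \<open>W_diag\<close>.\<close>

definition W :: "nat \<Rightarrow> nat \<Rightarrow> bmor" where
  "W d j = symmetrizer d \<odot> diag (SOME D. D \<in> diagrams d d \<and> cups D = j) \<odot> symmetrizer d"

lemma symm_relabel:
  assumes D: "D \<in> diagrams d d" and \<sigma>: "\<sigma> permutes {..<d}" and \<pi>: "\<pi> permutes {..<d}"
  shows "symmetrizer d \<odot> diag (relabel \<sigma> \<pi> D) \<odot> symmetrizer d = symmetrizer d \<odot> diag D \<odot> symmetrizer d"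
proof -
  let ?S = "symmetrizer d" and ?R = "relabel id \<pi> D"
  have R: "?R \<in> diagrams d d" by (rule relabel(1)[OF D permutes_id \<pi>])
  have "relabel (inv (inv \<sigma>)) id ?R = relabel \<sigma> \<pi> D"
    unfolding relabel_def image_image inv_inv_eq[OF permutes_bij[OF \<sigma>]] by (intro image_cong) auto
  then have "diag (relabel \<sigma> \<pi> D) = diag ?R \<odot> pmor d (inv \<sigma>)"
    using dcomp_perm_right_relabel[OF R permutes_inv[OF \<sigma>]]
    by (simp add: pmor_def bcomp_diag[OF perm_diagram_in_diagrams[OF permutes_inv[OF \<sigma>]] R])
  then have "diag (relabel \<sigma> \<pi> D) \<odot> ?S = diag ?R \<odot> ?S"
    using bcomp_assoc[OF bhom_diag[OF R] pmor_in_bhom[OF permutes_inv[OF \<sigma>]] symm_in_bhom, of t]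
    by (simp add: pmor_symm[OF permutes_inv[OF \<sigma>]])
  moreover have "diag ?R = pmor d \<pi> \<odot> diag D"
    using dcomp_perm_left_relabel[OF D \<pi>]
    by (simp add: pmor_def bcomp_diag[OF D perm_diagram_in_diagrams[OF \<pi>]])
  ultimately have "?S \<odot> diag (relabel \<sigma> \<pi> D) \<odot> ?S = ?S \<odot> (pmor d \<pi> \<odot> diag D) \<odot> ?S" by simp
  also have "\<dots> = ?S \<odot> pmor d \<pi> \<odot> diag D \<odot> ?S"
    using bcomp_assoc[OF pmor_in_bhom[OF \<pi>] bhom_diag[OF D] symm_in_bhom, of t] by simp
  also have "\<dots> = (?S \<odot> pmor d \<pi>) \<odot> diag D \<odot> ?S"
    by (rule bcomp_assoc[OF symm_in_bhom pmor_in_bhom[OF \<pi>] bcomp_in_bhom[OF bhom_diag[OF D] symm_in_bhom]])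
  finally show ?thesis by (simp add: symm_pmor[OF \<pi>])
qed

text \<open>Equal numbers of cups mean the same double coset, and the symmetrizers on both sides
  absorb the two permutations.\<close>

theorem W_diag:
  assumes D: "D \<in> diagrams d d"
  shows "symmetrizer d \<odot> diag D \<odot> symmetrizer d = W d (cups D)"
proof -
  define D' where "D' = (SOME D'. D' \<in> diagrams d d \<and> cups D' = cups D)"
  have D': "D' \<in> diagrams d d \<and> cups D' = cups D"
    unfolding D'_def by (rule someI[of _ D]) (simp add: D)
  then obtain \<sigma> \<pi> where "\<sigma> permutes {..<d}" "\<pi> permutes {..<d}" "D' = relabel \<sigma> \<pi> D"
    using same_cups_relabel[OF D] by metis
  then show ?thesis unfolding W_def D'_def[symmetric] using symm_relabel[OF D] by simp
qed

lemma W_in_bhom: "2 * j \<le> d \<Longrightarrow> W d j \<in> bhom d d"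
proof -
  assume "2 * j \<le> d"
  then obtain D where D: "D \<in> diagrams d d" "cups D = j" using exists_cups by blast
  then show ?thesis
    using bcomp_in_bhom[OF symm_in_bhom bcomp_in_bhom[OF bhom_diag[OF D(1)] symm_in_bhom], of t t] W_diag[OF D(1)] by simp
qed

text \<open>The case distinction of \<open>cap_arc\<close> and \<open>cap_merge\<close> written as a
  generic value plus two corrections, so that summing over pairs of targets only requires counting
  arcs and pairs of through strands.\<close>

lemma cap_comp_W:
  assumes D: "D \<in> diagrams (2 + r) (2 + r)"
  shows "symmetrizer (2 + r) \<odot> ((cupcap t \<otimes> idm r) \<odot> diag D) \<odot> symmetrizer (2 + r) =
    W (2 + r) (cups D) + (if arc D 0 1 then (t - 1) \<bullet>\<^sub>s W (2 + r) (cups D) else 0) +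
    (if thru D 0 \<and> thru D 1 then W (2 + r) (Suc (cups D)) - W (2 + r) (cups D) else 0)"
proof -
  note X = dcomp_in_diagrams[OF D cap_diagram_in_diagrams]
  have "(cupcap t \<otimes> idm r) \<odot> diag D = t ^ loops (cap_diagram r) D \<bullet>\<^sub>s diag (dcomp (cap_diagram r) D)"
    unfolding cupcap_diag idm_def btensor_diag by (rule bcomp_diag[OF D cap_diagram_in_diagrams])
  then have "symmetrizer (2 + r) \<odot> ((cupcap t \<otimes> idm r) \<odot> diag D) \<odot> symmetrizer (2 + r) =
    t ^ loops (cap_diagram r) D \<bullet>\<^sub>s W (2 + r) (cups (dcomp (cap_diagram r) D))"
    by (simp only: bmor_linear W_diag[OF X])
  then show ?thesis
    using cap_arc[OF D] cap_merge[OF D] thru_not_arc[OF D, of 0 1]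
    by (cases "arc D 0 1") (auto simp: bmor.scale_left_diff_distrib)
qed


lemma symm_W: "symmetrizer d \<odot> W d j = W d j" "W d j \<odot> symmetrizer d = W d j" if j: "2 * j \<le> d"
proof -
  obtain D where D: "D \<in> diagrams d d" "cups D = j" using exists_cups[OF j] by blast
  note S = symm_in_bhom[of d] and DD = bhom_diag[OF D(1)]
  have W: "W d j = symmetrizer d \<odot> diag D \<odot> symmetrizer d" using W_diag[OF D(1)] D(2) by simp
  show "symmetrizer d \<odot> W d j = W d j"
    unfolding W by (simp add: bcomp_assoc[OF S S bcomp_in_bhom[OF DD S]] symm_symm)
  show "W d j \<odot> symmetrizer d = W d j"
    unfolding W using bcomp_assoc[OF S bcomp_in_bhom[OF DD S] S, of t t] bcomp_assoc[OF DD S S, of t]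
    by (simp add: symm_symm)
qed

lemma W_0: "W d 0 = symmetrizer d"
  using W_diag[OF perm_diagram_in_diagrams[OF permutes_id], of d]
  by (simp add: cups_perm_diagram idm_def[symmetric] bcomp_idm_left[OF symm_in_bhom] symm_symm)

text \<open>The symmetrizer between the cup-cap and the diagram replaces the targets 0 and 1 by a
  uniformly distributed ordered pair. Of the \<open>d * (d - 1)\<close> pairs, \<open>2 * j\<close>
  are arcs and \<open>(d - 2 * j) * (d - 2 * j - 1)\<close> consist of two through strands.\<close>

lemma cap_W:
  assumes d: "d = 2 + r" and j: "2 * j \<le> d"
  shows "of_nat (d * (d - 1)) \<bullet>\<^sub>s (symmetrizer d \<odot> (cupcap t \<otimes> idm r) \<odot> W d j) =
    (of_nat (d * (d - 1)) + (t - 1) * of_nat (2 * j) - of_nat ((d - 2 * j) * (d - 2 * j - 1))) \<bullet>\<^sub>s W d j +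
    of_nat ((d - 2 * j) * (d - 2 * j - 1)) \<bullet>\<^sub>s W d (Suc j)"
proof -
  obtain D where D: "D \<in> diagrams d d" and cD: "cups D = j" using exists_cups[OF j] by blast
  let ?S = "symmetrizer d" and ?K = "cupcap t \<otimes> idm r"
  let ?O = "{(a, b). a \<in> {..<d} \<and> b \<in> {..<d} \<and> a \<noteq> b}"
  note S = symm_in_bhom[of d] and DD = bhom_diag[OF D]
  have K: "?K \<in> bhom d d" unfolding d by (intro btensor_in_bhom cupcap_in_bhom idm_in_bhom)
  define G where "G a b = W d j + (if arc D a b then (t - 1) \<bullet>\<^sub>s W d j else 0) +
    (if thru D a \<and> thru D b then W d (Suc j) - W d j else 0)" for a b
  have "?S \<odot> ?K \<odot> W d j = ?S \<odot> (?K \<odot> (?S \<odot> diag D)) \<odot> ?S"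
    unfolding W_diag[OF D, unfolded cD, symmetric]
    using bcomp_assoc[OF S DD S, of t] bcomp_assoc[OF K bcomp_in_bhom[OF S DD] S, of t t] by simp
  also have "\<dots> = (1 / fact d) \<bullet>\<^sub>s (\<Sum>\<pi> | \<pi> permutes {..<d}. ?S \<odot> (?K \<odot> (pmor d \<pi> \<odot> diag D)) \<odot> ?S)"
    by (rule symm_expand[where \<phi> = "\<lambda>f. ?S \<odot> (?K \<odot> (f \<odot> diag D)) \<odot> ?S"]) (simp_all add: bmor_linear)
  finally have 1: "?S \<odot> ?K \<odot> W d j = (1 / fact d) \<bullet>\<^sub>s (\<Sum>\<pi> | \<pi> permutes {..<d}. ?S \<odot> (?K \<odot> (pmor d \<pi> \<odot> diag D)) \<odot> ?S)" .
  \<comment> \<open>Relabelling the targets by \<open>\<pi>\<close> turns a question about targets 0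
    and 1 into one about their preimages in \<open>D\<close>.\<close>
  have "?S \<odot> (?K \<odot> (pmor d \<pi> \<odot> diag D)) \<odot> ?S = G (inv \<pi> 0) (inv \<pi> 1)" if \<pi>: "\<pi> permutes {..<d}" for \<pi>
  proof -
    have R: "relabel id \<pi> D \<in> diagrams d d" "cups (relabel id \<pi> D) = j"
      using relabel[OF D permutes_id \<pi>] cD by auto
    have "pmor d \<pi> \<odot> diag D = diag (relabel id \<pi> D)"
      using dcomp_perm_left_relabel[OF D \<pi>]
      by (simp add: pmor_def bcomp_diag[OF D perm_diagram_in_diagrams[OF \<pi>]])
    then show ?thesis
      using cap_comp_W[of "relabel id \<pi> D" r] R
        relabel_arc_thru(1)[OF D \<pi>, of "inv \<pi> 0" "inv \<pi> 1"] relabel_arc_thru(2)[OF D \<pi>, of "inv \<pi> 0"]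
        relabel_arc_thru(2)[OF D \<pi>, of "inv \<pi> 1"] permutes_inverses(1)[OF \<pi>]
      unfolding G_def d by simp
  qed
  then have "(\<Sum>\<pi> | \<pi> permutes {..<d}. ?S \<odot> (?K \<odot> (pmor d \<pi> \<odot> diag D)) \<odot> ?S) =
      (\<Sum>\<pi> | \<pi> permutes {..<d}. G (inv \<pi> 0) (inv \<pi> 1))"
    by (intro sum.cong refl) simp
  also have "\<dots> = (\<Sum>\<pi> | \<pi> permutes {..<d}. G (\<pi> 0) (\<pi> 1))"
    by (rule sum_permutations_inverse[symmetric])
  finally have "of_nat (d * (d - 1)) \<bullet>\<^sub>s (?S \<odot> ?K \<odot> W d j) =
     (1 / fact d) \<bullet>\<^sub>s (of_nat (d * (d - 1)) \<bullet>\<^sub>s (\<Sum>\<pi> | \<pi> permutes {..<d}. G (\<pi> 0) (\<pi> 1)))"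
    unfolding 1 by (simp only: bmor.scale_scale mult.commute)
  also have "\<dots> = (\<Sum>(a, b)\<in>?O. G a b)"
  proof -
    have "2 \<le> d" using d by simp
    then show ?thesis unfolding average_pairs[OF \<open>2 \<le> d\<close>] by simp
  qed
  also have "\<dots> = (of_nat (d * (d - 1)) + (t - 1) * of_nat (2 * j) - of_nat ((d - 2 * j) * (d - 2 * j - 1))) \<bullet>\<^sub>s W d j +
    of_nat ((d - 2 * j) * (d - 2 * j - 1)) \<bullet>\<^sub>s W d (Suc j)"
  proof -
    have const: "(\<Sum>x\<in>I. c) = of_nat (card I) \<bullet>\<^sub>s c" for I :: "(nat \<times> nat) set" and c :: bmor
      by (induction I rule: infinite_finite_induct) (simp_all add: bmor.scale_left_distrib)
    have fO: "finite ?O" by (rule finite_subset[of _ "{..<d} \<times> {..<d}"]) auto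
    have filt: "(\<Sum>(a, b)\<in>?O. if P a b then c else 0) = of_nat (card {(a, b). a < d \<and> b < d \<and> a \<noteq> b \<and> P a b}) \<bullet>\<^sub>s c"
      for P and c :: bmor
    proof -
      have "(\<Sum>(a, b)\<in>?O. if P a b then c else 0) = (\<Sum>x\<in>?O. if x \<in> {(a, b). P a b} then c else 0)"
        by (intro sum.cong refl) auto
      also have "\<dots> = (\<Sum>x\<in>?O \<inter> {(a, b). P a b}. c)"
        by (rule sum.inter_restrict[OF fO, symmetric])
      also have "?O \<inter> {(a, b). P a b} = {(a, b). a < d \<and> b < d \<and> a \<noteq> b \<and> P a b}" by auto
      finally show ?thesis unfolding const .
    qed
    have a: "{(a, b). a < d \<and> b < d \<and> a \<noteq> b \<and> arc D a b} = {(a, b). a < d \<and> b < d \<and> arc D a b}"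
      using arc_neq[OF D] by auto
    have th: "card {(a, b). a < d \<and> b < d \<and> a \<noteq> b \<and> thru D a \<and> thru D b} = (d - 2 * j) * (d - 2 * j - 1)"
    proof -
      have "{(a, b). a < d \<and> b < d \<and> a \<noteq> b \<and> thru D a \<and> thru D b} =
        {(a, b). a \<in> {a. a < d \<and> thru D a} \<and> b \<in> {a. a < d \<and> thru D a} \<and> a \<noteq> b}" by auto
      then show ?thesis using card_off_diagonal[of "{a. a < d \<and> thru D a}"] card_thru[OF D] cD by simp
    qed
    have "(\<Sum>(a, b)\<in>?O. G a b) = (\<Sum>(a, b)\<in>?O. W d j) + (\<Sum>(a, b)\<in>?O. if arc D a b then (t - 1) \<bullet>\<^sub>s W d j else 0)
       + (\<Sum>(a, b)\<in>?O. if thru D a \<and> thru D b then W d (Suc j) - W d j else 0)"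
      unfolding G_def split_beta by (simp only: sum.distrib)
    also have "(\<Sum>(a, b)\<in>?O. W d j) = of_nat (d * (d - 1)) \<bullet>\<^sub>s W d j"
    proof -
      have "(\<Sum>(a, b)\<in>?O. W d j) = (\<Sum>x\<in>?O. W d j)" by (intro sum.cong refl) auto
      then show ?thesis unfolding const card_off_diagonal[OF finite_lessThan] by simp
    qed
    also have "(\<Sum>(a, b)\<in>?O. if arc D a b then (t - 1) \<bullet>\<^sub>s W d j else 0) = of_nat (2 * j) \<bullet>\<^sub>s ((t - 1) \<bullet>\<^sub>s W d j)"
      unfolding filt a card_arcs[OF D] cD ..
    also have "(\<Sum>(a, b)\<in>?O. if thru D a \<and> thru D b then W d (Suc j) - W d j else 0) =
       of_nat ((d - 2 * j) * (d - 2 * j - 1)) \<bullet>\<^sub>s (W d (Suc j) - W d j)"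
      unfolding filt th ..
    finally show ?thesis
      by (simp only: bmor.scale_left_distrib bmor.scale_left_diff_distrib bmor.scale_right_diff_distrib bmor.scale_scale mult.commute)
        (simp add: algebra_simps)
  qed
  finally show ?thesis .
qed

text \<open>\<open>u d j\<close> is the restriction of \<open>\<Theta>\<^sup>j \<Delta>\<^sup>j\<close> to \<open>P\<^sup>d\<close>.\<close>
definition u :: "nat \<Rightarrow> nat \<Rightarrow> bmor" where
  "u d j = (if 2 * j \<le> d then (fact d / (4 ^ j * fact (d - 2 * j))) \<bullet>\<^sub>s W d j else 0)"

lemma u_0: "u d 0 = symmetrizer d"
  by (simp add: u_def W_0)

lemma u_in_bhom: "u d j \<in> bhom d d"
  by (simp add: u_def bhom_scale W_in_bhom bhom_0)

lemma symm_u: "symmetrizer d \<odot> u d j = u d j" "u d j \<odot> symmetrizer d = u d j"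
  by (simp_all add: u_def bmor_linear symm_W)

text \<open>\<open>cap_W\<close> after rescaling: the normalization of \<open>u\<close> is the one
  that makes the coefficient of \<open>u d (Suc j)\<close> equal to 1. The other coefficient comes
  from d(d - 1) + 2j(t - 1) - m(m - 1) with m = d - 2j, which is 4j(d - j - 1 + t/2).\<close>

theorem U_u:
  "U t d \<odot> u d j = u d (Suc j) + (of_nat j * (of_nat d - of_nat j - 1 + t / 2)) \<bullet>\<^sub>s u d j"
proof (cases "2 * j \<le> d")
  case False
  then show ?thesis by (simp add: u_def bmor_linear)
next
  case j: True
  show ?thesis
  proof (cases "d < 2")
    case True
    then have "j = 0" "\<not> 2 * Suc j \<le> d" using j by auto
    then show ?thesis using True by (simp add: U_less_2 u_def bmor_linear)
  next
    case False
    define r where "r = d - 2"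
    have d: "d = 2 + r" using False by (simp add: r_def)
    define m where "m = d - 2 * j"
    have dm: "d = m + 2 * j" using j by (simp add: m_def)
    let ?S = "symmetrizer d" and ?K = "cupcap t \<otimes> idm r"
    define Y where "Y = ?S \<odot> ?K \<odot> W d j"
    have K: "?K \<in> bhom d d" unfolding d by (intro btensor_in_bhom cupcap_in_bhom idm_in_bhom)
    note S = symm_in_bhom[of d] and WW = W_in_bhom[OF j]
    have fr: "fact d / fact r = (of_nat (d * (d - 1)) :: complex)"
      unfolding d by (simp add: field_simps)
    have "U t d = (1 / 4 * of_nat (d * (d - 1))) \<bullet>\<^sub>s (?S \<odot> ?K \<odot> ?S)"
      using Theta_Delta[of t r] fr unfolding U_def d by simp
    moreover have "(?S \<odot> ?K \<odot> ?S) \<odot> W d j = Y"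
      unfolding Y_def using bcomp_assoc[OF S bcomp_in_bhom[OF K S] WW, of t t] bcomp_assoc[OF K S WW, of t] symm_W(1)[OF j] by simp
    ultimately have "U t d \<odot> W d j = (1 / 4) \<bullet>\<^sub>s (of_nat (d * (d - 1)) \<bullet>\<^sub>s Y)"
      by (simp only: bmor_linear bmor.scale_scale)
    also have "of_nat (d * (d - 1)) \<bullet>\<^sub>s Y = (of_nat (d * (d - 1)) + (t - 1) * of_nat (2 * j) - of_nat (m * (m - 1))) \<bullet>\<^sub>s W d j +
      of_nat (m * (m - 1)) \<bullet>\<^sub>s W d (Suc j)"
      unfolding Y_def m_def by (rule cap_W[OF d j])
    also have "of_nat (d * (d - 1)) + (t - 1) * of_nat (2 * j) - of_nat (m * (m - 1)) =
       4 * (of_nat j * (of_nat d - of_nat j - 1 + t / 2))"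
    proof -
      have e: "of_nat (n * (n - 1)) = (of_nat n * (of_nat n - 1) :: complex)" for n
        by (cases n) (auto simp: algebra_simps)
      have dd: "of_nat d = (of_nat m + 2 * of_nat j :: complex)" unfolding dm by simp
      show ?thesis unfolding e dd by (simp add: algebra_simps)
    qed
    finally have UW: "U t d \<odot> W d j = (of_nat j * (of_nat d - of_nat j - 1 + t / 2)) \<bullet>\<^sub>s W d j +
      (1 / 4 * of_nat (m * (m - 1))) \<bullet>\<^sub>s W d (Suc j)"
      by (simp only: bmor.scale_right_distrib bmor.scale_scale) simp
    have next_u: "u d (Suc j) = (fact d / (4 ^ j * fact m) * (1 / 4 * of_nat (m * (m - 1)))) \<bullet>\<^sub>s W d (Suc j)"
    proof (cases "2 \<le> m")
      case True
      then obtain m' where m': "m = Suc (Suc m')" by (metis add_2_eq_Suc le_Suc_ex)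
      then have "2 * Suc j \<le> d" "d - 2 * Suc j = m'" using dm by auto
      define q :: complex where "q = of_nat (m * (m - 1))"
      have "q \<noteq> 0" unfolding q_def m' of_nat_eq_0_iff by simp
      moreover have "fact m = q * fact m'" unfolding q_def m' by (simp add: algebra_simps)
      ultimately have "fact d / (4 ^ Suc j * fact m') = fact d / (4 ^ j * fact m) * (1 / 4 * q)"
        by (simp add: field_simps)
      then show ?thesis
        using \<open>2 * Suc j \<le> d\<close> \<open>d - 2 * Suc j = m'\<close> unfolding u_def q_def by (simp only: if_True)
    next
      case False
      \<comment> \<open>At most one through strand is left; the coefficient vanishes, in agreement
        with \<open>u\<close> being 0 beyond \<open>d div 2\<close>.\<close>
      then have "m * (m - 1) = 0" "\<not> 2 * Suc j \<le> d" using dm by auto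
      then show ?thesis unfolding u_def by simp
    qed
    have uj: "u d j = (fact d / (4 ^ j * fact m)) \<bullet>\<^sub>s W d j" using j by (simp only: u_def m_def if_True)
    show ?thesis
      unfolding next_u uj bmor_linear UW
      by (simp only: bmor.scale_right_distrib bmor.scale_scale mult.commute add.commute)
  qed
qed

text \<open>Identity strands add no cups and the outer symmetrizers absorb the inner ones, so only
  the normalization of \<open>u\<close> changes. The ratio of factorials becomes the binomial
  coefficient in \<open>act_capelli\<close>.\<close>

lemma u_tensor:
  assumes j: "2 * j \<le> d"
  shows "(fact (d + r) / fact d) \<bullet>\<^sub>s (symmetrizer (d + r) \<odot> (u d j \<otimes> idm r) \<odot> symmetrizer (d + r)) =
    (fact (d + r - 2 * j) / fact (d - 2 * j)) \<bullet>\<^sub>s u (d + r) j"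
proof -
  let ?S = "symmetrizer (d + r)" and ?s = "symmetrizer d"
  obtain D where D: "D \<in> diagrams d d" and cD: "cups D = j" using exists_cups[OF j] by blast
  let ?E = "dtensor D (perm_diagram r id)"
  have I: "perm_diagram r id \<in> diagrams r r" by (intro perm_diagram_in_diagrams permutes_id)
  have E: "?E \<in> diagrams (d + r) (d + r)" by (rule dtensor_in_diagrams[OF D I])
  note S = symm_in_bhom[of "d + r"] and s = symm_in_bhom[of d] and DD = bhom_diag[OF D] and EE = bhom_diag[OF E]
  have si: "?s \<otimes> idm r \<in> bhom (d + r) (d + r)" by (intro btensor_in_bhom symm_in_bhom idm_in_bhom)
  have diE: "diag D \<otimes> idm r = diag ?E" by (simp add: idm_def btensor_diag)
  have "W d j \<otimes> idm r = (?s \<otimes> idm r) \<odot> diag ?E \<odot> (?s \<otimes> idm r)"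
    unfolding W_diag[OF D, unfolded cD, symmetric]
    using comp_tensor_idm[OF s bcomp_in_bhom[OF DD s], of t t r] comp_tensor_idm[OF DD s, of t r]
    by (simp add: diE)
  then have "?S \<odot> (W d j \<otimes> idm r) \<odot> ?S = (?S \<odot> (?s \<otimes> idm r)) \<odot> diag ?E \<odot> (?s \<otimes> idm r) \<odot> ?S"
    using bcomp_assoc[OF S si bcomp_in_bhom[OF EE bcomp_in_bhom[OF si S]], of t t t]
      bcomp_assoc[OF si bcomp_in_bhom[OF EE si] S, of t t] bcomp_assoc[OF EE si S, of t] by simp
  also have "\<dots> = ?S \<odot> diag ?E \<odot> ?S" by (simp add: symm_idm_tensor)
  also have "\<dots> = W (d + r) j"
    using W_diag[OF E] cups_dtensor[OF D I] cD by (simp add: cups_perm_diagram)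
  finally have "?S \<odot> (W d j \<otimes> idm r) \<odot> ?S = W (d + r) j" .
  then show ?thesis using j by (simp add: u_def bmor_linear field_simps)
qed

text \<open>The total coefficient of the diagrams with \<open>j\<close> cups. It is returned as a
  multiple of the placeholder \<open>diag {}\<close> instead of a number, so that
  \<open>symm_avg\<close> applies to it.\<close>

definition cups_part :: "nat \<Rightarrow> bmor \<Rightarrow> bmor" where
  "cups_part j = linext (\<lambda>D. if cups D = j then diag {} else 0)"

lemma cups_part_W:
  assumes "2 * i \<le> d"
  shows "cups_part j (W d i) = (if i = j then diag {} else 0)"
proof -
  obtain D where D: "D \<in> diagrams d d" and cD: "cups D = i" using exists_cups[OF assms] by blast
  let ?S = "symmetrizer d" and ?c = "if i = j then diag {} else 0"
  have "cups_part j (?S \<odot> diag D \<odot> ?S) = ?c"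
  proof (rule symm_avg[where \<phi> = "\<lambda>f. cups_part j (f \<odot> diag D \<odot> ?S)"])
    fix \<pi> assume \<pi>: "\<pi> permutes {..<d}"
    show "cups_part j (pmor d \<pi> \<odot> diag D \<odot> ?S) = ?c"
    proof (rule symm_avg[where \<phi> = "\<lambda>f. cups_part j (pmor d \<pi> \<odot> diag D \<odot> f)"])
      fix \<sigma> assume \<sigma>: "\<sigma> permutes {..<d}"
      have R: "relabel (inv \<sigma>) id D \<in> diagrams d d" "cups (relabel (inv \<sigma>) id D) = i"
        using relabel[OF D permutes_inv[OF \<sigma>] permutes_id] cD by auto
      have "diag D \<odot> pmor d \<sigma> = diag (relabel (inv \<sigma>) id D)"
        using dcomp_perm_right_relabel[OF D \<sigma>]
        by (simp add: pmor_def bcomp_diag[OF perm_diagram_in_diagrams[OF \<sigma>] D])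
      moreover have "pmor d \<pi> \<odot> \<dots> = diag (relabel id \<pi> (relabel (inv \<sigma>) id D))"
        using dcomp_perm_left_relabel[OF R(1) \<pi>]
        by (simp add: pmor_def bcomp_diag[OF R(1) perm_diagram_in_diagrams[OF \<pi>]])
      ultimately show "cups_part j (pmor d \<pi> \<odot> diag D \<odot> pmor d \<sigma>) = ?c"
        using relabel(2)[OF R(1) permutes_id \<pi>] R(2) by (simp add: cups_part_def)
    qed (simp_all add: bmor_linear cups_part_def linext_add linext_scale)
  qed (simp_all add: bmor_linear cups_part_def linext_add linext_scale)
  then show ?thesis using W_diag[OF D] cD by simp
qed

lemma u_independent:
  assumes sum: "(\<Sum>i\<le>d div 2. a i \<bullet>\<^sub>s u d i) = 0" and j: "j \<le> d div 2"
  shows "a j = 0"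
proof -
  define c :: "nat \<Rightarrow> complex" where "c i = fact d / (4 ^ i * fact (d - 2 * i))" for i
  have "cups_part j (\<Sum>i\<in>I. f i) = (\<Sum>i\<in>I. cups_part j (f i))" for f and I :: "nat set"
    by (induction I rule: infinite_finite_induct) (simp_all add: cups_part_def linext_add)
  then have "cups_part j (\<Sum>i\<le>d div 2. a i \<bullet>\<^sub>s u d i) = (\<Sum>i\<le>d div 2. cups_part j (a i \<bullet>\<^sub>s u d i))" .
  also have "\<dots> = (\<Sum>i\<le>d div 2. if i = j then (a j * c j) \<bullet>\<^sub>s diag {} else 0)"
  proof (intro sum.cong refl)
    fix i assume "i \<in> {..d div 2}"
    then have i: "2 * i \<le> d" by auto
    then have "u d i = c i \<bullet>\<^sub>s W d i" by (simp add: u_def c_def)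
    then have "cups_part j (a i \<bullet>\<^sub>s u d i) = (a i * c i) \<bullet>\<^sub>s cups_part j (W d i)"
      by (simp add: cups_part_def linext_scale)
    then show "cups_part j (a i \<bullet>\<^sub>s u d i) = (if i = j then (a j * c j) \<bullet>\<^sub>s diag {} else 0)"
      using cups_part_W[OF i, of j] by simp
  qed
  also have "\<dots> = (a j * c j) \<bullet>\<^sub>s diag {}" using j by simp
  finally have "(a j * c j) \<bullet>\<^sub>s diag {} = 0" unfolding sum by (simp add: cups_part_def)
  from arg_cong[OF this, of "\<lambda>x. Poly_Mapping.lookup x {}"] show ?thesis by (simp add: lookup_diag c_def)
qed

end

section \<open>Polynomials in the Casimir operator\<close>

text \<open>The Casimir eigenvalue a(a + t - 2) at a = d - 2i, that is \<open>c_val\<close> of the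
  partition (d - i, i).\<close>

definition node :: "complex \<Rightarrow> nat \<Rightarrow> nat \<Rightarrow> complex" where
  "node t d i = (of_nat d - 2 * of_nat i) * (of_nat d - 2 * of_nat i + t - 2)"

definition newton :: "complex \<Rightarrow> nat \<Rightarrow> nat \<Rightarrow> complex poly" where
  "newton t d j = (\<Prod>i<j. [:node t d i / 4, - 1 / 4:])"

definition nodal :: "complex \<Rightarrow> nat \<Rightarrow> complex poly" where
  "nodal t d = (\<Prod>i\<le>d div 2. [:- node t d i, 1:])"

lemma node_diff: "node t d i - node t d r = 4 * (of_nat r - of_nat i) * (of_nat d - 1 + t / 2 - of_nat r - of_nat i)"
  by (simp add: node_def algebra_simps)

lemma degree_newton: "degree (newton t d j) = j"
proof -
  have "degree (newton t d j) = (\<Sum>i<j. degree [:node t d i / 4, - 1 / 4:])"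
    unfolding newton_def by (rule degree_prod_eq_sum_degree) auto
  then show ?thesis by simp
qed

lemma newton_0: "newton t d 0 = 1"
  by (simp add: newton_def)

lemma newton_Suc: "newton t d (Suc j) = newton t d j * [:node t d j / 4, - 1 / 4:]"
  by (simp add: newton_def)

text \<open>This turns the vanishing of \<open>u\<close> beyond \<open>d div 2\<close> into an
  annihilating polynomial of the Casimir operator.\<close>

lemma newton_nodal: "newton t d (Suc (d div 2)) = smult ((- 1 / 4) ^ Suc (d div 2)) (nodal t d)"
proof -
  have "[:c / 4, - 1 / 4:] = [:- 1 / 4:] * [:- c, 1:]" for c :: complex by simp
  then have "newton t d (Suc (d div 2)) = (\<Prod>i\<le>d div 2. [:- 1 / 4:] * [:- node t d i, 1:])"
    unfolding newton_def lessThan_Suc_atMost by simp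
  also have "\<dots> = [:- 1 / 4:] ^ Suc (d div 2) * nodal t d"
    unfolding nodal_def prod.distrib by simp
  also have "[:- 1 / 4:] ^ n = [:(- 1 / 4 :: complex) ^ n:]" for n
    by (induction n) simp_all
  finally show ?thesis by simp
qed

lemma nodal_ne_0: "nodal t d \<noteq> 0"
  by (simp add: nodal_def)

lemma degree_nodal: "degree (nodal t d) = Suc (d div 2)"
  unfolding nodal_def by (subst degree_prod_eq_sum_degree) auto

lemma lead_coeff_nodal: "lead_coeff (nodal t d) = 1"
  unfolding nodal_def by (simp add: lead_coeff_prod)

lemma newton_expansion:
  assumes "degree p \<le> n"
  shows "\<exists>a. p = (\<Sum>j\<le>n. smult (a j) (newton t d j))"
  using assms
proof (induction n arbitrary: p)
  case 0
  then obtain c where "p = [:c:]" by (metis degree_eq_zeroE le_zero_eq)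
  then show ?case by (intro exI[of _ "\<lambda>_. c"]) (simp add: newton_0)
next
  case (Suc n)
  define N where "N = newton t d (Suc n)"
  define c where "c = coeff p (Suc n) / coeff N (Suc n)"
  have N0: "coeff N (Suc n) \<noteq> 0"
    using degree_newton[of t d "Suc n"] unfolding N_def by (metis degree_0 leading_coeff_0_iff nat.distinct(1))
  have "degree (p - smult c N) \<le> n"
  proof (rule degree_le, intro allI impI)
    fix i assume i: "n < i"
    show "coeff (p - smult c N) i = 0"
    proof (cases "i = Suc n")
      case True
      then show ?thesis using N0 by (simp add: c_def)
    next
      case False
      then have "coeff p i = 0" "coeff N i = 0"
        using i Suc.prems degree_newton[of t d "Suc n"] unfolding N_def by (auto intro: coeff_eq_0)
      then show ?thesis by simp
    qed
  qed
  then obtain a where a: "p - smult c N = (\<Sum>j\<le>n. smult (a j) (newton t d j))" using Suc.IH by blast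
  then have "p = (\<Sum>j\<le>n. smult (a j) (newton t d j)) + smult c N" by (simp add: algebra_simps)
  then show ?case
    by (intro exI[of _ "\<lambda>j. if j = Suc n then c else a j"]) (simp add: N_def)
qed

section \<open>Evaluation of polynomials at the Casimir operator\<close>

context
  fixes t :: complex and d :: nat
begin

abbreviation bcomp_cas  (infixr "\<odot>" 70) where
  "g \<odot> f \<equiv> bcomp t g f"

text \<open>An algebra homomorphism from polynomials to the endomorphisms of \<open>symP d\<close>,
  whose unit is \<open>symmetrizer d\<close>.\<close>

definition rho :: "complex poly \<Rightarrow> bmor" where
  "rho p = end_poly t (symP d) p (casimir t d)"

text \<open>\<open>U_u\<close> at j = 0 expresses \<open>U\<close> through elements already known to
  lie in \<open>bhom d d\<close>.\<close>

lemma casimir_in_bhom: "casimir t d \<in> bhom d d"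
proof -
  have "U t d \<odot> u t d 0 \<in> bhom d d"
    unfolding U_u by (intro bhom_add bhom_scale u_in_bhom)
  moreover have "U t d = U t d \<odot> u t d 0"
  proof (cases "d < 2")
    case True
    then show ?thesis by (simp add: U_less_2 bmor_linear)
  next
    case False
    define r where "r = d - 2"
    have d: "d = 2 + r" using False by (simp add: r_def)
    have K: "cupcap t \<otimes> idm r \<in> bhom d d" unfolding d by (intro btensor_in_bhom cupcap_in_bhom idm_in_bhom)
    note S = symm_in_bhom[of d]
    have "U t d = (1 / 4 * (fact d / fact r)) \<bullet>\<^sub>s (symmetrizer d \<odot> (cupcap t \<otimes> idm r) \<odot> symmetrizer d)"
      using Theta_Delta[of t r] unfolding U_def d by simp
    then show ?thesis
      using bcomp_assoc[OF S bcomp_in_bhom[OF K S] S, of t t] bcomp_assoc[OF K S S, of t]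
      by (simp add: u_0 bmor_linear symm_symm)
  qed
  ultimately have "U t d \<in> bhom d d" by simp
  then show ?thesis unfolding casimir_eq by (intro bhom_diff bhom_scale symm_in_bhom)
qed

text \<open>The diagonal coefficient d(d + t - 2) - 4j(d - j - 1 + t/2), obtained from
  \<open>casimir_eq\<close> and \<open>U_u\<close>, is the eigenvalue of index j.\<close>

lemma casimir_u: "casimir t d \<odot> u t d j = node t d j \<bullet>\<^sub>s u t d j - 4 \<bullet>\<^sub>s u t d (Suc j)"
proof -
  have n: "node t d j = of_nat d * (of_nat d + t - 2) - 4 * (of_nat j * (of_nat d - of_nat j - 1 + t / 2))"
    by (simp add: node_def algebra_simps)
  show ?thesis
    unfolding casimir_eq n bcomp_diff_left bmor_linear U_u symm_u
    by (simp only: bmor.scale_right_distrib bmor.scale_left_diff_distrib bmor.scale_scale) (simp add: algebra_simps)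
qed

lemma casimir_symm: "casimir t d \<odot> symmetrizer d = casimir t d" "symmetrizer d \<odot> casimir t d = casimir t d"
proof -
  have 1: "casimir t d = node t d 0 \<bullet>\<^sub>s u t d 0 - 4 \<bullet>\<^sub>s u t d (Suc 0)" if "casimir t d \<odot> symmetrizer d = casimir t d"
    using casimir_u[of 0] that by (simp add: u_0)
  show 2: "casimir t d \<odot> symmetrizer d = casimir t d"
  proof -
    have "U t d \<odot> symmetrizer d = U t d"
    proof (cases "d < 2")
      case True
      then show ?thesis by (simp add: U_less_2 bmor_linear)
    next
      case False
      define r where "r = d - 2"
      have d: "d = 2 + r" using False by (simp add: r_def)
      have K: "cupcap t \<otimes> idm r \<in> bhom d d" unfolding d by (intro btensor_in_bhom cupcap_in_bhom idm_in_bhom)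
      note S = symm_in_bhom[of d]
      have "U t d = (1 / 4 * (fact d / fact r)) \<bullet>\<^sub>s (symmetrizer d \<odot> (cupcap t \<otimes> idm r) \<odot> symmetrizer d)"
        using Theta_Delta[of t r] unfolding U_def d by simp
      then show ?thesis
        using bcomp_assoc[OF S bcomp_in_bhom[OF K S] S, of t t] bcomp_assoc[OF K S S, of t]
        by (simp add: bmor_linear symm_symm)
    qed
    then show ?thesis unfolding casimir_eq by (simp add: bcomp_diff_left bmor_linear symm_symm)
  qed
  show "symmetrizer d \<odot> casimir t d = casimir t d"
    unfolding 1[OF 2] by (simp only: bcomp_diff_right bmor_linear symm_u)
qed

lemma end_pow_in_bhom: "end_pow t (symP d) (casimir t d) n \<in> bhom d d"
  by (induction n) (simp_all add: symP_def symm_in_bhom bcomp_in_bhom[OF casimir_in_bhom])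

lemma rho_sum:
  assumes "degree p \<le> n"
  shows "rho p = (\<Sum>i\<le>n. coeff p i \<bullet>\<^sub>s end_pow t (symP d) (casimir t d) i)"
  unfolding rho_def end_poly_def using assms
  by (intro sum.mono_neutral_left) (auto simp: coeff_eq_0)

lemma rho_in_bhom: "rho p \<in> bhom d d"
  unfolding rho_def end_poly_def by (intro bhom_sum bhom_scale end_pow_in_bhom)

lemma rho_add: "rho (p + q) = rho p + rho q"
proof -
  let ?n = "max (degree p) (degree q)"
  have "degree (p + q) \<le> ?n" by (rule degree_add_le_max)
  then show ?thesis
    by (simp add: rho_sum[of _ ?n] bmor.scale_left_distrib sum.distrib)
qed

lemma rho_smult: "rho (smult c p) = c \<bullet>\<^sub>s rho p"
  by (simp add: rho_sum[of "smult c p" "degree p"] rho_sum[of p "degree p"] bmor.scale_sum_right)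

lemma rho_0: "rho 0 = 0"
  by (simp add: rho_def end_poly_def)

lemma rho_pCons: "rho (pCons a p) = a \<bullet>\<^sub>s symmetrizer d + casimir t d \<odot> rho p"
proof -
  have "rho (pCons a p) = (\<Sum>i\<le>Suc (degree p). coeff (pCons a p) i \<bullet>\<^sub>s end_pow t (symP d) (casimir t d) i)"
    by (rule rho_sum) (rule degree_pCons_le)
  also have "\<dots> = a \<bullet>\<^sub>s symmetrizer d + (\<Sum>i\<le>degree p. coeff p i \<bullet>\<^sub>s (casimir t d \<odot> end_pow t (symP d) (casimir t d) i))"
    by (subst sum.atMost_Suc_shift) (simp add: symP_def)
  also have "(\<Sum>i\<le>degree p. coeff p i \<bullet>\<^sub>s (casimir t d \<odot> end_pow t (symP d) (casimir t d) i)) = casimir t d \<odot> rho p"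
    by (simp add: rho_sum[of p "degree p"] bcomp_sum_right bmor_linear)
  finally show ?thesis .
qed

lemma rho_1: "rho 1 = symmetrizer d"
  using rho_pCons[of 1 0] by (simp add: rho_0 bmor_linear one_pCons)

lemma symm_rho: "symmetrizer d \<odot> rho p = rho p"
proof (induction p)
  case (pCons a p)
  then show ?case
    by (simp add: rho_pCons bmor_linear symm_symm bcomp_assoc[OF symm_in_bhom casimir_in_bhom rho_in_bhom] casimir_symm)
qed (simp add: rho_0 bmor_linear)

lemma rho_symm: "rho p \<odot> symmetrizer d = rho p"
proof (induction p)
  case (pCons a p)
  then show ?case
    by (simp add: rho_pCons bmor_linear symm_symm bcomp_assoc[OF casimir_in_bhom rho_in_bhom symm_in_bhom, symmetric])
qed (simp add: rho_0 bmor_linear)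

lemma rho_mult: "rho (p * q) = rho p \<odot> rho q"
proof (induction p)
  case (pCons a p)
  have "rho (pCons a p * q) = a \<bullet>\<^sub>s rho q + (0 \<bullet>\<^sub>s symmetrizer d + casimir t d \<odot> rho (p * q))"
    by (simp only: mult_pCons_left rho_add rho_smult rho_pCons)
  then show ?case
    by (simp add: pCons rho_pCons bmor_linear symm_rho bcomp_assoc[OF casimir_in_bhom rho_in_bhom rho_in_bhom])
qed (simp add: rho_0 bmor_linear)

lemma rho_sum_poly: "rho (\<Sum>i\<in>I. f i) = (\<Sum>i\<in>I. rho (f i))"
  by (induction I rule: infinite_finite_induct) (simp_all add: rho_0 rho_add)

lemma rho_diff: "rho (p - q) = rho p - rho q"
  using rho_add[of "p - q" q] by (simp add: algebra_simps)

text \<open>By \<open>casimir_u\<close>, evaluating the factor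
  \<open>[:node t d j / 4, - 1 / 4:]\<close> at the Casimir operator takes \<open>u t d j\<close> to
  \<open>u t d (Suc j)\<close>.\<close>

lemma rho_newton: "rho (newton t d j) = u t d j"
proof (induction j)
  case 0
  show ?case by (simp add: newton_0 rho_1 u_0)
next
  case (Suc j)
  have lin: "rho ([:a, b:] * q) = a \<bullet>\<^sub>s rho q + b \<bullet>\<^sub>s (casimir t d \<odot> rho q)" for a b q
    by (simp add: mult_pCons_left rho_add rho_smult rho_pCons bmor_linear)
  have "rho (newton t d (Suc j)) = rho ([:node t d j / 4, - 1 / 4:] * newton t d j)"
    by (simp only: newton_Suc mult.commute)
  also have "\<dots> = u t d (Suc j)"
    unfolding lin Suc casimir_u by (simp add: bmor.scale_right_diff_distrib)
  finally show ?case .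
qed

lemma rho_nodal: "rho (nodal t d) = 0"
proof -
  have "rho (newton t d (Suc (d div 2))) = 0"
  proof -
    have "\<not> 2 * Suc (d div 2) \<le> d" by presburger
    then show ?thesis unfolding rho_newton u_def by simp
  qed
  then show ?thesis unfolding newton_nodal rho_smult by simp
qed

text \<open>The remainder modulo \<open>nodal\<close> has degree at most \<open>d div 2\<close>, and
  its Newton coefficients are its coordinates in the independent family \<open>u\<close>. From here
  on equality of operators is congruence of polynomials.\<close>

theorem rho_eq_0_iff: "rho p = 0 \<longleftrightarrow> nodal t d dvd p"
proof
  assume "nodal t d dvd p"
  then obtain q where "p = nodal t d * q" by (rule dvdE)
  then show "rho p = 0" by (simp add: rho_mult rho_nodal bmor_linear)
next
  assume 0: "rho p = 0"
  define r where "r = p mod nodal t d"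
  have "degree r < Suc (d div 2)" if "r \<noteq> 0"
    using degree_mod_less[OF nodal_ne_0, of p t d] that by (simp add: r_def degree_nodal)
  then have "degree r \<le> d div 2" by (cases "r = 0") auto
  then obtain a where a: "r = (\<Sum>j\<le>d div 2. smult (a j) (newton t d j))" using newton_expansion by blast
  have "p = nodal t d * (p div nodal t d) + r" by (simp add: r_def)
  then have "rho p = rho (nodal t d * (p div nodal t d)) + rho r" by (metis rho_add)
  then have "rho r = 0" using 0 by (simp add: rho_mult rho_nodal bmor_linear)
  then have "(\<Sum>j\<le>d div 2. a j \<bullet>\<^sub>s u t d j) = 0" unfolding a rho_sum_poly rho_smult rho_newton .
  then have "a j = 0" if "j \<le> d div 2" for j using u_independent[where a = a] that by blast
  then have "r = 0" unfolding a by simp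
  then show "nodal t d dvd p" by (simp add: r_def dvd_eq_mod_eq_0)
qed

lemma rho_eqI: "nodal t d dvd p - q \<Longrightarrow> rho p = rho q"
  using rho_eq_0_iff[of "p - q"] by (simp add: rho_diff)

lemma min_poly_casimir: "min_poly t (symP d) (casimir t d) = nodal t d"
  unfolding min_poly_def rho_def[symmetric] rho_eq_0_iff
proof (rule the_equality)
  show "lead_coeff (nodal t d) = 1 \<and> nodal t d dvd nodal t d \<and>
    (\<forall>q. q \<noteq> 0 \<and> nodal t d dvd q \<longrightarrow> degree (nodal t d) \<le> degree q)"
    using lead_coeff_nodal by (auto intro: dvd_imp_degree_le)
next
  fix p assume p: "lead_coeff p = 1 \<and> nodal t d dvd p \<and> (\<forall>q. q \<noteq> 0 \<and> nodal t d dvd q \<longrightarrow> degree p \<le> degree q)"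
  then have "p \<noteq> 0" by auto
  obtain q where q: "p = nodal t d * q" using p by (auto elim: dvdE)
  then have "q \<noteq> 0" using \<open>p \<noteq> 0\<close> by auto
  have "degree p \<le> degree (nodal t d)" using p nodal_ne_0 by auto
  then have "degree q = 0" unfolding q using degree_mult_eq[OF nodal_ne_0 \<open>q \<noteq> 0\<close>, of t d] by simp
  then obtain c where c: "q = [:c:]" by (rule degree_eq_zeroE)
  have "lead_coeff p = c" unfolding q c lead_coeff_mult lead_coeff_nodal by simp
  then have "c = 1" using p by simp
  then show "p = nodal t d" unfolding q c by simp
qed

lemma end_pow_rho: "end_pow t (symP d) (rho p) n = rho (p ^ n)"
  by (induction n) (simp_all add: symP_def rho_1 rho_mult)

lemma rho_X: "rho [:- c, 1:] = casimir t d - c \<bullet>\<^sub>s symmetrizer d"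
  by (simp add: rho_pCons rho_0 bmor_linear casimir_symm)

end

hide_const (open) Fundamental_Theorem_Algebra.psize
hide_fact (open) Fundamental_Theorem_Algebra.psize_def

section \<open>Decomposition into generalized eigenspaces\<close>

lemma order_prod_linear:
  fixes f :: "'i \<Rightarrow> complex"
  assumes "finite A"
  shows "order c (\<Prod>i\<in>A. [:- f i, 1:]) = card {i \<in> A. f i = c}"
  using assms
proof (induction A rule: finite_induct)
  case (insert i A)
  have o: "order c [:- f i, 1:] = (if f i = c then 1 else 0)"
  proof (cases "f i = c")
    case True
    then show ?thesis using order_power_n_n[of c 1] by simp
  next
    case False
    then show ?thesis by (simp add: order_0I)
  qed
  have ne: "[:- f i, 1:] * (\<Prod>i\<in>A. [:- f i, 1:]) \<noteq> 0"
    using insert.hyps(1) by (simp only: mult_eq_0_iff prod_zero_iff) simp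
  have "{j \<in> insert i A. f j = c} = (if f i = c then insert i {j \<in> A. f j = c} else {j \<in> A. f j = c})" by auto
  then have "card {j \<in> insert i A. f j = c} = (if f i = c then 1 else 0) + card {j \<in> A. f j = c}"
    using insert by simp
  then show ?case
    using insert.IH by (simp only: prod.insert[OF insert.hyps(1,2)] order_mult[OF ne] o)
qed simp

lemma order_nodal: "order c (nodal t d) = card {i. i \<le> d div 2 \<and> node t d i = c}"
  unfolding nodal_def using order_prod_linear[of "{..d div 2}"] by simp

text \<open>Over the complex numbers divisibility is local at the roots; the induction strips a
  common root from both polynomials. Congruences modulo \<open>nodal\<close> are checked root by
  root with it.\<close>

lemma dvd_if_orders_dvd:
  fixes M p :: "complex poly"
  assumes "M \<noteq> 0" "\<And>c. [:- c, 1:] ^ order c M dvd p"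
  shows "M dvd p"
  using assms
proof (induction "degree M" arbitrary: M p)
  case 0
  then obtain a where "M = [:a:]" "a \<noteq> 0" by (metis degree_eq_zeroE pCons_0_0)
  then show ?case by (simp add: is_unit_iff_degree unit_imp_dvd)
next
  case (Suc n)
  show ?case
  proof (cases "p = 0")
    case False
    have "\<not> constant (poly M)" using Suc.hyps(2) by (simp add: constant_degree)
    then obtain c where "poly M c = 0" using fundamental_theorem_of_algebra by blast
    then obtain M' where M': "M = [:- c, 1:] * M'" unfolding poly_eq_0_iff_dvd by (rule dvdE)
    have "order c M \<noteq> 0" using \<open>poly M c = 0\<close> Suc.prems(1) order_root by blast
    then have "[:- c, 1:] dvd [:- c, 1:] ^ order c M" by (intro dvd_power) simp
    then have "[:- c, 1:] dvd p" using Suc.prems(2)[of c] dvd_trans by blast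
    then obtain p' where p': "p = [:- c, 1:] * p'" by (rule dvdE)
    have ne: "M' \<noteq> 0" "p' \<noteq> 0" using Suc.prems(1) False M' p' by auto
    have "degree M = Suc (degree M')" unfolding M' using ne by (subst degree_mult_eq) auto
    then have "n = degree M'" using Suc.hyps(2) by simp
    moreover have "[:- a, 1:] ^ order a M' dvd p'" for a
    proof -
      have "order a M \<le> order a p" using Suc.prems(2)[of a] False by (simp add: order_divides)
      moreover have "order a M = order a [:- c, 1:] + order a M'" "order a p = order a [:- c, 1:] + order a p'"
        using order_mult[OF Suc.prems(1)[unfolded M'], of a] order_mult[OF False[unfolded p'], of a]
        unfolding M'[symmetric] p'[symmetric] by auto
      ultimately show ?thesis using ne by (simp add: order_divides)
    qed
    ultimately have "M' dvd p'" using Suc.hyps(1) ne by blast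
    then show ?thesis unfolding M' p' by (rule mult_dvd_mono[OF dvd_refl])
  qed simp
qed

text \<open>The Chinese remainder idempotent of the root \<open>c\<close>. For \<open>M\<close> the
  minimal polynomial of an operator, its value at the operator is the projection onto the
  generalized eigenspace of \<open>c\<close>.\<close>

definition root_idempotent :: "complex poly \<Rightarrow> complex \<Rightarrow> complex poly \<Rightarrow> bool" where
  "root_idempotent M c e \<longleftrightarrow> [:- c, 1:] ^ order c M dvd e - 1 \<and>
     (\<forall>a. a \<noteq> c \<longrightarrow> [:- a, 1:] ^ order a M dvd e)"

text \<open>Write M = (x - c)^n G. Then y = 1 - G / G(c) vanishes at c, so 1 - y^n is 1 modulo (x -
  c)^n, and it is divisible by 1 - y, hence by G.\<close>

lemma root_idempotent_exists:
  assumes "M \<noteq> 0"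
  shows "\<exists>e. root_idempotent M c e"
proof -
  define n where "n = order c M"
  obtain G where G: "M = [:- c, 1:] ^ n * G" "\<not> [:- c, 1:] dvd G" using order_decomp[OF assms] unfolding n_def by blast
  have Gc: "poly G c \<noteq> 0" using G(2) by (simp add: poly_eq_0_iff_dvd)
  define y where "y = 1 - smult (1 / poly G c) G"
  have "poly y c = 0" using Gc by (simp add: y_def)
  then have "[:- c, 1:] dvd y" by (simp only: poly_eq_0_iff_dvd)
  then have "[:- c, 1:] ^ n dvd y ^ n" by (rule dvd_power_same)
  moreover have "(1 - y ^ n) - 1 = - (y ^ n)" by simp
  ultimately have 1: "[:- c, 1:] ^ n dvd (1 - y ^ n) - 1" by (simp only: dvd_minus_iff)
  have "G dvd smult (1 / poly G c) G" by (rule dvd_smult) simp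
  moreover have "smult (1 / poly G c) G = 1 - y" by (simp add: y_def)
  ultimately have "G dvd 1 - y ^ n"
    unfolding one_diff_power_eq by (simp only: dvd_mult2)
  moreover have "[:- a, 1:] ^ order a M dvd G" if "a \<noteq> c" for a
  proof -
    have "order a ([:- c, 1:] ^ n) = 0" using that by (intro order_0I) simp
    then have "order a M = order a G" using order_mult[of "[:- c, 1:] ^ n" G a] assms G(1) by simp
    then show ?thesis using order_1[of a G] by simp
  qed
  ultimately have "root_idempotent M c (1 - y ^ n)"
    using 1 unfolding root_idempotent_def n_def by (blast intro: dvd_trans)
  then show ?thesis by blast
qed

lemma root_idempotent_cong:
  assumes "M \<noteq> 0" "root_idempotent M c e" "root_idempotent M c e'"
  shows "M dvd e - e'"
proof (rule dvd_if_orders_dvd[OF assms(1)])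
  fix a
  show "[:- a, 1:] ^ order a M dvd e - e'"
  proof (cases "a = c")
    case True
    then have "[:- a, 1:] ^ order a M dvd (e - 1) - (e' - 1)"
      using assms(2,3) unfolding root_idempotent_def by (simp only: dvd_diff)
    then show ?thesis by simp
  qed (use assms(2,3) in \<open>auto simp: root_idempotent_def intro: dvd_diff\<close>)
qed

lemma root_idempotent_idem:
  assumes "M \<noteq> 0" "root_idempotent M c e"
  shows "M dvd e * e - e"
proof (rule dvd_if_orders_dvd[OF assms(1)])
  fix a
  have "e * e - e = e * (e - 1)" by (simp add: algebra_simps)
  then show "[:- a, 1:] ^ order a M dvd e * e - e"
    using assms(2) unfolding root_idempotent_def by (cases "a = c") (auto intro: dvd_mult dvd_mult2)
qed

lemma root_idempotent_poly:
  assumes "M \<noteq> 0" "root_idempotent M c e" "poly M c = 0"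
  shows "poly e c = 1"
proof -
  have "order c M \<noteq> 0" using assms(1,3) order_root by blast
  then have "[:- c, 1:] dvd [:- c, 1:] ^ order c M" by (intro dvd_power) simp
  then have "[:- c, 1:] dvd e - 1" using assms(2) dvd_trans unfolding root_idempotent_def by blast
  then have "poly (e - 1) c = 0" by (simp only: poly_eq_0_iff_dvd)
  then show ?thesis by simp
qed

subsection \<open>Nodes and partitions\<close>

context
  fixes t :: complex and k :: nat
  assumes t: "t = - 2 * of_nat k"
begin

text \<open>At t = -2k the second factor of \<open>node_diff\<close> is the integer d - 1 - k - r -
  i, so nodes collide exactly under the reflection of i to d - k - 1 - i.\<close>

lemma node_eq_iff: "node t d i = node t d r \<longleftrightarrow> i = r \<or> i + r + k + 1 = d"
proof -
  have "node t d i = node t d r \<longleftrightarrow> node t d i - node t d r = 0" by simp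
  also have "\<dots> \<longleftrightarrow> (of_nat r - of_nat i :: complex) = 0 \<or> (of_nat d - 1 + t / 2 - of_nat r - of_nat i :: complex) = 0"
    unfolding node_diff by simp
  also have "(of_nat r - of_nat i :: complex) = 0 \<longleftrightarrow> i = r" by auto
  also have "(of_nat d - 1 + t / 2 - of_nat r - of_nat i :: complex) = 0 \<longleftrightarrow> (of_nat d :: complex) = of_nat (i + r + k + 1)"
    unfolding t by (auto simp: algebra_simps)
  also have "\<dots> \<longleftrightarrow> i + r + k + 1 = d" unfolding of_nat_eq_iff by auto
  finally show ?thesis .
qed

lemma order_nodal_le: "order c (nodal t d) \<le> 2"
proof (cases "\<exists>i. node t d i = c")
  case True
  then obtain i where i: "node t d i = c" by blast
  have "{j. j \<le> d div 2 \<and> node t d j = c} \<subseteq> {i, d - (i + k + 1)}"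
    unfolding i[symmetric] node_eq_iff by auto
  then have "card {j. j \<le> d div 2 \<and> node t d j = c} \<le> card {i, d - (i + k + 1)}"
    by (intro card_mono) auto
  also have "\<dots> \<le> 2" by (simp add: card_insert_if)
  finally show ?thesis unfolding order_nodal .
next
  case False
  then have "{i. i \<le> d div 2 \<and> node t d i = c} = {}" by auto
  then show ?thesis unfolding order_nodal by (simp only: card.empty)
qed

lemma c_val_node:
  assumes "l \<in> partitions2" "psize l = d"
  shows "c_val t l = node t d (snd l)" "snd l \<le> d div 2" "fst l = d - snd l"
proof -
  have le: "snd l \<le> fst l" "fst l + snd l = d" using assms by (auto simp: partitions2_def psize_def)
  then have "of_nat (fst l - snd l) = (of_nat d - 2 * of_nat (snd l) :: complex)"
    by (simp add: of_nat_diff) (metis add.commute add_diff_cancel_left' diff_diff_eq mult_2 of_nat_add)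
  then show "c_val t l = node t d (snd l)" unfolding c_val_def node_def by simp
  show "snd l \<le> d div 2" "fst l = d - snd l" using le by auto
qed

definition Ireg_degree :: "nat \<Rightarrow> (nat \<times> nat) set" where
  "Ireg_degree d = {l \<in> Ireg k. psize l = d}"

lemma finite_Ireg_degree: "finite (Ireg_degree d)"
  by (rule finite_subset[of _ "{..d} \<times> {..d}"]) (auto simp: Ireg_degree_def psize_def)

lemma Ireg_degree_partitions2: "l \<in> Ireg_degree d \<Longrightarrow> l \<in> partitions2" "l \<in> Ireg_degree d \<Longrightarrow> psize l = d"
  by (auto simp: Ireg_degree_def Ireg_def)

text \<open>Of two different partitions with the same eigenvalue, the one with the smaller second
  part has a difference of parts between k + 2 and 2k + 2. It is singular and thus not in
  \<open>Ireg\<close>.\<close>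

lemma c_val_inj:
  assumes l: "l \<in> Ireg_degree d" and m: "m \<in> Ireg_degree d" and eq: "c_val t l = c_val t m"
  shows "l = m"
proof -
  have no: False if l: "l \<in> Ireg_degree d" and m: "m \<in> Ireg_degree d" and eq: "snd l + snd m + k + 1 = d" and lt: "snd l < snd m" for l m
  proof -
    note L = c_val_node[OF Ireg_degree_partitions2[OF l]] and M = c_val_node[OF Ireg_degree_partitions2[OF m]]
    have "snd l \<le> fst l" using Ireg_degree_partitions2(1)[OF l] by (auto simp: partitions2_def)
    moreover have "kregular k l \<or> kquasiregular k l" using l by (simp add: Ireg_degree_def Ireg_def)
    ultimately show False
      using L(2,3) M(2,3) eq lt unfolding kregular_def kquasiregular_def by linarith
  qed
  note L = c_val_node[OF Ireg_degree_partitions2[OF l]] and M = c_val_node[OF Ireg_degree_partitions2[OF m]]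
  have "snd l = snd m \<or> snd l + snd m + k + 1 = d"
    using eq unfolding L(1) M(1) node_eq_iff .
  moreover have False if "snd l + snd m + k + 1 = d" "snd l \<noteq> snd m"
    using no[OF l m] no[OF m l] that by linarith
  ultimately have "snd l = snd m" by blast
  then show ?thesis using L(3) M(3) by (simp add: prod_eq_iff)
qed

text \<open>A singular partition shares its eigenvalue with the reflected one, which is
  quasiregular, so leaving out the singular partitions loses no eigenvalue.\<close>

lemma node_cover:
  assumes i: "i \<le> d div 2"
  shows "\<exists>l\<in>Ireg_degree d. c_val t l = node t d i"
proof -
  have mem: "(d - j, j) \<in> Ireg_degree d \<and> c_val t (d - j, j) = node t d j"
    if "j \<le> d div 2" "kregular k (d - j, j) \<or> kquasiregular k (d - j, j)" for j
  proof -
    have "(d - j, j) \<in> Ireg_degree d" using that by (auto simp: Ireg_degree_def Ireg_def partitions2_def psize_def)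
    then show ?thesis using c_val_node(1)[OF Ireg_degree_partitions2] by fastforce
  qed
  show ?thesis
  proof (cases "kregular k (d - i, i) \<or> kquasiregular k (d - i, i)")
    case True
    then show ?thesis using mem[OF i] by blast
  next
    case False
    define j where "j = d - (i + k + 1)"
    have j: "i + j + k + 1 = d" "j \<le> d div 2" "kquasiregular k (d - j, j)"
      using False i unfolding j_def kregular_def kquasiregular_def by auto
    then have "node t d j = node t d i" unfolding node_eq_iff by simp
    then show ?thesis using mem[OF j(2)] j(3) by auto
  qed
qed

end

section \<open>Existence and uniqueness of the decomposition of P^d\<close>

lemma khom_symP: "f \<in> khom t (symP d) (symP d) \<longleftrightarrow>
    f \<in> bhom d d \<and> bcomp t (symmetrizer d) f = f \<and> bcomp t f (symmetrizer d) = f"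
  by (simp add: khom_def symP_def)

text \<open>\<open>pr m\<close> and \<open>pr' m\<close> are kernels of the same operator, so
  \<open>pr' m\<close> factors through \<open>pr m\<close> and is fixed by it. Orthogonality and the
  decomposition of the identity by \<open>pr'\<close> then give equality. This justifies the
  \<open>THE\<close> in \<open>Vproj\<close>.\<close>

lemma decomposition_unique:
  assumes "is_decomposition t k d pr" "is_decomposition t k d pr'"
  shows "pr = pr'"
proof
  fix l
  define J where "J = {l \<in> Ireg k. psize l = d}"
  have D: "pr l \<in> khom t (symP d) (symP d)" "bcomp t (pr l) (pr l) = pr l"
      "is_kernel t (symP d) (symP d) (gen_eigen_op t l) (d, pr l) (pr l)"
      "\<And>m. m \<in> J \<Longrightarrow> l \<noteq> m \<Longrightarrow> bcomp t (pr l) (pr m) = 0"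
      "(\<Sum>l\<in>J. pr l) = symmetrizer d"
    if "l \<in> J" "is_decomposition t k d pr" for l pr
    using that unfolding is_decomposition_def Let_def J_def by blast+
  have out: "pr l = 0" if "l \<notin> J" "is_decomposition t k d pr" for pr
  proof -
    have "\<forall>l. l \<notin> J \<longrightarrow> pr l = 0"
      using that(2) unfolding is_decomposition_def Let_def J_def by (elim conjE)
    then show ?thesis using that(1) by blast
  qed
  have absorb: "bcomp t (pr m) (pr' m) = pr' m"
    if m: "m \<in> J" and a: "is_decomposition t k d pr" "is_decomposition t k d pr'" for m pr pr'
  proof -
    let ?Z = "(d, pr' m)"
    have Z: "?Z \<in> kobjects t" "pr' m \<in> khom t ?Z (symP d)" "bcomp t (gen_eigen_op t m) (pr' m) = 0"
      using D(3)[OF m a(2)] unfolding is_kernel_def by auto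
    then obtain h where "h \<in> khom t ?Z (d, pr m)" "bcomp t (pr m) h = pr' m"
      using D(3)[OF m a(1)] unfolding is_kernel_def by blast
    then have "h = pr' m" by (simp add: khom_def)
    then show ?thesis using \<open>bcomp t (pr m) h = pr' m\<close> by simp
  qed
  show "pr l = pr' l"
  proof (cases "l \<in> J")
    case False
    show ?thesis unfolding out[OF False assms(1)] out[OF False assms(2)] ..
  next
    case True
    have bh: "pr m \<in> bhom d d" "pr' m \<in> bhom d d" if "m \<in> J" for m
      using D(1)[OF that assms(1)] D(1)[OF that assms(2)] unfolding khom_symP by auto
    have fin: "finite J"
      by (rule finite_subset[of _ "{..d} \<times> {..d}"]) (auto simp: J_def psize_def)
    have zero: "bcomp t (pr l) (pr' m) = 0" if m: "m \<in> J" "m \<noteq> l" for m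
    proof -
      have "bcomp t (pr l) (pr' m) = bcomp t (pr l) (bcomp t (pr m) (pr' m))"
        using absorb[OF m(1) assms] by simp
      also have "\<dots> = bcomp t (bcomp t (pr l) (pr m)) (pr' m)"
        by (rule bcomp_assoc[OF bh(1)[OF True] bh(1)[OF m(1)] bh(2)[OF m(1)]])
      finally show ?thesis using D(4)[OF True assms(1) m(1)] m(2) by (simp add: bmor_linear)
    qed
    have "pr l = bcomp t (pr l) (symmetrizer d)"
      using D(1)[OF True assms(1)] by (simp add: khom_symP)
    also have "\<dots> = (\<Sum>m\<in>J. bcomp t (pr l) (pr' m))"
      unfolding D(5)[OF True assms(2), symmetric] by (rule bcomp_sum_right)
    also have "\<dots> = (\<Sum>m\<in>J. if m = l then bcomp t (pr l) (pr' l) else 0)"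
      by (intro sum.cong refl) (use zero in auto)
    also have "\<dots> = bcomp t (pr l) (pr' l)" using fin True by simp
    also have "\<dots> = pr' l" by (rule absorb[OF True assms])
    finally show ?thesis .
  qed
qed

context
  fixes t :: complex and k :: nat
  assumes t: "t = - 2 * of_nat k"
begin

lemma Ireg_degree_iff: "l \<in> Ireg_degree k d \<longleftrightarrow> l \<in> Ireg k \<and> psize l = d"
  by (simp add: Ireg_degree_def[OF t])

lemma nodal_root: "l \<in> Ireg_degree k d \<Longrightarrow> poly (nodal t d) (c_val t l) = 0"
proof -
  assume "l \<in> Ireg_degree k d"
  then have "c_val t l = node t d (snd l)" "snd l \<le> d div 2"
    using c_val_node[OF t Ireg_degree_partitions2[OF t]] by auto
  then show ?thesis unfolding nodal_def poly_prod by (intro prod_zero) auto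
qed

lemma root_nodal:
  assumes "order a (nodal t d) \<noteq> 0"
  shows "\<exists>l\<in>Ireg_degree k d. c_val t l = a"
proof -
  have "card {i. i \<le> d div 2 \<and> node t d i = a} \<noteq> 0" using assms unfolding order_nodal .
  then obtain i where "i \<le> d div 2" "node t d i = a" by (metis (mono_tags, lifting) card.empty empty_Collect_eq)
  then show ?thesis using node_cover[OF t, of i d] by metis
qed

text \<open>For the kernel property, let q be the power of x - c that defines
  \<open>gen_eigen_op\<close>. The product of q and \<open>E c\<close> is divisible by
  \<open>nodal\<close>, and \<open>E c - 1\<close> is divisible by q, so whatever q kills is fixed
  by the projection.\<close>

lemma decomposition:
  assumes E: "\<And>c. root_idempotent (nodal t d) c (E c)"
  shows "is_decomposition t k d (\<lambda>l. if l \<in> Ireg_degree k d then rho t d (E (c_val t l)) else 0)"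
proof -
  note M0 = nodal_ne_0[of t d]
  let ?pr = "\<lambda>l. rho t d (E (c_val t l))"
  have EE: "[:- a, 1:] ^ order a (nodal t d) dvd E a - 1" "a \<noteq> c \<Longrightarrow> [:- a, 1:] ^ order a (nodal t d) dvd E c" for a c
    using E unfolding root_idempotent_def by auto
  have idem: "bcomp t (?pr l) (?pr l) = ?pr l" for l
    unfolding rho_mult[symmetric] by (rule rho_eqI[OF root_idempotent_idem[OF M0 E]])
  have kh: "?pr l \<in> khom t (symP d) (symP d)" for l
    unfolding khom_symP by (simp add: rho_in_bhom symm_rho rho_symm)
  have ker: "is_kernel t (symP d) (symP d) (gen_eigen_op t l) (d, ?pr l) (?pr l)" if l: "l \<in> Ireg_degree k d" for l
  proof -
    let ?c = "c_val t l"
    let ?q = "[:- ?c, 1:] ^ order ?c (nodal t d)"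
    have d: "psize l = d" using l Ireg_degree_iff by simp
    have gen: "gen_eigen_op t l = rho t d ?q"
      unfolding gen_eigen_op_def m_val_def d min_poly_casimir rho_X[symmetric] end_pow_rho ..
    show ?thesis unfolding is_kernel_def gen
    proof (intro conjI ballI impI)
      show "(d, ?pr l) \<in> kobjects t" by (simp add: kobjects_def rho_in_bhom idem)
      show "?pr l \<in> khom t (d, ?pr l) (symP d)" by (simp add: khom_def symP_def rho_in_bhom idem symm_rho)
      have "nodal t d dvd ?q * E ?c"
      proof (rule dvd_if_orders_dvd[OF M0])
        show "[:- a, 1:] ^ order a (nodal t d) dvd ?q * E ?c" for a
          using EE(2)[of a ?c] by (cases "a = ?c") (auto intro: dvd_mult)
      qed
      then show "bcomp t (rho t d ?q) (?pr l) = 0"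
        unfolding rho_mult[symmetric] rho_eq_0_iff .
      fix Z g assume Z: "Z \<in> kobjects t" and g: "g \<in> khom t Z (symP d)" and 0: "bcomp t (rho t d ?q) g = 0"
      have gb: "g \<in> bhom (fst Z) d" "bcomp t (symmetrizer d) g = g" "bcomp t g (snd Z) = g"
        using g by (auto simp: khom_def symP_def)
      obtain y where y: "E ?c - 1 = ?q * y" using EE(1) by (rule dvdE)
      have "bcomp t (?pr l) g - g = bcomp t (rho t d (y * ?q)) g"
        using gb(2) by (simp add: mult.commute[of y] y[symmetric] rho_diff rho_1 bcomp_diff_left)
      also have "\<dots> = bcomp t (rho t d y) (bcomp t (rho t d ?q) g)"
        unfolding rho_mult by (rule bcomp_assoc[OF rho_in_bhom rho_in_bhom gb(1), symmetric])
      finally have prg: "bcomp t (?pr l) g = g" using 0 by (simp add: bmor_linear)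
      show "\<exists>!h. h \<in> khom t Z (d, ?pr l) \<and> bcomp t (?pr l) h = g"
      proof (rule ex1I[of _ g])
        show "g \<in> khom t Z (d, ?pr l) \<and> bcomp t (?pr l) g = g"
          using gb prg by (simp add: khom_def)
      qed (auto simp: khom_def)
    qed
  qed
  have orth: "bcomp t (?pr l) (?pr m) = 0" if "l \<in> Ireg_degree k d" "m \<in> Ireg_degree k d" "l \<noteq> m" for l m
  proof -
    have ne: "c_val t l \<noteq> c_val t m" using c_val_inj[OF t that(1,2)] that(3) by blast
    have "nodal t d dvd E (c_val t l) * E (c_val t m)"
    proof (rule dvd_if_orders_dvd[OF M0])
      show "[:- a, 1:] ^ order a (nodal t d) dvd E (c_val t l) * E (c_val t m)" for a
        using EE(2)[of a "c_val t l"] EE(2)[of a "c_val t m"] ne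
        by (cases "a = c_val t l") (auto intro: dvd_mult dvd_mult2)
    qed
    then show ?thesis unfolding rho_mult[symmetric] rho_eq_0_iff .
  qed
  have fin: "finite (Ireg_degree k d)" by (rule finite_Ireg_degree[OF t])
  have "(\<Sum>l\<in>Ireg_degree k d. ?pr l) = rho t d (\<Sum>l\<in>Ireg_degree k d. E (c_val t l))" by (rule rho_sum_poly[symmetric])
  \<comment> \<open>At every root exactly one summand is congruent to 1 and the others to 0: the
    eigenvalues of \<open>Ireg_degree\<close> are distinct and exhaust the roots.\<close>
  also have "\<dots> = rho t d 1"
  proof (rule rho_eqI, rule dvd_if_orders_dvd[OF M0])
    fix a
    show "[:- a, 1:] ^ order a (nodal t d) dvd (\<Sum>l\<in>Ireg_degree k d. E (c_val t l)) - 1"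
    proof (cases "order a (nodal t d) = 0")
      case False
      then obtain m where m: "m \<in> Ireg_degree k d" "c_val t m = a" using root_nodal by blast
      have "(\<Sum>l\<in>Ireg_degree k d. E (c_val t l)) - 1 = (E a - 1) + (\<Sum>l\<in>Ireg_degree k d - {m}. E (c_val t l))"
        using sum.remove[OF fin m(1), of "\<lambda>l. E (c_val t l)"] m(2) by simp
      moreover have "[:- a, 1:] ^ order a (nodal t d) dvd (\<Sum>l\<in>Ireg_degree k d - {m}. E (c_val t l))"
      proof (rule dvd_sum)
        fix l assume "l \<in> Ireg_degree k d - {m}"
        then have l: "l \<in> Ireg_degree k d" "l \<noteq> m" by simp_all
        have "a \<noteq> c_val t l"
        proof
          assume "a = c_val t l"
          then have "c_val t l = c_val t m" using m(2) by simp
          then show False using c_val_inj[OF t l(1) m(1)] l(2) by simp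
        qed
        then show "[:- a, 1:] ^ order a (nodal t d) dvd E (c_val t l)" by (rule EE(2))
      qed
      ultimately show ?thesis using EE(1)[of a] by (simp only: dvd_add)
    qed simp
  qed
  finally have sum: "(\<Sum>l\<in>Ireg_degree k d. ?pr l) = symmetrizer d" by (simp add: rho_1)
  have Iset: "{l \<in> Ireg k. psize l = d} = Ireg_degree k d" by (auto simp: Ireg_degree_iff)
  show ?thesis
    unfolding is_decomposition_def Let_def Iset
  proof (intro conjI ballI allI impI)
    show "(\<Sum>l\<in>Ireg_degree k d. if l \<in> Ireg_degree k d then ?pr l else 0) = symmetrizer d"
      unfolding sum[symmetric] by (rule sum.cong) simp_all
  qed (simp_all add: idem kh ker orth)
qed

text \<open>Any polynomial with the congruences of the idempotent may represent the projection; this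
  is what allows the limit of Lagrange polynomials to be inserted.\<close>

theorem Vproj_eq:
  assumes l: "l \<in> Ireg k" and e: "root_idempotent (nodal t (psize l)) (c_val t l) e"
  shows "Vproj t k l = rho t (psize l) e"
proof -
  define d where "d = psize l"
  obtain E where E: "\<And>c. root_idempotent (nodal t d) c (E c)"
    using root_idempotent_exists[OF nodal_ne_0] by metis
  note dec = decomposition[OF E]
  have "(THE pr. is_decomposition t k d pr) = (\<lambda>l. if l \<in> Ireg_degree k d then rho t d (E (c_val t l)) else 0)"
  proof (rule the_equality)
    show "is_decomposition t k d (\<lambda>l. if l \<in> Ireg_degree k d then rho t d (E (c_val t l)) else 0)" by (rule dec)
  qed (rule decomposition_unique[OF _ dec])
  then have "Vproj t k l = rho t d (E (c_val t l))"
    unfolding Vproj_def d_def[symmetric] using l by (simp add: Ireg_degree_iff d_def)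
  also have "\<dots> = rho t d e"
    by (rule rho_eqI[OF root_idempotent_cong[OF nodal_ne_0 E e[folded d_def]]])
  finally show ?thesis unfolding d_def .
qed

lemma Vproj_props:
  assumes l: "l \<in> Ireg k"
  shows "Vproj t k l \<in> bhom (psize l) (psize l)" "bcomp t (Vproj t k l) (Vproj t k l) = Vproj t k l"
    "bcomp t (symmetrizer (psize l)) (Vproj t k l) = Vproj t k l"
    "bcomp t (Vproj t k l) (symmetrizer (psize l)) = Vproj t k l" "Vproj t k l \<noteq> 0"
proof -
  obtain e where e: "root_idempotent (nodal t (psize l)) (c_val t l) e"
    using root_idempotent_exists[OF nodal_ne_0] by blast
  note V = Vproj_eq[OF l e]
  show "Vproj t k l \<in> bhom (psize l) (psize l)" "bcomp t (symmetrizer (psize l)) (Vproj t k l) = Vproj t k l"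
    "bcomp t (Vproj t k l) (symmetrizer (psize l)) = Vproj t k l"
    unfolding V by (simp_all add: rho_in_bhom symm_rho rho_symm)
  show "bcomp t (Vproj t k l) (Vproj t k l) = Vproj t k l"
    unfolding V rho_mult[symmetric] by (rule rho_eqI[OF root_idempotent_idem[OF nodal_ne_0 e]])
  show "Vproj t k l \<noteq> 0"
  proof
    assume "Vproj t k l = 0"
    then have "nodal t (psize l) dvd e" unfolding V rho_eq_0_iff .
    moreover have r: "poly (nodal t (psize l)) (c_val t l) = 0" using l by (intro nodal_root) (simp add: Ireg_degree_iff)
    ultimately have "poly e (c_val t l) = 0" by (auto elim!: dvdE)
    then show False using root_idempotent_poly[OF nodal_ne_0 e r] by simp
  qed
qed

text \<open>The difference of \<open>F\<close> and its value at the eigenvalue c is divisible by x -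
  c. Its square is divisible by (x - c)^2, which suffices because \<open>nodal\<close> has roots of
  order at most 2.\<close>

lemma rho_on_component:
  assumes l: "l \<in> Ireg k"
  shows "\<exists>\<eta>\<in>khom t (Vcomp t k l) (Vcomp t k l). bcomp t \<eta> \<eta> = 0 \<and>
    bcomp t (rho t (psize l) F) (Vproj t k l) = poly F (c_val t l) \<bullet>\<^sub>s Vproj t k l + \<eta>"
proof -
  define d where "d = psize l"
  define c where "c = c_val t l"
  obtain e where e: "root_idempotent (nodal t d) c e"
    using root_idempotent_exists[OF nodal_ne_0] by blast
  have V: "Vproj t k l = rho t d e" using Vproj_eq[OF l] e by (simp add: d_def c_def)
  define N where "N = F - [:poly F c:]"
  define \<eta> where "\<eta> = rho t d (N * e)"
  have ee: "nodal t d dvd e * e - e" by (rule root_idempotent_idem[OF nodal_ne_0 e])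
  have "nodal t d dvd e * (N * e) - N * e"
  proof -
    have "e * (N * e) - N * e = N * (e * e - e)" by (simp add: algebra_simps)
    then show ?thesis using ee by simp
  qed
  then have 1: "bcomp t (rho t d e) \<eta> = \<eta>" "bcomp t \<eta> (rho t d e) = \<eta>"
    unfolding \<eta>_def rho_mult[symmetric] using rho_eqI by (simp_all add: mult_ac)
  have "[:- c, 1:] dvd N" unfolding N_def poly_eq_0_iff_dvd[symmetric] by simp
  then have N2: "[:- c, 1:] ^ 2 dvd N * N" unfolding power2_eq_square by (intro mult_dvd_mono)
  have "nodal t d dvd (N * e) * (N * e)"
  proof (rule dvd_if_orders_dvd[OF nodal_ne_0])
    fix a
    have eq: "(N * e) * (N * e) = (N * N) * (e * e)" by (simp add: algebra_simps)
    show "[:- a, 1:] ^ order a (nodal t d) dvd (N * e) * (N * e)"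
    proof (cases "a = c")
      case True
      then have "[:- a, 1:] ^ order a (nodal t d) dvd [:- c, 1:] ^ 2"
        using order_nodal_le[OF t, of c d] by (simp add: le_imp_power_dvd)
      then show ?thesis unfolding eq using N2 by (meson dvd_mult2 dvd_trans)
    next
      case False
      then show ?thesis using e unfolding root_idempotent_def by (blast intro: dvd_mult dvd_mult2)
    qed
  qed
  then have 2: "bcomp t \<eta> \<eta> = 0" unfolding \<eta>_def rho_mult[symmetric] rho_eq_0_iff .
  have "F * e = smult (poly F c) e + N * e" by (simp add: N_def algebra_simps)
  then have 3: "bcomp t (rho t d F) (rho t d e) = poly F c \<bullet>\<^sub>s rho t d e + \<eta>"
    unfolding \<eta>_def rho_mult[symmetric] by (simp only: rho_add rho_smult)
  have "\<eta> \<in> khom t (Vcomp t k l) (Vcomp t k l)"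
    using 1 unfolding khom_def Vcomp_def V d_def[symmetric] by (simp add: \<eta>_def rho_in_bhom)
  then show ?thesis using 2 3 unfolding V d_def[symmetric] c_def[symmetric] by blast
qed

text \<open>Let P be the projection and c = v - v' nonzero. Squaring
  \<open>\<eta>' = c P + \<eta>\<close> gives \<open>\<eta> = - (c / 2) P\<close>, whose square (c^2
  / 4) P is not zero.\<close>

lemma eigenvalue_unique:
  assumes l: "l \<in> Ireg k" and \<eta>: "\<eta> \<in> khom t (Vcomp t k l) (Vcomp t k l)" "bcomp t \<eta> \<eta> = 0"
    and \<eta>': "\<eta>' \<in> khom t (Vcomp t k l) (Vcomp t k l)" "bcomp t \<eta>' \<eta>' = 0"
    and eq: "v \<bullet>\<^sub>s Vproj t k l + \<eta> = v' \<bullet>\<^sub>s Vproj t k l + \<eta>'"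
  shows "v = v'"
proof (rule ccontr)
  assume ne: "v \<noteq> v'"
  define P where "P = Vproj t k l"
  define c where "c = v - v'"
  have c: "c \<noteq> 0" using ne by (simp add: c_def)
  have PP: "bcomp t P P = P" "P \<noteq> 0" using Vproj_props[OF l] by (simp_all add: P_def)
  have P\<eta>: "bcomp t P \<eta> = \<eta>" "bcomp t \<eta> P = \<eta>" using \<eta>(1) by (simp_all add: khom_def Vcomp_def P_def)
  have \<eta>'_eq: "\<eta>' = c \<bullet>\<^sub>s P + \<eta>"
    using eq by (simp add: P_def c_def bmor.scale_left_diff_distrib algebra_simps)
  have "0 = bcomp t \<eta>' \<eta>'" using \<eta>'(2) by simp
  also have "\<dots> = (c * c) \<bullet>\<^sub>s P + (2 * c) \<bullet>\<^sub>s \<eta>"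
  proof -
    have "(2 * c) \<bullet>\<^sub>s \<eta> = c \<bullet>\<^sub>s \<eta> + c \<bullet>\<^sub>s \<eta>"
      unfolding bmor.scale_left_distrib[symmetric] by simp
    then show ?thesis
      unfolding \<eta>'_eq bmor_linear PP(1) P\<eta> \<eta>(2) by (simp add: bmor.scale_right_distrib add_ac)
  qed
  finally have "(2 * c) \<bullet>\<^sub>s \<eta> = - ((c * c) \<bullet>\<^sub>s P)" by (simp add: eq_neg_iff_add_eq_0 add.commute)
  then have "(1 / (2 * c)) \<bullet>\<^sub>s ((2 * c) \<bullet>\<^sub>s \<eta>) = (1 / (2 * c)) \<bullet>\<^sub>s - ((c * c) \<bullet>\<^sub>s P)" by simp
  then have h: "\<eta> = (- c / 2) \<bullet>\<^sub>s P" using c by simp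
  have "0 = (c * c / 4) \<bullet>\<^sub>s P" using \<eta>(2) unfolding h bmor_linear PP(1) by simp
  then show False using c PP(2) by simp
qed

end

section \<open>Eigenvalue polynomials of Capelli operators\<close>

lemma poly2_diff: "poly2 (f - g) x y = poly2 f x y - poly2 g x y"
  and poly2_mult: "poly2 (f * g) x y = poly2 f x y * poly2 g x y"
  and poly2_const2: "poly2 (const2 c) x y = c"
  by (simp_all add: poly2_def)

lemma poly2_sum: "poly2 (\<Sum>i\<in>B. g i) x y = (\<Sum>i\<in>B. poly2 (g i) x y)"
  by (simp add: poly2_def poly_sum)

lemma poly2_ffact: "poly2 (ffact X2 a) x y = ffact x a" "poly2 (ffact Y2 b) x y = ffact y b"
proof -
  have of_nat: "of_nat n = const2 (of_nat n)" for n
    by (metis of_nat_poly pCons_0_0)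
  show "poly2 (ffact X2 a) x y = ffact x a" "poly2 (ffact Y2 b) x y = ffact y b"
    unfolding ffact_def poly2_def of_nat by (simp_all add: poly_prod)
qed

lemma infinite_upto: "infinite {of_nat a :: complex |a. n \<le> a}"
proof -
  have "{of_nat a :: complex |a. n \<le> a} = of_nat ` {n..}" by auto
  moreover have "inj_on (of_nat :: nat \<Rightarrow> complex) {n..}" by (simp add: inj_on_def)
  ultimately show ?thesis using finite_image_iff infinite_Ici by metis
qed

text \<open>For every \<open>b\<close> infinitely many values of \<open>a\<close> make the
  specialization at y = b zero, and infinitely many \<open>b\<close> then force \<open>f\<close> to
  vanish.\<close>

lemma poly2_eq_0I:
  assumes "\<And>a b. b + n \<le> a \<Longrightarrow> poly2 f (of_nat a) (of_nat b) = 0"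
  shows "f = 0"
proof (rule ccontr)
  assume f: "f \<noteq> 0"
  have 0: "poly f [:of_nat b:] = 0" for b
  proof (rule ccontr)
    assume "poly f [:of_nat b:] \<noteq> 0"
    then have fin: "finite {x. poly (poly f [:of_nat b:]) x = 0}" by (rule poly_roots_finite)
    have "{of_nat a :: complex |a. b + n \<le> a} \<subseteq> {x. poly (poly f [:of_nat b:]) x = 0}"
      using assms by (auto simp: poly2_def)
    then have "finite {of_nat a :: complex |a. b + n \<le> a}" using fin by (rule finite_subset)
    then show False using infinite_upto by simp
  qed
  have "range (\<lambda>b. [:of_nat b :: complex:]) \<subseteq> {p. poly f p = 0}" using 0 by blast
  then have fin: "finite (range (\<lambda>b. [:of_nat b :: complex:]))"
    using poly_roots_finite[OF f] by (rule finite_subset)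
  have "inj (\<lambda>b. [:of_nat b :: complex:])" by (simp add: inj_on_def)
  then have "finite (UNIV :: nat set)" using fin by (rule finite_imageD[rotated])
  then show False by simp
qed

text \<open>For e = x + y and t = -2k the second argument is x - k - 1. This is the origin of the
  shift in the first argument of the eigenvalue polynomial, and of its symmetry.\<close>

lemma poly_newton:
  "poly (newton t e j) (node t e y) = ffact (of_nat y) j * ffact (of_nat e - 1 + t / 2 - of_nat y) j"
proof -
  have "poly (newton t e j) (node t e y) = (\<Prod>i<j. (node t e i - node t e y) / 4)"
    by (simp add: newton_def poly_prod diff_divide_distrib)
  also have "\<dots> = (\<Prod>i<j. (of_nat y - of_nat i) * (of_nat e - 1 + t / 2 - of_nat y - of_nat i))"
    unfolding node_diff mult.assoc by simp
  finally show ?thesis by (simp add: ffact_def prod.distrib)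
qed

section \<open>The eigenvalues of the Capelli operators\<close>

context
  fixes t :: complex and k :: nat
  assumes t: "t = - 2 * of_nat k"
begin

abbreviation bcomp_cap  (infixr "\<odot>" 70) where
  "g \<odot> f \<equiv> bcomp t g f"

text \<open>An element of A_t acts on each degree through some polynomial in the Casimir operator,
  which may vary with the degree; hence \<open>F\<close> takes the degree as an argument.\<close>

lemma eigenvalue_poly_eqI:
  assumes sym: "symmetric_poly2 f"
    and act: "\<And>m. m \<in> Ireg k \<Longrightarrow> act t D (psize m) = rho t (psize m) (F (psize m))"
    and val: "\<And>m. m \<in> Ireg k \<Longrightarrow>
      poly2 f (of_nat (fst m) - of_nat k - 1) (of_nat (snd m)) = poly (F (psize m)) (c_val t m)"
  shows "eigenvalue_poly t k D = f"
  unfolding eigenvalue_poly_def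
proof (rule the_equality)
  show "symmetric_poly2 f \<and> (\<forall>m\<in>Ireg k. \<exists>\<eta>\<in>khom t (Vcomp t k m) (Vcomp t k m). \<eta> \<odot> \<eta> = 0 \<and>
      act t D (psize m) \<odot> Vproj t k m =
        poly2 f (of_nat (fst m) - of_nat k - 1) (of_nat (snd m)) \<bullet>\<^sub>s Vproj t k m + \<eta>)"
  proof (intro conjI sym ballI)
    fix m assume m: "m \<in> Ireg k"
    show "\<exists>\<eta>\<in>khom t (Vcomp t k m) (Vcomp t k m). \<eta> \<odot> \<eta> = 0 \<and>
        act t D (psize m) \<odot> Vproj t k m =
          poly2 f (of_nat (fst m) - of_nat k - 1) (of_nat (snd m)) \<bullet>\<^sub>s Vproj t k m + \<eta>"
      unfolding act[OF m] val[OF m] by (rule rho_on_component[OF t m])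
  qed
next
  fix g
  assume g: "symmetric_poly2 g \<and> (\<forall>m\<in>Ireg k. \<exists>\<eta>\<in>khom t (Vcomp t k m) (Vcomp t k m). \<eta> \<odot> \<eta> = 0 \<and>
      act t D (psize m) \<odot> Vproj t k m =
        poly2 g (of_nat (fst m) - of_nat k - 1) (of_nat (snd m)) \<bullet>\<^sub>s Vproj t k m + \<eta>)"
  have eq: "poly2 g (of_nat (fst m) - of_nat k - 1) (of_nat (snd m)) =
      poly2 f (of_nat (fst m) - of_nat k - 1) (of_nat (snd m))" if m: "m \<in> Ireg k" for m
  proof -
    let ?V = "Vcomp t k m"
    obtain \<eta> where \<eta>: "\<eta> \<in> khom t ?V ?V" "\<eta> \<odot> \<eta> = 0" "act t D (psize m) \<odot> Vproj t k m =
        poly2 g (of_nat (fst m) - of_nat k - 1) (of_nat (snd m)) \<bullet>\<^sub>s Vproj t k m + \<eta>"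
      using bspec[OF conjunct2[OF g] m] by blast
    obtain \<eta>' where \<eta>': "\<eta>' \<in> khom t ?V ?V" "\<eta>' \<odot> \<eta>' = 0"
        "rho t (psize m) (F (psize m)) \<odot> Vproj t k m = poly (F (psize m)) (c_val t m) \<bullet>\<^sub>s Vproj t k m + \<eta>'"
      using rho_on_component[OF t m] by blast
    show ?thesis unfolding val[OF m]
      by (rule eigenvalue_unique[OF t m \<eta>(1,2) \<eta>'(1,2)])
        (simp only: \<eta>(3)[symmetric] \<eta>'(3)[symmetric] act[OF m])
  qed
  have "g - f = 0"
  proof (rule poly2_eq_0I[where n = "k + 2"])
    fix a b :: nat assume "b + (k + 2) \<le> a"
    \<comment> \<open>The difference of the two parts is at least 2k + 3, so the partition is
      regular. These partitions alone determine the polynomial.\<close>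
    then have "(a + k + 1, b) \<in> Ireg k" by (auto simp: Ireg_def partitions2_def kregular_def)
    from eq[OF this] show "poly2 (g - f) (of_nat a) (of_nat b) = 0" by (simp add: poly2_diff)
  qed
  then show "g = f" by simp
qed

text \<open>Inverting \<open>dual_iso\<close>, which is multiplication by d! on symmetric tensors,
  produces the factor 1/d!.\<close>

lemma capelli_eq:
  assumes l: "l \<in> Ireg k"
  defines "d \<equiv> psize l"
  shows "capelli t k l = Poly_Mapping.single d ((((1 / fact d) \<bullet>\<^sub>s Vproj t k l) \<otimes> idm d) \<odot> coev d)"
proof -
  let ?S = "symmetrizer d"
  note V = Vproj_props[OF t l, folded d_def]
  define x where "x = (Vproj t k l \<otimes> idm d) \<odot> coev d"
  have x: "x \<in> bhom 0 (d + d)" unfolding x_def by (rule coev_twist_in_bhom[OF V(1)])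
  have SSx: "(?S \<otimes> ?S) \<odot> x = x" unfolding x_def by (rule symm_symm_coev[OF V(1,3,4)])
  have k: "kcoev t (Vcomp t k l) = x" unfolding x_def Vcomp_def d_def[symmetric] by (rule kcoev_eq[OF V(1,2)])
  have "(THE x. x \<in> khom t kunit (ktensor (symP d) (symP d)) \<and>
      (?S \<otimes> dual_iso t d) \<odot> x = kcoev t (Vcomp t k l)) = (1 / fact d) \<bullet>\<^sub>s x"
    unfolding k
  proof (rule the_equality)
    show "(1 / fact d) \<bullet>\<^sub>s x \<in> khom t kunit (ktensor (symP d) (symP d)) \<and>
        (?S \<otimes> dual_iso t d) \<odot> (1 / fact d) \<bullet>\<^sub>s x = x"
      using SSx bcomp_idm_right[OF x]
      by (simp add: khom_def kunit_def ktensor_def symP_def bhom_scale x dual_iso_eq bmor_linear)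
  next
    fix y assume y: "y \<in> khom t kunit (ktensor (symP d) (symP d)) \<and> (?S \<otimes> dual_iso t d) \<odot> y = x"
    then have "(?S \<otimes> ?S) \<odot> y = y" by (simp add: khom_def ktensor_def symP_def)
    then have "fact d \<bullet>\<^sub>s y = x" using y by (simp add: dual_iso_eq bmor_linear)
    then show "y = (1 / fact d) \<bullet>\<^sub>s x" by auto
  qed
  then show ?thesis unfolding capelli_def Let_def d_def[symmetric] by (simp add: x_def bmor_linear)
qed

text \<open>Combining \<open>act_coev\<close> with \<open>u_tensor\<close>, the coefficient of
  \<open>u t e j\<close> acquires the factor (e - 2j)! / ((d - 2j)! (e - d)!), a binomial
  coefficient. Apart from it the Newton coefficients are those of the projection.\<close>

lemma act_capelli:
  assumes l: "l \<in> Ireg k" and V: "Vproj t k l = rho t (psize l) (\<Sum>j\<le>psize l div 2. smult (A j) (newton t (psize l) j))"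
  shows "act t (capelli t k l) e = rho t e (if e < psize l then 0 else
    (\<Sum>j\<le>psize l div 2. smult (A j * of_nat ((e - 2 * j) choose (psize l - 2 * j))) (newton t e j)))"
proof (cases "e < psize l")
  case True
  then show ?thesis unfolding capelli_eq[OF l] by (simp add: act_single_gt rho_0)
next
  case False
  define d where "d = psize l"
  define r where "r = e - d"
  have e: "e = d + r" using False by (simp add: r_def d_def)
  let ?S = "symmetrizer (d + r)"
  note P = Vproj_props[OF t l, folded d_def]
  have "act t (capelli t k l) e = (fact (d + r) / fact r) \<bullet>\<^sub>s (?S \<odot> (((1 / fact d) \<bullet>\<^sub>s Vproj t k l) \<otimes> idm r) \<odot> ?S)"
    unfolding capelli_eq[OF l] d_def[symmetric] e
    by (rule act_coev) (simp_all add: bhom_scale P bmor_linear)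
  also have "\<dots> = (1 / fact r) \<bullet>\<^sub>s ((fact (d + r) / fact d) \<bullet>\<^sub>s (?S \<odot> (Vproj t k l \<otimes> idm r) \<odot> ?S))"
    by (simp add: bmor_linear)
  also have "Vproj t k l = (\<Sum>j\<le>d div 2. A j \<bullet>\<^sub>s u t d j)"
    unfolding V d_def[symmetric] rho_sum_poly rho_smult rho_newton ..
  also have "(1 / fact r) \<bullet>\<^sub>s ((fact (d + r) / fact d) \<bullet>\<^sub>s (?S \<odot> ((\<Sum>j\<le>d div 2. A j \<bullet>\<^sub>s u t d j) \<otimes> idm r) \<odot> ?S)) =
      (\<Sum>j\<le>d div 2. (1 / fact r * A j) \<bullet>\<^sub>s ((fact (d + r) / fact d) \<bullet>\<^sub>s (?S \<odot> (u t d j \<otimes> idm r) \<odot> ?S)))"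
    by (simp add: btensor_sum_left bcomp_sum_left bcomp_sum_right bmor_linear bmor.scale_sum_right mult_ac)
  also have "\<dots> = (\<Sum>j\<le>d div 2. (A j * of_nat ((e - 2 * j) choose (d - 2 * j))) \<bullet>\<^sub>s u t e j)"
  proof (rule sum.cong[OF refl])
    fix j assume "j \<in> {..d div 2}"
    then have j: "2 * j \<le> d" by auto
    have "e - 2 * j - (d - 2 * j) = r" using j by (simp add: e)
    then have "of_nat ((e - 2 * j) choose (d - 2 * j)) = (fact (e - 2 * j) / (fact (d - 2 * j) * fact r) :: complex)"
      by (subst binomial_fact) (simp_all add: e)
    then show "(1 / fact r * A j) \<bullet>\<^sub>s ((fact (d + r) / fact d) \<bullet>\<^sub>s (?S \<odot> (u t d j \<otimes> idm r) \<odot> ?S)) =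
        (A j * of_nat ((e - 2 * j) choose (d - 2 * j))) \<bullet>\<^sub>s u t e j"
      unfolding u_tensor[OF j] by (simp add: e mult_ac)
  qed
  finally show ?thesis using False unfolding d_def by (simp add: rho_sum_poly rho_smult rho_newton)
qed

text \<open>The interface between the category and the polynomials: what remains is to find the
  Newton coefficients of the idempotent and a symmetric polynomial with the resulting
  values.\<close>

theorem eigenvalue_poly_capelli:
  fixes A :: "nat \<Rightarrow> complex" and l :: "nat \<times> nat"
  defines "d \<equiv> psize l"
  assumes l: "l \<in> Ireg k"
    and e: "root_idempotent (nodal t d) (c_val t l) (\<Sum>j\<le>d div 2. smult (A j) (newton t d j))"
    and sym: "symmetric_poly2 f"
    and val: "\<And>x y :: nat. y \<le> x \<Longrightarrow> poly2 f (of_nat x - of_nat k - 1) (of_nat y) =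
      (if x + y < d then 0 else \<Sum>j\<le>d div 2. A j * of_nat ((x + y - 2 * j) choose (d - 2 * j)) *
         (ffact (of_nat x - of_nat k - 1) j * ffact (of_nat y) j))"
  shows "eigenvalue_poly t k (capelli t k l) = f"
proof (rule eigenvalue_poly_eqI[OF sym])
  show "act t (capelli t k l) (psize m) = rho t (psize m) ((\<lambda>e. if e < d then 0 else
    (\<Sum>j\<le>d div 2. smult (A j * of_nat ((e - 2 * j) choose (d - 2 * j))) (newton t e j))) (psize m))" for m
    unfolding d_def by (rule act_capelli[OF l]) (rule Vproj_eq[OF t l e[unfolded d_def]])
next
  fix m assume m: "m \<in> Ireg k"
  define x y where "x = fst m" and "y = snd m"
  have yx: "y \<le> x" and mp: "m \<in> partitions2" using m by (auto simp: Ireg_def partitions2_def x_def y_def)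
  have pm: "psize m = x + y" by (simp add: psize_def x_def y_def)
  have c: "c_val t m = node t (x + y) y" using c_val_node(1)[OF t mp pm] by (simp add: y_def)
  show "poly2 f (of_nat (fst m) - of_nat k - 1) (of_nat (snd m)) =
      poly (if psize m < d then 0 else
    (\<Sum>j\<le>d div 2. smult (A j * of_nat ((psize m - 2 * j) choose (d - 2 * j))) (newton t (psize m) j))) (c_val t m)"
    unfolding pm c x_def[symmetric] y_def[symmetric] val[OF yx]
    by (simp add: poly_sum poly_newton t algebra_simps)
qed

end

section \<open>Interpolation and Knop--Sahi polynomials\<close>

lemma ffact_gchoose: "ffact a n = fact n * (a gchoose n)" for a :: complex
  by (simp add: gbinomial_prod_rev ffact_def atLeast0LessThan)

lemma ffact_add: "ffact a (m + n) = ffact a m * ffact (a - of_nat m) n"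
  by (induction n) (simp_all add: ffact_def algebra_simps)

lemma ffact_of_nat_self: "ffact (of_nat n :: complex) n = fact n"
  by (simp add: ffact_gchoose binomial_gbinomial[symmetric])

lemma ffact_ne_0:
  fixes a :: complex
  assumes "a \<notin> \<int>"
  shows "ffact a n \<noteq> 0"
  using assms by (auto simp: ffact_def)

lemma triangle_Sigma: "{(i, j). i + j \<le> n} = (SIGMA i:{..n}. {..n - i})" for n :: nat
  by auto

lemma finite_triangle: "finite {(i, j). i + j \<le> (n::nat)}"
  unfolding triangle_Sigma by simp

lemma vandermonde3:
  fixes a b c :: complex
  shows "(\<Sum>(i, j)\<in>{(i, j). i + j \<le> n}. (a gchoose i) * (b gchoose j) * (c gchoose (n - i - j))) = (a + b + c) gchoose n"
proof -
  have "(\<Sum>(i, j)\<in>{(i, j). i + j \<le> n}. (a gchoose i) * (b gchoose j) * (c gchoose (n - i - j))) =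
      (\<Sum>i\<le>n. \<Sum>j\<le>n - i. (a gchoose i) * (b gchoose j) * (c gchoose (n - i - j)))"
    unfolding triangle_Sigma by (rule sum.Sigma[symmetric]) auto
  also have "\<dots> = (\<Sum>i\<le>n. (a gchoose i) * (\<Sum>j\<le>n - i. (b gchoose j) * (c gchoose (n - i - j))))"
    by (simp add: sum_distrib_left mult.assoc)
  also have "\<dots> = (\<Sum>i\<le>n. (a gchoose i) * ((b + c) gchoose (n - i)))"
    by (simp add: gbinomial_Vandermonde[symmetric] atLeast0AtMost)
  also have "\<dots> = (a + (b + c)) gchoose n"
    by (simp add: gbinomial_Vandermonde[symmetric] atLeast0AtMost)
  finally show ?thesis by (simp add: add.assoc)
qed

text \<open>The Newton coefficients of a Lagrange basis polynomial are the divided differences of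
  the indicator of \<open>r\<close>: zero before \<open>r\<close>, reciprocal products of node
  differences afterwards. Each further summand extends the partial Lagrange product by one
  node.\<close>

lemma lagrange_newton:
  fixes \<xi> :: "nat \<Rightarrow> complex"
  assumes "r \<le> J" and "\<And>i. i \<le> J \<Longrightarrow> i \<noteq> r \<Longrightarrow> \<xi> i \<noteq> \<xi> r"
  shows "(\<Sum>j=r..J. (\<Prod>i<j. z - \<xi> i) / (\<Prod>i\<in>{..j} - {r}. \<xi> r - \<xi> i)) = (\<Prod>i\<in>{..J} - {r}. (z - \<xi> i) / (\<xi> r - \<xi> i))"
  using assms
proof (induction J rule: dec_induct)
  case base
  have "{..r} - {r} = {..<r}" by auto
  then show ?case by (simp add: prod_dividef)
next
  case (step J)
  have S: "{..Suc J} - {r} = insert (Suc J) ({..J} - {r})" using step.hyps by auto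
  have d: "\<xi> r - \<xi> i \<noteq> 0" if "i \<le> Suc J" "i \<noteq> r" for i
    using step.prems[OF that] by simp
  define N Q where "N = (\<Prod>i\<in>{..J} - {r}. z - \<xi> i)" and "Q = (\<Prod>i\<in>{..J} - {r}. \<xi> r - \<xi> i)"
  have ne: "Q \<noteq> 0" "\<xi> r - \<xi> (Suc J) \<noteq> 0"
    unfolding Q_def using d step.hyps by simp_all
  have prod_Suc: "(\<Prod>i\<in>{..Suc J} - {r}. f i) = f (Suc J) * (\<Prod>i\<in>{..J} - {r}. f i)" for f :: "nat \<Rightarrow> complex"
    unfolding S by (rule prod.insert) auto
  have N: "(\<Prod>i<Suc J. z - \<xi> i) = (z - \<xi> r) * N"
    using prod.remove[of "{..J}" r "\<lambda>i. z - \<xi> i"] step.hyps by (simp only: N_def lessThan_Suc_atMost) simp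
  have "(\<Sum>j=r..J. (\<Prod>i<j. z - \<xi> i) / (\<Prod>i\<in>{..j} - {r}. \<xi> r - \<xi> i)) = N / Q"
    using step by (simp add: prod_dividef N_def Q_def)
  then have "(\<Sum>j=r..Suc J. (\<Prod>i<j. z - \<xi> i) / (\<Prod>i\<in>{..j} - {r}. \<xi> r - \<xi> i)) =
      N / Q + (z - \<xi> r) * N / ((\<xi> r - \<xi> (Suc J)) * Q)"
    using step.hyps by (simp only: sum.nat_ivl_Suc' prod_Suc N Q_def[symmetric]) (simp only: add.commute)
  also have "\<dots> = (z - \<xi> (Suc J)) * N / ((\<xi> r - \<xi> (Suc J)) * Q)"
    using ne by (simp add: divide_simps) (simp add: algebra_simps)
  finally show ?case by (simp only: prod_dividef prod_Suc N_def Q_def)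
qed

text \<open>An affine coordinate for the nodes:
  \<open>node t d i = node t d 0 - 4 * xi (- t / 2) d i\<close>, which absorbs the factors 1/4 and
  the signs in \<open>newton\<close>.\<close>

definition xi :: "complex \<Rightarrow> nat \<Rightarrow> nat \<Rightarrow> complex" where
  "xi \<kappa> d i = of_nat i * (of_nat d - 1 - \<kappa> - of_nat i)"

lemma xi_diff: "xi \<kappa> d r - xi \<kappa> d i = (of_nat r - of_nat i) * (of_nat d - 1 - \<kappa> - of_nat r - of_nat i)"
  by (simp add: xi_def algebra_simps)

lemma poly_newton_xi: "poly (newton t d j) (node t d y) = (\<Prod>i<j. xi (- t / 2) d y - xi (- t / 2) d i)"
proof -
  have "poly (newton t d j) (node t d y) = (\<Prod>i<j. (node t d i - node t d y) / 4)"
    by (simp add: newton_def poly_prod diff_divide_distrib)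
  also have "\<dots> = (\<Prod>i<j. xi (- t / 2) d y - xi (- t / 2) d i)"
    unfolding node_diff xi_diff mult.assoc by simp
  finally show ?thesis .
qed

text \<open>The Newton coefficient of index \<open>q\<close> of the Lagrange basis polynomial of
  node \<open>r\<close>. It does not depend on how many nodes follow, so their number is not a
  parameter.\<close>

definition lag :: "complex \<Rightarrow> nat \<Rightarrow> nat \<Rightarrow> nat \<Rightarrow> complex" where
  "lag \<kappa> d r q = (if q < r then 0 else 1 / (\<Prod>i\<in>{..q} - {r}. xi \<kappa> d r - xi \<kappa> d i))"

lemma xi_inj:
  assumes "\<kappa> \<notin> \<int>" "i \<noteq> r"
  shows "xi \<kappa> d i \<noteq> xi \<kappa> d r"
proof
  assume "xi \<kappa> d i = xi \<kappa> d r"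
  then have "(of_nat r - of_nat i :: complex) * (of_nat d - 1 - \<kappa> - of_nat r - of_nat i) = 0"
    unfolding xi_diff[symmetric] by simp
  then have "of_nat d - 1 - \<kappa> - of_nat r - of_nat i = 0" using assms(2) by simp
  then have "\<kappa> = of_nat d - 1 - of_nat r - of_nat i" by (simp add: algebra_simps)
  then have "\<kappa> \<in> \<int>" by simp
  then show False using assms(1) by simp
qed

lemma lag_poly:
  assumes "- t / 2 \<notin> \<int>" "r \<le> h" "y \<le> h"
  shows "poly (\<Sum>j\<le>h. smult (lag (- t / 2) d r j) (newton t d j)) (node t d y) = (if y = r then 1 else 0)"
proof -
  let ?x = "xi (- t / 2) d"
  have "poly (\<Sum>j\<le>h. smult (lag (- t / 2) d r j) (newton t d j)) (node t d y) =
      (\<Sum>j\<le>h. lag (- t / 2) d r j * (\<Prod>i<j. ?x y - ?x i))"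
    by (simp add: poly_sum poly_newton_xi)
  also have "\<dots> = (\<Sum>j=r..h. (\<Prod>i<j. ?x y - ?x i) / (\<Prod>i\<in>{..j} - {r}. ?x r - ?x i))"
    by (rule sum.mono_neutral_cong_right) (auto simp: lag_def)
  also have "\<dots> = (\<Prod>i\<in>{..h} - {r}. (?x y - ?x i) / (?x r - ?x i))"
    by (rule lagrange_newton[OF assms(2)]) (rule xi_inj[OF assms(1)])
  also have "\<dots> = (if y = r then 1 else 0)"
  proof (cases "y = r")
    case True
    have "(?x r - ?x i) / (?x r - ?x i) = 1" if "i \<in> {..h} - {r}" for i
      using xi_inj[OF assms(1), of i r d] that by auto
    then show ?thesis using True by simp
  next
    case False
    then have "y \<in> {..h} - {r}" using assms(3) by simp
    then have "(\<Prod>i\<in>{..h} - {r}. (?x y - ?x i) / (?x r - ?x i)) = 0" by (intro prod_zero) auto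
    then show ?thesis using False by simp
  qed
  finally show ?thesis .
qed

text \<open>The node differences factor by \<open>xi_diff\<close>. The indices below
  \<open>r\<close> give r! and the falling factorial that occur in \<open>Hnorm\<close>; the
  \<open>p\<close> indices above \<open>r\<close> give the other two factors.\<close>

lemma lag_add:
  fixes \<kappa> :: complex
  assumes d: "d = n + 2 * r"
  shows "lag \<kappa> d r (r + p) =
    1 / (fact r * ffact (of_nat (n + r) - 1 - \<kappa>) r * fact p * ffact (\<kappa> + 1 - of_nat n + of_nat p) p)"
proof -
  have "(\<Prod>i\<in>{..r + p} - {r}. xi \<kappa> d r - xi \<kappa> d i) =
      fact r * ffact (of_nat (n + r) - 1 - \<kappa>) r * fact p * ffact (\<kappa> + 1 - of_nat n + of_nat p) p"
  proof (induction p)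
    case 0
    have s: "{..r} - {r} = {..<r}" by auto
    have "(\<Prod>i<r. xi \<kappa> d r - xi \<kappa> d i) = (\<Prod>i<r. (of_nat r - of_nat i) * (of_nat (n + r) - 1 - \<kappa> - of_nat i))"
      unfolding xi_diff d by (simp add: algebra_simps)
    also have "\<dots> = ffact (of_nat r) r * ffact (of_nat (n + r) - 1 - \<kappa>) r"
      by (simp add: prod.distrib ffact_def)
    finally show ?case unfolding ffact_of_nat_self by (simp add: s ffact_def)
  next
    case (Suc p)
    have s: "{..r + Suc p} - {r} = insert (r + Suc p) ({..r + p} - {r})" by auto
    have x: "xi \<kappa> d r - xi \<kappa> d (r + Suc p) = of_nat (Suc p) * (\<kappa> + 1 - of_nat n + of_nat (Suc p))"
      unfolding xi_diff d by (simp add: algebra_simps)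
    have "ffact (\<kappa> + 1 - of_nat n + of_nat (Suc p)) (1 + p) =
        (\<kappa> + 1 - of_nat n + of_nat (Suc p)) * ffact (\<kappa> + 1 - of_nat n + of_nat p) p"
      unfolding ffact_add by (simp add: ffact_def algebra_simps)
    then have f: "fact (Suc p) * ffact (\<kappa> + 1 - of_nat n + of_nat (Suc p)) (Suc p) =
        (of_nat (Suc p) * (\<kappa> + 1 - of_nat n + of_nat (Suc p))) * (fact p * ffact (\<kappa> + 1 - of_nat n + of_nat p) p)"
      by (simp add: fact_Suc mult_ac)
    have "(\<Prod>i\<in>{..r + Suc p} - {r}. xi \<kappa> d r - xi \<kappa> d i) =
        (xi \<kappa> d r - xi \<kappa> d (r + Suc p)) * (\<Prod>i\<in>{..r + p} - {r}. xi \<kappa> d r - xi \<kappa> d i)"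
      unfolding s by (rule prod.insert) auto
    also have "\<dots> = fact r * ffact (of_nat (n + r) - 1 - \<kappa>) r *
        ((of_nat (Suc p) * (\<kappa> + 1 - of_nat n + of_nat (Suc p))) * (fact p * ffact (\<kappa> + 1 - of_nat n + of_nat p) p))"
      unfolding x Suc by (simp only: mult_ac)
    finally show ?case unfolding f[symmetric] by (simp only: mult.assoc)
  qed
  then show ?thesis by (simp add: lag_def)
qed

text \<open>Vandermonde's identity \<open>\<Sum>\<^sub>p (j choose p) (w + i choose i - p) = (w + i + j choose i)\<close>, with \<open>w = \<kappa> + 1 - n\<close>.\<close>

lemma ffact_vandermonde:
  fixes w :: complex
  assumes w: "w \<notin> \<int>"
  shows "(\<Sum>p\<le>min i j. 1 / (fact p * ffact (w + of_nat p) p * fact (i - p) * fact (j - p))) =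
    ffact (w + of_nat i + of_nat j) i / (fact i * fact j * ffact (w + of_nat i) i)"
proof -
  have nz: "ffact (w + of_nat m) q \<noteq> 0" for m q
    using w by (intro ffact_ne_0) (simp add: add_in_Ints_iff_right)
  have summand: "(of_nat j gchoose p) * ((w + of_nat i) gchoose (i - p)) =
      fact j * ffact (w + of_nat i) i * (1 / (fact p * ffact (w + of_nat p) p * fact (i - p) * fact (j - p)))"
    if p: "p \<le> i" "p \<le> j" for p
  proof -
    have "ffact (w + of_nat i) (i - p + p) = ffact (w + of_nat i) (i - p) * ffact (w + of_nat p) p"
      unfolding ffact_add using p by (simp add: of_nat_diff)
    then have "ffact (w + of_nat i) i = fact (i - p) * ((w + of_nat i) gchoose (i - p)) * ffact (w + of_nat p) p"
      using p by (simp add: ffact_gchoose)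
    moreover have "(of_nat j gchoose p :: complex) = fact j / (fact p * fact (j - p))"
      using p by (simp add: binomial_gbinomial[symmetric] binomial_fact)
    ultimately show ?thesis using nz[of p p] by (simp add: field_simps)
  qed
  have "fact j * ffact (w + of_nat i) i * (\<Sum>p\<le>min i j. 1 / (fact p * ffact (w + of_nat p) p * fact (i - p) * fact (j - p))) =
      (\<Sum>p\<le>min i j. (of_nat j gchoose p) * ((w + of_nat i) gchoose (i - p)))"
    unfolding sum_distrib_left by (rule sum.cong) (simp_all add: summand)
  also have "\<dots> = (\<Sum>p\<le>i. (of_nat j gchoose p) * ((w + of_nat i) gchoose (i - p)))"
    by (rule sum.mono_neutral_left) (auto simp: binomial_gbinomial[symmetric] not_le)
  also have "\<dots> = (of_nat j + (w + of_nat i)) gchoose i"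
    by (simp add: gbinomial_Vandermonde[symmetric] atLeast0AtMost)
  also have "\<dots> = ffact (w + of_nat i + of_nat j) i / fact i"
    by (simp add: ffact_gchoose add_ac)
  finally show ?thesis using nz[of i i] by (simp add: field_simps)
qed

section \<open>Symmetric polynomials in the falling factorial basis\<close>

definition falling_poly :: "nat \<Rightarrow> (nat \<Rightarrow> nat \<Rightarrow> complex) \<Rightarrow> complex poly poly" where
  "falling_poly d c = (\<Sum>(a, b)\<in>{(a, b). a + b \<le> d}. const2 (c a b) * ffact X2 a * ffact Y2 b)"

lemma of_nat_const2: "of_nat n = const2 (of_nat n)"
  by (metis of_nat_poly pCons_0_0)

lemma coeff_ffact_X2: "ffact X2 a = [:ffact [:0, 1:] a:]"
proof -
  have "ffact X2 a = (\<Prod>i<a. [:[:0, 1:] - of_nat i:])" unfolding ffact_def of_nat_const2 by (simp add: of_nat_poly)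
  also have "\<dots> = [:\<Prod>i<a. [:0, 1:] - of_nat i:]" by (induction a) (simp_all add: one_pCons)
  finally show ?thesis by (simp add: ffact_def)
qed

lemma coeff_ffact_Y2: "coeff (ffact Y2 b) j = [:coeff (ffact [:0, 1:] b) j:]"
proof (induction b arbitrary: j)
  case 0
  then show ?case by (cases j) (simp_all add: ffact_def one_pCons)
next
  case (Suc b)
  have 1: "ffact Y2 (Suc b) = ffact Y2 b * [:- [:of_nat b:], 1:]"
    unfolding ffact_def by (simp add: of_nat_const2)
  have 2: "ffact [:0, 1 :: complex:] (Suc b) = ffact [:0, 1:] b * [:- of_nat b, 1:]"
    unfolding ffact_def by (simp add: of_nat_poly)
  show ?case unfolding 1 2 mult_pCons_right by (cases j) (simp_all add: Suc)
qed

lemma coeff_falling_poly: "coeff (coeff (falling_poly d c) j) i =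
    (\<Sum>(a, b)\<in>{(a, b). a + b \<le> d}. c a b * (coeff (ffact [:0, 1:] a) i * coeff (ffact [:0, 1:] b) j))"
proof -
  have "coeff (coeff (const2 c * ffact X2 a * ffact Y2 b) j) i = c * (coeff (ffact [:0, 1:] a) i * coeff (ffact [:0, 1:] b) j)"
    for c a b
    unfolding coeff_ffact_X2 by (simp add: coeff_ffact_Y2)
  then show ?thesis
    unfolding falling_poly_def coeff_sum by (intro sum.cong refl) auto
qed

lemma symmetric_falling_poly:
  assumes "\<And>a b. c a b = c b a"
  shows "symmetric_poly2 (falling_poly d c)"
  unfolding symmetric_poly2_def coeff_falling_poly
proof (intro allI)
  show "(\<Sum>(a, b)\<in>{(a, b). a + b \<le> d}. c a b * (coeff (ffact [:0, 1:] a) i * coeff (ffact [:0, 1:] b) j)) =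
      (\<Sum>(a, b)\<in>{(a, b). a + b \<le> d}. c a b * (coeff (ffact [:0, 1:] a) j * coeff (ffact [:0, 1:] b) i))" for i j
    by (rule sum.reindex_bij_witness[of _ prod.swap prod.swap]) (auto simp: assms mult_ac add.commute)
qed

lemma poly2_falling_poly: "poly2 (falling_poly d c) x y =
    (\<Sum>(a, b)\<in>{(a, b). a + b \<le> d}. c a b * (ffact x a * ffact y b))"
  unfolding falling_poly_def poly2_sum case_prod_beta poly2_mult poly2_const2 poly2_ffact mult.assoc ..

text \<open>The coefficients of the sum over q of \<open>A q * ((x + y + \<kappa> + 1 - 2 * of_nat
  q) gchoose (d - 2 * q)) * ffact x q * ffact y q\<close>, found by expanding the binomial
  coefficient with \<open>vandermonde3\<close>. At integers its terms are those in
  \<open>eigenvalue_poly_capelli\<close>.\<close>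

definition falling_coeff :: "complex \<Rightarrow> nat \<Rightarrow> (nat \<Rightarrow> complex) \<Rightarrow> nat \<Rightarrow> nat \<Rightarrow> complex" where
  "falling_coeff \<kappa> d A a b =
     (\<Sum>q\<le>min a b. A q * ((\<kappa> + 1) gchoose (d - a - b)) / (fact (a - q) * fact (b - q)))"

lemma falling_coeff_sym: "falling_coeff \<kappa> d A a b = falling_coeff \<kappa> d A b a"
  unfolding falling_coeff_def by (simp add: min.commute mult.commute add.commute)

lemma sum_triangle_shift:
  fixes h :: "nat \<Rightarrow> nat \<Rightarrow> 'a :: comm_monoid_add"
  assumes q: "2 * q \<le> d" and "\<And>a b. a < q \<or> b < q \<Longrightarrow> h a b = 0"
  shows "(\<Sum>(a, b)\<in>{(a, b). a + b \<le> d}. h a b) = (\<Sum>(i, j)\<in>{(i, j). i + j \<le> d - 2 * q}. h (q + i) (q + j))"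
proof -
  have "(\<Sum>(a, b)\<in>{(a, b). a + b \<le> d}. h a b) = (\<Sum>(a, b)\<in>{(a, b). a + b \<le> d \<and> q \<le> a \<and> q \<le> b}. h a b)"
    by (rule sum.mono_neutral_right) (auto simp: finite_triangle, (metis assms(2) not_le)+)
  also have "\<dots> = (\<Sum>(i, j)\<in>{(i, j). i + j \<le> d - 2 * q}. h (q + i) (q + j))"
    by (rule sum.reindex_bij_witness[of _ "\<lambda>(i, j). (q + i, q + j)" "\<lambda>(a, b). (a - q, b - q)"]) (use q in auto)
  finally show ?thesis .
qed

lemma sum_atMost_shift:
  fixes g :: "nat \<Rightarrow> 'a :: comm_monoid_add"
  assumes "\<And>q. q < r \<Longrightarrow> g q = 0"
  shows "sum g {..r + m} = (\<Sum>p\<le>m. g (r + p))"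
proof (induction m)
  case 0
  have "sum g {..r} = sum g {r}" by (rule sum.mono_neutral_right) (auto simp: assms)
  then show ?case by simp
qed simp

text \<open>Coefficients of falling factorials are compared. For fixed \<open>i\<close> and
  \<open>j\<close> the sum over the Newton coefficients is evaluated by
  \<open>ffact_vandermonde\<close>, and the factors of \<open>Hnorm\<close> are supplied by
  \<open>lag_add\<close>.\<close>

theorem normalized_KnopSahi:
  fixes \<kappa> :: complex
  assumes \<kappa>: "\<kappa> \<notin> \<int>" and l: "snd l \<le> fst l"
  shows "const2 (1 / Hnorm l \<kappa>) * KnopSahi l \<kappa> =
    falling_poly (psize l) (falling_coeff \<kappa> (psize l) (lag \<kappa> (psize l) (snd l)))"
proof -
  define r n d where "r = snd l" and "n = fst l - snd l" and "d = psize l"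
  have fl: "fst l = n + r" and d: "d = n + 2 * r" using l by (simp_all add: r_def n_def d_def psize_def)
  define H where "H = ffact (of_nat (n + r) - 1 - \<kappa>) r"
  \<comment> \<open>Non-integrality of \<open>\<kappa>\<close> is inherited by these shifts and
    keeps all falling factorials in denominators nonzero.\<close>
  have k1: "\<kappa> + 1 \<notin> \<int>" and kn: "of_nat (n + r) - 1 - \<kappa> \<notin> \<int>" and w: "\<kappa> + 1 - of_nat n \<notin> \<int>"
  proof -
    show "\<kappa> + 1 \<notin> \<int>" using \<kappa> Ints_diff[of "\<kappa> + 1" 1] by auto
    show "of_nat (n + r) - 1 - \<kappa> \<notin> \<int>" using \<kappa> Ints_diff[of "of_nat (n + r) - 1" "of_nat (n + r) - 1 - \<kappa>"] by auto
    show "\<kappa> + 1 - of_nat n \<notin> \<int>" using \<kappa> Ints_add[of "\<kappa> + 1 - of_nat n" "of_nat n - 1"] by auto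
  qed
  define F where "F = ffact (\<kappa> + 1)"
  have F0: "F m \<noteq> 0" for m unfolding F_def by (rule ffact_ne_0[OF k1])
  have H0: "H \<noteq> 0" unfolding H_def by (rule ffact_ne_0[OF kn])
  have coeff: "falling_coeff \<kappa> d (lag \<kappa> d r) (r + i) (r + j) = 1 / (fact n * fact r * H) *
      (fact n * F (n - i) * F (n - j) / (fact i * fact j * fact (n - i - j) * F n))"
    if ij: "i + j \<le> n" for i j
  proof -
    let ?w = "\<kappa> + 1 - of_nat n"
    \<comment> \<open>The quotients F(n - j) / F(n - i - j) and F(n) / F(n - i) of falling
      factorials of \<open>\<kappa> + 1\<close>, in the form in which
      \<open>ffact_vandermonde\<close> produces them.\<close>
    define T R where "T = ffact (?w + of_nat i + of_nat j) i" and "R = ffact (?w + of_nat i) i"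
    have R0: "R \<noteq> 0" unfolding R_def using w by (intro ffact_ne_0) (simp add: add_in_Ints_iff_right)
    have "F (n - i + i) = F (n - i) * R"
      unfolding F_def R_def ffact_add using ij by (simp add: of_nat_diff algebra_simps)
    then have Fn: "F n = F (n - i) * R" using ij by simp
    have "F (n - i - j + i) = F (n - i - j) * T"
      unfolding F_def T_def ffact_add using ij by (simp add: of_nat_diff algebra_simps)
    then have Fj: "F (n - j) = F (n - i - j) * T" using ij by (simp add: add.commute)
    have g: "(\<kappa> + 1) gchoose (n - i - j) = F (n - i - j) / fact (n - i - j)"
      by (simp add: F_def ffact_gchoose)
    have dd: "d - (r + i) - (r + j) = n - i - j" using ij by (simp add: d)
    have "falling_coeff \<kappa> d (lag \<kappa> d r) (r + i) (r + j) =
        (\<Sum>p\<le>min i j. lag \<kappa> d r (r + p) * ((\<kappa> + 1) gchoose (n - i - j)) / (fact (i - p) * fact (j - p)))"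
      unfolding falling_coeff_def dd min_add_distrib_right[symmetric]
      by (subst sum_atMost_shift) (simp_all add: lag_def)
    also have "\<dots> = ((\<kappa> + 1) gchoose (n - i - j)) / (fact r * H) *
        (\<Sum>p\<le>min i j. 1 / (fact p * ffact (?w + of_nat p) p * fact (i - p) * fact (j - p)))"
      unfolding lag_add[OF d] H_def[symmetric] sum_distrib_left by (simp add: mult_ac)
    also have "\<dots> = F (n - i - j) / fact (n - i - j) / (fact r * H) * (T / (fact i * fact j * R))"
      unfolding ffact_vandermonde[OF w] T_def R_def g ..
    also have "\<dots> = 1 / (fact n * fact r * H) *
        (fact n * F (n - i) * F (n - j) / (fact i * fact j * fact (n - i - j) * F n))"
      unfolding Fn Fj using F0[of "n - i"] R0 H0 by (simp add: field_simps)
    finally show ?thesis .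
  qed
  have zero: "falling_coeff \<kappa> d (lag \<kappa> d r) a b = 0" if "a < r \<or> b < r" for a b
    unfolding falling_coeff_def by (rule sum.neutral) (use that in \<open>auto simp: lag_def\<close>)
  have "falling_poly d (falling_coeff \<kappa> d (lag \<kappa> d r)) =
      (\<Sum>(i, j)\<in>{(i, j). i + j \<le> d - 2 * r}. const2 (falling_coeff \<kappa> d (lag \<kappa> d r) (r + i) (r + j)) * ffact X2 (r + i) * ffact Y2 (r + j))"
    unfolding falling_poly_def
  proof (rule sum_triangle_shift)
    show "const2 (falling_coeff \<kappa> d (lag \<kappa> d r) a b) * ffact X2 a * ffact Y2 b = 0" if "a < r \<or> b < r" for a b
      unfolding zero[OF that] by simp
  qed (simp add: d)
  also have "\<dots> = (\<Sum>(i, j)\<in>{(i, j). i + j \<le> n}. const2 (1 / (fact n * fact r * H)) *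
      (const2 (fact n * F (n - i) * F (n - j) / (fact i * fact j * fact (n - i - j) * F n)) * ffact X2 (r + i) * ffact Y2 (r + j)))"
  proof (rule sum.cong)
    show "{(i, j). i + j \<le> d - 2 * r} = {(i, j). i + j \<le> n}" by (simp add: d)
    fix z assume "z \<in> {(i, j). i + j \<le> n}"
    then obtain i j where z: "z = (i, j)" "i + j \<le> n" by auto
    have cc: "const2 (a * b) * p * q = const2 a * (const2 b * p * q)" for a b p q by simp
    show "(case z of (i, j) \<Rightarrow> const2 (falling_coeff \<kappa> d (lag \<kappa> d r) (r + i) (r + j)) * ffact X2 (r + i) * ffact Y2 (r + j)) =
      (case z of (i, j) \<Rightarrow> const2 (1 / (fact n * fact r * H)) *
      (const2 (fact n * F (n - i) * F (n - j) / (fact i * fact j * fact (n - i - j) * F n)) * ffact X2 (r + i) * ffact Y2 (r + j)))"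
      unfolding z(1) prod.case coeff[OF z(2)] by (rule cc)
  qed
  also have "\<dots> = const2 (1 / (fact n * fact r * H)) * KnopSahi l \<kappa>"
    unfolding KnopSahi_def Let_def n_def F_def sum_distrib_left case_prod_beta by (simp only: r_def mult.assoc)
  also have "fact n * fact r * H = Hnorm l \<kappa>"
    by (simp add: Hnorm_def H_def fl r_def[symmetric])
  finally show ?thesis by (simp add: d_def r_def)
qed

text \<open>Each falling factorial of length q + i splits into one of length q and i! times a
  binomial coefficient, so for fixed q the sum over the triangle is Vandermonde's identity with
  three terms.\<close>

lemma poly2_falling_coeff:
  fixes x y \<kappa> :: complex
  shows "poly2 (falling_poly d (falling_coeff \<kappa> d A)) x y =
    (\<Sum>q\<le>d div 2. A q * ((x + y + \<kappa> + 1 - 2 * of_nat q) gchoose (d - 2 * q)) * (ffact x q * ffact y q))"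
proof -
  \<comment> \<open>Extended by zero, so that the range of \<open>q\<close> does not depend on
    \<open>a\<close> and \<open>b\<close> and the sums can be exchanged.\<close>
  define h where "h q a b = (if q \<le> a \<and> q \<le> b then A q * ((\<kappa> + 1) gchoose (d - a - b)) / (fact (a - q) * fact (b - q)) * (ffact x a * ffact y b) else 0)" for q a b
  have "falling_coeff \<kappa> d A a b * (ffact x a * ffact y b) = (\<Sum>q\<le>d div 2. h q a b)" if "a + b \<le> d" for a b
  proof -
    have "falling_coeff \<kappa> d A a b * (ffact x a * ffact y b) = (\<Sum>q\<le>min a b. h q a b)"
      unfolding falling_coeff_def sum_distrib_right by (rule sum.cong) (simp_all add: h_def)
    also have "\<dots> = (\<Sum>q\<le>d div 2. h q a b)"
      by (rule sum.mono_neutral_left) (use that in \<open>auto simp: h_def\<close>)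
    finally show ?thesis .
  qed
  then have "poly2 (falling_poly d (falling_coeff \<kappa> d A)) x y = (\<Sum>(a, b)\<in>{(a, b). a + b \<le> d}. \<Sum>q\<le>d div 2. h q a b)"
    unfolding poly2_falling_poly by (intro sum.cong refl) auto
  also have "\<dots> = (\<Sum>q\<le>d div 2. \<Sum>(a, b)\<in>{(a, b). a + b \<le> d}. h q a b)"
    unfolding case_prod_beta by (rule sum.swap)
  also have "\<dots> = (\<Sum>q\<le>d div 2. A q * ((x + y + \<kappa> + 1 - 2 * of_nat q) gchoose (d - 2 * q)) * (ffact x q * ffact y q))"
  proof (rule sum.cong[OF refl])
    fix q assume "q \<in> {..d div 2}"
    then have q: "2 * q \<le> d" by auto
    have "(\<Sum>(a, b)\<in>{(a, b). a + b \<le> d}. h q a b) = (\<Sum>(i, j)\<in>{(i, j). i + j \<le> d - 2 * q}. h q (q + i) (q + j))"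
      by (rule sum_triangle_shift[OF q]) (auto simp: h_def)
    also have "\<dots> = (\<Sum>(i, j)\<in>{(i, j). i + j \<le> d - 2 * q}. A q * (ffact x q * ffact y q) *
        (((x - of_nat q) gchoose i) * ((y - of_nat q) gchoose j) * ((\<kappa> + 1) gchoose (d - 2 * q - i - j))))"
    proof (rule sum.cong[OF refl])
      fix z assume "z \<in> {(i, j). i + j \<le> d - 2 * q}"
      obtain i j where z: "z = (i, j)" by (cases z)
      have "d - (q + i) - (q + j) = d - 2 * q - i - j" by simp
      then show "(case z of (i, j) \<Rightarrow> h q (q + i) (q + j)) = (case z of (i, j) \<Rightarrow> A q * (ffact x q * ffact y q) *
        (((x - of_nat q) gchoose i) * ((y - of_nat q) gchoose j) * ((\<kappa> + 1) gchoose (d - 2 * q - i - j))))"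
        unfolding z prod.case h_def ffact_add ffact_gchoose[of _ i] ffact_gchoose[of _ j] by simp
    qed
    also have "\<dots> = A q * (ffact x q * ffact y q) * ((x - of_nat q + (y - of_nat q) + (\<kappa> + 1)) gchoose (d - 2 * q))"
      unfolding vandermonde3[symmetric] sum_distrib_left case_prod_beta ..
    also have "x - of_nat q + (y - of_nat q) + (\<kappa> + 1) = x + y + \<kappa> + 1 - 2 * of_nat q" by simp
    finally show "(\<Sum>(a, b)\<in>{(a, b). a + b \<le> d}. h q a b) =
        A q * ((x + y + \<kappa> + 1 - 2 * of_nat q) gchoose (d - 2 * q)) * (ffact x q * ffact y q)"
      by (simp only: mult_ac)
  qed
  finally show ?thesis .
qed

text \<open>At \<open>\<kappa> = k\<close> the shift of x cancels and the upper index is the integer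
  x + y - 2j. It can be negative only for y < j, and then \<open>ffact (of_nat y) j\<close> is zero.
  For x + y < d the ordinary binomial coefficient vanishes.\<close>

lemma poly2_falling_coeff_nat:
  assumes yx: "y \<le> x"
  shows "poly2 (falling_poly d (falling_coeff (of_nat k) d A)) (of_nat x - of_nat k - 1) (of_nat y) =
      (if x + y < d then 0 else \<Sum>j\<le>d div 2. A j * of_nat ((x + y - 2 * j) choose (d - 2 * j)) *
         (ffact (of_nat x - of_nat k - 1) j * ffact (of_nat y) j))"
proof -
  let ?X = "of_nat x - of_nat k - 1 :: complex"
  have summand: "A j * ((?X + of_nat y + of_nat k + 1 - 2 * of_nat j) gchoose (d - 2 * j)) * (ffact ?X j * ffact (of_nat y) j) =
      (if x + y < d then 0 else A j * of_nat ((x + y - 2 * j) choose (d - 2 * j)) * (ffact ?X j * ffact (of_nat y) j))"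
    if j: "2 * j \<le> d" for j
  proof (cases "y < j")
    case True
    then have "ffact (of_nat y :: complex) j = 0" by (auto simp: ffact_def)
    then show ?thesis by simp
  next
    case False
    then have "2 * j \<le> x + y" using yx by simp
    then have "?X + of_nat y + of_nat k + 1 - 2 * of_nat j = of_nat (x + y - 2 * j)"
      by (simp add: of_nat_diff)
    moreover have "(x + y - 2 * j) choose (d - 2 * j) = 0" if "x + y < d"
      using that j \<open>2 * j \<le> x + y\<close> by (intro binomial_eq_0) simp
    ultimately show ?thesis by (simp add: binomial_gbinomial[symmetric])
  qed
  show ?thesis unfolding poly2_falling_coeff
    by (subst sum.cong[OF refl summand]) (auto intro: sum.neutral)
qed

section \<open>The limit\<close>

text \<open>The cofactor of z - w is built factor by factor instead of by division, since z and w
  merge in the limit.\<close>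

lemma prod_diff_quotient:
  fixes z w :: "'s \<Rightarrow> complex" and a :: "'i \<Rightarrow> 's \<Rightarrow> complex"
  assumes "finite A" "(z \<longlongrightarrow> z0) F" "(w \<longlongrightarrow> w0) F" "\<And>i. i \<in> A \<Longrightarrow> (a i \<longlongrightarrow> a0 i) F"
  shows "\<exists>Q L. (\<forall>s. (\<Prod>i\<in>A. z s - a i s) - (\<Prod>i\<in>A. w s - a i s) = (z s - w s) * Q s) \<and> (Q \<longlongrightarrow> L) F"
  using assms(1,4)
proof (induction A rule: finite_induct)
  case empty
  show ?case by (intro exI[of _ "\<lambda>_. 0"] exI[of _ 0]) simp
next
  case (insert x A)
  then obtain Q L where Q: "\<And>s. (\<Prod>i\<in>A. z s - a i s) - (\<Prod>i\<in>A. w s - a i s) = (z s - w s) * Q s" "(Q \<longlongrightarrow> L) F"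
    by blast
  define Q' where "Q' s = (z s - a x s) * Q s + (\<Prod>i\<in>A. w s - a i s)" for s
  have "(\<Prod>i\<in>insert x A. z s - a i s) - (\<Prod>i\<in>insert x A. w s - a i s) = (z s - w s) * Q' s" for s
  proof -
    have "(\<Prod>i\<in>insert x A. z s - a i s) - (\<Prod>i\<in>insert x A. w s - a i s) =
        (z s - a x s) * ((\<Prod>i\<in>A. z s - a i s) - (\<Prod>i\<in>A. w s - a i s)) + (z s - w s) * (\<Prod>i\<in>A. w s - a i s)"
      using insert.hyps by (simp add: algebra_simps)
    then show ?thesis unfolding Q(1) Q'_def by (simp add: algebra_simps)
  qed
  moreover have "(Q' \<longlongrightarrow> (z0 - a0 x) * L + (\<Prod>i\<in>A. w0 - a0 i)) F"
    unfolding Q'_def using insert.prems by (intro tendsto_intros assms(2,3) Q(2)) auto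
  ultimately show ?case by blast
qed

lemma tendsto_xi: "((\<lambda>s. xi (- s / 2) d i) \<longlongrightarrow> xi (- t / 2) d i) (at t)"
  unfolding xi_def by (intro tendsto_intros) simp

text \<open>The exceptional parameters are the even integers, so a punctured disc of radius 2 around
  one of them contains no other.\<close>

lemma eventually_not_Ints:
  fixes t :: complex
  assumes t: "t = - 2 * of_nat k"
  shows "eventually (\<lambda>s. - s / 2 \<notin> \<int>) (at t)"
  unfolding eventually_at
proof (intro exI[of _ 2] conjI ballI impI notI)
  fix s assume s: "s \<noteq> t \<and> dist s t < 2" and int: "- s / 2 \<in> \<int>"
  from int obtain m where m: "- s / 2 = of_int m" by (rule Ints_cases)
  have "s = - 2 * (- s / 2)" by simp
  then have st: "s - t = - 2 * of_int (m - int k)" unfolding m t by simp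
  then have "dist s t = 2 * norm (of_int (m - int k) :: complex)"
    unfolding dist_norm by (simp only: norm_mult) simp
  also have "\<dots> = 2 * \<bar>of_int (m - int k)\<bar>" by (simp only: norm_of_int)
  finally have "\<bar>real_of_int (m - int k)\<bar> < 1" using s by simp
  then have "m - int k = 0" by linarith
  then show False using st s by simp
qed simp

text \<open>For j \<ge> r both coefficients have the vanishing difference of the nodes
  \<open>r\<close> and \<open>r'\<close> in the denominator, with opposite signs, and the poles
  cancel. For smaller j at most the coefficient of \<open>r'\<close> is nonzero, and its denominator
  does not yet contain node \<open>r\<close>.\<close>

lemma lag_sum_convergent:
  fixes t :: complex
  assumes t: "t = - 2 * of_nat k" and r: "r' < r" "r + r' + k + 1 = d"
  shows "\<exists>L. ((\<lambda>s. lag (- s / 2) d r j + lag (- s / 2) d r' j) \<longlongrightarrow> L) (at t)"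
proof -
  let ?x = "\<lambda>i s. xi (- s / 2) d i"
  have ne: "?x i t \<noteq> ?x r t" "?x i t \<noteq> ?x r' t" if "i \<noteq> r" "i \<noteq> r'" for i
  proof -
    have "node t d i \<noteq> node t d r" "node t d i \<noteq> node t d r'"
      unfolding node_eq_iff[OF t] using that r by auto
    moreover have "node t d i - node t d q = 4 * (?x q t - ?x i t)" for q
      unfolding node_diff xi_diff by simp
    ultimately show "?x i t \<noteq> ?x r t" "?x i t \<noteq> ?x r' t"
      by (metis cancel_comm_monoid_add_class.diff_cancel mult_zero_right right_minus_eq)+
  qed
  consider "j < r'" | "r' \<le> j" "j < r" | "r \<le> j" by linarith
  then show ?thesis
  proof cases
    case 1
    then show ?thesis using r(1) by (intro exI[of _ 0]) (simp add: lag_def)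
  next
    case 2
    have "((\<lambda>s. 1 / (\<Prod>i\<in>{..j} - {r'}. ?x r' s - ?x i s)) \<longlongrightarrow> 1 / (\<Prod>i\<in>{..j} - {r'}. ?x r' t - ?x i t)) (at t)"
    proof (intro tendsto_intros tendsto_xi)
      have "?x r' t - ?x i t \<noteq> 0" if "i \<in> {..j} - {r'}" for i
        using ne(2)[of i] that 2 by auto
      then show "(\<Prod>i\<in>{..j} - {r'}. ?x r' t - ?x i t) \<noteq> 0" by simp
    qed
    then show ?thesis using 2 by (auto simp: lag_def)
  next
    case 3
    define B where "B = {..j} - {r, r'}"
    define G where "G q s = (\<Prod>i\<in>B. ?x q s - ?x i s)" for q s
    have B: "{..j} - {r} = insert r' B" "{..j} - {r'} = insert r B" "finite B" "r \<notin> B" "r' \<notin> B"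
      using 3 r(1) by (auto simp: B_def)
    obtain Q L where Q: "\<And>s. G r s - G r' s = (?x r s - ?x r' s) * Q s" "(Q \<longlongrightarrow> L) (at t)"
    proof -
      have "\<exists>Q L. (\<forall>s. G r s - G r' s = (?x r s - ?x r' s) * Q s) \<and> (Q \<longlongrightarrow> L) (at t)"
        unfolding G_def by (rule prod_diff_quotient[OF B(3)]) (rule tendsto_xi)+
      then show ?thesis using that by blast
    qed
    have G: "(G q \<longlongrightarrow> G q t) (at t)" for q
      unfolding G_def by (intro tendsto_intros tendsto_xi)
    have G0: "G r t \<noteq> 0" "G r' t \<noteq> 0"
    proof -
      have "?x r t - ?x i t \<noteq> 0" "?x r' t - ?x i t \<noteq> 0" if "i \<in> B" for i
        using ne[of i] that by (simp_all add: B_def)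
      then show "G r t \<noteq> 0" "G r' t \<noteq> 0" unfolding G_def prod_zero_iff[OF B(3)] by blast+
    qed
    \<comment> \<open>With x and x' the two merging nodes, the sum is -(G r - G r') / ((x - x') G r
      G r'); the factor x - x' of the numerator cancels and leaves \<open>Q\<close>.\<close>
    have lim: "((\<lambda>s. - Q s / (G r s * G r' s)) \<longlongrightarrow> - L / (G r t * G r' t)) (at t)"
      using G0 by (intro tendsto_intros Q(2) G) simp
    have ev: "eventually (\<lambda>s. - Q s / (G r s * G r' s) = lag (- s / 2) d r j + lag (- s / 2) d r' j) (at t)"
      using eventually_not_Ints[OF t]
    proof eventually_elim
      case (elim s)
      have x: "?x r s - ?x r' s \<noteq> 0" using xi_inj[OF elim, of r r' d] r(1) by simp
      have Gs: "G r s \<noteq> 0" "G r' s \<noteq> 0"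
      proof -
        have "?x r s - ?x i s \<noteq> 0" "?x r' s - ?x i s \<noteq> 0" if "i \<in> B" for i
          using xi_inj[OF elim, of i r d] xi_inj[OF elim, of i r' d] that by (simp_all add: B_def)
        then show "G r s \<noteq> 0" "G r' s \<noteq> 0" unfolding G_def prod_zero_iff[OF B(3)] by blast+
      qed
      have "lag (- s / 2) d r j = 1 / ((?x r s - ?x r' s) * G r s)" "lag (- s / 2) d r' j = 1 / ((?x r' s - ?x r s) * G r' s)"
        using 3 r(1) B by (simp_all add: lag_def G_def)
      moreover have "1 / ((?x r s - ?x r' s) * G r s) + 1 / ((?x r' s - ?x r s) * G r' s) = - (G r s - G r' s) / ((?x r s - ?x r' s) * G r s * G r' s)"
        using x Gs by (simp add: divide_simps) (simp add: algebra_simps)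
      ultimately show ?case unfolding Q(1) using x by simp
    qed
    show ?thesis using Lim_transform_eventually[OF lim ev] by blast
  qed
qed

section \<open>Coefficientwise limits and divisibility\<close>

definition coeff_tendsto :: "('s \<Rightarrow> complex poly) \<Rightarrow> complex poly \<Rightarrow> 's filter \<Rightarrow> bool" where
  "coeff_tendsto f g F \<longleftrightarrow> (\<forall>i. ((\<lambda>s. coeff (f s) i) \<longlongrightarrow> coeff g i) F)"

lemma coeff_tendsto_const: "coeff_tendsto (\<lambda>_. g) g F"
  by (simp add: coeff_tendsto_def)

lemma coeff_tendsto_diff: "coeff_tendsto f g F \<Longrightarrow> coeff_tendsto f' g' F \<Longrightarrow> coeff_tendsto (\<lambda>s. f s - f' s) (g - g') F"
  by (simp add: coeff_tendsto_def tendsto_diff)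

lemma coeff_tendsto_mult: "coeff_tendsto f g F \<Longrightarrow> coeff_tendsto f' g' F \<Longrightarrow> coeff_tendsto (\<lambda>s. f s * f' s) (g * g') F"
  unfolding coeff_tendsto_def coeff_mult by (intro allI tendsto_intros) blast+

lemma coeff_tendsto_smult: "(c \<longlongrightarrow> c') F \<Longrightarrow> coeff_tendsto f g F \<Longrightarrow> coeff_tendsto (\<lambda>s. smult (c s) (f s)) (smult c' g) F"
  by (simp add: coeff_tendsto_def tendsto_mult)

lemma coeff_tendsto_sum: "(\<And>i. i \<in> B \<Longrightarrow> coeff_tendsto (f i) (g i) F) \<Longrightarrow> coeff_tendsto (\<lambda>s. \<Sum>i\<in>B. f i s) (\<Sum>i\<in>B. g i) F"
  unfolding coeff_tendsto_def coeff_sum by (intro allI tendsto_sum) blast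

lemma coeff_tendsto_linear: "(a \<longlongrightarrow> a') F \<Longrightarrow> coeff_tendsto (\<lambda>s. [:a s, b:]) [:a', b:] F"
  by (simp add: coeff_tendsto_def coeff_pCons split: nat.split)

text \<open>The linear factors are removed one at a time by synthetic division. The quotients
  converge as well, and the value at the moving root, being eventually zero, has limit zero. Roots
  are allowed to merge in the limit, which is the point of the lemma.\<close>

lemma dvd_limit:
  fixes a :: "'i \<Rightarrow> 's \<Rightarrow> complex"
  assumes "finite A" and F: "F \<noteq> bot" and a: "\<And>i. i \<in> A \<Longrightarrow> (a i \<longlongrightarrow> b i) F"
    and "coeff_tendsto f g F" "\<And>s. degree (f s) \<le> N"
    and "eventually (\<lambda>s. (\<Prod>i\<in>A. [:- a i s, 1:]) dvd f s) F"
  shows "(\<Prod>i\<in>A. [:- b i, 1:]) dvd g"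
  using assms(1,3-)
proof (induction A arbitrary: f g rule: finite_induct)
  case (insert x A)
  define q where "q s = synthetic_div (f s) (a x s)" for s
  define q' where "q' = synthetic_div g (b x)"
  have rec: "coeff p (Suc i) + c * coeff (synthetic_div p c) (Suc i) = coeff (synthetic_div p c) i"
    "coeff p 0 + c * coeff (synthetic_div p c) 0 = poly p c" for p :: "complex poly" and c i
    using arg_cong[OF synthetic_div_correct[of p c], of "\<lambda>p. coeff p (Suc i)"]
      arg_cong[OF synthetic_div_correct[of p c], of "\<lambda>p. coeff p 0"] by simp_all
  have f: "((\<lambda>s. coeff (f s) i) \<longlongrightarrow> coeff g i) F" for i
    using insert.prems(2) by (simp add: coeff_tendsto_def)
  have ax: "(a x \<longlongrightarrow> b x) F" using insert.prems(1) by simp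
  have dq: "degree (q s) \<le> N" for s using insert.prems(3)[of s] by (simp add: q_def degree_synthetic_div)
  have dg: "degree g \<le> N"
  proof (rule degree_le, intro allI impI)
    fix i assume "N < i"
    then have "coeff (f s) i = 0" for s using insert.prems(3)[of s] by (intro coeff_eq_0) simp
    then show "coeff g i = 0" using f[of i] tendsto_unique[OF F] by (simp add: tendsto_const_iff[OF F])
  qed
  \<comment> \<open>Horner's recursion determines the coefficients of the quotient from the top
    down; the uniform degree bound \<open>N\<close> gives the induction its start.\<close>
  have q: "((\<lambda>s. coeff (q s) i) \<longlongrightarrow> coeff q' i) F" for i
  proof (induction "N - i" arbitrary: i)
    case 0
    then have "coeff (q s) i = 0" for s
    proof (cases "N = i")
      case True
      have "degree (q s) < N \<or> q s = 0" using insert.prems(3)[of s]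
        by (auto simp: q_def degree_synthetic_div synthetic_div_eq_0_iff)
      then show ?thesis using True by (auto intro: coeff_eq_0)
    qed (use 0 dq[of s] in \<open>auto intro: coeff_eq_0\<close>)
    moreover have "coeff q' i = 0"
    proof (cases "N = i")
      case True
      have "degree q' < N \<or> q' = 0" using dg
        by (auto simp: q'_def degree_synthetic_div synthetic_div_eq_0_iff)
      then show ?thesis using True by (auto intro: coeff_eq_0)
    next
      case False
      have "degree q' \<le> N" using dg by (simp add: q'_def degree_synthetic_div)
      then show ?thesis using 0 False by (auto intro: coeff_eq_0)
    qed
    ultimately show ?case by simp
  next
    case (Suc n)
    then have "((\<lambda>s. coeff (q s) (Suc i)) \<longlongrightarrow> coeff q' (Suc i)) F" by simp
    then have "((\<lambda>s. coeff (f s) (Suc i) + a x s * coeff (q s) (Suc i)) \<longlongrightarrow> coeff g (Suc i) + b x * coeff q' (Suc i)) F"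
      by (intro tendsto_intros f ax)
    then show ?case unfolding q_def q'_def rec(1) .
  qed
  have split: "[:- a x s, 1:] * q s = f s \<and> (\<Prod>i\<in>A. [:- a i s, 1:]) dvd q s \<and> poly (f s) (a x s) = 0"
    if dv: "(\<Prod>i\<in>insert x A. [:- a i s, 1:]) dvd f s" for s
  proof -
    have dv': "[:- a x s, 1:] * (\<Prod>i\<in>A. [:- a i s, 1:]) dvd f s" using dv unfolding prod.insert[OF insert.hyps(1,2)] .
    then have "[:- a x s, 1:] dvd f s" by (rule dvd_mult_left)
    then have 0: "poly (f s) (a x s) = 0" by (simp only: poly_eq_0_iff_dvd)
    then have fs: "[:- a x s, 1:] * q s = f s"
      using synthetic_div_correct'[of "a x s" "f s"] by (simp add: q_def)
    have "[:- a x s, 1:] \<noteq> 0" by simp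
    then have "(\<Prod>i\<in>A. [:- a i s, 1:]) dvd q s" using dv' unfolding fs[symmetric] by (simp only: dvd_mult_cancel_left) simp
    then show ?thesis using 0 fs by blast
  qed
  have "eventually (\<lambda>s. (\<Prod>i\<in>A. [:- a i s, 1:]) dvd q s) F"
    using insert.prems(4) by eventually_elim (use split in blast)
  then have q'dvd: "(\<Prod>i\<in>A. [:- b i, 1:]) dvd q'"
    using insert.prems(1) q dq by (intro insert.IH[of q q']) (auto simp: coeff_tendsto_def)
  have "((\<lambda>s. poly (f s) (a x s)) \<longlongrightarrow> poly g (b x)) F"
    unfolding rec(2)[symmetric] q_def[symmetric] q'_def[symmetric] by (intro tendsto_intros f q ax)
  moreover have "((\<lambda>s. poly (f s) (a x s)) \<longlongrightarrow> 0) F"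
    by (rule tendsto_eventually) (use insert.prems(4) in eventually_elim, use split in blast)
  ultimately have "poly g (b x) = 0" using tendsto_unique[OF F] by blast
  then have "g = [:- b x, 1:] * q'" using synthetic_div_correct'[of "b x" g] by (simp add: q'_def)
  then show ?case unfolding prod.insert[OF insert.hyps(1,2)] using q'dvd by (simp only: mult_dvd_mono[OF dvd_refl])
qed simp


lemma coeff_tendsto_newton: "coeff_tendsto (\<lambda>s. newton s d j) (newton t d j) (at t)"
proof (induction j)
  case 0
  show ?case by (simp add: newton_0 coeff_tendsto_const)
next
  case (Suc j)
  have "((\<lambda>s. node s d j / 4) \<longlongrightarrow> node t d j / 4) (at t)"
    unfolding node_def by (intro tendsto_intros) simp
  then show ?case
    unfolding newton_Suc by (intro coeff_tendsto_mult Suc coeff_tendsto_linear)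
qed

lemma dvd_cofactor:
  fixes p q :: "complex poly"
  assumes "[:- c, 1:] ^ n dvd p * q" "poly p c \<noteq> 0"
  shows "[:- c, 1:] ^ n dvd q"
proof (cases "q = 0")
  case False
  have "p \<noteq> 0" using assms(2) by auto
  then have "order c (p * q) = order c q" using False assms(2) by (simp add: order_mult order_0I)
  then show ?thesis using assms(1) False \<open>p \<noteq> 0\<close> by (simp add: order_divides)
qed simp

text \<open>For generic s the polynomial \<open>P s\<close> is 0 or 1 at every node, so
  \<open>nodal\<close> divides \<open>P s * (P s - 1)\<close>, and this survives the limit although
  nodes merge. At each root of the limit only one of p and p - 1 vanishes, so the other is prime to
  the linear factor and the first takes its full power.\<close>

theorem root_idempotent_limit:
  fixes t :: complex
  assumes t: "t = - 2 * of_nat k" and r: "r' < r" "r + r' + k + 1 = d" "r \<le> d div 2"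
    and A: "\<And>j. ((\<lambda>s. lag (- s / 2) d r j + lag (- s / 2) d r' j) \<longlongrightarrow> A j) (at t)"
  shows "root_idempotent (nodal t d) (node t d r) (\<Sum>j\<le>d div 2. smult (A j) (newton t d j))"
proof -
  define p where "p = (\<Sum>j\<le>d div 2. smult (A j) (newton t d j))"
  define P where "P s = (\<Sum>j\<le>d div 2. smult (lag (- s / 2) d r j + lag (- s / 2) d r' j) (newton s d j))" for s
  have Pp: "coeff_tendsto P p (at t)"
    unfolding P_def p_def by (intro coeff_tendsto_sum coeff_tendsto_smult A coeff_tendsto_newton)
  have P_node: "poly (P s) (node s d y) = (if y = r \<or> y = r' then 1 else 0)"
    if "- s / 2 \<notin> \<int>" "y \<le> d div 2" for s y
  proof -
    have "P s = (\<Sum>j\<le>d div 2. smult (lag (- s / 2) d r j) (newton s d j)) + (\<Sum>j\<le>d div 2. smult (lag (- s / 2) d r' j) (newton s d j))"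
      by (simp add: P_def smult_add_left sum.distrib)
    moreover have "r' \<le> d div 2" using r(1,3) by simp
    ultimately show ?thesis
      using r(1) by (simp only: poly_add lag_poly[OF that(1) r(3) that(2)] lag_poly[OF that(1) _ that(2)]) auto
  qed
  have deg: "degree (P s * (P s - 1)) \<le> 2 * (d div 2)" for s
  proof -
    have "degree (P s) \<le> d div 2"
      unfolding P_def
    proof (rule degree_sum_le)
      show "degree (smult c (newton s d j)) \<le> d div 2" if "j \<in> {..d div 2}" for c j
        using that degree_smult_le[of c "newton s d j"] by (simp add: degree_newton)
    qed simp
    moreover have "degree (P s - 1) \<le> d div 2"
      using calculation by (intro degree_diff_le) simp_all
    ultimately show ?thesis using degree_mult_le[of "P s" "P s - 1"] by linarith
  qed
  have "nodal t d dvd p * (p - 1)"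
    unfolding nodal_def
  proof (rule dvd_limit)
    show "coeff_tendsto (\<lambda>s. P s * (P s - 1)) (p * (p - 1)) (at t)"
      by (intro coeff_tendsto_mult coeff_tendsto_diff Pp coeff_tendsto_const)
    show "((\<lambda>s. node s d i) \<longlongrightarrow> node t d i) (at t)" for i
      unfolding node_def by (intro tendsto_intros)
    show "eventually (\<lambda>s. (\<Prod>i\<le>d div 2. [:- node s d i, 1:]) dvd P s * (P s - 1)) (at t)"
      using eventually_not_Ints[OF t]
    proof eventually_elim
      case (elim s)
      \<comment> \<open>Away from the exceptional parameters all nodes are simple, so divisibility
        is a matter of values.\<close>
      have "nodal s d dvd P s * (P s - 1)"
      proof (rule dvd_if_orders_dvd[OF nodal_ne_0])
        fix c
        show "[:- c, 1:] ^ order c (nodal s d) dvd P s * (P s - 1)"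
        proof (cases "\<exists>y\<le>d div 2. node s d y = c")
          case True
          then obtain y where y: "y \<le> d div 2" "node s d y = c" by blast
          have uniq: "i = y" if "node s d i = c" for i
          proof (rule ccontr)
            assume "i \<noteq> y"
            have "node s d i - node s d y = 4 * (xi (- s / 2) d y - xi (- s / 2) d i)"
              unfolding node_diff xi_diff by simp
            then show False using xi_inj[OF elim \<open>i \<noteq> y\<close>, of d] that y(2) by simp
          qed
          have "{i. i \<le> d div 2 \<and> node s d i = c} = {y}"
          proof (intro equalityI subsetI)
            show "i \<in> {y}" if "i \<in> {i. i \<le> d div 2 \<and> node s d i = c}" for i
              using uniq[of i] that by simp
          qed (use y in simp)
          then have "order c (nodal s d) = 1" unfolding order_nodal by simp
          moreover have "poly (P s) c = 0 \<or> poly (P s) c = 1"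
            using P_node[OF elim y(1)] unfolding y(2) by (cases "y = r \<or> y = r'") simp_all
          then have "poly (P s * (P s - 1)) c = 0" by (simp only: poly_mult poly_diff poly_1 mult_eq_0_iff) simp
          ultimately show ?thesis by (simp only: poly_eq_0_iff_dvd power_one_right)
        next
          case False
          then have "{i. i \<le> d div 2 \<and> node s d i = c} = {}" by auto
          then have "order c (nodal s d) = 0" unfolding order_nodal by simp
          then show ?thesis by simp
        qed
      qed
      then show ?case unfolding nodal_def .
    qed
    show "degree (P s * (P s - 1)) \<le> 2 * (d div 2)" for s by (rule deg)
  qed simp_all
  then have idem: "[:- c, 1:] ^ order c (nodal t d) dvd p * (p - 1)" for c
    by (rule dvd_trans[OF order_1])
  have p_node: "poly p (node t d y) = (if y = r \<or> y = r' then 1 else 0)" if y: "y \<le> d div 2" for y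
  proof -
    have "((\<lambda>s. poly (P s) (node s d y)) \<longlongrightarrow> poly p (node t d y)) (at t)"
      unfolding P_def p_def poly_sum poly_smult poly_newton_xi
      by (intro tendsto_intros A tendsto_xi)
    moreover have "((\<lambda>s. poly (P s) (node s d y)) \<longlongrightarrow> (if y = r \<or> y = r' then 1 else 0)) (at t)"
      by (rule tendsto_eventually) (use eventually_not_Ints[OF t] in eventually_elim, use P_node y in blast)
    ultimately show ?thesis by (rule tendsto_unique[OF at_neq_bot])
  qed
  show ?thesis unfolding root_idempotent_def p_def[symmetric]
  proof (intro conjI allI impI)
    show "[:- node t d r, 1:] ^ order (node t d r) (nodal t d) dvd p - 1"
      using p_node[OF r(3)] by (intro dvd_cofactor[OF idem]) simp
    fix a assume a: "a \<noteq> node t d r"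
    show "[:- a, 1:] ^ order a (nodal t d) dvd p"
    proof (cases "\<exists>y\<le>d div 2. node t d y = a")
      case True
      then obtain y where y: "y \<le> d div 2" "node t d y = a" by blast
      then have "y \<noteq> r \<and> y \<noteq> r'" using a r(2) unfolding y(2)[symmetric] node_eq_iff[OF t] by auto
      then have "poly p a = 0" using p_node[OF y(1)] y(2) by simp
      then have "poly (p - 1) a \<noteq> 0" by simp
      moreover have "[:- a, 1:] ^ order a (nodal t d) dvd (p - 1) * p" by (subst mult.commute) (rule idem)
      ultimately show ?thesis using dvd_cofactor by blast
    next
      case False
      then have "{i. i \<le> d div 2 \<and> node t d i = a} = {}" by auto
      then have "order a (nodal t d) = 0" unfolding order_nodal by simp
      then show ?thesis by simp
    qed
  qed
qed

theorem mainTheorem8: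
  fixes t :: complex and k :: nat and l :: "nat \<times> nat"
  assumes "t = - 2 * of_nat k"
    and "l \<in> partitions2"
    and "kquasiregular k l"
  shows "\<forall>i j.
    ((\<lambda>s. coeff (coeff
        (const2 (1 / Hnorm l (- s / 2)) * KnopSahi l (- s / 2)
         + const2 (1 / Hnorm (dagger k l) (- s / 2)) * KnopSahi (dagger k l) (- s / 2)) j) i)
      \<longlongrightarrow> coeff (coeff (eigenvalue_poly t k (capelli t k l)) j) i) (at t)"
proof (intro allI)
  fix i j
  note t = assms(1)
  \<comment> \<open>\<open>r'\<close> is the second part of \<open>dagger k l\<close>, and the
    relation r + r' + k + 1 = d below says that the two eigenvalues collide at t.\<close>
  define r r' d where "r = snd l" and "r' = fst l - k - 1" and "d = psize l"
  have le: "snd l \<le> fst l" "k + 1 \<le> fst l" "fst l \<le> snd l + k"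
    using assms(2,3) by (auto simp: partitions2_def kquasiregular_def)
  have r: "r' < r" "r + r' + k + 1 = d" "r \<le> d div 2"
    using le by (auto simp: r_def r'_def d_def psize_def)
  have dag: "psize (dagger k l) = d" "snd (dagger k l) = r'" "snd (dagger k l) \<le> fst (dagger k l)"
    using le by (auto simp: r'_def d_def psize_def dagger_def)
  have k: "- t / 2 = of_nat k" by (simp add: t)
  have "\<forall>j. \<exists>L. ((\<lambda>s. lag (- s / 2) d r j + lag (- s / 2) d r' j) \<longlongrightarrow> L) (at t)"
    using lag_sum_convergent[OF t r(1,2)] by blast
  then obtain A where A: "\<And>j. ((\<lambda>s. lag (- s / 2) d r j + lag (- s / 2) d r' j) \<longlongrightarrow> A j) (at t)"
    unfolding choice_iff by blast
  have l: "l \<in> Ireg k" using assms(2,3) by (simp add: Ireg_def)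
  have e: "root_idempotent (nodal t d) (c_val t l) (\<Sum>j\<le>d div 2. smult (A j) (newton t d j))"
    using root_idempotent_limit[OF t r A] c_val_node(1)[OF t assms(2) d_def[symmetric]] by (simp add: r_def)
  \<comment> \<open>The eigenvalue polynomial at t and the normalized Knop-Sahi polynomials near t
    are now given by the same formula \<open>falling_poly\<close>, so it remains to let its
    coefficients converge.\<close>
  have eig: "eigenvalue_poly t k (capelli t k l) = falling_poly d (falling_coeff (- t / 2) d A)"
    unfolding d_def k
    by (rule eigenvalue_poly_capelli[OF t l e[unfolded d_def]])
      (rule symmetric_falling_poly falling_coeff_sym poly2_falling_coeff_nat; assumption?)+
  have "((\<lambda>s. coeff (coeff (falling_poly d (falling_coeff (- s / 2) d (\<lambda>q. lag (- s / 2) d r q + lag (- s / 2) d r' q))) j) i)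
      \<longlongrightarrow> coeff (coeff (falling_poly d (falling_coeff (- t / 2) d A)) j) i) (at t)"
    \<comment> \<open>Writing the binomial coefficient as a product makes its continuity in s
      visible.\<close>
    unfolding coeff_falling_poly falling_coeff_def gbinomial_prod_rev case_prod_beta
    by (intro tendsto_intros A) simp_all
  moreover have "eventually (\<lambda>s.
      coeff (coeff (falling_poly d (falling_coeff (- s / 2) d (\<lambda>q. lag (- s / 2) d r q + lag (- s / 2) d r' q))) j) i =
      coeff (coeff (const2 (1 / Hnorm l (- s / 2)) * KnopSahi l (- s / 2)
         + const2 (1 / Hnorm (dagger k l) (- s / 2)) * KnopSahi (dagger k l) (- s / 2)) j) i) (at t)"
    using eventually_not_Ints[OF t]
  proof eventually_elim
    case (elim s)
    have add: "falling_coeff \<kappa> d (\<lambda>q. B q + C q) a b = falling_coeff \<kappa> d B a b + falling_coeff \<kappa> d C a b" for \<kappa> B C a b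
      unfolding falling_coeff_def sum.distrib[symmetric] by (simp add: ring_distribs add_divide_distrib)
    have "const2 (1 / Hnorm l (- s / 2)) * KnopSahi l (- s / 2) = falling_poly d (falling_coeff (- s / 2) d (lag (- s / 2) d r))"
      unfolding normalized_KnopSahi[OF elim le(1)] d_def r_def ..
    moreover have "const2 (1 / Hnorm (dagger k l) (- s / 2)) * KnopSahi (dagger k l) (- s / 2) =
        falling_poly d (falling_coeff (- s / 2) d (lag (- s / 2) d r'))"
      unfolding normalized_KnopSahi[OF elim dag(3)] dag(1,2) ..
    ultimately show ?case
      by (simp only: coeff_add coeff_falling_poly case_prod_beta sum.distrib[symmetric] add distrib_right)
        (rule sum.cong, auto)
  qed
  ultimately show "((\<lambda>s. coeff (coeff
        (const2 (1 / Hnorm l (- s / 2)) * KnopSahi l (- s / 2)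
         + const2 (1 / Hnorm (dagger k l) (- s / 2)) * KnopSahi (dagger k l) (- s / 2)) j) i)
      \<longlongrightarrow> coeff (coeff (eigenvalue_poly t k (capelli t k l)) j) i) (at t)"
    unfolding eig by (rule Lim_transform_eventually)
qed

end
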